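(* Let $f\in L^2(\Omega)$ and $z_d\in L^p(\Omega)$. The problem $\langle\inf_{(A,y,z)\in\Xi}I(A,y,z)\rangle$ is the variational limit, as $\varepsilon\to0$ and $k\to\infty$, of the family $\langle\inf_{(A,y,z)\in\Xi_{\varepsilon,k}}I_{\varepsilon,k}(A,y,z)\rangle$ with respect to $\tau_1$-convergence; that is: (d) whenever $\varepsilon_n\to0$, $k_n\to\infty$, $(A_n,y_n,z_n)\in\Xi_{\varepsilon_n,k_n}$ and $A_n^{1/2}\stackrel{*}{\rightharpoonup}A^{1/2}$ weakly-$*$ in $BV(\Omega;\mathbb{S}^N)$ (so $A_n^{1/2}\to A^{1/2}$ in $L^1$), $y_n\rightharpoonup y$ weakly in $H^1_0(\Omega)$ (so $y_n\to y$ in $L^2$), $z_n\rightharpoonup z$ weakly in $L^2(\Omega)$, then $(A,y,z)\in\Xi$ and $I(A,y,z)\le\liminf_{n\to\infty}I_{\varepsilon_n,k_n}(A_n,y_n,z_n)$; (dd) for every $(A,y,z)\in\Xi$ there exists a family $(A_{\varepsilon,k},y_{\varepsilon,k},z_{\varepsilon,k})\in\Xi_{\varepsilon,k}$ ($\varepsilon>0$, $k\in\mathbb{N}$) which $\tau_1$-converges to $(A,y,z)$ as $\varepsilon\to0$, $k\to\infty$, and satisfies $I(A,y,z)\ge\limsup_{\varepsilon\to0,k\to\infty}I_{\varepsilon,k}(A_{\varepsilon,k},y_{\varepsilon,k},z_{\varepsilon,k})$.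
   Context: $\Omega\subset\mathbb{R}^N$ bounded open with Lipschitz boundary; $2\le p<\infty$, $q=p/(p-1)$. $\mathbb{S}^N$: real symmetric $N\times N$ matrices. $\xi_1,\xi_2\in L^\infty(\Omega)\cap BV(\Omega)$ with $0<\alpha\le\xi_1\le\xi_2$ a.e., $\gamma>0$, $\mathfrak{A}_{ad}=\{A\in L^\infty(\Omega;\mathbb{S}^N):\ \xi_1^2|\eta|^2\le(\eta,A\eta)\le\xi_2^2|\eta|^2$ a.e. $\forall\eta$, $A^{1/2}\in BV(\Omega;\mathbb{S}^N)$, $\int_\Omega|DA^{1/2}|\le\gamma\}$ ($A^{1/2}$ the positive square root, $\int|DA|$ the sum over $i\le j$ of total variations of entries). Weak-$*$ convergence in $BV$: strong $L^1$ convergence plus weak-$*$ convergence of derivatives as Radon measures. For $k\in\mathbb{N}$, $\mathcal{F}_k:[0,\infty)\to[0,\infty)$ is a fixed nondecreasing $C^1$ function with $\mathcal{F}_k(t)=t$ on $[0,k^2]$, $\mathcal{F}_k(t)=k^2+1$ for $t>k^2+1$, $t\le\mathcal{F}_k(t)\le t+\delta$ on $[k^2,k^2+1)$, some $\delta\in(0,1)$. $(Bu)(x)=\int_\Omega K(x,t)u(t)\,dt$ with measurable $K$, $\int_\Omega\int_\Omega|K|^p\,dx\,dt<\infty$, and $B$ positive: $\int_\Omega(Bu)u\,dx>0$ for all nonzero $u\in L^q(\Omega)$. $F(y,z)=|y|^{p-2}y+|z|^{p-2}z$; $F_{\varepsilon,k}(y,z)=[\varepsilon+\mathcal{F}_k(|y|^2)]^{\frac{p-2}{2}}y+[\varepsilon+\mathcal{F}_k(|z|^2)]^{\frac{p-2}{2}}z$.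 Original problem: $\Xi$ is the set of $(A,y,z)\in L^\infty(\Omega;\mathbb{S}^N)\times W^{1,p}_0(\Omega)\times L^p(\Omega)$ with $A\in\mathfrak{A}_{ad}$, $\int_\Omega|A^{1/2}\nabla y|^{p-2}(A\nabla y,\nabla\varphi)\,dx=\int_\Omega f\varphi\,dx$ for all $\varphi\in W^{1,p}_0(\Omega)$, and $z+BF(y,z)=0$ a.e.; $I(A,y,z)=\int_\Omega|z-z_d|^2\,dx$. Regularized problems: $\Xi_{\varepsilon,k}$ is the set of $(A,y,z)\in L^\infty(\Omega;\mathbb{S}^N)\times H^1_0(\Omega)\times L^2(\Omega)$ with $A\in\mathfrak{A}_{ad}$, $\int_\Omega[\varepsilon+\mathcal{F}_k(|A^{1/2}\nabla y|^2)]^{\frac{p-2}{2}}(A\nabla y,\nabla v)\,dx=\int_\Omega fv\,dx$ for all $v\in H^1_0(\Omega)$, and $z+BF_{\varepsilon,k}(y,z)=0$ a.e.; $I_{\varepsilon,k}(A,y,z)=\int_\Omega|z-z_d|^2\,dx$. $\tau_1$-convergence: $(A_n,y_n,z_n)\stackrel{\tau_1}{\to}(A,y,z)$ iff $A_n^{1/2}\to A^{1/2}$ weakly-$*$ in $BV(\Omega;\mathbb{S}^N)$, $y_n\rightharpoonup y$ weakly in $H^1_0(\Omega)$, $z_n\rightharpoonup z$ weakly in $L^2(\Omega)$. *)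

theory Defs
  imports "HOL-Analysis.Analysis"
begin

definition intO :: "(real^'n) set \<Rightarrow> (real^'n \<Rightarrow> real) \<Rightarrow> real" where
  "intO \<Omega> u = integral\<^sup>L (lebesgue_on \<Omega>) u"

text \<open>Lipschitz boundary: locally, Omega is the subgraph of a Lipschitz function
  in some direction e (graph over the hyperplane orthogonal to e).\<close>
definition lipschitz_boundary :: "(real^'n) set \<Rightarrow> bool" where
  "lipschitz_boundary \<Omega> \<longleftrightarrow>
     (\<forall>x0\<in>frontier \<Omega>. \<exists>(e::real^'n) r (g::real^'n \<Rightarrow> real) C.
        norm e = 1 \<and> r > 0 \<and> C-lipschitz_on UNIV g \<and>
        (\<forall>x. g x = g (x - (x \<bullet> e) *\<^sub>R e)) \<and>
        \<Omega> \<inter> ball x0 r = {x \<in> ball x0 r. x \<bullet> e < g x})"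

definition Lp :: "(real^'n) set \<Rightarrow> real \<Rightarrow> (real^'n \<Rightarrow> real) \<Rightarrow> bool" where
  "Lp \<Omega> p u \<longleftrightarrow> u \<in> borel_measurable (lebesgue_on \<Omega>) \<and>
                  integrable (lebesgue_on \<Omega>) (\<lambda>x. \<bar>u x\<bar> powr p)"

definition Linf :: "(real^'n) set \<Rightarrow> (real^'n \<Rightarrow> real) \<Rightarrow> bool" where
  "Linf \<Omega> u \<longleftrightarrow> u \<in> borel_measurable (lebesgue_on \<Omega>) \<and>
                  (\<exists>C. AE x in lebesgue_on \<Omega>. \<bar>u x\<bar> \<le> C)"

definition Lloc1 :: "(real^'n) set \<Rightarrow> (real^'n \<Rightarrow> real) \<Rightarrow> bool" where
  "Lloc1 \<Omega> u \<longleftrightarrow> (\<forall>K. compact K \<and> K \<subseteq> \<Omega> \<longrightarrow> integrable (lebesgue_on K) u)"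

definition pd :: "(real^'n \<Rightarrow> real) \<Rightarrow> 'n \<Rightarrow> real^'n \<Rightarrow> real" where
  "pd \<phi> i x = frechet_derivative \<phi> (at x) (axis i 1)"

definition cgrad :: "(real^'n \<Rightarrow> real) \<Rightarrow> real^'n \<Rightarrow> real^'n" where
  "cgrad \<phi> x = (\<chi> i. pd \<phi> i x)"

definition C1c :: "(real^'n) set \<Rightarrow> (real^'n \<Rightarrow> real) \<Rightarrow> bool" where
  "C1c \<Omega> \<phi> \<longleftrightarrow> (\<forall>x. \<phi> differentiable (at x)) \<and>
                  (\<forall>i. continuous_on UNIV (\<lambda>x. pd \<phi> i x)) \<and>
                  compact (closure {x. \<phi> x \<noteq> 0}) \<and> closure {x. \<phi> x \<noteq> 0} \<subseteq> \<Omega>"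

definition C0 :: "(real^'n) set \<Rightarrow> (real^'n \<Rightarrow> real) \<Rightarrow> bool" where
  "C0 \<Omega> \<phi> \<longleftrightarrow> continuous_on \<Omega> \<phi> \<and>
     (\<forall>e>0. \<exists>K. compact K \<and> K \<subseteq> \<Omega> \<and> (\<forall>x\<in>\<Omega> - K. \<bar>\<phi> x\<bar> < e))"

definition weak_grad :: "(real^'n) set \<Rightarrow> (real^'n \<Rightarrow> real) \<Rightarrow> (real^'n \<Rightarrow> real^'n) \<Rightarrow> bool" where
  "weak_grad \<Omega> u g \<longleftrightarrow> Lloc1 \<Omega> u \<and> (\<forall>i. Lloc1 \<Omega> (\<lambda>x. g x $ i)) \<and>
     (\<forall>\<phi> i. C1c \<Omega> \<phi> \<longrightarrow> intO \<Omega> (\<lambda>x. u x * pd \<phi> i x) = - intO \<Omega> (\<lambda>x. g x $ i * \<phi> x))"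

definition wgrad :: "(real^'n) set \<Rightarrow> (real^'n \<Rightarrow> real) \<Rightarrow> real^'n \<Rightarrow> real^'n" where
  "wgrad \<Omega> u = (SOME g. weak_grad \<Omega> u g)"

definition W1p0 :: "(real^'n) set \<Rightarrow> real \<Rightarrow> (real^'n \<Rightarrow> real) \<Rightarrow> bool" where
  "W1p0 \<Omega> p u \<longleftrightarrow> Lp \<Omega> p u \<and>
     (\<exists>g. weak_grad \<Omega> u g \<and> (\<forall>i. Lp \<Omega> p (\<lambda>x. g x $ i)) \<and>
        (\<exists>\<phi>s. (\<forall>n. C1c \<Omega> (\<phi>s n)) \<and>
           (\<lambda>n. intO \<Omega> (\<lambda>x. \<bar>\<phi>s n x - u x\<bar> powr p)) \<longlonglongrightarrow> 0 \<and>
           (\<lambda>n. intO \<Omega> (\<lambda>x. norm (cgrad (\<phi>s n) x - g x) powr p)) \<longlonglongrightarrow> 0))"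

abbreviation H10 :: "(real^'n) set \<Rightarrow> (real^'n \<Rightarrow> real) \<Rightarrow> bool" where
  "H10 \<Omega> u \<equiv> W1p0 \<Omega> 2 u"

definition TV :: "(real^'n) set \<Rightarrow> (real^'n \<Rightarrow> real) \<Rightarrow> ereal" where
  "TV \<Omega> u = (SUP \<phi>\<in>{\<phi>::real^'n \<Rightarrow> real^'n. (\<forall>i. C1c \<Omega> (\<lambda>x. \<phi> x $ i)) \<and> (\<forall>x. norm (\<phi> x) \<le> 1)}.
      ereal (intO \<Omega> (\<lambda>x. u x * (\<Sum>i\<in>UNIV. pd (\<lambda>y. \<phi> y $ i) i x))))"

definition BV :: "(real^'n) set \<Rightarrow> (real^'n \<Rightarrow> real) \<Rightarrow> bool" where
  "BV \<Omega> u \<longleftrightarrow> Lp \<Omega> 1 u \<and> TV \<Omega> u < \<infinity>"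

text \<open>(mu, nu) represents the distributional derivative D_i u as the finite signed
  Radon measure mu - nu on Omega.\<close>
definition Drep :: "(real^'n) set \<Rightarrow> (real^'n \<Rightarrow> real) \<Rightarrow> 'n \<Rightarrow> (real^'n) measure \<Rightarrow> (real^'n) measure \<Rightarrow> bool" where
  "Drep \<Omega> u i \<mu> \<nu> \<longleftrightarrow> finite_measure \<mu> \<and> finite_measure \<nu> \<and>
     sets \<mu> = sets (restrict_space borel \<Omega>) \<and> sets \<nu> = sets (restrict_space borel \<Omega>) \<and>
     (\<forall>\<phi>. C1c \<Omega> \<phi> \<longrightarrow> intO \<Omega> (\<lambda>x. u x * pd \<phi> i x) = - (integral\<^sup>L \<mu> \<phi> - integral\<^sup>L \<nu> \<phi>))"

definition wstar_BV :: "(real^'n) set \<Rightarrow> ('i \<Rightarrow> real^'n \<Rightarrow> real) \<Rightarrow> 'i filter \<Rightarrow> (real^'n \<Rightarrow> real) \<Rightarrow> bool" where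
  "wstar_BV \<Omega> us F u \<longleftrightarrow> eventually (\<lambda>n. BV \<Omega> (us n)) F \<and> BV \<Omega> u \<and>
     ((\<lambda>n. intO \<Omega> (\<lambda>x. \<bar>us n x - u x\<bar>)) \<longlongrightarrow> 0) F \<and>
     (\<forall>l \<mu>s \<nu>s \<mu> \<nu>. eventually (\<lambda>n. Drep \<Omega> (us n) l (\<mu>s n) (\<nu>s n)) F \<longrightarrow> Drep \<Omega> u l \<mu> \<nu> \<longrightarrow>
        (\<forall>\<phi>. C0 \<Omega> \<phi> \<longrightarrow>
           ((\<lambda>n. integral\<^sup>L (\<mu>s n) \<phi> - integral\<^sup>L (\<nu>s n) \<phi>) \<longlongrightarrow> integral\<^sup>L \<mu> \<phi> - integral\<^sup>L \<nu> \<phi>) F))"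

definition wstar_BVm :: "(real^'n) set \<Rightarrow> ('i \<Rightarrow> real^'n \<Rightarrow> real^'n^'n) \<Rightarrow> 'i filter \<Rightarrow> (real^'n \<Rightarrow> real^'n^'n) \<Rightarrow> bool" where
  "wstar_BVm \<Omega> Ss F S \<longleftrightarrow> (\<forall>i j. wstar_BV \<Omega> (\<lambda>n x. Ss n x $ i $ j) F (\<lambda>x. S x $ i $ j))"

definition weak_H10 :: "(real^'n) set \<Rightarrow> ('i \<Rightarrow> real^'n \<Rightarrow> real) \<Rightarrow> 'i filter \<Rightarrow> (real^'n \<Rightarrow> real) \<Rightarrow> bool" where
  "weak_H10 \<Omega> ys F y \<longleftrightarrow> eventually (\<lambda>n. H10 \<Omega> (ys n)) F \<and> H10 \<Omega> y \<and>
     (\<forall>v. H10 \<Omega> v \<longrightarrow>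
       ((\<lambda>n. intO \<Omega> (\<lambda>x. ys n x * v x + wgrad \<Omega> (ys n) x \<bullet> wgrad \<Omega> v x))
          \<longlongrightarrow> intO \<Omega> (\<lambda>x. y x * v x + wgrad \<Omega> y x \<bullet> wgrad \<Omega> v x)) F)"

definition weak_L2 :: "(real^'n) set \<Rightarrow> ('i \<Rightarrow> real^'n \<Rightarrow> real) \<Rightarrow> 'i filter \<Rightarrow> (real^'n \<Rightarrow> real) \<Rightarrow> bool" where
  "weak_L2 \<Omega> zs F z \<longleftrightarrow> eventually (\<lambda>n. Lp \<Omega> 2 (zs n)) F \<and> Lp \<Omega> 2 z \<and>
     (\<forall>v. Lp \<Omega> 2 v \<longrightarrow> ((\<lambda>n. intO \<Omega> (\<lambda>x. zs n x * v x)) \<longlongrightarrow> intO \<Omega> (\<lambda>x. z x * v x)) F)"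

definition psd :: "real^'n^'n \<Rightarrow> bool" where
  "psd M \<longleftrightarrow> transpose M = M \<and> (\<forall>v. 0 \<le> v \<bullet> (M *v v))"

definition psqrt :: "real^'n^'n \<Rightarrow> real^'n^'n" where
  "psqrt M = (THE S. psd S \<and> S ** S = M)"

definition LinfSym :: "(real^'n) set \<Rightarrow> (real^'n \<Rightarrow> real^'n^'n) \<Rightarrow> bool" where
  "LinfSym \<Omega> A \<longleftrightarrow> (\<forall>i j. Linf \<Omega> (\<lambda>x. A x $ i $ j)) \<and>
                     (AE x in lebesgue_on \<Omega>. transpose (A x) = A x)"

definition Aad :: "(real^'n::{finite,linorder}) set \<Rightarrow> (real^'n::{finite,linorder} \<Rightarrow> real) \<Rightarrow> (real^'n::{finite,linorder} \<Rightarrow> real) \<Rightarrow> real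
                   \<Rightarrow> (real^'n::{finite,linorder} \<Rightarrow> real^'n::{finite,linorder}^'n::{finite,linorder}) \<Rightarrow> bool" where
  "Aad \<Omega> \<xi>1 \<xi>2 \<gamma> A \<longleftrightarrow> LinfSym \<Omega> A \<and>
     (AE x in lebesgue_on \<Omega>. \<forall>\<eta>. (\<xi>1 x)\<^sup>2 * (norm \<eta>)\<^sup>2 \<le> \<eta> \<bullet> (A x *v \<eta>) \<and>
                                \<eta> \<bullet> (A x *v \<eta>) \<le> (\<xi>2 x)\<^sup>2 * (norm \<eta>)\<^sup>2) \<and>
     (\<forall>i j. BV \<Omega> (\<lambda>x. psqrt (A x) $ i $ j)) \<and>
     (\<Sum>(i,j)\<in>{(i,j). i \<le> j}. TV \<Omega> (\<lambda>x. psqrt (A x) $ i $ j)) \<le> ereal \<gamma>"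

definition Bop :: "(real^'n) set \<Rightarrow> (real^'n \<Rightarrow> real^'n \<Rightarrow> real) \<Rightarrow> (real^'n \<Rightarrow> real) \<Rightarrow> real^'n \<Rightarrow> real" where
  "Bop \<Omega> K u x = intO \<Omega> (\<lambda>t. K x t * u t)"

definition Fnl :: "real \<Rightarrow> real \<Rightarrow> real \<Rightarrow> real" where
  "Fnl p a b = \<bar>a\<bar> powr (p - 2) * a + \<bar>b\<bar> powr (p - 2) * b"

definition Fek :: "real \<Rightarrow> (nat \<Rightarrow> real \<Rightarrow> real) \<Rightarrow> real \<Rightarrow> nat \<Rightarrow> real \<Rightarrow> real \<Rightarrow> real" where
  "Fek p Fk \<epsilon> k a b = (\<epsilon> + Fk k (a\<^sup>2)) powr ((p - 2) / 2) * a + (\<epsilon> + Fk k (b\<^sup>2)) powr ((p - 2) / 2) * b"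

definition Xi :: "(real^'n::{finite,linorder}) set \<Rightarrow> (real^'n::{finite,linorder} \<Rightarrow> real) \<Rightarrow> (real^'n::{finite,linorder} \<Rightarrow> real) \<Rightarrow> real \<Rightarrow> real
     \<Rightarrow> (real^'n::{finite,linorder} \<Rightarrow> real^'n::{finite,linorder} \<Rightarrow> real) \<Rightarrow> (real^'n::{finite,linorder} \<Rightarrow> real)
     \<Rightarrow> (real^'n::{finite,linorder} \<Rightarrow> real^'n::{finite,linorder}^'n::{finite,linorder}) \<Rightarrow> (real^'n::{finite,linorder} \<Rightarrow> real) \<Rightarrow> (real^'n::{finite,linorder} \<Rightarrow> real) \<Rightarrow> bool" where
  "Xi \<Omega> \<xi>1 \<xi>2 \<gamma> p K f A y z \<longleftrightarrow> Aad \<Omega> \<xi>1 \<xi>2 \<gamma> A \<and> W1p0 \<Omega> p y \<and> Lp \<Omega> p z \<and>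
     (\<forall>\<phi>. W1p0 \<Omega> p \<phi> \<longrightarrow>
        intO \<Omega> (\<lambda>x. norm (psqrt (A x) *v wgrad \<Omega> y x) powr (p - 2) *
                       ((A x *v wgrad \<Omega> y x) \<bullet> wgrad \<Omega> \<phi> x))
        = intO \<Omega> (\<lambda>x. f x * \<phi> x)) \<and>
     (AE x in lebesgue_on \<Omega>. z x + Bop \<Omega> K (\<lambda>t. Fnl p (y t) (z t)) x = 0)"

definition Xi_ek :: "(real^'n::{finite,linorder}) set \<Rightarrow> (real^'n::{finite,linorder} \<Rightarrow> real) \<Rightarrow> (real^'n::{finite,linorder} \<Rightarrow> real) \<Rightarrow> real \<Rightarrow> real
     \<Rightarrow> (real^'n::{finite,linorder} \<Rightarrow> real^'n::{finite,linorder} \<Rightarrow> real) \<Rightarrow> (real^'n::{finite,linorder} \<Rightarrow> real) \<Rightarrow> (nat \<Rightarrow> real \<Rightarrow> real) \<Rightarrow> real \<Rightarrow> nat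
     \<Rightarrow> (real^'n::{finite,linorder} \<Rightarrow> real^'n::{finite,linorder}^'n::{finite,linorder}) \<Rightarrow> (real^'n::{finite,linorder} \<Rightarrow> real) \<Rightarrow> (real^'n::{finite,linorder} \<Rightarrow> real) \<Rightarrow> bool" where
  "Xi_ek \<Omega> \<xi>1 \<xi>2 \<gamma> p K f Fk \<epsilon> k A y z \<longleftrightarrow> Aad \<Omega> \<xi>1 \<xi>2 \<gamma> A \<and> H10 \<Omega> y \<and> Lp \<Omega> 2 z \<and>
     (\<forall>v. H10 \<Omega> v \<longrightarrow>
        intO \<Omega> (\<lambda>x. (\<epsilon> + Fk k ((norm (psqrt (A x) *v wgrad \<Omega> y x))\<^sup>2)) powr ((p - 2) / 2) *
                       ((A x *v wgrad \<Omega> y x) \<bullet> wgrad \<Omega> v x))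
        = intO \<Omega> (\<lambda>x. f x * v x)) \<and>
     (AE x in lebesgue_on \<Omega>. z x + Bop \<Omega> K (\<lambda>t. Fek p Fk \<epsilon> k (y t) (z t)) x = 0)"

definition Icost :: "(real^'n) set \<Rightarrow> (real^'n \<Rightarrow> real) \<Rightarrow> (real^'n \<Rightarrow> real) \<Rightarrow> real" where
  "Icost \<Omega> zd z = intO \<Omega> (\<lambda>x. (z x - zd x)\<^sup>2)"

text \<open>tau_1 convergence along a filter. The limit matrix field A must be in L^infty(Omega;S^N)
  and positive semidefinite a.e., so that its square root A^{1/2} is meaningful.\<close>
definition tau1 :: "(real^'n) set \<Rightarrow> ('i \<Rightarrow> real^'n \<Rightarrow> real^'n^'n) \<Rightarrow> ('i \<Rightarrow> real^'n \<Rightarrow> real)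
     \<Rightarrow> ('i \<Rightarrow> real^'n \<Rightarrow> real) \<Rightarrow> 'i filter
     \<Rightarrow> (real^'n \<Rightarrow> real^'n^'n) \<Rightarrow> (real^'n \<Rightarrow> real) \<Rightarrow> (real^'n \<Rightarrow> real) \<Rightarrow> bool" where
  "tau1 \<Omega> As ys zs F A y z \<longleftrightarrow> LinfSym \<Omega> A \<and> (AE x in lebesgue_on \<Omega>. psd (A x)) \<and>
     wstar_BVm \<Omega> (\<lambda>n x. psqrt (As n x)) F (\<lambda>x. psqrt (A x)) \<and>
     weak_H10 \<Omega> ys F y \<and> weak_L2 \<Omega> zs F z"

end

(* The regularized weights aw eps k are monotone with a doubling constant independent of eps
   and k, so a modular Poincare inequality bounds the energies of the states uniformly. Testing
   a weak limit against truncations of its own flux shows that its gradient lies in L^p; there the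
   Lipschitz boundary identifies H^1_0 functions with p-integrable gradient as W^{1,p}_0.
   Minty's argument identifies the limit of the fluxes, and monotonicity upgrades weak to strong
   convergence of the states. In the Hammerstein equation the strong convergence of y_n, the
   monotonicity of F and the positivity of B force strong convergence of z_n. Both limit problems
   have a unique solution for given A, so a recovery family keeps A fixed and solves the
   regularized equations. *)
theory Submission
  imports Defs "HOL-Library.Function_Algebras"
begin

text \<open>The obstacle is that no single L^p space serves all regularized problems: the weight is
  constant above height about \<open>k\<close>, so a regularized state lies in H^1_0 only and its
  p-energy may be infinite. Distances are therefore measured by the varying modulars
  \<open>en (aw eps k)\<close>, with doubling in place of the triangle inequality; L^2 and L^p
  bounds come from \<open>aw eps k t >= pw p (min t k)\<close>. The roots of the matrices converge
  in L^1, hence a.e. along a subsequence. This suffices, because limits are taken through fluxes of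
  fixed C^1 test functions, which are uniformly bounded. Strong convergence of the states replaces a
  compact embedding: along a subsequence it gives a.e. convergence and an integrable majorant for
  the energies of \<open>y_n - y\<close>, whence the fluxes of \<open>y_n\<close> converge in L^q.
  For \<open>z_n\<close>, whose limit is not yet known, Hoelder's inequality in the kernel supplies
  one majorant in L^p for the whole sequence. Functions that agree a.e. are not identified, so the
  Hilbert space arguments are made for semidefinite forms: minimization for Riesz, iteration for
  existence, convex hulls for weak compactness.\<close>

notation (input) LIMSEQ (infix "---->" 60)

lemmas Lintegrable_add = Bochner_Integration.integrable_add
lemmas Lintegrable_bound = Bochner_Integration.integrable_bound

section \<open>Integrals of powers\<close>

lemma powr_add_le:
  fixes s t p :: real
  assumes "0 <= s" "0 <= t" "0 <= p"
  shows "(s + t) powr p <= 2 powr p * (s powr p + t powr p)"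
proof -
  have "(s + t) powr p <= (2 * max s t) powr p" using assms by (intro powr_mono2) auto
  also have "... = 2 powr p * (max s t) powr p" using assms by (simp add: powr_mult)
  also have "(max s t) powr p <= s powr p + t powr p" by (auto simp: max_def)
  finally show ?thesis by simp
qed

text \<open>Vector-valued and over any measure, because gradients, pairs of gradients and kernels on
  the product space are all measured this way.\<close>

definition LpV :: "'a measure => real => ('a => 'b::euclidean_space) => bool" where
  "LpV M p u \<longleftrightarrow> u : borel_measurable M & integrable M (%x. norm (u x) powr p)"

text \<open>The p-th power of the L^p norm. Without the root no Minkowski inequality is needed, only
  the quasi-triangle inequality with factor \<open>2 powr p\<close>.\<close>

definition Ipow :: "'a measure => real => ('a => 'b::euclidean_space) => real" where
  "Ipow M p u = (LINT x|M. norm (u x) powr p)"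

lemma LpV_measurable [measurable_dest]: "LpV M p u ==> u : borel_measurable M" by (simp add: LpV_def)

lemma LpV_integrable: "LpV M p u ==> integrable M (%x. norm (u x) powr p)" by (simp add: LpV_def)

lemma Ipow_nonneg [simp]: "0 <= Ipow M p u" by (simp add: Ipow_def)

lemma LpV_bound:
  assumes "u : borel_measurable M" "integrable M w" "AE x in M. norm (u x) powr p <= w x"
  shows "LpV M p u" unfolding LpV_def
proof
  show "integrable M (%x. norm (u x) powr p)" by (rule Lintegrable_bound[OF assms(2)]) (use assms in auto)
qed (use assms in auto)

lemma LpV_mono:
  assumes "u : borel_measurable M" "LpV M p v" "AE x in M. norm (u x) <= norm (v x)" "0 <= p"
  shows "LpV M p u" by (rule LpV_bound[OF assms(1) LpV_integrable[OF assms(2)]])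
    (use assms(3,4) in "auto elim!: eventually_mono intro: powr_mono2")

lemma LpV_zero [simp]: "LpV M p (%x. 0)" by (simp add: LpV_def)

lemma LpV_add:
  assumes "LpV M p u" "LpV M p v" "0 <= p"
  shows "LpV M p (%x. u x + v x)"
proof (rule LpV_bound)
  show "integrable M (%x. 2 powr p * (norm (u x) powr p + norm (v x) powr p))"
    using assms by (auto simp: LpV_def)
  show "AE x in M. norm (u x + v x) powr p <= 2 powr p * (norm (u x) powr p + norm (v x) powr p)"
  proof (rule AE_I2)
    fix x
    have "norm (u x + v x) powr p <= (norm (u x) + norm (v x)) powr p"
      using assms by (intro powr_mono2 norm_triangle_ineq) auto
    also have "... <= 2 powr p * (norm (u x) powr p + norm (v x) powr p)"
      using assms by (intro powr_add_le) auto
    finally show "norm (u x + v x) powr p <= 2 powr p * (norm (u x) powr p + norm (v x) powr p)" .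
  qed
qed (use assms in "auto simp: LpV_def")

lemma LpV_scale:
  assumes "LpV M p u"
  shows "LpV M p (%x. c *\<^sub>R u x)" using assms by (auto simp: LpV_def powr_mult)

lemma LpV_diff:
  assumes "LpV M p u" "LpV M p v" "0 <= p"
  shows "LpV M p (%x. u x - v x)" using LpV_add[OF assms(1) LpV_scale[OF assms(2), of "-1"] assms(3)] by simp

lemma Ipow_add_le:
  assumes "LpV M p u" "LpV M p v" "0 <= p"
  shows "Ipow M p (%x. u x + v x) <= 2 powr p * (Ipow M p u + Ipow M p v)"
proof -
  have "Ipow M p (%x. u x + v x) <= (LINT x|M. 2 powr p * (norm (u x) powr p + norm (v x) powr p))"
    unfolding Ipow_def
  proof (rule integral_mono)
    fix x
    have "norm (u x + v x) powr p <= (norm (u x) + norm (v x)) powr p"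
      using assms by (intro powr_mono2 norm_triangle_ineq) auto
    also have "... <= 2 powr p * (norm (u x) powr p + norm (v x) powr p)"
      using assms by (intro powr_add_le) auto
    finally show "norm (u x + v x) powr p <= 2 powr p * (norm (u x) powr p + norm (v x) powr p)" .
  qed (use assms LpV_add[OF assms] in "auto simp: LpV_def")
  also have "... = 2 powr p * (Ipow M p u + Ipow M p v)" using assms by (auto simp: LpV_def Ipow_def)
  finally show ?thesis .
qed

lemma Ipow_diff_commute: "Ipow M p (%x. u x - v x) = Ipow M p (%x. v x - u x)"
  by (simp add: Ipow_def norm_minus_commute)

lemma Ipow_diff_triangle:
  assumes "LpV M p u" "LpV M p v" "LpV M p w" "0 <= p"
  shows "Ipow M p (%x. u x - w x) <= 2 powr p * (Ipow M p (%x. u x - v x) + Ipow M p (%x. v x - w x))"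
  using Ipow_add_le[OF LpV_diff[OF assms(1,2,4)] LpV_diff[OF assms(2,3,4)] assms(4)] by simp

lemma Ipow_cong_AE:
  assumes "AE x in M. u x = v x" "u : borel_measurable M" "v : borel_measurable M"
  shows "Ipow M p u = Ipow M p v" unfolding Ipow_def using assms by (intro integral_cong_AE) auto

lemma Ipow_eq_0D:
  assumes "LpV M p u" "Ipow M p u = 0"
  shows "AE x in M. u x = 0"
proof -
  have "AE x in M. norm (u x) powr p = 0"
    using assms by (subst integral_nonneg_eq_0_iff_AE[symmetric]) (auto simp: LpV_def Ipow_def)
  thus ?thesis by auto
qed

lemma Holder_ineq:
  fixes f g :: "'a => real"
  assumes pq: "1 < p" "1 < q" "1 / p + 1 / q = 1"
    and f: "LpV M p f" and g: "LpV M q g"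
  shows "integrable M (%x. f x * g x)"
    and "(LINT x|M. abs (f x * g x)) <= Ipow M p f powr (1/p) * Ipow M q g powr (1/q)"
proof -
  have fm [measurable]: "f : borel_measurable M" and gm [measurable]: "g : borel_measurable M"
    using f g by (auto simp: LpV_def)
  show int: "integrable M (%x. f x * g x)"
  proof (rule Lintegrable_bound)
    show "integrable M (%x. abs (f x) powr p / p + abs (g x) powr q / q)" using f g by (auto simp: LpV_def)
    show "AE x in M. norm (f x * g x) <= norm (abs (f x) powr p / p + abs (g x) powr q / q)"
      using Youngs_inequality[OF pq, of "abs (f _)" "abs (g _)"] pq by (intro AE_I2) (simp add: abs_mult)
  qed auto
  let ?A = "Ipow M p f" and ?B = "Ipow M q g"
  show "(LINT x|M. abs (f x * g x)) <= ?A powr (1/p) * ?B powr (1/q)"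
  proof (cases "?A = 0 \<or> ?B = 0")
    case True
    hence "AE x in M. f x * g x = 0" using Ipow_eq_0D[OF f] Ipow_eq_0D[OF g] by auto
    hence "(LINT x|M. abs (f x * g x)) = (LINT x|M. 0)" by (intro integral_cong_AE) auto
    thus ?thesis by simp
  next
    case False
    hence A: "?A > 0" and B: "?B > 0" using Ipow_nonneg[of M p f] Ipow_nonneg[of M q g] by linarith+
    define a where "a = ?A powr (1/p)"
    define b where "b = ?B powr (1/q)"
    have ab: "a > 0" "b > 0" using A B by (auto simp: a_def b_def)
    have ap: "a powr p = ?A" "b powr q = ?B" using A B pq by (auto simp: a_def b_def powr_powr)
    have "(LINT x|M. abs (f x * g x) / (a * b)) <= (LINT x|M. abs (f x) powr p / (p * ?A) + abs (g x) powr q / (q * ?B))"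
    proof (rule integral_mono)
      fix x
      have "(abs (f x) / a) * (abs (g x) / b) <= (abs (f x) / a) powr p / p + (abs (g x) / b) powr q / q"
        using ab by (intro Youngs_inequality pq) auto
      also have "... = abs (f x) powr p / (p * ?A) + abs (g x) powr q / (q * ?B)"
        using ab by (simp add: powr_divide ap mult.commute)
      finally show "abs (f x * g x) / (a * b) <= abs (f x) powr p / (p * ?A) + abs (g x) powr q / (q * ?B)"
        by (simp add: abs_mult)
    qed (use int f g in "auto simp: LpV_def")
    also have "... = 1 / p + 1 / q" using f g A B by (simp add: LpV_def Ipow_def)
    finally have "(LINT x|M. abs (f x * g x)) / (a * b) <= 1" using pq by simp
    thus ?thesis using ab by (simp add: field_simps a_def b_def)
  qed
qed

lemma Cauchy_Schwarz_integral:
  fixes f g :: "'a => 'b::euclidean_space"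
  assumes f: "LpV M 2 f" and g: "LpV M 2 g"
  shows "integrable M (%x. f x \<bullet> g x)"
    and "abs (LINT x|M. f x \<bullet> g x) <= sqrt (Ipow M 2 f) * sqrt (Ipow M 2 g)"
    and "(LINT x|M. norm (f x) * norm (g x)) <= sqrt (Ipow M 2 f) * sqrt (Ipow M 2 g)"
proof -
  have [measurable]: "f : borel_measurable M" "g : borel_measurable M" using f g by (auto simp: LpV_def)
  have nf: "LpV M 2 (%x. norm (f x))" "LpV M 2 (%x. norm (g x))" using f g by (auto simp: LpV_def)
  have h: "integrable M (%x. norm (f x) * norm (g x))" by (rule Holder_ineq[OF _ _ _ nf]) auto
  show i: "integrable M (%x. f x \<bullet> g x)" by (rule Lintegrable_bound[OF h])
      (auto simp: Cauchy_Schwarz_ineq2)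
  show h2: "(LINT x|M. norm (f x) * norm (g x)) <= sqrt (Ipow M 2 f) * sqrt (Ipow M 2 g)"
    using Holder_ineq(2)[OF _ _ _ nf] by (simp add: Ipow_def powr_half_sqrt)
  have "abs (LINT x|M. f x \<bullet> g x) <= (LINT x|M. abs (f x \<bullet> g x))"
    using integral_norm_bound[of M "%x. f x \<bullet> g x"] by simp
  also have "... <= (LINT x|M. norm (f x) * norm (g x))"
    by (rule integral_mono) (use i h in "auto simp: Cauchy_Schwarz_ineq2")
  finally show "abs (LINT x|M. f x \<bullet> g x) <= sqrt (Ipow M 2 f) * sqrt (Ipow M 2 g)"
    using h2 by linarith
qed

section \<open>Subsequences\<close>

lemma strict_mono_subseq_eventually:
  fixes P :: "nat => nat => bool"
  assumes "ALL j. eventually (P j) sequentially"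
  shows "EX r::nat=>nat. strict_mono r & (ALL j. P j (r j))"
proof -
  have "EX r. ALL j. P j (r j) & r j < r (Suc j)"
  proof (rule dependent_nat_choice)
    show "EX x. P 0 x" using spec[OF assms, of 0] by (auto simp: eventually_sequentially)
    fix x n
    show "EX y. P (Suc n) y & x < y"
    proof -
      obtain N where "!!m. m >= N ==> P (Suc n) m"
        using spec[OF assms, of "Suc n"] by (auto simp: eventually_sequentially)
      thus ?thesis by (intro exI[of _ "max N (Suc x)"]) auto
    qed
  qed
  then obtain r where "ALL j. P j (r j) & r j < r (Suc j)" by blast
  thus ?thesis by (intro exI[of _ r]) (simp add: strict_mono_Suc_iff)
qed

lemma strict_mono_subseq_frequently:
  assumes "~ eventually P sequentially"
  shows "EX r::nat=>nat. strict_mono r & (ALL j. ~ P (r j))"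
proof -
  have inf: "infinite {n. ~ P n}"
    using assms by (simp add: eventually_cofinite[symmetric] cofinite_eq_sequentially)
  thus ?thesis using strict_mono_enumerate[OF inf] enumerate_in_set[OF inf]
    by (intro exI[of _ "enumerate {n. ~ P n}"]) simp
qed

lemma tendsto_subseq_principle:
  fixes X :: "nat => 'b::topological_space"
  assumes "!!r::nat=>nat. strict_mono r ==> EX s::nat=>nat. strict_mono s & (%n. X (r (s n))) ----> L"
  shows "X ----> L"
proof (rule topological_tendstoI, rule ccontr)
  fix S assume S: "open S" "L : S" and nev: "~ eventually (%n. X n : S) sequentially"
  obtain r :: "nat=>nat" where r: "strict_mono r" "!!j. X (r j) ~: S"
    using strict_mono_subseq_frequently[OF nev] by auto
  obtain s :: "nat=>nat" where s: "(%n. X (r (s n))) ----> L" using assms[OF r(1)] by auto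
  have "eventually (%n. X (r (s n)) : S) sequentially" using topological_tendstoD[OF s S] .
  thus False using r(2) by (auto simp: eventually_sequentially)
qed

section \<open>Dominated subsequences and completeness\<close>

text \<open>By monotone convergence the sum has integral at most 2, so it is finite a.e. and is
  itself the common majorant.\<close>

lemma AE_summable_dominating:
  fixes f :: "nat => 'a => real"
  assumes int: "!!j. integrable M (f j)" and nn: "!!j x. 0 <= f j x"
    and le: "!!j. (LINT x|M. f j x) <= (1/2)^j"
  obtains W where "integrable M W" "AE x in M. summable (%j. f j x)" "AE x in M. ALL j. f j x <= W x"
proof -
  have [measurable]: "!!j. f j : borel_measurable M" using int by auto
  have "(\<integral>\<^sup>+x. (\<Sum>j. ennreal (f j x)) \<partial>M) = (\<Sum>j. \<integral>\<^sup>+x. ennreal (f j x) \<partial>M)"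
    by (rule nn_integral_suminf) auto
  also have "... = (\<Sum>j. ennreal (LINT x|M. f j x))" using int nn by (simp add: nn_integral_eq_integral)
  also have "... <= (\<Sum>j. ennreal ((1/2)^j))" by (rule suminf_le) (use le in "auto intro: ennreal_leI")
  also have "... = ennreal (\<Sum>j. (1/2)^j)" by (rule suminf_ennreal2) auto
  finally have fin: "(\<integral>\<^sup>+x. (\<Sum>j. ennreal (f j x)) \<partial>M) < \<infinity>"
    using le_less_trans[OF _ ennreal_less_top] by simp
  hence "AE x in M. (\<Sum>j. ennreal (f j x)) ~= \<infinity>" by (intro nn_integral_PInf_AE) auto
  hence AEs: "AE x in M. summable (%j. f j x)"
    by eventually_elim (use nn in "auto intro: summable_suminf_not_top")
  define W where "W x = enn2real (\<Sum>j. ennreal (f j x))" for x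
  have Weq: "AE x in M. ennreal (W x) = (\<Sum>j. ennreal (f j x))"
    using \<open>AE x in M. (\<Sum>j. ennreal (f j x)) ~= \<infinity>\<close>
    by eventually_elim (auto simp: W_def top.not_eq_extremum)
  have "integrable M W"
  proof (rule integrableI_nonneg)
    show "W : borel_measurable M" unfolding W_def by measurable
    have "(\<integral>\<^sup>+x. ennreal (W x) \<partial>M) = (\<integral>\<^sup>+x. (\<Sum>j. ennreal (f j x)) \<partial>M)"
      using Weq by (intro nn_integral_cong_AE)
    thus "(\<integral>\<^sup>+x. ennreal (W x) \<partial>M) < \<infinity>" using fin by simp
  qed (simp add: W_def)
  moreover have "AE x in M. ALL j. f j x <= W x" using AEs Weq
  proof eventually_elim
    case (elim x)
    have "ennreal (W x) = ennreal (\<Sum>j. f j x)" using elim nn by (simp add: suminf_ennreal2)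
    hence "W x = (\<Sum>j. f j x)"
      using nn elim by (subst (asm) ennreal_inj) (auto simp: W_def intro: suminf_nonneg)
    moreover have "f j x <= (\<Sum>j. f j x)" for j using sum_le_suminf[OF elim(1), of "{j}"] nn by auto
    ultimately show ?case by auto
  qed
  ultimately show ?thesis using that AEs by blast
qed

text \<open>A subsequence with geometrically small errors has an integrable sum of p-th powers. This
  converts L^p convergence into the hypotheses of dominated convergence, and so allows nonlinear
  integrands.\<close>

lemma Ipow_dominated_subseq:
  fixes u :: "'a => 'b::euclidean_space"
  assumes p: "0 < p" and un: "!!n. LpV M p (%x. us n x - u x)"
    and lim: "(%n. Ipow M p (%x. us n x - u x)) ----> 0"
  obtains r W where "strict_mono r" "integrable M W"
    "AE x in M. ALL j. norm (us (r j) x - u x) powr p <= W x"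
    "AE x in M. (%j. us (r j) x) ----> u x"
proof -
  have "eventually (%n. Ipow M p (%x. us n x - u x) <= (1/2)^j) sequentially" for j
    using order_tendstoD(2)[OF lim, of "(1/2)^j"] by (auto elim: eventually_mono)
  hence "ALL j. eventually (%n. Ipow M p (%x. us n x - u x) <= (1/2)^j) sequentially" ..
  from strict_mono_subseq_eventually[OF this] obtain r where r: "strict_mono r" "!!j. Ipow M p (%x. us (r j) x - u x) <= (1/2)^j"
    by auto
  obtain W where W: "integrable M W" "AE x in M. summable (%j. norm (us (r j) x - u x) powr p)"
      "AE x in M. ALL j. norm (us (r j) x - u x) powr p <= W x"
    by (rule AE_summable_dominating[of M "%j x. norm (us (r j) x - u x) powr p"])
      (use un r(2) in "auto simp: LpV_def Ipow_def")
  have "AE x in M. (%j. us (r j) x) ----> u x" using W(2)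
  proof eventually_elim
    case (elim x)
    have "(%j. norm (us (r j) x - u x) powr p) ----> 0" using summable_LIMSEQ_zero[OF elim] .
    hence "(%j. (norm (us (r j) x - u x) powr p) powr (1/p)) ----> 0"
      using p by (intro tendsto_zero_powrI[of _ _ "%_. 1/p" "1/p"]) auto
    hence "(%j. norm (us (r j) x - u x)) ----> 0" using p by (simp add: powr_powr)
    thus ?case by (simp add: tendsto_norm_zero_iff LIM_zero_iff)
  qed
  thus ?thesis using that r(1) W by blast
qed

text \<open>Above the level \<open>l\<close> the factor \<open>(t / l) powr (p - 1)\<close> is at
  least 1. The inequality trades a p-th power for a first power pointwise, at the price of the
  additive \<open>l\<close>.\<close>

lemma le_add_powr:
  fixes t l p :: real
  assumes "0 < l" "0 <= t" "1 <= p"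
  shows "t <= l + l powr (1 - p) * t powr p"
proof (cases "t <= l")
  case True
  thus ?thesis using assms by (simp add: add_increasing2)
next
  case False
  have "1 <= (t / l) powr (p - 1)" using False assms by (intro ge_one_powr_ge_zero) auto
  hence "t <= t * (t / l) powr (p - 1)" using assms by (simp add: mult_le_cancel_left1)
  also have "... = l powr (1 - p) * t powr p"
    using False assms by (simp add: powr_divide powr_diff field_simps)
  finally show ?thesis using assms by simp
qed

text \<open>Riesz-Fischer: \<open>le_add_powr\<close> with level \<open>2^-j\<close> bounds the j-th
  increment of a fast subsequence by a summable number plus a term that is summable a.e.; no
  Minkowski inequality is involved.\<close>

lemma Ipow_complete:
  fixes us :: "nat => 'a => 'b::euclidean_space"
  assumes p: "1 <= p" and un: "!!n. LpV M p (us n)"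
    and cau: "!!e. 0 < e ==> EX N. ALL m>=N. ALL n>=N. Ipow M p (%x. us m x - us n x) < e"
  obtains u where "LpV M p u" "(%n. Ipow M p (%x. us n x - u x)) ----> 0"
proof -
  have [measurable]: "us n : borel_measurable M" for n using un by (auto simp: LpV_def)
  define l :: "nat => real" where "l j = (1/2)^j" for j
  have l: "l j > 0" for j by (simp add: l_def)
  \<comment> \<open>This threshold is \<open>l j\<close> to the power p, so that the weight
    \<open>l j powr (1 - p)\<close> turns it into \<open>l j\<close>, which is summable.\<close>
  let ?e = "%j. l j * l j powr (p - 1)"
  have "eventually (%n. ALL m>=n. Ipow M p (%x. us m x - us n x) < ?e j) sequentially" for j
  proof -
    have "?e j > 0" using l[of j] by auto
    from cau[OF this] obtain N where N: "ALL m>=N. ALL n>=N. Ipow M p (%x. us m x - us n x) < ?e j" by auto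
    thus ?thesis unfolding eventually_sequentially by (intro exI[of _ N] allI impI) (auto dest: order_trans)
  qed
  hence "ALL j. eventually (%n. ALL m>=n. Ipow M p (%x. us m x - us n x) < ?e j) sequentially" ..
  from strict_mono_subseq_eventually[OF this] obtain r where r: "strict_mono r"
      "!!j. ALL m>=r j. Ipow M p (%x. us m x - us (r j) x) < ?e j" by auto
  define d where "d j x = us (r (Suc j)) x - us (r j) x" for j x
  have d_eq: "d j = (%x. us (r (Suc j)) x - us (r j) x)" for j by (simp add: d_def fun_eq_iff)
  have dL: "LpV M p (d j)" for j unfolding d_eq using p by (intro LpV_diff un) auto
  define f where "f = (%j x. l j powr (1 - p) * norm (d j x) powr p)"
  have "!!j. (LINT x|M. f j x) <= (1/2)^j"
  proof -
    fix j
    have "r j <= r (Suc j)" using r(1) by (simp add: strict_mono_less_eq)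
    hence "Ipow M p (d j) < ?e j" using r(2)[of j] by (auto simp: d_eq)
    hence "l j powr (1 - p) * Ipow M p (d j) <= l j powr (1 - p) * ?e j"
      using l[of j] by (intro mult_left_mono) auto
    also have "... = l j" using l[of j] by (simp add: powr_diff field_simps)
    finally show "(LINT x|M. f j x) <= (1/2)^j" by (simp add: f_def Ipow_def l_def)
  qed
  note f_le = this
  have f_int: "integrable M (f j)" for j using dL[of j] by (auto simp: LpV_def f_def)
  have f_nn: "0 <= f j x" for j x by (simp add: f_def)
  obtain W where W: "AE x in M. summable (%j. f j x)" by (rule AE_summable_dominating[OF f_int f_nn f_le])
  have conv: "AE x in M. convergent (%j. us (r j) x)" using W
  proof eventually_elim
    case (elim x)
    have "summable (%j. l j + f j x)" using elim by (intro summable_add) (auto simp: l_def[abs_def])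
    hence "summable (%j. d j x)" by (rule summable_comparison_test'[where N=0])
        (use le_add_powr[OF l _ p] in "auto simp: f_def")
    hence "summable (%j. us (r (Suc j)) x - us (r j) x)" by (simp add: d_def)
    hence "convergent (%n. \<Sum>j<n. us (r (Suc j)) x - us (r j) x)" by (simp add: summable_iff_convergent)
    hence "convergent (%n. us (r n) x - us (r 0) x)" using sum_lessThan_telescope[of "%j. us (r j) x"] by simp
    thus ?case
      using convergent_add[of "%n. us (r n) x - us (r 0) x" "%_. us (r 0) x"] by (simp add: convergent_const)
  qed
  define u where "u x = lim (%j. us (r j) x)" for x
  have um [measurable]: "u : borel_measurable M" unfolding u_def by (rule borel_measurable_lim_metric) auto
  have ulim: "AE x in M. (%j. us (r j) x) ----> u x"
    using conv by eventually_elim (simp add: u_def convergent_LIMSEQ_iff)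
  \<comment> \<open>Fatou's lemma along the a.e. convergent subsequence; \<open>r j >= j\<close>
    places its indices in the tail where the Cauchy bound holds.\<close>
  have key: "LpV M p (%x. us n x - u x) & Ipow M p (%x. us n x - u x) <= e"
    if n: "ALL m>=n. Ipow M p (%x. us m x - us n x) < e" and e: "e > 0" for n e
  proof -
    have "(\<integral>\<^sup>+x. ennreal (norm (us n x - u x) powr p) \<partial>M)
        = (\<integral>\<^sup>+x. liminf (%j. ennreal (norm (us n x - us (r j) x) powr p)) \<partial>M)"
    proof (rule nn_integral_cong_AE, use ulim in eventually_elim)
      case (elim x)
      have "(%j. norm (us n x - us (r j) x) powr p) ----> norm (us n x - u x) powr p"
      proof (rule tendsto_powr2)
        show "(%j. norm (us n x - us (r j) x)) ----> norm (us n x - u x)" by (intro tendsto_intros elim)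
      qed (use p in auto)
      hence "(%j. ennreal (norm (us n x - us (r j) x) powr p)) ----> ennreal (norm (us n x - u x) powr p)"
        by (rule tendsto_ennrealI)
      thus ?case by (intro lim_imp_Liminf[symmetric]) auto
    qed
    also have "... <= liminf (%j. \<integral>\<^sup>+x. ennreal (norm (us n x - us (r j) x) powr p) \<partial>M)"
      by (rule nn_integral_liminf) auto
    also have "... <= ennreal e"
    proof (rule Liminf_le)
      show "\<forall>\<^sub>F j in sequentially. (\<integral>\<^sup>+x. ennreal (norm (us n x - us (r j) x) powr p) \<partial>M) <= ennreal e"
        using eventually_ge_at_top[of n]
      proof eventually_elim
        case (elim j)
        have "r j >= n" using seq_suble[OF r(1), of j] elim by linarith
        hence "Ipow M p (%x. us n x - us (r j) x) < e" using n by (subst Ipow_diff_commute) auto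
        moreover have "(\<integral>\<^sup>+x. ennreal (norm (us n x - us (r j) x) powr p) \<partial>M) = ennreal (Ipow M p (%x. us n x - us (r j) x))"
          unfolding Ipow_def using LpV_diff[OF un[of n] un[of "r j"]] p
          by (intro nn_integral_eq_integral) (auto simp: LpV_def)
        ultimately show ?case by (auto intro: ennreal_leI)
      qed
    qed auto
    finally have le: "(\<integral>\<^sup>+x. ennreal (norm (us n x - u x) powr p) \<partial>M) <= ennreal e" .
    have "integrable M (%x. norm (us n x - u x) powr p)"
      by (rule integrableI_nonneg) (use le in "auto intro: le_less_trans")
    moreover from this have "ennreal (Ipow M p (%x. us n x - u x)) <= ennreal e"
      using le unfolding Ipow_def by (subst nn_integral_eq_integral[symmetric]) auto
    ultimately show ?thesis using e by (auto simp: LpV_def)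
  qed
  have ev: "EX N. ALL n>=N. LpV M p (%x. us n x - u x) & Ipow M p (%x. us n x - u x) <= e" if e: "e > 0" for e
    proof -
    obtain N where "ALL m>=N. ALL n>=N. Ipow M p (%x. us m x - us n x) < e" using cau[OF e] by auto
    thus ?thesis by (intro exI[of _ N] allI impI key e) auto
  qed
  show ?thesis
  proof
    obtain n where "LpV M p (%x. us n x - u x)" using ev[of 1] by auto
    from LpV_diff[OF un[of n] this] p show "LpV M p u" by simp
    show "(%n. Ipow M p (%x. us n x - u x)) ----> 0"
    proof (rule LIMSEQ_I)
      fix e :: real assume "e > 0"
      then obtain N where "ALL n>=N. Ipow M p (%x. us n x - u x) <= e/2" using ev[of "e/2"] by auto
      thus "EX no. ALL n>=no. norm (Ipow M p (%x. us n x - u x) - 0) < e"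
        using \<open>e > 0\<close> by (intro exI[of _ N]) (force simp: abs_of_nonneg)
    qed
  qed
qed

lemma powr_two: "0 <= (t::real) ==> t powr 2 = t^2" by (cases "t = 0") auto

lemma Ipow_tendsto_dominated:
  fixes us :: "nat => 'a => 'b::euclidean_space"
  assumes r: "0 < r" and m: "!!n. us n : borel_measurable M" "u : borel_measurable M" and w: "integrable M w"
    and lim: "AE x in M. (%n. us n x) ----> u x" and le: "AE x in M. ALL n. norm (us n x) powr r <= w x"
  shows "(%n. Ipow M r (%x. us n x - u x)) ----> 0"
proof -
  have lu: "AE x in M. norm (u x) powr r <= w x" using lim le
  proof eventually_elim
    case (elim x)
    have "(%n. norm (us n x) powr r) ----> norm (u x) powr r"
      using r by (intro tendsto_powr' tendsto_norm elim(1) tendsto_const) auto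
    thus ?case using elim(2) by (intro LIMSEQ_le_const2) auto
  qed
  have "(%n. (LINT x|M. norm (us n x - u x) powr r)) ----> (LINT x|M. 0)"
  proof (rule integral_dominated_convergence[where w="%x. 2 powr r * (w x + w x)"])
    show "AE x in M. (%n. norm (us n x - u x) powr r) ----> 0" using lim
    proof eventually_elim
      case (elim x)
      have "(%n. norm (us n x - u x)) ----> 0" using tendsto_norm[OF tendsto_diff[OF elim tendsto_const, of "u x"]] by simp
      from tendsto_zero_powrI[OF this tendsto_const _ r] show ?case by simp
    qed
    show "AE x in M. norm (norm (us n x - u x) powr r) <= 2 powr r * (w x + w x)" for n using lu le
    proof eventually_elim
      case (elim x)
      have "norm (us n x - u x) powr r <= (norm (us n x) + norm (u x)) powr r"
        using norm_triangle_ineq4[of "us n x" "u x"] r by (intro powr_mono2) auto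
      also have "... <= 2 powr r * (norm (us n x) powr r + norm (u x) powr r)" using r by (intro powr_add_le) auto
      also have "... <= 2 powr r * (w x + w x)" using elim by (intro mult_left_mono add_mono) auto
      finally show ?case by simp
    qed
  qed (use w m in auto)
  thus ?thesis by (simp add: Ipow_def)
qed

section \<open>Semi-Hilbert spaces of functions\<close>

instantiation "fun" :: (type, real_vector) real_vector
begin

definition scaleR_fun_def: "scaleR c f = (%x. c *\<^sub>R f x)"

instance by standard (auto simp: scaleR_fun_def fun_eq_iff plus_fun_def scaleR_add_right scaleR_add_left)

end

lemma scaleR_fun_apply [simp]: "(c *\<^sub>R f) x = c *\<^sub>R f x" by (simp add: scaleR_fun_def)

text \<open>The first-order condition at a minimum, used both for Riesz representation and for the
  extremal characterization of eigenvectors.\<close>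

lemma quadratic_nonneg_imp_zero:
  fixes a b :: real
  assumes "!!t. 0 <= t * a + t^2 * b" "0 <= b"
  shows "a = 0"
proof -
  \<comment> \<open>Nearly the minimizer \<open>- a / (2 * b)\<close>; the \<open>+ 1\<close> covers
    \<open>b = 0\<close> as well.\<close>
  have "0 <= (- a / (b + 1)) * a + (- a / (b + 1))^2 * b" by (rule assms(1))
  also have "... = - (a^2) / (b + 1)^2"
    using assms(2) by (simp add: divide_simps power2_eq_square) (simp add: algebra_simps)
  finally have "a^2 / (b + 1)^2 <= 0" by simp
  moreover have "0 < (b + 1)^2" using assms(2) by simp
  ultimately have "a^2 <= 0" by (simp add: divide_le_0_iff)
  thus ?thesis by simp
qed

text \<open>The form is only semidefinite: elements that agree almost everywhere are not identified.\<close>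

locale semi_hilbert =
  fixes V :: "'a::real_vector set" and ip :: "'a => 'a => real"
  assumes subspace: "subspace V"
    and ip_add: "!!x y z. x : V ==> y : V ==> z : V ==> ip (x + y) z = ip x z + ip y z"
    and ip_scale: "!!c x y. x : V ==> y : V ==> ip (c *\<^sub>R x) y = c * ip x y"
    and ip_sym: "!!x y. x : V ==> y : V ==> ip x y = ip y x"
    and ip_nonneg: "!!x. x : V ==> 0 <= ip x x"
    and ip_complete: "!!X. (!!n::nat. X n : V) ==>
        (!!e. 0 < e ==> EX N. ALL m>=N. ALL n>=N. ip (X m - X n) (X m - X n) < e) ==>
        EX x:V. (%n. ip (X n - x) (X n - x)) ----> 0"
begin

lemma V_add: "x : V ==> y : V ==> x + y : V"
  and V_scale: "x : V ==> c *\<^sub>R x : V"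
  and V_diff: "x : V ==> y : V ==> x - y : V"
  and V_zero: "0 : V" using subspace by (auto simp: subspace_add subspace_scale subspace_diff subspace_0)

lemmas V_closed = V_add V_scale V_diff V_zero

lemma ip_add2: "x : V ==> y : V ==> z : V ==> ip z (x + y) = ip z x + ip z y"
  by (simp add: ip_add ip_sym[of z] V_closed)

lemma ip_scale2: "x : V ==> y : V ==> ip x (c *\<^sub>R y) = c * ip x y"
  by (simp add: ip_scale ip_sym[of x] V_closed)

lemma ip_diff: "x : V ==> y : V ==> z : V ==> ip (x - y) z = ip x z - ip y z"
  using ip_add[OF _ V_scale, of x y z "-1"] ip_scale[of y z "-1"] by simp

lemma ip_diff2: "x : V ==> y : V ==> z : V ==> ip z (x - y) = ip z x - ip z y"
  by (simp add: ip_diff ip_sym[of z] V_closed)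

definition nrm :: "'a => real" where "nrm x = sqrt (ip x x)"

lemma nrm_sq: "x : V ==> (nrm x)^2 = ip x x" by (simp add: nrm_def ip_nonneg)

lemma nrm_nonneg: "x : V ==> 0 <= nrm x" by (simp add: nrm_def ip_nonneg)

lemma Cauchy_Schwarz:
  assumes x: "x : V" and y: "y : V"
  shows "abs (ip x y) <= nrm x * nrm y"
proof -
  have eq: "ip (x + t *\<^sub>R y) (x + t *\<^sub>R y) = ip x x + t * (2 * ip x y) + t^2 * ip y y" for t
    using x y by (simp add: ip_add ip_add2 ip_scale ip_scale2 V_closed ip_sym[of y x] power2_eq_square algebra_simps)
  have nn: "0 <= ip x x + t * (2 * ip x y) + t^2 * ip y y" for t
    using ip_nonneg[of "x + t *\<^sub>R y"] x y unfolding eq by (simp add: V_closed)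
  have "(ip x y)^2 <= ip x x * ip y y"
  proof (cases "ip y y = 0")
    case True
    have "ip x y = 0"
    proof (rule ccontr)
      assume "ip x y ~= 0"
      \<comment> \<open>For a semidefinite form \<open>ip y y = 0\<close> does not force
        \<open>y = 0\<close>. The expression is then affine in \<open>t\<close>, and this value of
        \<open>t\<close> makes it equal to -1.\<close>
      thus False using nn[of "- (ip x x + 1) / (2 * ip x y)"] True by simp
    qed
    thus ?thesis using True by simp
  next
    case False
    hence pos: "ip y y > 0" using ip_nonneg[OF y] by simp
    have "0 <= ip x x + (- ip x y / ip y y) * (2 * ip x y) + (- ip x y / ip y y)^2 * ip y y" by (rule nn)
    also have "... = ip x x - (ip x y)^2 / ip y y" using pos by (simp add: field_simps power2_eq_square)
    finally show ?thesis using pos by (simp add: field_simps)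
  qed
  hence "sqrt ((ip x y)^2) <= sqrt (ip x x * ip y y)" by (rule real_sqrt_le_mono)
  thus ?thesis by (simp add: nrm_def real_sqrt_mult)
qed

lemma nrm_scale: "x : V ==> nrm (c *\<^sub>R x) = abs c * nrm x"
  by (simp add: nrm_def ip_scale ip_scale2 V_closed real_sqrt_mult mult.assoc[symmetric])

lemma nrm_triangle:
  assumes x: "x : V" and y: "y : V"
  shows "nrm (x + y) <= nrm x + nrm y"
proof (rule power2_le_imp_le)
  have "(nrm (x + y))^2 = (nrm x)^2 + 2 * ip x y + (nrm y)^2"
    using x y by (simp add: nrm_sq V_closed ip_add ip_add2 ip_sym[of y x])
  also have "... <= (nrm x + nrm y)^2" using Cauchy_Schwarz[OF x y] by (simp add: power2_sum)
  finally show "(nrm (x + y))^2 <= (nrm x + nrm y)^2" .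
qed (simp add: nrm_nonneg x y)

lemma nrm_triangle_diff: "x : V ==> y : V ==> nrm (x - y) <= nrm x + nrm y"
  using nrm_triangle[OF _ V_scale, of x y "-1"] nrm_scale[of y "-1"] by simp

lemma ip_tendsto:
  assumes X: "!!n. X n : V" and x: "x : V" and v: "v : V"
    and lim: "(%n. ip (X n - x) (X n - x)) ----> 0"
  shows "(%n. ip (X n) v) ----> ip x v"
proof -
  have "(%n. nrm (X n - x) * nrm v) ----> sqrt 0 * nrm v" unfolding nrm_def by (intro tendsto_intros lim)
  hence h: "(%n. nrm (X n - x) * nrm v) ----> 0" by simp
  have "(%n. ip (X n - x) v) ----> 0"
    by (rule Lim_null_comparison[OF _ h]) (auto intro!: always_eventually Cauchy_Schwarz V_closed X x v)
  thus ?thesis using X x v by (simp add: ip_diff LIM_zero_iff)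
qed

section \<open>Bounded functionals, representation, monotone operators and weak cluster
  points\<close>

definition bdlin :: "('a => real) => bool" where
  "bdlin l \<longleftrightarrow> (ALL x:V. ALL y:V. l (x + y) = l x + l y) & (ALL c. ALL x:V. l (c *\<^sub>R x) = c * l x) \<and>
     (EX C. ALL x:V. abs (l x) <= C * nrm x)"

lemma bdlinI:
  assumes "!!x y. x : V ==> y : V ==> l (x + y) = l x + l y"
    "!!c x. x : V ==> l (c *\<^sub>R x) = c * l x" "!!x. x : V ==> abs (l x) <= C * nrm x"
  shows "bdlin l" using assms unfolding bdlin_def by blast

lemma bdlin_diff:
  assumes "bdlin l" "x : V" "y : V"
  shows "l (x - y) = l x - l y"
proof -
  have "l (x + (-1) *\<^sub>R y) = l x + l ((-1) *\<^sub>R y)"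
    using assms V_scale[of y "-1"] unfolding bdlin_def by blast
  also have "l ((-1) *\<^sub>R y) = (-1) * l y" using assms unfolding bdlin_def by blast
  finally show ?thesis by simp
qed

lemma bdlin_minus:
  assumes "bdlin l"
  shows "bdlin (%x. - l x)" using assms unfolding bdlin_def by (auto simp: algebra_simps)

lemma bdlin_add:
  assumes "bdlin l" "bdlin m"
  shows "bdlin (%x. l x + m x)"
proof -
  obtain C D where C: "!!x. x\<in>V ==> abs (l x) <= C * nrm x" and D: "!!x. x\<in>V ==> abs (m x) <= D * nrm x"
    using assms unfolding bdlin_def by blast
  show ?thesis
  proof (rule bdlinI)
    show "abs (l x + m x) <= (C + D) * nrm x" if "x : V" for x
      using C[OF that] D[OF that] by (simp add: algebra_simps)
  qed (use assms in "auto simp: bdlin_def algebra_simps")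
qed

lemma bdlin_tendsto:
  assumes l: "bdlin l" and X: "!!n. X n : V" and x: "x : V"
    and lim: "(%n. ip (X n - x) (X n - x)) ----> 0"
  shows "(%n. l (X n)) ----> l x"
proof -
  obtain C where C: "!!x. x\<in>V ==> abs (l x) <= C * nrm x" using l unfolding bdlin_def by blast
  have "(%n. C * nrm (X n - x)) ----> C * sqrt 0" unfolding nrm_def by (intro tendsto_intros lim)
  hence h: "(%n. C * nrm (X n - x)) ----> 0" by simp
  have "(%n. l (X n - x)) ----> 0"
    by (rule Lim_null_comparison[OF _ h]) (auto intro!: always_eventually C V_closed X x)
  thus ?thesis using X x by (simp add: bdlin_diff[OF l] LIM_zero_iff)
qed

lemma Cauchy_of_bound:
  fixes X :: "nat => 'a" and c :: "nat => real"
  assumes X: "!!n. X n : V" and c: "c ----> 0"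
    and le: "!!m n. ip (X m - X n) (X m - X n) <= c m + c n"
  shows "EX x:V. (%n. ip (X n - x) (X n - x)) ----> 0"
proof (rule ip_complete[OF X])
  fix e :: real assume "e > 0"
  then obtain N where "ALL n>=N. c n < e / 2"
    using order_tendstoD(2)[OF c, of "e/2"] by (auto simp: eventually_sequentially)
  thus "EX N. ALL m>=N. ALL n>=N. ip (X m - X n) (X m - X n) < e"
    using le by (intro exI[of _ N]) (smt (verit) field_sum_of_halves)
qed

text \<open>A minimizing sequence of \<open>J v = ip v v - 2 * l v\<close> is Cauchy by the
  parallelogram identity, and the first-order condition at its limit is the representation.\<close>

theorem Riesz:
  assumes l: "bdlin l"
  obtains w where "w : V" "!!v. v : V ==> l v = ip w v"
proof -
  obtain C where C: "!!x. x\<in>V ==> abs (l x) <= C * nrm x" using l unfolding bdlin_def by blast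
  have ladd: "l (x + y) = l x + l y" if "x : V" "y : V" for x y using l that unfolding bdlin_def by auto
  have lsc: "l (c *\<^sub>R x) = c * l x" if "x : V" for x c using l that unfolding bdlin_def by auto
  define J where "J v = ip v v - 2 * l v" for v
  have "- (C^2) <= J v" if v: "v : V" for v
  proof -
    have "0 <= (nrm v - C)^2" by simp
    thus ?thesis using C[OF v] nrm_sq[OF v] by (simp add: J_def power2_diff algebra_simps)
  qed
  hence bdd: "bdd_below (J ` V)" by (auto intro!: bdd_belowI2)
  define m where "m = Inf (J ` V)"
  have mle: "m <= J v" if "v : V" for v unfolding m_def using bdd that by (simp add: cInf_lower)
  have "EX v:V. J v < m + e" if "e > 0" for e
  proof -
    have "Inf (J ` V) < m + e" using that by (simp add: m_def)
    thus ?thesis using V_zero bdd by (subst (asm) cInf_less_iff) auto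
  qed
  hence "ALL n. EX v. v : V & J v < m + 1 / real (Suc n)" by (meson of_nat_0_less_iff zero_less_Suc zero_less_divide_1_iff)
  then obtain X where X: "!!n. X n : V" "!!n. J (X n) < m + 1 / real (Suc n)" by metis
  let ?c = "%n. 2 * (1 / real (Suc n))"
  have c0: "?c ----> 0"
    using tendsto_mult_right[OF LIMSEQ_inverse_real_of_nat, of 2] by (simp add: inverse_eq_divide)
  have "ip (X i - X j) (X i - X j) <= ?c i + ?c j" for i j
  proof -
    let ?h = "(1/2) *\<^sub>R (X i + X j)"
    have "4 * J ?h = ip (X i) (X i) + 2 * ip (X i) (X j) + ip (X j) (X j) - 4 * l (X i) - 4 * l (X j)"
      using X by (simp add: J_def ip_add ip_add2 ip_scale ip_scale2 V_closed ladd lsc ip_sym[of "X j" "X i"]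
          del: scaleR_add_right) (simp add: field_simps)
    hence "ip (X i - X j) (X i - X j) = 2 * J (X i) + 2 * J (X j) - 4 * J ?h"
      using X by (simp add: J_def ip_diff ip_diff2 V_closed ip_sym[of "X j" "X i"])
    also have "... <= 2 * (m + 1 / real (Suc i)) + 2 * (m + 1 / real (Suc j)) - 4 * m"
      using X(2)[of i] X(2)[of j] mle[of ?h] X(1) by (simp add: V_closed)
    finally show ?thesis by simp
  qed
  from Cauchy_of_bound[of X, OF X(1) c0 this] obtain w where w: "w : V" "(%n. ip (X n - w) (X n - w)) ----> 0"
    by blast
  have "l v = ip w v" if v: "v : V" for v
  proof -
    \<comment> \<open>Taken as a limit over \<open>n\<close>: the change of \<open>J\<close> from
      \<open>X n\<close> to \<open>X n + t v\<close> is at least \<open>m - J (X n)\<close>, which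
      exceeds \<open>- 1 / real (Suc n)\<close>.\<close>
    have "0 <= t * (2 * (ip w v - l v)) + t^2 * ip v v" for t
    proof (rule LIMSEQ_le[OF _ _ exI[of _ 0]])
      show "(%n. - (1 / real (Suc n))) ----> 0"
        using tendsto_minus[OF LIMSEQ_inverse_real_of_nat] by (simp add: inverse_eq_divide)
      show "(%n. t * (2 * (ip (X n) v - l v)) + t^2 * ip v v) ----> t * (2 * (ip w v - l v)) + t^2 * ip v v"
        by (intro tendsto_intros ip_tendsto[OF X(1) w(1) v w(2)])
      have "- (1 / real (Suc n)) <= t * (2 * (ip (X n) v - l v)) + t^2 * ip v v" for n
      proof -
        have "J (X n + t *\<^sub>R v) = J (X n) + (t * (2 * (ip (X n) v - l v)) + t^2 * ip v v)"
          using X(1) v by (simp add: J_def ip_add ip_add2 ip_scale ip_scale2 V_closed ladd lsc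
              ip_sym[of v "X n"] power2_eq_square algebra_simps)
        moreover have "m <= J (X n + t *\<^sub>R v)" using X(1) v by (intro mle V_closed)
        ultimately show ?thesis using X(2)[of n] by linarith
      qed
      thus "ALL n>=0. - (1 / real (Suc n)) <= t * (2 * (ip (X n) v - l v)) + t^2 * ip v v" by simp
    qed
    thus ?thesis using quadratic_nonneg_imp_zero[of "2 * (ip w v - l v)" "ip v v"] ip_nonneg[OF v] by simp
  qed
  thus ?thesis using that w(1) by blast
qed

text \<open>Zarantonello's fixed point argument: \<open>u - c R u\<close> is a contraction, where \<open>R u\<close> represents the residual.\<close>

theorem strongly_monotone_solvable:
  fixes A :: "'a => 'a => real"
  assumes A: "!!u. u : V ==> bdlin (A u)" and l: "bdlin l" and c: "0 < c"
    and mono: "!!u v. u : V ==> v : V ==> c * (nrm (u - v))^2 <= A u (u - v) - A v (u - v)"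
    and lip: "!!u v w. u : V ==> v : V ==> w : V ==> abs (A u w - A v w) <= L * nrm (u - v) * nrm w"
  obtains u where "u : V" "!!v. v : V ==> A u v = l v"
proof -
  have "EX w:V. ALL v:V. A u v - l v = ip w v" if "u : V" for u
    using Riesz[OF bdlin_add[OF A[OF that] bdlin_minus[OF l]]] by (metis diff_conv_add_uminus)
  then obtain R where R: "!!u. u : V ==> R u : V" "!!u v. u : V ==> v : V ==> A u v - l v = ip (R u) v"
    by metis
  \<comment> \<open>The maximum makes \<open>K\<close> positive and at least \<open>c\<close>, so
    that the factor \<open>th\<close> below lies in [0,1).\<close>
  define K where "K = max L c"
  have K: "K > 0" "c <= K" "L <= K" using c by (auto simp: K_def)
  \<comment> \<open>The minimizer of \<open>1 - 2 * c * lam + K^2 * lam^2\<close>, whose value is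
    \<open>1 - c^2 / K^2\<close>.\<close>
  define lam where "lam = c / K^2"
  have lam: "lam > 0" using c K by (simp add: lam_def)
  have Rlip: "nrm (R u - R v) <= K * nrm (u - v)" if "u : V" "v : V" for u v
  proof -
    let ?w = "R u - R v"
    have w: "?w : V" using R that by (simp add: V_closed)
    have "(nrm ?w)^2 = A u ?w - A v ?w"
      using R(2)[OF that(1) w] R(2)[OF that(2) w] that R(1) w by (simp add: nrm_sq ip_diff)
    also have "... <= L * nrm (u - v) * nrm ?w" using lip[OF that w] by simp
    also have "... <= K * nrm (u - v) * nrm ?w"
      using K nrm_nonneg[OF w] nrm_nonneg[OF V_diff[OF that]] by (intro mult_right_mono) auto
    finally have "nrm ?w * nrm ?w <= (K * nrm (u - v)) * nrm ?w" by (simp add: power2_eq_square)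
    thus ?thesis using nrm_nonneg[OF w] nrm_nonneg[OF V_diff[OF that]] K
      by (cases "nrm ?w = 0") (auto simp: mult_le_cancel_right)
  qed
  have Rmono: "c * (nrm (u - v))^2 <= ip (R u - R v) (u - v)" if "u : V" "v : V" for u v
    using mono[OF that] R(2)[OF that(1) V_diff[OF that]] R(2)[OF that(2) V_diff[OF that]] that R(1)
    by (simp add: ip_diff[of "R u" "R v"] V_closed)
  define T where "T u = u - lam *\<^sub>R R u" for u
  have TV: "T u : V" if "u : V" for u using that R by (simp add: T_def V_closed)
  define th where "th = 1 - c^2 / K^2"
  have th: "0 <= th" "th < 1" using c K by (auto simp: th_def power_mono)
  \<comment> \<open>It is the residual that is shown to contract. Strong monotonicity then bounds
    the distance of two iterates by the difference of their residuals, which makes the iterates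
    Cauchy.\<close>
  have con: "ip (R (T u)) (R (T u)) <= th * ip (R u) (R u)" if u: "u : V" for u
  proof -
    let ?r = "R u" and ?d = "R u - R (T u)"
    have r: "?r : V" and d: "?d : V" and rT: "R (T u) : V" using u R TV by (auto simp: V_closed)
    have uT: "u - T u = lam *\<^sub>R ?r" by (simp add: T_def)
    have n2: "(nrm (lam *\<^sub>R ?r))^2 = lam^2 * ip ?r ?r"
      using r nrm_sq[OF V_scale[OF r]] by (simp add: ip_scale ip_scale2 V_closed power2_eq_square)
    have "ip (R (T u)) (R (T u)) = ip ?r ?r - 2 * ip ?d ?r + ip ?d ?d"
      using r rT by (simp add: ip_diff ip_diff2 V_closed ip_sym[of "R (T u)" "R u"])
    moreover have "lam * (c * lam * ip ?r ?r) <= lam * ip ?d ?r"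
      using Rmono[OF u TV[OF u]] r d unfolding uT n2 by (simp add: ip_scale2 power2_eq_square mult_ac)
    hence "c * lam * ip ?r ?r <= ip ?d ?r" using lam by simp
    moreover have "(nrm ?d)^2 <= (K * nrm (u - T u))^2"
      by (rule power_mono[OF Rlip[OF u TV[OF u]] nrm_nonneg[OF d]])
    hence "ip ?d ?d <= K^2 * (lam^2 * ip ?r ?r)" unfolding uT power_mult_distrib n2 nrm_sq[OF d] .
    moreover have "ip ?r ?r - 2 * (c * lam * ip ?r ?r) + K^2 * (lam^2 * ip ?r ?r) = th * ip ?r ?r"
      using K by (simp add: lam_def th_def field_simps power2_eq_square)
    ultimately show ?thesis by linarith
  qed
  define X where "X n = (T ^^ n) 0" for n
  have X: "X n : V" for n by (induction n) (auto simp: X_def TV V_zero)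
  define b where "b n = th ^ n * ip (R 0) (R 0)" for n
  have Rb: "ip (R (X n)) (R (X n)) <= b n" for n
  proof (induction n)
    case (Suc n)
    have "ip (R (X (Suc n))) (R (X (Suc n))) <= th * ip (R (X n)) (R (X n))" using con[OF X[of n]] by (simp add: X_def)
    also have "... <= th * b n" by (rule mult_left_mono[OF Suc th(1)])
    finally show ?case by (simp add: b_def)
  qed (simp add: b_def X_def)
  have b0: "b ----> 0"
    using tendsto_mult_left_zero[OF LIMSEQ_power_zero[of th]] th unfolding b_def by simp
  have "ip (X m - X n) (X m - X n) <= 2 / c^2 * b m + 2 / c^2 * b n" for m n
  proof -
    let ?x = "X m - X n" and ?r = "R (X m) - R (X n)"
    have V: "?x : V" "?r : V" "R (X m) + R (X n) : V" using X R by (auto simp: V_closed)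
    have "c * nrm ?x * nrm ?x <= nrm ?r * nrm ?x"
      using Rmono[OF X[of m] X[of n]] Cauchy_Schwarz[OF V(2,1)] by (simp add: power2_eq_square)
    hence "c * nrm ?x <= nrm ?r"
      using nrm_nonneg[OF V(1)] nrm_nonneg[OF V(2)] by (cases "nrm ?x = 0") (auto simp: mult_le_cancel_right)
    hence "(c * nrm ?x)^2 <= (nrm ?r)^2" using c nrm_nonneg[OF V(1)] by (intro power_mono) auto
    moreover have "ip ?r ?r + ip (R (X m) + R (X n)) (R (X m) + R (X n)) = 2 * ip (R (X m)) (R (X m)) + 2 * ip (R (X n)) (R (X n))"
      using X R by (simp add: ip_add ip_add2 ip_diff ip_diff2 V_closed)
    ultimately have "c^2 * ip ?x ?x <= 2 * b m + 2 * b n"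
      using Rb[of m] Rb[of n] ip_nonneg[OF V(3)] nrm_sq[OF V(1)] nrm_sq[OF V(2)] by (simp add: power_mult_distrib)
    thus ?thesis using c by (simp add: field_simps)
  qed
  moreover have "(%n. 2 / c^2 * b n) ----> 0" using tendsto_mult_right_zero[OF b0] .
  ultimately obtain u where u: "u : V" "(%n. ip (X n - u) (X n - u)) ----> 0"
    using Cauchy_of_bound[of X "%n. 2 / c^2 * b n", OF X] by blast
  have "(%n. sqrt (b n) + K * nrm (X n - u)) ----> sqrt 0 + K * sqrt 0"
    unfolding nrm_def by (intro tendsto_intros b0 u)
  moreover have "nrm (R u) <= sqrt (b n) + K * nrm (X n - u)" for n
  proof -
    have "nrm (R u) <= nrm (R (X n)) + nrm (R (X n) - R u)"
      using nrm_triangle_diff[of "R (X n)" "R (X n) - R u"] R X u by (simp add: V_closed)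
    moreover have "nrm (R (X n)) <= sqrt (b n)" using Rb[of n] by (simp add: nrm_def)
    ultimately show ?thesis using Rlip[OF X[of n] u(1)] by linarith
  qed
  ultimately have "nrm (R u) <= sqrt 0 + K * sqrt 0" by (intro LIMSEQ_le_const) auto
  hence R0: "nrm (R u) = 0" using nrm_nonneg R u by fastforce
  have "A u v = l v" if "v : V" for v
    using R(2)[OF u(1) that] Cauchy_Schwarz[OF R(1)[OF u(1)] that] R0 by simp
  thus ?thesis using that u(1) by blast
qed

text \<open>A substitute for weak sequential compactness: minimal-norm elements of the convex hulls of the tails
  form a Cauchy sequence, and half spaces are convex.\<close>

theorem weak_cluster_point:
  assumes X: "!!n::nat. X n : V" and bd: "!!n. ip (X n) (X n) <= C"
  obtains g where "g : V"
    "!!l c. bdlin l ==> eventually (%n. l (X n) <= c) sequentially ==> l g <= c"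
proof -
  define H where "H n = convex hull (X ` {n..})" for n
  have HV: "H n \<subseteq> V" for n
    unfolding H_def using X subspace by (intro hull_minimal) (auto intro: subspace_imp_convex)
  have Hmono: "H m \<subseteq> H n" if "n <= m" for m n unfolding H_def using that by (intro hull_mono) auto
  have XH: "X n : H n" for n unfolding H_def by (rule hull_inc) auto
  define d where "d n = Inf ((%x. ip x x) ` H n)" for n
  have bdd: "bdd_below ((%x. ip x x) ` H n)" for n
    using HV by (intro bdd_belowI2[of _ 0]) (auto intro: ip_nonneg)
  have dle: "d n <= ip x x" if "x : H n" for x n unfolding d_def using that bdd by (simp add: cInf_lower)
  \<comment> \<open>The hulls of the tails decrease, so their smallest squared norms increase; they
    are bounded by \<open>C\<close> and converge.\<close>
  have "incseq d"
  proof (rule incseq_SucI)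
    fix n
    show "d n <= d (Suc n)"
      unfolding d_def using XH[of "Suc n"] Hmono[of n "Suc n"] by (intro cInf_superset_mono bdd) auto
  qed
  moreover have "d n <= C" for n using dle[OF XH] bd order_trans by blast
  ultimately obtain D where D: "d ----> D" "!!n. d n <= D" using incseq_convergent[of d C] by auto
  have "EX g. g : H n & ip g g < d n + 1 / real (Suc n)" for n
  proof -
    have "Inf ((%x. ip x x) ` H n) < d n + 1 / real (Suc n)" by (simp add: d_def)
    thus ?thesis using XH[of n] bdd by (subst (asm) cInf_less_iff) auto
  qed
  then obtain g where g: "!!n. g n : H n" "!!n. ip (g n) (g n) < d n + 1 / real (Suc n)" by metis
  have gV: "g n : V" for n using g HV by auto
  define c where "c n = 2 * (D - d n) + 2 * (1 / real (Suc n))" for n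
  have cnn: "0 <= c n" for n using D(2)[of n] by (simp add: c_def)
  \<comment> \<open>For \<open>n <= m\<close> both points lie in the larger hull \<open>H n\<close>,
    hence so does their midpoint, whose squared norm is at least \<open>d n\<close>; the
    parallelogram identity does the rest.\<close>
  have aux: "ip (g m - g n) (g m - g n) <= c m + c n" if "n <= m" for m n
  proof -
    let ?h = "(1/2) *\<^sub>R (g m + g n)"
    have "?h = (1/2) *\<^sub>R g m + (1/2) *\<^sub>R g n" by (simp add: algebra_simps)
    also have "... : H n" using g(1)[of m] g(1)[of n] Hmono[OF that] convex_convex_hull[of "X ` {n..}"]
      by (intro convexD) (auto simp: H_def)
    finally have "d n <= ip ?h ?h" by (rule dle)
    moreover have "ip (g m - g n) (g m - g n) = 2 * ip (g m) (g m) + 2 * ip (g n) (g n) - 4 * ip ?h ?h"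
      using gV by (simp add: ip_add ip_add2 ip_diff ip_diff2 ip_scale ip_scale2 V_closed ip_sym[of "g n" "g m"] algebra_simps)
    ultimately show ?thesis using g(2)[of m] g(2)[of n] D(2)[of m] by (simp add: c_def)
  qed
  have "ip (g m - g n) (g m - g n) <= c m + c n" for m n
  proof (cases "n <= m")
    case False
    have "ip (g m - g n) (g m - g n) = ip (g n - g m) (g n - g m)"
      using gV by (simp add: ip_diff ip_diff2 V_closed ip_sym algebra_simps)
    thus ?thesis using aux[of m n] False by simp
  qed (rule aux)
  moreover have "c ----> 2 * (D - D) + 2 * 0"
    unfolding c_def using LIMSEQ_inverse_real_of_nat by (intro tendsto_intros D) (simp add: inverse_eq_divide)
  ultimately obtain z where z: "z : V" "(%n. ip (g n - z) (g n - z)) ----> 0"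
    using Cauchy_of_bound[of g c, OF gV] by auto
  \<comment> \<open>The half space of \<open>l\<close> contains a tail of the sequence, hence the
    hulls of the later tails, hence almost all \<open>g n\<close>.\<close>
  have "l z <= a" if l: "bdlin l" and ev: "eventually (%n. l (X n) <= a) sequentially" for l a
  proof -
    obtain N where N: "!!n. n >= N ==> l (X n) <= a" using ev by (auto simp: eventually_sequentially)
    have "convex {x : V. l x <= a}"
      unfolding convex_def using l by (auto simp: bdlin_def V_closed intro!: convex_bound_le)
    hence "H n \<subseteq> {x : V. l x <= a}" if "n >= N" for n
      unfolding H_def using N that X by (intro hull_minimal) auto
    hence "ALL n>=N. l (g n) <= a" using g(1) by auto
    thus ?thesis by (intro LIMSEQ_le_const2[OF bdlin_tendsto[OF l gV z]]) auto
  qed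
  thus ?thesis using that z(1) by blast
qed

end

section \<open>Moduli with the doubling property\<close>

definition flux :: "(real => real) => 'b::real_inner => 'b" where
  "flux a x = a (norm x) *\<^sub>R x"

definition nondec :: "(real => real) => bool" where
  "nondec a \<longleftrightarrow> continuous_on {0..} a & (ALL s t. 0 <= s & s <= t --> a s <= a t) & (ALL t>=0. 0 <= a t)"

text \<open>The doubling condition of Orlicz theory, with \<open>a t * t^2\<close> as the Young
  function. Estimates that see \<open>a\<close> only through \<open>D\<close> are uniform over all
  regularized weights.\<close>

definition modulus :: "real => (real => real) => bool" where
  "modulus D a \<longleftrightarrow> nondec a & 1 <= D & (ALL t>=0. a (2 * t) <= D * a t)"

lemma nondecD:
  assumes "nondec a"
  shows "!!s t. 0 <= s ==> s <= t ==> a s <= a t" "!!t. 0 <= t ==> 0 <= a t" "continuous_on {0..} a"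
  using assms by (auto simp: nondec_def)

lemma modulusD:
  assumes "modulus D a"
  shows "nondec a" "!!s t. 0 <= s ==> s <= t ==> a s <= a t" "!!t. 0 <= t ==> 0 <= a t" "1 <= D"
    "!!t. 0 <= t ==> a (2 * t) <= D * a t" using assms by (auto simp: modulus_def nondec_def)

lemma continuous_on_nondec_norm:
  assumes "nondec a"
  shows "continuous_on UNIV (%x. a (norm x))"
  by (rule continuous_on_compose2[OF nondecD(3)[OF assms]]) (auto intro: continuous_intros)

lemma borel_measurable_nondec_norm [measurable (raw)]:
  assumes "nondec a" "f : borel_measurable M"
  shows "(%x. a (norm (f x))) : borel_measurable M"
  using measurable_compose[OF assms(2) borel_measurable_continuous_onI[OF continuous_on_nondec_norm[OF assms(1)]]] .

lemma continuous_on_flux: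
  assumes "nondec a"
  shows "continuous_on UNIV (flux a)"
  unfolding flux_def by (intro continuous_intros continuous_on_nondec_norm assms)

lemma borel_measurable_flux:
  fixes f :: "'a => 'b::euclidean_space"
  assumes "nondec a" "f : borel_measurable M"
  shows "(%x. flux a (f x)) : borel_measurable M"
  using measurable_compose[OF assms(2) borel_measurable_continuous_onI[OF continuous_on_flux[OF assms(1)]]] .

lemma norm_flux: "nondec a ==> norm (flux a x) = a (norm x) * norm x" by (simp add: flux_def nondecD)

lemma flux_inner_self: "flux a x \<bullet> x = a (norm x) * (norm x)^2"
  by (simp add: flux_def dot_square_norm)

text \<open>The two sides differ by half of \<open>(a s - a t) * (s^2 - t^2)\<close>, where
  \<open>s\<close>, \<open>t\<close> are the two norms; both factors have the same sign because
  \<open>a\<close> is nondecreasing.\<close>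

lemma flux_monotone:
  fixes x y :: "'b::real_inner"
  assumes a: "nondec a"
  shows "1/2 * (a (norm x) + a (norm y)) * (norm (x - y))^2 <= (flux a x - flux a y) \<bullet> (x - y)"
proof -
  let ?s = "a (norm x)" and ?t = "a (norm y)"
  have "(flux a x - flux a y) \<bullet> (x - y)
     = 1/2 * (?s + ?t) * (norm (x - y))^2 + 1/2 * ((?s - ?t) * ((norm x)^2 - (norm y)^2))"
    by (simp add: flux_def power2_norm_eq_inner inner_diff_left inner_diff_right inner_commute algebra_simps)
      (simp add: field_simps)
  moreover have "0 <= (?s - ?t) * ((norm x)^2 - (norm y)^2)"
  proof (cases "norm x <= norm y")
    case True
    thus ?thesis using nondecD(1)[OF a, of "norm x" "norm y"]
      by (intro mult_nonpos_nonpos) (auto simp: power_mono)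
  next
    case False
    thus ?thesis using nondecD(1)[OF a, of "norm y" "norm x"]
      by (intro mult_nonneg_nonneg) (auto simp: power_mono)
  qed
  ultimately show ?thesis by linarith
qed

text \<open>The larger of the two norms is at least half of \<open>norm (x - y)\<close>. The lower
  bound thus depends on the difference alone and can be read as its energy.\<close>

lemma flux_monotone_half:
  fixes x y :: "'b::real_inner"
  assumes a: "nondec a"
  shows "1/2 * a (norm (x - y) / 2) * (norm (x - y))^2 <= (flux a x - flux a y) \<bullet> (x - y)"
proof -
  have "a (norm (x - y) / 2) <= a (norm x) + a (norm y)"
  proof (cases "norm x <= norm y")
    case True
    hence "norm (x - y) / 2 <= norm y" using norm_triangle_ineq4[of x y] by simp
    thus ?thesis using nondecD(1)[OF a, of "norm (x - y) / 2" "norm y"] nondecD(2)[OF a, of "norm x"] by simp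
  next
    case False
    hence "norm (x - y) / 2 <= norm x" using norm_triangle_ineq4[of x y] by simp
    thus ?thesis using nondecD(1)[OF a, of "norm (x - y) / 2" "norm x"] nondecD(2)[OF a, of "norm y"] by simp
  qed
  hence "1/2 * a (norm (x - y) / 2) * (norm (x - y))^2 <= 1/2 * (a (norm x) + a (norm y)) * (norm (x - y))^2"
    by (intro mult_right_mono) auto
  thus ?thesis using flux_monotone[OF a, of x y] by linarith
qed

lemma flux_monotone_nonneg:
  fixes x y :: "'b::real_inner"
  assumes a: "nondec a"
  shows "0 <= (flux a x - flux a y) \<bullet> (x - y)"
proof -
  have "0 <= 1/2 * (a (norm x) + a (norm y)) * (norm (x - y))^2"
    using nondecD(2)[OF a] by (intro mult_nonneg_nonneg add_nonneg_nonneg) auto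
  thus ?thesis using flux_monotone[OF a, of x y] by linarith
qed

lemma modulus_pow2:
  assumes a: "modulus D a" and t: "0 <= t"
  shows "a (2 ^ m * t) <= D ^ m * a t"
proof (induction m)
  case (Suc m)
  have "a (2 * (2 ^ m * t)) <= D * a (2 ^ m * t)" using t by (intro modulusD(5)[OF a]) auto
  also have "... <= D * (D ^ m * a t)" using Suc modulusD(4)[OF a] by (intro mult_left_mono) auto
  finally show ?case by (simp add: mult.assoc)
qed simp

lemma modulus_energy_le:
  assumes a: "modulus D a" and st: "0 <= s" "s <= t"
  shows "a s * s^2 <= a t * t^2"
  using st modulusD(2)[OF a, of s t] modulusD(3)[OF a, of s] modulusD(3)[OF a, of t]
  by (intro mult_mono power_mono) auto

lemma modulus_energy_scale:
  assumes a: "modulus D a" and t: "0 <= t"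
  shows "a (2 ^ m * t) * (2 ^ m * t)^2 <= (4 * D) ^ m * (a t * t^2)"
proof -
  have "a (2 ^ m * t) * (2 ^ m * t)^2 <= (D ^ m * a t) * (2 ^ m * t)^2"
    using modulus_pow2[OF assms] by (intro mult_right_mono) auto
  also have sq: "(2 ^ m * t)^2 = 4 ^ m * t^2"
  proof -
    have "(2 ^ m :: real)^2 = 4 ^ m" by (simp add: power2_eq_square flip: power_mult_distrib)
    thus ?thesis by (simp add: power_mult_distrib)
  qed
  finally have "a (2 ^ m * t) * (2 ^ m * t)^2 <= D ^ m * a t * (4 ^ m * t^2)" by (simp only: sq)
  also have "... = (4 * D) ^ m * (a t * t^2)" by (simp only: power_mult_distrib mult_ac)
  finally show ?thesis .
qed

text \<open>\<open>C\<close> is chosen before \<open>a\<close>: with \<open>2^m >= 1/c\<close> it is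
  the constant of \<open>m\<close> doublings. For \<open>D < 1\<close> no modulus exists and the
  claim is vacuous.\<close>

lemma modulus_energy_dominates:
  assumes c: "0 < (c::real)"
  shows "EX C>0. ALL a t. modulus D a --> 0 <= t --> a t * t^2 <= C * (a (c * t) * (c * t)^2)"
proof -
  obtain m :: nat where m: "1 / c <= 2 ^ m" using real_arch_pow[of 2 "1/c"] by (auto intro: less_imp_le)
  show ?thesis
  proof (cases "1 <= D")
    case True
    have "a t * t^2 <= (4 * D) ^ m * (a (c * t) * (c * t)^2)" if a: "modulus D a" and t: "0 <= t" for a t
    proof -
      have "t <= 2 ^ m * (c * t)" using mult_right_mono[OF m, of "c * t"] c t by simp
      hence "a t * t^2 <= a (2 ^ m * (c * t)) * (2 ^ m * (c * t))^2"
        using t by (intro modulus_energy_le[OF a])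
      also have "... <= (4 * D) ^ m * (a (c * t) * (c * t)^2)"
        using c t by (intro modulus_energy_scale[OF a]) auto
      finally show ?thesis .
    qed
    thus ?thesis using True by (intro exI[of _ "(4 * D) ^ m"]) auto
  qed (auto simp: modulus_def intro: exI[of _ 1])
qed

lemma modulus_energy_add:
  assumes a: "modulus D a" and st: "0 <= s" "0 <= t"
  shows "a (s + t) * (s + t)^2 <= 4 * D * (a s * s^2 + a t * t^2)"
proof -
  have "a (s + t) * (s + t)^2 <= a (2 * max s t) * (2 * max s t)^2"
    using st by (intro modulus_energy_le[OF a]) auto
  also have "... <= 4 * D * (a (max s t) * (max s t)^2)"
    using modulus_energy_scale[OF a, of "max s t" 1] st by simp
  also have "a (max s t) * (max s t)^2 <= a s * s^2 + a t * t^2"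
    using modulusD(3)[OF a] st by (auto simp: max_def)
  finally show ?thesis using modulusD(4)[OF a] by (simp add: mult_left_mono)
qed

lemma modulus_energy_norm_add:
  assumes a: "modulus D a"
  shows "a (norm (x + y)) * (norm (x + y))^2 <= 4 * D * (a (norm x) * (norm x)^2 + a (norm y) * (norm y)^2)"
  using modulus_energy_le[OF a, of "norm (x + y)" "norm x + norm y"] modulus_energy_add[OF a, of "norm x" "norm y"]
  by (auto intro: norm_triangle_ineq order_trans)

text \<open>Young's inequality without a conjugate function: if \<open>t <= eta * s\<close> the
  first term absorbs the product, otherwise \<open>s\<close> is at most \<open>2^m * t\<close> and
  doubling moves the weight from \<open>s\<close> to \<open>t\<close>.\<close>

lemma modulus_Young:
  assumes eta: "0 < (eta::real)"
  shows "EX C>=0. ALL a s t. modulus D a --> 0 <= s --> 0 <= t --> a s * s * t <= eta * (a s * s^2) + C * (a t * t^2)"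
proof -
  obtain m :: nat where m: "1 / eta <= 2 ^ m" using real_arch_pow[of 2 "1/eta"] by (auto intro: less_imp_le)
  show ?thesis
  proof (cases "1 <= D")
    case True
    have "a s * s * t <= eta * (a s * s^2) + D ^ m * 2 ^ m * (a t * t^2)"
      if a: "modulus D a" and st: "0 <= s" "0 <= t" for a s t
    proof (cases "t <= eta * s")
      case True
      have "a s * s * t <= a s * s * (eta * s)" using True st modulusD(3)[OF a] by (intro mult_left_mono) auto
      moreover have "0 <= D ^ m * 2 ^ m * (a t * t^2)"
        using modulusD(3)[OF a, of t] modulusD(4)[OF a] st by simp
      ultimately show ?thesis by (simp add: power2_eq_square mult_ac)
    next
      case False
      hence "s <= (1 / eta) * t" using eta by (simp add: field_simps)
      also have "... <= 2 ^ m * t" using m st by (intro mult_right_mono)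
      finally have s: "s <= 2 ^ m * t" .
      have "a s <= a (2 ^ m * t)" using s st by (intro modulusD(2)[OF a])
      also have "... <= D ^ m * a t" by (rule modulus_pow2[OF a st(2)])
      finally have "a s * s <= (D ^ m * a t) * (2 ^ m * t)"
        using s st modulusD(3)[OF a, of t] modulusD(4)[OF a] by (intro mult_mono) auto
      hence "a s * s * t <= (D ^ m * a t) * (2 ^ m * t) * t" using st by (intro mult_right_mono)
      moreover have "0 <= eta * (a s * s^2)" using eta modulusD(3)[OF a, of s] st by simp
      ultimately show ?thesis by (simp add: power2_eq_square mult_ac)
    qed
    thus ?thesis using True by (intro exI[of _ "D ^ m * 2 ^ m"]) auto
  qed (auto simp: modulus_def intro: exI[of _ 0])
qed

section \<open>Power weights\<close>

text \<open>Since \<open>0 powr 0 = 0\<close>, the weight \<open>t powr (p - 2)\<close> is discontinuous at \<open>0\<close> when \<open>p = 2\<close>.\<close>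

definition pw :: "real => real => real" where
  "pw p t = (if p = 2 then 1 else t powr (p - 2))"

lemma pw_scaleR: "norm x powr (p - 2) *\<^sub>R x = flux (pw p) x" by (auto simp: flux_def pw_def)

lemma pw_mult: "abs x powr (p - 2) * x = flux (pw p) x" by (auto simp: flux_def pw_def)

lemma pw_energy: "0 <= t ==> pw p t * t^2 = t powr p" by (cases "t = 0") (auto simp: pw_def powr_diff)

lemma pw_mult_self: "0 <= t ==> pw p t * t = t powr (p - 1)"
  by (cases "t = 0") (auto simp: pw_def powr_diff power2_eq_square)

lemma nondec_pw:
  assumes "2 <= p"
  shows "nondec (pw p)" unfolding nondec_def
proof (intro conjI allI impI)
  show "continuous_on {0..} (pw p)"
  proof (cases "p = 2")
    case False
    hence "continuous_on {0..} (%t::real. t powr (p - 2))"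
      using assms by (intro continuous_on_powr' continuous_intros) auto
    thus ?thesis using False by (simp add: pw_def[abs_def])
  qed (simp add: pw_def[abs_def])
qed (use assms in "auto simp: pw_def intro: powr_mono2")

lemma modulus_pw:
  assumes "2 <= p"
  shows "modulus (2 powr (p - 2)) (pw p)"
  using assms nondec_pw[OF assms] by (auto simp: modulus_def pw_def powr_mult intro: ge_one_powr_ge_zero)

text \<open>Truncation keeps the doubling constant, since
  \<open>min (2 * t) M <= 2 * min t M\<close>. A truncated weight is bounded, so its energy is
  finite on all of L^2; this makes absorption arguments legitimate before p-integrability is
  known.\<close>

lemma modulus_pw_min:
  assumes p: "2 <= p" and M: "0 <= M"
  shows "modulus (2 powr (p - 2)) (%t. pw p (min t M))" unfolding modulus_def nondec_def
proof (intro conjI allI impI)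
  note pw = modulusD[OF modulus_pw[OF p]]
  show "continuous_on {0..} (%t. pw p (min t M))"
    by (rule continuous_on_compose2[OF nondecD(3)[OF pw(1)]]) (use M in "auto intro!: continuous_intros")
  show "pw p (min s M) <= pw p (min t M)" if "0 <= s & s <= t" for s t using that M by (intro pw(2)) auto
  show "0 <= pw p (min t M)" for t using M by (auto simp: pw_def)
  show "pw p (min (2 * t) M) <= 2 powr (p - 2) * pw p (min t M)" if "0 <= t" for t
  proof -
    have "pw p (min (2 * t) M) <= pw p (2 * min t M)" using that M by (intro pw(2)) auto
    also have "... <= 2 powr (p - 2) * pw p (min t M)" using that M by (intro pw(5)) auto
    finally show ?thesis .
  qed
  show "1 <= 2 powr (p - 2)" by (rule pw(4))
qed

lemma pw_flux_tendsto_norm_le: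
  assumes "2 <= p"
  shows "norm (flux (pw p) x) = norm x powr (p - 1)"
  using norm_flux[OF nondec_pw[OF assms], of x] by (simp add: pw_mult_self)

lemma square_powr_half: "0 <= (t::real) ==> (t^2) powr ((p - 2) / 2) = t powr (p - 2)"
  by (cases "t = 0") (simp_all add: powr_powr diff_divide_distrib flip: powr_numeral)

lemma pw_eq_square_powr: "0 <= t ==> p ~= 2 ==> pw p t = (t^2) powr ((p - 2) / 2)"
  by (simp add: pw_def square_powr_half)

section \<open>The regularized weights\<close>

locale cutoff =
  fixes Fk :: "nat => real => real" and p dlt :: real
  assumes p: "2 <= p"
    and dlt: "0 < dlt" "dlt < 1"
    and Fk_mono: "!!k. mono_on {0..} (Fk k)"
    and Fk_deriv: "!!k. EX F'. (ALL t>=0. (Fk k has_real_derivative F' t) (at t within {0..})) & continuous_on {0..} F'"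
    and Fk_nonneg: "!!k t. 0 <= t ==> 0 <= Fk k t"
    and Fk_id: "!!k t. 0 <= t ==> t <= real k ^ 2 ==> Fk k t = t"
    and Fk_const: "!!k t. t > real k ^ 2 + 1 ==> Fk k t = real k ^ 2 + 1"
    and Fk_mid: "!!k t. real k ^ 2 <= t ==> t < real k ^ 2 + 1 ==> t <= Fk k t & Fk k t <= t + dlt"
begin

definition aw :: "real => nat => real => real" where
  "aw eps k t = (eps + Fk k (t^2)) powr ((p - 2) / 2)"

lemma Fk_le: "0 <= s ==> Fk k s <= real k ^ 2 + 1"
  using mono_onD[OF Fk_mono, of s "max s (real k ^ 2 + 2)" k] Fk_const[of k "max s (real k ^ 2 + 2)"] by auto

lemma Fk_ge_min: "0 <= s ==> min s (real k ^ 2) <= Fk k s"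
  using Fk_id[of s k] mono_onD[OF Fk_mono, of "real k ^ 2" s k] Fk_id[of "real k ^ 2" k] by (auto simp: min_def)

lemma Fk_le_add: "0 <= s ==> Fk k s <= s + 1" using Fk_id[of s k] Fk_mid[of k s] Fk_le[of s k] dlt
  by (cases "s <= real k ^ 2"; cases "s < real k ^ 2 + 1") auto

lemma Fk_le_double:
  assumes "0 <= s" "1 <= k"
  shows "Fk k s <= 2 * s"
proof (cases "s <= real k ^ 2")
  case True
  thus ?thesis using Fk_id[of s k] assms by simp
next
  case False
  have "1 <= real k ^ 2" using assms by simp
  thus ?thesis using False Fk_le_add[OF assms(1), of k] by simp
qed

text \<open>Doubling for the cutoff in the variable \<open>t^2\<close>: below \<open>k^2\<close> it
  is the identity, above it \<open>k^2 + 1 <= 2 * k^2\<close> because \<open>1 <= k\<close>.\<close>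

lemma Fk_quad:
  assumes s: "0 <= s" and k: "1 <= k"
  shows "Fk k (4 * s) <= 8 * Fk k s"
proof (cases "s <= real k ^ 2")
  case True
  hence "Fk k s = s" using Fk_id s by simp
  thus ?thesis using Fk_le_double[of "4 * s" k] s k by simp
next
  case False
  have "1 <= real k ^ 2" using k by simp
  moreover have "real k ^ 2 <= Fk k s" using Fk_ge_min[OF s, of k] False by simp
  ultimately show ?thesis using Fk_le[of "4 * s" k] s by simp
qed

lemma continuous_on_Fk: "continuous_on {0..} (Fk k)"
proof -
  obtain F' where "ALL t>=0. (Fk k has_real_derivative F' t) (at t within {0..})" using Fk_deriv[of k] by auto
  thus ?thesis by (intro DERIV_continuous_on[of _ _ F']) auto
qed

lemma nondec_aw:
  assumes "0 < eps"
  shows "nondec (aw eps k)" unfolding nondec_def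
proof (intro conjI allI impI)
  have "continuous_on {0..} (%t. Fk k (t^2))"
    by (rule continuous_on_compose2[OF continuous_on_Fk]) (auto intro: continuous_intros)
  thus "continuous_on {0..} (aw eps k)" unfolding aw_def[abs_def] using assms Fk_nonneg[of "_^2" k]
    by (intro continuous_on_powr continuous_intros) (auto simp: add_pos_nonneg less_imp_neq[symmetric])
  show "aw eps k s <= aw eps k t" if "0 <= s & s <= t" for s t
    unfolding aw_def using that assms p mono_onD[OF Fk_mono, of "s^2" "t^2" k] Fk_nonneg[of "s^2" k]
    by (intro powr_mono2) (auto simp: power_mono)
qed (simp add: aw_def)

lemma modulus_aw:
  assumes "0 < eps" "1 <= k"
  shows "modulus (8 powr ((p - 2) / 2)) (aw eps k)" unfolding modulus_def
proof (intro conjI allI impI nondec_aw assms)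
  show "1 <= 8 powr ((p - 2) / 2)" using p by (intro ge_one_powr_ge_zero) auto
  fix t :: real assume t: "0 <= t"
  have "aw eps k (2 * t) <= (8 * (eps + Fk k (t^2))) powr ((p - 2) / 2)"
    unfolding aw_def using Fk_quad[of "t^2" k] assms p Fk_nonneg[of "(2 * t)^2" k]
    by (intro powr_mono2) (auto simp: power_mult_distrib)
  also have "... = 8 powr ((p - 2) / 2) * aw eps k t"
    using assms Fk_nonneg[of "t^2" k] unfolding aw_def by (subst powr_mult) auto
  finally show "aw eps k (2 * t) <= 8 powr ((p - 2) / 2) * aw eps k t" .
qed

text \<open>The lower comparison, uniform in \<open>eps\<close>: through it energies of regularized
  states control truncated p-energies, and L^2 norms.\<close>

lemma aw_ge_pw:
  assumes "0 < eps" "0 <= t"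
  shows "pw p (min t (real k)) <= aw eps k t"
proof (cases "p = 2")
  case True
  thus ?thesis using assms Fk_nonneg[of "t^2" k] unfolding pw_def aw_def by simp
next
  case False
  have "(min t (real k))^2 = min (t^2) ((real k)^2)"
    using assms by (auto simp: min_def power_mono power2_le_iff_abs_le dest: power2_le_imp_le)
  hence "(min t (real k))^2 <= eps + Fk k (t^2)" using Fk_ge_min[of "t^2" k] assms by simp
  thus ?thesis using False assms p by (simp add: pw_eq_square_powr aw_def powr_mono2)
qed

lemma aw_ge_eps:
  assumes "0 < eps"
  shows "eps powr ((p - 2) / 2) <= aw eps k t"
  unfolding aw_def using assms p Fk_nonneg[of "t^2" k] by (intro powr_mono2) auto

lemma aw_le_pw:
  assumes "0 < eps" "eps <= 1" "1 <= k" "0 <= t"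
  shows "aw eps k t <= 3 powr ((p - 2) / 2) * (1 + pw p t)"
proof -
  \<comment> \<open>The 3 collects \<open>eps <= 1\<close> and
    \<open>Fk k (t^2) <= 2 * t^2\<close>.\<close>
  have "aw eps k t <= (3 * max 1 (t^2)) powr ((p - 2) / 2)"
    unfolding aw_def using assms p Fk_le_double[of "t^2" k] Fk_nonneg[of "t^2" k] by (intro powr_mono2) auto
  also have "... = 3 powr ((p - 2) / 2) * (max 1 (t^2)) powr ((p - 2) / 2)" by (simp add: powr_mult)
  also have "(max 1 (t^2)) powr ((p - 2) / 2) <= 1 + pw p t"
  proof (cases "p = 2")
    case False
    thus ?thesis using assms by (auto simp: max_def pw_eq_square_powr)
  qed (simp add: pw_def)
  finally show ?thesis by simp
qed

lemma aw_le_const: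
  assumes "0 < eps"
  shows "aw eps k t <= (eps + real k ^ 2 + 1) powr ((p - 2) / 2)"
  unfolding aw_def using assms p Fk_le[of "t^2" k] Fk_nonneg[of "t^2" k] by (intro powr_mono2) auto

text \<open>The arguments \<open>ts n\<close> need only be bounded. Once \<open>ks n\<close> exceeds
  the bound the cutoff is the identity, and uniform continuity of the power on a compact interval
  finishes. This form is needed for \<open>z_n\<close>, which is majorized pointwise before it is
  known to converge.\<close>

lemma aw_diff_tendsto:
  assumes eps: "!!n. 0 < epss n" "epss ----> 0" and k: "filterlim ks at_top sequentially"
    and t: "!!n. 0 <= ts n" "!!n. ts n <= R"
  shows "(%n. aw (epss n) (ks n) (ts n) - pw p (ts n)) ----> 0"
proof (cases "p = 2")
  case True
  have "aw (epss n) (ks n) (ts n) = 1" for n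
    using True eps(1)[of n] Fk_nonneg[of "(ts n)^2" "ks n"] unfolding aw_def by simp
  thus ?thesis using True by (simp add: pw_def)
next
  case False
  have uc: "uniformly_continuous_on {0..R^2 + 1} (%s::real. s powr ((p - 2) / 2))"
    using p False by (intro compact_uniformly_continuous continuous_on_powr' continuous_intros) auto
  show ?thesis
  proof (rule LIMSEQ_I)
    fix e :: real assume "e > 0"
    then obtain d where d: "d > 0" "!!s s'. s : {0..R^2 + 1} ==> s' : {0..R^2 + 1} ==> dist s' s < d ==>
        dist (s' powr ((p - 2) / 2)) (s powr ((p - 2) / 2)) < e"
      using uc unfolding uniformly_continuous_on_def by metis
    have ks: "eventually (%n. nat \<lceil>R\<rceil> <= ks n) sequentially"
      using k unfolding filterlim_at_top by blast
    have "eventually (%n. epss n < min d 1) sequentially"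
      using order_tendstoD(2)[OF eps(2), of "min d 1"] d(1) by auto
    with ks have "eventually (%n. norm (aw (epss n) (ks n) (ts n) - pw p (ts n) - 0) < e) sequentially"
    proof eventually_elim
      case (elim n)
      have "ts n <= real (ks n)" using elim(1) t(2)[of n] by linarith
      hence "(ts n)^2 <= real (ks n) ^ 2" using t(1)[of n] by (intro power_mono)
      hence F: "Fk (ks n) ((ts n)^2) = (ts n)^2" by (intro Fk_id) auto
      have R: "(ts n)^2 <= R^2" using t[of n] by (intro power_mono)
      have "dist ((epss n + (ts n)^2) powr ((p - 2) / 2)) (((ts n)^2) powr ((p - 2) / 2)) < e"
        using elim(2) eps(1)[of n] R by (intro d(2)) (auto simp: dist_real_def)
      thus ?case using False t(1)[of n] by (simp add: aw_def F pw_eq_square_powr dist_real_def)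
    qed
    thus "EX no. ALL n>=no. norm (aw (epss n) (ks n) (ts n) - pw p (ts n) - 0) < e"
      by (simp add: eventually_sequentially)
  qed
qed

lemma aw_tendsto:
  assumes eps: "!!n. 0 < epss n" "epss ----> 0" and k: "filterlim ks at_top sequentially"
    and t: "!!n. 0 <= ts n" "ts ----> t"
  shows "(%n. aw (epss n) (ks n) (ts n)) ----> pw p t"
proof -
  obtain R where R: "!!n. norm (ts n) <= R"
    using convergent_imp_Bseq[of ts] t(2) by (auto simp: convergent_def Bseq_def)
  have t0: "0 <= t" using t by (intro LIMSEQ_le_const) auto
  have "(%n. pw p (ts n)) ----> pw p t"
    using continuous_on_tendsto_compose[OF nondecD(3)[OF nondec_pw[OF p]] t(2)] t(1) t0 by auto
  moreover have "(%n. aw (epss n) (ks n) (ts n) - pw p (ts n)) ----> 0"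
    using R t(1) by (intro aw_diff_tendsto[OF eps k, of ts R]) (auto dest: abs_le_D1)
  ultimately show ?thesis using tendsto_add by fastforce
qed

lemma flux_aw_tendsto:
  fixes x :: "'b::real_inner"
  assumes eps: "!!n. 0 < epss n" "epss ----> 0" and k: "filterlim ks at_top sequentially"
    and x: "xs ----> x"
  shows "(%n. flux (aw (epss n) (ks n)) (xs n)) ----> flux (pw p) x"
  unfolding flux_def by (intro tendsto_scaleR x aw_tendsto[OF eps k] tendsto_norm) auto

text \<open>The weight is C^1 on a compact interval and constant beyond it. The constant depends on
  \<open>eps\<close> and \<open>k\<close>; it serves only to solve the equations for fixed
  parameters.\<close>

lemma flux_aw_Lipschitz:
  assumes eps: "0 < eps"
  shows "EX L>=0. ALL x y::'b::real_inner. norm (flux (aw eps k) x - flux (aw eps k) y) <= L * norm (x - y)"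
proof -
  obtain F' where F': "!!t. 0 <= t ==> (Fk k has_real_derivative F' t) (at t within {0..})" "continuous_on {0..} F'"
    using Fk_deriv[of k] by auto
  \<comment> \<open>Any \<open>T\<close> with \<open>T^2 > k^2 + 1\<close> works: from
    \<open>T\<close> on the cutoff is constant.\<close>
  define T where "T = sqrt (real k ^ 2 + 2)"
  have T: "0 <= T" "T^2 = real k ^ 2 + 2" by (auto simp: T_def)
  let ?r = "(p - 2) / 2"
  define a' where "a' t = ?r * (eps + Fk k (t^2)) powr (?r - 1) * (F' (t^2) * (2 * t))" for t
  have pos: "eps + Fk k (t^2) > 0" for t using eps Fk_nonneg[of "t^2" k] by (simp add: add_pos_nonneg)
  have der: "(aw eps k has_real_derivative a' t) (at t within {0..T})" if t: "t : {0..T}" for t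
  proof -
    have "((%t. t^2) has_real_derivative 2 * t) (at t within {0..T})" by (auto intro!: derivative_eq_intros)
    moreover have "(Fk k has_real_derivative F' (t^2)) (at (t^2) within (%t. t^2) ` {0..T})"
      using F'(1)[of "t^2"] by (rule DERIV_subset) auto
    ultimately have "((%t. Fk k (t^2)) has_real_derivative F' (t^2) * (2 * t)) (at t within {0..T})"
      using DERIV_image_chain[of "Fk k" "F' (t^2)" "%t. t^2" t "{0..T}" "2 * t"] by (simp add: o_def)
    hence "((%t. eps + Fk k (t^2)) has_real_derivative F' (t^2) * (2 * t)) (at t within {0..T})"
      by (auto intro!: derivative_eq_intros)
    hence "((%t. (eps + Fk k (t^2)) powr ?r) has_real_derivative a' t) (at t within {0..T})"
      unfolding a'_def by (rule DERIV_chain2[where f="%z. z powr ?r" and g="%t. eps + Fk k (t^2)", OF has_real_derivative_powr[OF pos[of t]]])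
    thus ?thesis by (simp add: aw_def[abs_def])
  qed
  have "continuous_on {0..T} a'"
  proof -
    have "continuous_on {0..T} (%t. F' (t^2))" "continuous_on {0..T} (%t. Fk k (t^2))"
      by (rule continuous_on_compose2[OF F'(2)], auto intro: continuous_intros)
        (rule continuous_on_compose2[OF continuous_on_Fk], auto intro: continuous_intros)
    thus ?thesis unfolding a'_def using pos by (intro continuous_intros) (auto simp: less_imp_neq[symmetric])
  qed
  hence "bounded (a' ` {0..T})" by (intro compact_imp_bounded compact_continuous_image) auto
  then obtain B where "ALL t:{0..T}. norm (a' t) <= B" by (auto simp: bounded_iff)
  hence B: "!!t. t : {0..T} ==> norm (a' t) <= B" by blast
  have B0: "0 <= B" using B[of 0] T by (auto intro: order_trans[OF norm_ge_zero])
  have lip: "norm (aw eps k s - aw eps k t) <= B * norm (s - t)" if "s : {0..T}" "t : {0..T}" for s t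
    by (rule field_differentiable_bound[OF convex_real_interval(5) der B]) (use that in auto)
  have const: "aw eps k t = aw eps k T" if "T <= t" for t
  proof -
    have "T^2 <= t^2" using that T by (intro power_mono)
    thus ?thesis using Fk_const[of k "t^2"] Fk_const[of k "T^2"] T by (simp add: aw_def)
  qed
  define A where "A = (eps + real k ^ 2 + 1) powr ?r"
  have A: "aw eps k t <= A" "0 <= aw eps k t" for t using aw_le_const[OF eps] by (auto simp: A_def aw_def)
  have key: "norm (flux (aw eps k) x - flux (aw eps k) y) <= (A + B * T) * norm (x - y)"
    if le: "norm y <= norm x" for x y :: 'b
  proof -
    \<comment> \<open>The difference of weights is multiplied by the shorter vector
      \<open>y\<close>: either \<open>norm y <= T\<close>, or both weights are equal.\<close>
    have eq: "flux (aw eps k) x - flux (aw eps k) y = aw eps k (norm x) *\<^sub>R (x - y) + (aw eps k (norm x) - aw eps k (norm y)) *\<^sub>R y"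
      by (simp add: flux_def algebra_simps)
    have "norm (flux (aw eps k) x - flux (aw eps k) y)
        <= aw eps k (norm x) * norm (x - y) + abs (aw eps k (norm x) - aw eps k (norm y)) * norm y"
      unfolding eq by (rule order_trans[OF norm_triangle_ineq]) (use A in auto)
    also have "abs (aw eps k (norm x) - aw eps k (norm y)) * norm y <= B * norm (x - y) * T"
    proof (cases "norm y <= T")
      case True
      have "aw eps k (norm x) = aw eps k (min (norm x) T)" using const[of "norm x"] by (auto simp: min_def)
      hence "abs (aw eps k (norm x) - aw eps k (norm y)) <= B * norm (min (norm x) T - norm y)"
        using lip[of "min (norm x) T" "norm y"] True T by simp
      also have "norm (min (norm x) T - norm y) <= norm (x - y)"
        using le True norm_triangle_ineq2[of x y] by auto
      finally show ?thesis using B0 True T by (intro mult_mono) (auto simp: mult_left_mono)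
    next
      case False
      hence "aw eps k (norm x) = aw eps k (norm y)" using const[of "norm x"] const[of "norm y"] le by simp
      thus ?thesis using B0 T by simp
    qed
    also have "aw eps k (norm x) * norm (x - y) <= A * norm (x - y)" using A by (intro mult_right_mono) auto
    finally show ?thesis by (simp add: algebra_simps)
  qed
  have "norm (flux (aw eps k) x - flux (aw eps k) y) <= (A + B * T) * norm (x - y)" for x y :: 'b
    using key[of y x] key[of x y] by (cases "norm y <= norm x") (auto simp: norm_minus_commute)
  thus ?thesis using A(1)[of 0] A(2)[of 0] B0 T by (intro exI[of _ "A + B * T"]) auto
qed

end

section \<open>The positive semidefinite square root\<close>

lemma symmetric_inner:
  fixes M :: "real^'n^'n"
  assumes "transpose M = M"
  shows "(M *v x) \<bullet> y = x \<bullet> (M *v y)"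
  using assms by (metis dot_lmul_matrix transpose_matrix_vector)

text \<open>A maximizer \<open>e\<close> of the quadratic form on the unit sphere of the invariant
  subspace; varying it along its own residual \<open>w = M e - l e\<close> shows
  \<open>w = 0\<close>.\<close>

lemma symmetric_eigenvector:
  fixes M :: "real^'n^'n"
  assumes M: "transpose M = M" and S: "subspace S" and inv: "!!x. x : S ==> M *v x : S"
    and ne: "S ~= {0}"
  obtains e c where "e : S" "norm e = 1" "M *v e = c *\<^sub>R e"
proof -
  obtain z where z: "z : S" "z ~= 0" using ne S subspace_0 by blast
  have "compact (S \<inter> sphere 0 1)" using S by (simp add: closed_Int_compact closed_subspace)
  moreover have "(1 / norm z) *\<^sub>R z : S \<inter> sphere 0 1" using z S by (simp add: subspace_scale)
  moreover have "continuous_on (S \<inter> sphere 0 1) (%x. x \<bullet> (M *v x))"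
    by (intro continuous_intros linear_continuous_on matrix_vector_mul_bounded_linear)
  ultimately obtain e where "e : S \<inter> sphere 0 1" "ALL y:S \<inter> sphere 0 1. y \<bullet> (M *v y) <= e \<bullet> (M *v e)"
    using continuous_attains_sup[of "S \<inter> sphere 0 1" "%x. x \<bullet> (M *v x)"] by blast
  hence e: "e : S" "norm e = 1"
    and max: "!!y. y : S ==> norm y = 1 ==> y \<bullet> (M *v y) <= e \<bullet> (M *v e)" by auto
  define l where "l = e \<bullet> (M *v e)"
  have le: "y \<bullet> (M *v y) <= l * (norm y)^2" if y: "y : S" for y
  proof (cases "y = 0")
    case False
    have "((1 / norm y) *\<^sub>R y) \<bullet> (M *v ((1 / norm y) *\<^sub>R y)) <= l"
      unfolding l_def using y S False by (intro max) (auto simp: subspace_scale)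
    thus ?thesis using False by (simp add: matrix_vector_mult_scaleR field_simps power2_eq_square)
  qed simp
  define w where "w = M *v e - l *\<^sub>R e"
  have wS: "w : S" using e inv S by (simp add: w_def subspace_diff subspace_scale)
  have we: "w \<bullet> e = 0" using e by (simp add: w_def l_def inner_diff_left inner_commute[of "M *v e" e] dot_square_norm)
  \<comment> \<open>Since \<open>w\<close> is orthogonal to \<open>e\<close>, the product
    \<open>w \<bullet> (M *v e)\<close> equals \<open>w \<bullet> w\<close>.\<close>
  have "- 2 * (w \<bullet> (M *v e)) = 0"
  proof (rule quadratic_nonneg_imp_zero)
    show "0 <= l * (norm w)^2 - w \<bullet> (M *v w)" using le[OF wS] by simp
    fix t :: real
    have "(e + t *\<^sub>R w) \<bullet> (M *v (e + t *\<^sub>R w)) <= l * (norm (e + t *\<^sub>R w))^2"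
      using e wS S by (intro le) (simp add: subspace_add subspace_scale)
    moreover have "(norm (e + t *\<^sub>R w))^2 = 1 + t^2 * (norm w)^2"
      unfolding power2_norm_eq_inner using we e dot_square_norm[of e]
      by (simp add: inner_add_left inner_add_right inner_commute[of e w] power2_eq_square)
    moreover have "(e + t *\<^sub>R w) \<bullet> (M *v (e + t *\<^sub>R w)) = l + t * (2 * (w \<bullet> (M *v e))) + t^2 * (w \<bullet> (M *v w))"
      using symmetric_inner[OF M, of e w]
      by (simp add: matrix_vector_right_distrib matrix_vector_mult_scaleR inner_add_left inner_add_right l_def
          inner_commute power2_eq_square algebra_simps)
    ultimately show "0 <= t * (- 2 * (w \<bullet> (M *v e))) + t^2 * (l * (norm w)^2 - w \<bullet> (M *v w))"
      by (simp add: algebra_simps)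
  qed
  hence "w \<bullet> w = 0" using we by (simp add: w_def inner_diff_right)
  hence "M *v e = l *\<^sub>R e" by (simp add: w_def)
  thus ?thesis using that e by blast
qed

text \<open>The spectral theorem by induction on the dimension: symmetry makes the orthogonal
  complement of an eigenvector invariant.\<close>

lemma symmetric_eigenbasis_subspace:
  fixes M :: "real^'n^'n"
  assumes M: "transpose M = M" and S: "subspace S" and inv: "!!x. x : S ==> M *v x : S"
  shows "EX B. finite B & B \<subseteq> S & (ALL b:B. norm b = 1 & (EX c. M *v b = c *\<^sub>R b)) & pairwise orthogonal B \<and>
     (ALL x:S. x = (\<Sum>b\<in>B. (x \<bullet> b) *\<^sub>R b))" using S inv
proof (induction "dim S" arbitrary: S rule: less_induct)
  case less
  show ?case
  proof (cases "S = {0}")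
    case True
    thus ?thesis by (intro exI[of _ "{}"]) auto
  next
    case False
    then obtain e c where e: "e : S" "norm e = 1" "M *v e = c *\<^sub>R e"
      using symmetric_eigenvector[OF M less.prems(1,2)] by metis
    define S' where "S' = {x : S. x \<bullet> e = 0}"
    have sub: "subspace S'" using less.prems(1) unfolding S'_def subspace_def by (auto simp: inner_add_left)
    have "e ~: S'" using e by (auto simp: S'_def dot_square_norm)
    moreover have "S' \<subseteq> S" by (auto simp: S'_def)
    ultimately have "S' \<subset> S" using e(1) by blast
    hence "dim S' < dim S" using sub less.prems(1) by (intro dim_psubset) (metis span_eq_iff)
    moreover have "M *v x : S'" if "x : S'" for x
      using that less.prems(2) e symmetric_inner[OF M, of x e] by (auto simp: S'_def)
    ultimately obtain B where B: "finite B" "B \<subseteq> S'" "ALL b:B. norm b = 1 & (EX c. M *v b = c *\<^sub>R b)"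
        "pairwise orthogonal B" "ALL x:S'. x = (\<Sum>b\<in>B. (x \<bullet> b) *\<^sub>R b)"
      using less.hyps[OF _ sub] by blast
    have eB: "e \<bullet> b = 0" if "b : B" for b using B(2) that by (auto simp: S'_def inner_commute)
    have "x = (\<Sum>b\<in>insert e B. (x \<bullet> b) *\<^sub>R b)" if x: "x : S" for x
    proof -
      have "x - (x \<bullet> e) *\<^sub>R e : S'"
        using x e less.prems(1) by (auto simp: S'_def subspace_diff subspace_scale inner_diff_left dot_square_norm)
      hence "x - (x \<bullet> e) *\<^sub>R e = (\<Sum>b\<in>B. ((x - (x \<bullet> e) *\<^sub>R e) \<bullet> b) *\<^sub>R b)" using B(5) by blast
      also have "... = (\<Sum>b\<in>B. (x \<bullet> b) *\<^sub>R b)"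
        by (intro sum.cong) (auto simp: inner_diff_left eB)
      finally show ?thesis using B(1,2) \<open>e ~: S'\<close> by (subst sum.insert) (auto simp: algebra_simps)
    qed
    thus ?thesis using B e eB \<open>S' \<subset> S\<close>
      by (intro exI[of _ "insert e B"]) (auto simp: pairwise_insert orthogonal_def inner_commute)
  qed
qed

text \<open>\<open>psqrt\<close> is a definite description, so existence and uniqueness of the root
  are both required. Existence is read off an orthonormal eigenbasis.\<close>

lemma psd_psqrt:
  fixes M :: "real^'n^'n"
  assumes psd: "psd M"
  shows "psd (psqrt M)" "psqrt M ** psqrt M = M"
proof -
  have M: "transpose M = M" using psd by (simp add: psd_def)
  obtain B where B: "finite B" "ALL b:B. norm b = 1 & (EX c. M *v b = c *\<^sub>R b)"
      "pairwise orthogonal B" "!!x. x = (\<Sum>b\<in>B. (x \<bullet> b) *\<^sub>R b)"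
    using symmetric_eigenbasis_subspace[OF M subspace_UNIV] by auto
  then obtain l where l: "!!b. b : B ==> M *v b = l b *\<^sub>R b" by metis
  have bb: "b \<bullet> b = 1" if "b : B" for b using B(2) that by (simp add: dot_square_norm)
  have bc: "b \<bullet> c = 0" if "b : B" "c : B" "b ~= c" for b c
    using B(3) that by (auto simp: pairwise_def orthogonal_def)
  have l0: "0 <= l b" if "b : B" for b
    using psd l[OF that] bb[OF that] by (auto simp: psd_def dest!: spec[of _ b])
  define s where "s x = (\<Sum>b\<in>B. (sqrt (l b) * (x \<bullet> b)) *\<^sub>R b)" for x
  have lin: "linear s"
    by (rule linearI) (auto simp: s_def inner_add_left algebra_simps sum.distrib scaleR_sum_right)
  define T where "T = matrix s"
  have Tv: "T *v x = s x" for x using fun_cong[OF matrix_vector_mul(2)[OF lin]] by (simp add: T_def)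
  have sb: "s b = sqrt (l b) *\<^sub>R b" if "b : B" for b
  proof -
    have "s b = (\<Sum>c\<in>B. if c = b then sqrt (l b) *\<^sub>R b else 0)"
      unfolding s_def using that bb bc by (intro sum.cong) auto
    thus ?thesis using B(1) that by simp
  qed
  have Tb: "T *v b = sqrt (l b) *\<^sub>R b" if "b : B" for b using Tv sb that by simp
  have eqI: "P = Q" if "!!b. b : B ==> P *v b = Q *v b" for P Q :: "real^'n^'n"
  proof -
    have "P *v x = Q *v x" for x
    proof -
      have "P *v (\<Sum>b\<in>B. (x \<bullet> b) *\<^sub>R b) = Q *v (\<Sum>b\<in>B. (x \<bullet> b) *\<^sub>R b)"
        using that by (simp add: linear_sum[OF matrix_vector_mul_linear] matrix_vector_mult_scaleR)
      thus ?thesis using B(4)[of x] by simp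
    qed
    thus ?thesis by (simp add: matrix_eq)
  qed
  have sq: "T ** T = M"
    using l Tb l0 by (intro eqI) (simp add: matrix_vector_mul_assoc[symmetric] matrix_vector_mult_scaleR)
  have sym: "(T *v x) \<bullet> y = x \<bullet> (T *v y)" for x y
    by (simp add: Tv s_def inner_sum_left inner_sum_right inner_commute mult_ac)
  have "transpose T = T"
  proof -
    have "(transpose T *v x) \<bullet> y = (T *v x) \<bullet> y" for x y
      using sym[of x y] by (simp add: transpose_matrix_vector dot_lmul_matrix)
    hence "transpose T *v x = T *v x" for x by (metis vector_eq_ldot inner_commute)
    thus ?thesis by (simp add: matrix_eq)
  qed
  moreover have "0 <= x \<bullet> (T *v x)" for x
    using l0 by (simp add: Tv s_def inner_sum_right mult.assoc sum_nonneg)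
  ultimately have psdT: "psd T" by (simp add: psd_def)
  \<comment> \<open>On an eigenvector \<open>b\<close> with eigenvalue \<open>l b > 0\<close>, the
    defect \<open>R b - sqrt (l b) b\<close> is mapped by \<open>R\<close> to a negative multiple of
    itself, so positivity of \<open>R\<close> makes it vanish.\<close>
  have uniq: "R = T" if R: "psd R" "R ** R = M" for R
  proof (rule eqI)
    fix b assume b: "b : B"
    let ?r = "sqrt (l b)"
    have RR: "R *v (R *v b) = l b *\<^sub>R b" using R(2) l[OF b] by (simp add: matrix_vector_mul_assoc)
    have tR: "transpose R = R" using R by (simp add: psd_def)
    show "R *v b = T *v b"
    proof (cases "l b = 0")
      case True
      have "(R *v b) \<bullet> (R *v b) = b \<bullet> (R *v (R *v b))" by (rule symmetric_inner[OF tR])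
      hence "R *v b = 0" using RR True by simp
      thus ?thesis using Tb[OF b] True by simp
    next
      case False
      define w where "w = R *v b - ?r *\<^sub>R b"
      have "R *v w = - ?r *\<^sub>R w"
        using RR l0[OF b] by (simp add: w_def matrix_vector_mult_diff_distrib matrix_vector_mult_scaleR algebra_simps)
      hence "w \<bullet> (R *v w) = - ?r * (w \<bullet> w)" by simp
      moreover have "0 <= w \<bullet> (R *v w)" using R by (simp add: psd_def)
      moreover have "?r > 0" using False l0[OF b] by simp
      ultimately have "w \<bullet> w <= 0" by (simp add: mult_le_0_iff)
      hence "w = 0" by (metis inner_eq_zero_iff inner_ge_zero order_antisym)
      thus ?thesis using Tb[OF b] by (simp add: w_def)
    qed
  qed
  have "psqrt M = T" unfolding psqrt_def by (rule the_equality) (simp_all add: psdT sq uniq)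
  thus "psd (psqrt M)" "psqrt M ** psqrt M = M" using psdT sq by auto
qed

lemma psd_psqrt_vector:
  fixes M :: "real^'n^'n"
  assumes "psd M"
  shows "(psqrt M *v x) \<bullet> y = x \<bullet> (psqrt M *v y)"
    "(M *v x) \<bullet> y = (psqrt M *v x) \<bullet> (psqrt M *v y)"
    "x \<bullet> (M *v x) = (norm (psqrt M *v x))^2"
proof -
  have t: "transpose (psqrt M) = psqrt M" using psd_psqrt[OF assms] by (simp add: psd_def)
  show 1: "(psqrt M *v x) \<bullet> y = x \<bullet> (psqrt M *v y)" for x y by (rule symmetric_inner[OF t])
  have Mx: "M *v x = psqrt M *v (psqrt M *v x)" using psd_psqrt(2)[OF assms] by (simp only: matrix_vector_mul_assoc)
  show 2: "(M *v x) \<bullet> y = (psqrt M *v x) \<bullet> (psqrt M *v y)" for y unfolding Mx by (rule 1)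
  have "x \<bullet> (M *v x) = (M *v x) \<bullet> x" by (rule inner_commute)
  thus "x \<bullet> (M *v x) = (norm (psqrt M *v x))^2" by (simp only: 2 dot_square_norm)
qed

lemma borel_measurable_vec_nth' [measurable (raw)]:
  fixes f :: "'a => real^'n"
  assumes "f : borel_measurable M"
  shows "(%x. f x $ i) : borel_measurable M"
  by (rule borel_measurable_continuous_on[OF _ assms]) (intro continuous_intros)

lemma borel_measurable_vecI:
  fixes f :: "'a => real^'n"
  assumes "!!i. (%x. f x $ i) : borel_measurable M"
  shows "f : borel_measurable M"
  using assms by (subst borel_measurable_euclidean_space) (auto simp: Basis_vec_def inner_axis)

section \<open>Continuously differentiable functions\<close>

text \<open>The gradient is an explicit argument, so the calculus rules are statements about pairs;
  \<open>cgrad\<close> is recovered by uniqueness of derivatives.\<close>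

definition C1g :: "(real^'n => real) => (real^'n => real^'n) => bool" where
  "C1g phi G \<longleftrightarrow> (ALL x. (phi has_derivative (%h. G x \<bullet> h)) (at x)) & continuous_on UNIV G"

lemma C1g_pd:
  assumes "C1g phi G"
  shows "pd phi i x = G x $ i"
proof -
  have "(phi has_derivative (%h. G x \<bullet> h)) (at x)" using assms by (simp add: C1g_def)
  hence "frechet_derivative phi (at x) = (%h. G x \<bullet> h)" by (rule frechet_derivative_at[symmetric])
  thus ?thesis by (simp add: pd_def inner_axis)
qed

lemma C1g_cgrad: "C1g phi G ==> cgrad phi = G" by (simp add: fun_eq_iff cgrad_def C1g_pd vec_eq_iff)

lemma C1gI:
  assumes "!!x. phi differentiable (at x)" "!!i. continuous_on UNIV (%x. pd phi i x)"
  shows "C1g phi (cgrad phi)" unfolding C1g_def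
proof (intro conjI allI)
  fix x
  have lin: "linear (frechet_derivative phi (at x))" using assms(1) by (intro linear_frechet_derivative)
  have "frechet_derivative phi (at x) h = cgrad phi x \<bullet> h" for h
  proof -
    have "frechet_derivative phi (at x) h = frechet_derivative phi (at x) (\<Sum>i\<in>UNIV. (h $ i) *\<^sub>R axis i 1)"
      using basis_expansion[of h] by (simp add: scalar_mult_eq_scaleR)
    also have "... = (\<Sum>i\<in>UNIV. (h $ i) * pd phi i x)"
      using lin by (simp add: linear_sum linear_scale pd_def)
    finally show ?thesis by (simp add: inner_vec_def cgrad_def mult.commute)
  qed
  thus "(phi has_derivative (%h. cgrad phi x \<bullet> h)) (at x)"
    using assms(1)[of x] unfolding frechet_derivative_works by (simp add: \<open>!!h. frechet_derivative phi (at x) h = cgrad phi x \<bullet> h\<close>[abs_def])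
  show "continuous_on UNIV (cgrad phi)" unfolding cgrad_def using assms(2) by (intro continuous_on_vec_lambda)
qed

lemma C1g_differentiable: "C1g phi G ==> phi differentiable (at x)"
  unfolding C1g_def differentiable_def by blast

lemma C1g_continuous: "C1g phi G ==> continuous_on UNIV phi"
  using C1g_differentiable[of phi G] by (meson continuous_at_imp_continuous_on differentiable_imp_continuous_within)

lemma C1g_cont_grad: "C1g phi G ==> continuous_on UNIV G" by (simp add: C1g_def)

lemma C1g_add: "C1g phi G ==> C1g psi H ==> C1g (%x. phi x + psi x) (%x. G x + H x)"
  unfolding C1g_def by (auto intro!: derivative_eq_intros continuous_intros simp: inner_add_left)

lemma C1g_cmult: "C1g phi G ==> C1g (%x. c * phi x) (%x. c *\<^sub>R G x)"
  unfolding C1g_def by (auto intro!: derivative_eq_intros continuous_intros)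

lemma C1g_mult:
  assumes "C1g phi G" "C1g psi H"
  shows "C1g (%x. phi x * psi x) (%x. psi x *\<^sub>R G x + phi x *\<^sub>R H x)"
  using assms C1g_continuous[OF assms(1)] C1g_continuous[OF assms(2)] unfolding C1g_def
  by (auto intro!: derivative_eq_intros continuous_intros simp: inner_add_left algebra_simps)

lemma C1g_compose:
  assumes "C1g phi G" "!!x. (h has_real_derivative h' (phi x)) (at (phi x))" "continuous_on (range phi) h'"
  shows "C1g (%x. h (phi x)) (%x. h' (phi x) *\<^sub>R G x)" unfolding C1g_def
proof (intro conjI allI)
  fix x
  have "((h \<circ> phi) has_derivative ((%z. h' (phi x) * z) \<circ> (%v. G x \<bullet> v))) (at x)"
    using assms by (intro diff_chain_at) (auto simp: C1g_def has_field_derivative_def)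
  thus "((%x. h (phi x)) has_derivative (%v. h' (phi x) *\<^sub>R G x \<bullet> v)) (at x)"
    by (simp add: o_def)
  have "continuous_on UNIV (%x. h' (phi x))"
    by (rule continuous_on_compose2[OF assms(3) C1g_continuous[OF assms(1)]]) auto
  thus "continuous_on UNIV (%x. h' (phi x) *\<^sub>R G x)"
    using C1g_cont_grad[OF assms(1)] by (intro continuous_intros)
qed

lemma C1g_const: "C1g (%x. c) (%x. 0)" unfolding C1g_def by (auto intro!: derivative_eq_intros)

lemma C1g_coord: "C1g (%x. x $ i) (%x. axis i 1)" unfolding C1g_def
proof (intro conjI allI)
  fix x
  have "(\<bullet>) (axis i 1) = (%x. x $ i :: real)" by (auto simp: fun_eq_iff inner_axis inner_commute[of "axis i 1"])
  thus "((%x. x $ i) has_derivative (\<bullet>) (axis i 1)) (at x)"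
    using bounded_linear_imp_has_derivative[OF bounded_linear_vec_nth] by simp
qed auto

lemma C1g_sqdist: "C1g (%x. (norm (x - x0))^2) (%x. 2 *\<^sub>R (x - x0))"
  unfolding C1g_def power2_norm_eq_inner
  by (auto intro!: derivative_eq_intros continuous_intros simp: inner_commute)

lemma C1c_iff_C1g: "C1c U phi \<longleftrightarrow> (EX G. C1g phi G) & compact (closure {x. phi x ~= 0}) & closure {x. phi x ~= 0} \<subseteq> U"
proof -
  have "phi differentiable (at x)" "continuous_on UNIV (%x. pd phi i x)" if "C1g phi G" for G x i
    using C1g_differentiable[OF that] C1g_cont_grad[OF that] C1g_pd[OF that]
    by (auto intro!: continuous_intros)
  thus ?thesis unfolding C1c_def using C1gI by blast
qed

lemma C1c_C1g: "C1c U phi ==> C1g phi (cgrad phi)" using C1c_iff_C1g C1g_cgrad by metis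

lemma C1cI:
  assumes "C1g phi G" "compact K" "K \<subseteq> U" "!!x. x ~: K ==> phi x = 0"
  shows "C1c U phi"
proof -
  have "closure {x. phi x ~= 0} \<subseteq> K" using assms by (intro closure_minimal) (auto simp: compact_imp_closed)
  moreover from this have "compact (closure {x. phi x ~= 0})"
    using assms(2) by (meson bounded_subset closed_closure compact_eq_bounded_closed)
  ultimately show ?thesis using assms C1c_iff_C1g by blast
qed

lemma C1c_support:
  assumes "C1c U phi"
  shows "EX K. compact K & K \<subseteq> U & (ALL x. x ~: K --> phi x = 0 & cgrad phi x = 0)"
proof (intro exI conjI allI impI)
  let ?K = "closure {x. phi x ~= 0}"
  show "compact ?K" "?K \<subseteq> U" using assms by (auto simp: C1c_def)
  fix x assume x: "x ~: ?K"
  have z: "phi y = 0" if "y : - ?K" for y using that closure_subset[of "{x. phi x ~= 0}"] by auto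
  have "(phi has_derivative (%h. 0)) (at x)"
  proof (rule has_derivative_transform_within_open[of "%_. 0"])
    show "open (- ?K)" by auto
    show "x : - ?K" using x by simp
    show "0 = phi y" if "y : - ?K" for y using z[OF that] by simp
  qed simp
  moreover have "(phi has_derivative (%h. cgrad phi x \<bullet> h)) (at x)"
    using C1c_C1g[OF assms] by (simp add: C1g_def)
  ultimately have "(%h. cgrad phi x \<bullet> h) = (%h. 0)" by (rule has_derivative_unique[symmetric])
  from fun_cong[OF this, of "cgrad phi x"] have "cgrad phi x = 0" by simp
  with z[of x] x show "phi x = 0" "cgrad phi x = 0" by simp_all
qed

lemma C1c_mono: "C1c U phi ==> U \<subseteq> U' ==> C1c U' phi" by (auto simp: C1c_def)

lemma C1c_mult_C1g:
  assumes "C1c U phi" "C1g u G"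
  shows "C1c U (%x. u x * phi x)" "cgrad (%x. u x * phi x) = (%x. phi x *\<^sub>R G x + u x *\<^sub>R cgrad phi x)"
proof -
  obtain K where K: "compact K" "K \<subseteq> U" "ALL x. x ~: K --> phi x = 0 & cgrad phi x = 0"
    using C1c_support[OF assms(1)] by blast
  have g: "C1g (%x. u x * phi x) (%x. phi x *\<^sub>R G x + u x *\<^sub>R cgrad phi x)"
    by (rule C1g_mult[OF assms(2) C1c_C1g[OF assms(1)]])
  thus "cgrad (%x. u x * phi x) = (%x. phi x *\<^sub>R G x + u x *\<^sub>R cgrad phi x)" by (rule C1g_cgrad)
  show "C1c U (%x. u x * phi x)" by (rule C1cI[OF g K(1,2)]) (use K(3) in auto)
qed

lemma C1c_add:
  assumes "C1c U phi" "C1c U psi"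
  shows "C1c U (%x. phi x + psi x)" "cgrad (%x. phi x + psi x) = (%x. cgrad phi x + cgrad psi x)"
proof -
  obtain K where K: "compact K" "K \<subseteq> U" "ALL x. x ~: K --> phi x = 0 & cgrad phi x = 0"
    using C1c_support[OF assms(1)] by blast
  obtain L where L: "compact L" "L \<subseteq> U" "ALL x. x ~: L --> psi x = 0 & cgrad psi x = 0"
    using C1c_support[OF assms(2)] by blast
  have g: "C1g (%x. phi x + psi x) (%x. cgrad phi x + cgrad psi x)"
    by (intro C1g_add C1c_C1g[OF assms(1)] C1c_C1g[OF assms(2)])
  thus "cgrad (%x. phi x + psi x) = (%x. cgrad phi x + cgrad psi x)" by (rule C1g_cgrad)
  show "C1c U (%x. phi x + psi x)" by (rule C1cI[OF g, of "K \<union> L"]) (use K L in auto)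
qed

lemma C1c_cmult:
  assumes "C1c U phi"
  shows "C1c U (%x. c * phi x)" "cgrad (%x. c * phi x) = (%x. c *\<^sub>R cgrad phi x)"
  using C1c_mult_C1g[OF assms C1g_const[of c]] by simp_all

lemma C1c_zero: "C1c U (%x. 0)" "cgrad (%x. 0) = (%x. 0)"
  using C1cI[OF C1g_const, of "{}" U 0] C1g_cgrad[OF C1g_const] by auto

lemma continuous_compact_support_bounded:
  fixes f :: "'a::topological_space => 'b::real_normed_vector"
  assumes "continuous_on UNIV f" "compact K" "!!x. x ~: K ==> f x = 0"
  shows "EX B>=0. ALL x. norm (f x) <= B"
proof -
  have "bounded (f ` K)"
    using assms by (intro compact_imp_bounded compact_continuous_image) (auto intro: continuous_on_subset)
  then obtain B where "ALL x:K. norm (f x) <= B" by (auto simp: bounded_iff)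
  hence "norm (f x) <= max B 0" for x using assms(3)[of x] by (cases "x : K") auto
  thus ?thesis by (intro exI[of _ "max B 0"]) auto
qed

lemma C1c_bounded:
  assumes "C1c U phi"
  shows "EX B>=0. ALL x. abs (phi x) <= B & norm (cgrad phi x) <= B"
proof -
  obtain K where K: "compact K" "K \<subseteq> U" "ALL x. x ~: K --> phi x = 0 & cgrad phi x = 0"
    using C1c_support[OF assms(1)] by blast
  note g = C1c_C1g[OF assms]
  obtain B1 where "0 <= B1" "ALL x. norm (phi x) <= B1"
    using continuous_compact_support_bounded[OF C1g_continuous[OF g] K(1)] K(3) by auto
  moreover obtain B2 where "0 <= B2" "ALL x. norm (cgrad phi x) <= B2"
    using continuous_compact_support_bounded[OF C1g_cont_grad[OF g] K(1)] K(3) by auto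
  ultimately show ?thesis by (intro exI[of _ "max B1 B2"]) (auto simp: le_max_iff_disj)
qed

lemma C1c_measurable:
  assumes "C1c U phi"
  shows "phi : borel_measurable borel" "cgrad phi : borel_measurable borel"
    "phi : borel_measurable (lebesgue_on S)" "cgrad phi : borel_measurable (lebesgue_on S)"
proof -
  note g = C1c_C1g[OF assms]
  show 1: "phi : borel_measurable borel" "cgrad phi : borel_measurable borel"
    using C1g_continuous[OF g] C1g_cont_grad[OF g] by (auto intro: borel_measurable_continuous_onI)
  show "phi : borel_measurable (lebesgue_on S)" "cgrad phi : borel_measurable (lebesgue_on S)"
    using 1 by (auto intro!: measurable_restrict_space1 measurable_completion)
qed

lemma pd_eq_cgrad: "pd phi i x = cgrad phi x $ i" by (simp add: cgrad_def)

lemma integrable_indicator_compact: "compact K ==> integrable lborel (%x::real^'n. indicator K x * (c::real))"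
  using emeasure_compact_finite[of K]
  by (intro integrable_mult_left integrable_real_indicator) (auto simp: compact_imp_closed)

lemma integrable_lborel_bounded_support:
  fixes f :: "real^'n => 'b::euclidean_space"
  assumes "f : borel_measurable borel" "compact K" "!!x. x ~: K ==> f x = 0" "!!x. norm (f x) <= B"
  shows "integrable lborel f"
proof (rule Lintegrable_bound)
  show "integrable lborel (%x. indicator K x * B)" by (rule integrable_indicator_compact[OF assms(2)])
  show "AE x in lborel. norm (f x) <= norm (indicator K x * B)"
  proof (rule AE_I2)
    fix x
    show "norm (f x) <= norm (indicator K x * B)"
      using assms(3)[of x] assms(4)[of x] by (auto simp: indicator_def)
  qed
qed (use assms in simp)

lemma lborel_integrable_translate:
  fixes f :: "real^'n => 'b::{banach, second_countable_topology}"
  assumes "integrable lborel f"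
  shows "integrable lborel (%x. f (v + x))"
proof -
  have "integrable (distr lborel borel ((+) v)) f" using assms by (simp add: lborel_distr_plus)
  thus ?thesis using assms by (subst (asm) integrable_distr_eq) auto
qed

lemma lborel_integral_translate:
  fixes f :: "real^'n => 'b::{banach, second_countable_topology}"
  assumes "f : borel_measurable borel"
  shows "(LINT x|lborel. f (x + v)) = (LINT x|lborel. f x)"
proof -
  have "(LINT x|lborel. f x) = (LINT x|(distr lborel borel ((+) v)). f x)" by (simp add: lborel_distr_plus)
  also have "... = (LINT x|lborel. f (v + x))" using assms by (subst integral_distr) auto
  finally show ?thesis by (simp add: add.commute)
qed

text \<open>By translation invariance every difference quotient has integral zero; dominated
  convergence passes to the derivative. No iterated integrals are needed.\<close>

lemma integral_pd_eq_0:
  fixes w :: "real^'n => real"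
  assumes w: "C1c UNIV w"
  shows "(LINT x|lborel. pd w i x) = 0"
proof -
  obtain K where K: "compact K" "ALL x. x ~: K --> w x = 0 & cgrad w x = 0" using C1c_support[OF w] by blast
  obtain R where "ALL x:K. norm x <= R" using compact_imp_bounded[OF K(1)] by (auto simp: bounded_iff)
  hence R: "K \<subseteq> cball 0 R" by auto
  obtain B where B0: "0 <= B" "ALL x. abs (w x) <= B & norm (cgrad w x) <= B" using C1c_bounded[OF w] by blast
  hence B: "0 <= B" "!!x. abs (w x) <= B" "!!x. norm (cgrad w x) <= B" by simp_all
  note g = C1c_C1g[OF w]
  have [measurable]: "w : borel_measurable borel" "cgrad w : borel_measurable borel"
    using C1c_measurable[OF w] by auto
  let ?e = "axis i 1 :: real^'n"
  define h where "h n = 1 / real (Suc n)" for n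
  have h: "0 < h n" "h n <= 1" for n by (auto simp: h_def)
  have h0: "h ----> 0" unfolding h_def using LIMSEQ_inverse_real_of_nat by (simp add: inverse_eq_divide)
  define q where "q n x = (w (x + h n *\<^sub>R ?e) - w x) / h n" for n x
  have wint: "integrable lborel w"
    by (rule integrable_lborel_bounded_support[OF _ K(1), of w B]) (use K B in auto)
  have wint': "integrable lborel (%x. w (x + v))" for v
    using lborel_integrable_translate[OF wint, of v] by (simp add: add.commute)
  have int0: "(LINT x|lborel. q n x) = 0" for n
    unfolding q_def using wint wint' by (simp add: lborel_integral_translate)
  have "(%n. (LINT x|lborel. q n x)) ----> (LINT x|lborel. pd w i x)"
  proof (rule integral_dominated_convergence)
    \<comment> \<open>The radius \<open>R + 1\<close> also covers the shifted supports, since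
      \<open>h n <= 1\<close>.\<close>
    show "integrable lborel (%x::real^'n. indicator (cball 0 (R + 1)) x * B)" by (rule integrable_indicator_compact) simp
    show "AE x in lborel. (%n. q n x) ----> pd w i x"
    proof (rule AE_I2)
      fix x
      have "((%t. w (x + t *\<^sub>R ?e)) has_derivative (%t. cgrad w x \<bullet> (t *\<^sub>R ?e))) (at 0)"
      proof (rule has_derivative_compose[where f="%t. x + t *\<^sub>R ?e" and g=w])
        show "((%t. x + t *\<^sub>R ?e) has_derivative (%t. t *\<^sub>R ?e)) (at 0)" by (auto intro!: derivative_eq_intros)
        show "(w has_derivative (\<bullet>) (cgrad w x)) (at (x + 0 *\<^sub>R ?e))" using g by (simp add: C1g_def)
      qed
      hence "((%t. w (x + t *\<^sub>R ?e)) has_real_derivative pd w i x) (at 0)"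
        by (auto simp: has_field_derivative_def pd_eq_cgrad inner_axis fun_eq_iff elim!: has_derivative_eq_rhs)
      hence "((%t. (w (x + t *\<^sub>R ?e) - w x) / t) \<longlongrightarrow> pd w i x) (at 0)"
        by (simp add: DERIV_def)
      moreover have "filterlim h (at 0) sequentially"
        using h0 h by (auto simp: filterlim_at less_imp_neq[symmetric])
      ultimately show "(%n. q n x) ----> pd w i x" unfolding q_def by (rule filterlim_compose)
    qed
    fix n
    show "AE x in lborel. norm (q n x) <= indicator (cball 0 (R + 1)) x * B"
    proof (rule AE_I2)
      fix x
      have "norm (w (x + h n *\<^sub>R ?e) - w x) <= B * norm (x + h n *\<^sub>R ?e - x)"
      proof (rule differentiable_bound[where S=UNIV and f'="%x h. cgrad w x \<bullet> h"])
        show "onorm ((\<bullet>) (cgrad w y)) <= B" for y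
          using B(3)[of y] by (intro onorm_le) (metis Cauchy_Schwarz_ineq2 mult_right_mono norm_ge_zero order_trans real_norm_def)
      qed (use g in "auto simp: C1g_def")
      hence bd: "norm (q n x) <= B" using h[of n] B(1) by (simp add: q_def divide_simps mult.commute)
      show "norm (q n x) <= indicator (cball 0 (R + 1)) x * B"
      proof (cases "x : cball 0 (R + 1)")
        case False
        have "norm x <= norm (x + h n *\<^sub>R ?e) + norm (h n *\<^sub>R ?e)"
          by (metis add_diff_cancel norm_triangle_ineq4)
        hence "x ~: K" "x + h n *\<^sub>R ?e ~: K" using False R h[of n] by auto
        thus ?thesis using K(2) B(1) by (simp add: q_def)
      qed (use bd in simp)
    qed
  qed (auto simp: q_def pd_eq_cgrad)
  hence "(%n::nat. 0::real) ----> (LINT x|lborel. pd w i x)" by (simp only: int0)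
  thus ?thesis by (simp add: LIMSEQ_const_iff)
qed

lemma lebesgue_integral_eq_lborel:
  fixes f :: "real^'n => 'b::euclidean_space"
  assumes "f : borel_measurable borel" "open U" "!!x. x ~: U ==> f x = 0"
  shows "integral\<^sup>L (lebesgue_on U) f = integral\<^sup>L lborel f"
proof -
  have "integral\<^sup>L (lebesgue_on U) f = (LINT x|lebesgue. indicator U x *\<^sub>R f x)"
    using assms by (intro integral_restrict_space) auto
  also have "(%x. indicator U x *\<^sub>R f x) = f" using assms(3) by (auto simp: fun_eq_iff indicator_def)
  finally show ?thesis using assms by (simp add: integral_completion)
qed

lemma integration_by_parts:
  assumes U: "open U" and u: "C1g u G" and phi: "C1c U phi"
  shows "intO U (%x. u x * pd phi i x) = - intO U (%x. G x $ i * phi x)"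
proof -
  obtain K where K: "compact K" "K \<subseteq> U" "ALL x. x ~: K --> phi x = 0 & cgrad phi x = 0"
    using C1c_support[OF phi] by blast
  note c = C1c_mult_C1g[OF phi u]
  have [measurable]: "u : borel_measurable borel" "G : borel_measurable borel" "phi : borel_measurable borel"
    "cgrad phi : borel_measurable borel"
    using C1g_continuous[OF u] C1g_cont_grad[OF u] C1c_measurable[OF phi] by (auto intro: borel_measurable_continuous_onI)
  have cont: "continuous_on UNIV u" "continuous_on UNIV G" "continuous_on UNIV phi" "continuous_on UNIV (cgrad phi)"
    using C1g_continuous C1g_cont_grad C1c_C1g[OF phi] u by auto
  have "continuous_on UNIV (%x. u x * pd phi i x)" "continuous_on UNIV (%x. G x $ i * phi x)"
    unfolding pd_eq_cgrad using cont by (auto intro!: continuous_intros)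
  then obtain B1 B2 where "!!x. norm (u x * pd phi i x) <= B1" "!!x. norm (G x $ i * phi x) <= B2"
    using continuous_compact_support_bounded[OF _ K(1), of "%x. u x * pd phi i x"]
      continuous_compact_support_bounded[OF _ K(1), of "%x. G x $ i * phi x"] K(3) by (auto simp: pd_eq_cgrad)
  hence int: "integrable lborel (%x. u x * pd phi i x)" "integrable lborel (%x. G x $ i * phi x)"
    by (auto intro!: integrable_lborel_bounded_support[OF _ K(1)] simp: K(3) pd_eq_cgrad)
  have "(LINT x|lborel. pd (%x. u x * phi x) i x) = 0"
    using C1c_mono[OF c(1)] by (intro integral_pd_eq_0) auto
  hence "(LINT x|lborel. G x $ i * phi x + u x * pd phi i x) = 0"
    unfolding pd_eq_cgrad c(2) by (simp add: mult.commute)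
  hence "(LINT x|lborel. u x * pd phi i x) = - (LINT x|lborel. G x $ i * phi x)" using int by simp
  moreover have "intO U (%x. u x * pd phi i x) = (LINT x|lborel. u x * pd phi i x)"
    unfolding intO_def using K U by (intro lebesgue_integral_eq_lborel) (auto simp: pd_eq_cgrad subset_iff)
  moreover have "intO U (%x. G x $ i * phi x) = (LINT x|lborel. G x $ i * phi x)"
    unfolding intO_def using K U by (intro lebesgue_integral_eq_lborel) (auto simp: subset_iff)
  ultimately show ?thesis by simp
qed

section \<open>Bump functions\<close>

text \<open>The squared positive part is C^1 with a Lipschitz derivative. Test functions are only
  required to be C^1, so it replaces the usual smooth bump.\<close>

definition possq :: "real => real" where "possq t = (max 0 t)^2"

lemma possq_Taylor: "abs (possq (a + b) - possq a - 2 * max 0 a * b) <= b^2"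
proof (cases "0 <= a"; cases "0 <= a + b")
  assume *: "0 <= a" "~ 0 <= a + b"
  have "abs (a\<^sup>2 + 2 * a * b) <= b^2"
  proof -
    have "a^2 + 2 * a * b = (a + b)^2 - b^2" by (simp add: power2_sum)
    moreover have "(a + b)^2 <= b^2" using * by (intro abs_le_square_iff[THEN iffD1]) auto
    ultimately show ?thesis by (simp add: abs_le_iff)
  qed
  thus ?thesis using * by (simp add: possq_def max_def)
next
  assume *: "~ 0 <= a" "0 <= a + b"
  have "(a + b)^2 <= b^2" using * by (intro power_mono) auto
  thus ?thesis using * by (simp add: possq_def max_def)
qed (auto simp: possq_def max_def power2_sum)

lemma possq_deriv: "(possq has_real_derivative 2 * max 0 t) (at t)" unfolding DERIV_def
proof (rule LIM_zero_cancel, rule tendsto_rabs_zero_cancel, rule Lim_null_comparison)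
  show "((%h. abs h) \<longlongrightarrow> 0) (at (0::real))" by (intro tendsto_rabs_zero tendsto_ident_at)
  show "eventually (%h. norm (abs ((possq (t + h) - possq t) / h - 2 * max 0 t)) <= abs h) (at 0)"
    unfolding eventually_at_topological
  proof (intro exI[of _ UNIV] conjI ballI impI)
    fix h :: real assume h: "h ~= 0"
    have "abs ((possq (t + h) - possq t) / h - 2 * max 0 t) = abs (possq (t + h) - possq t - 2 * max 0 t * h) / abs h"
      using h by (simp add: abs_divide[symmetric] diff_divide_distrib del: abs_divide)
    also have "... <= h^2 / abs h" by (intro divide_right_mono possq_Taylor) auto
    also have "... = abs h" using h by (simp add: power2_eq_square field_simps)
    finally show "norm (abs ((possq (t + h) - possq t) / h - 2 * max 0 t)) <= abs h" by simp
  qed auto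
qed

lemma possq_nonneg [simp]: "0 <= possq t" and possq_eq_0_iff: "possq t = 0 \<longleftrightarrow> t <= 0"
  by (auto simp: possq_def max_def)

lemma C1g_possq: "C1g phi G ==> C1g (%x. possq (phi x)) (%x. (2 * max 0 (phi x)) *\<^sub>R G x)"
  by (rule C1g_compose[where h=possq and h'="%t. 2 * max 0 t"]) (auto intro!: continuous_intros possq_deriv)

definition bump :: "real^'n => real => real^'n => real" where
  "bump x0 r x = possq (r^2 - (norm (x - x0))^2)"

lemma C1g_bump: "C1g (bump x0 r) (%x. - (4 * max 0 (r^2 - (norm (x - x0))^2)) *\<^sub>R (x - x0))"
proof -
  have "C1g (%x. r^2 + (-1) * (norm (x - x0))^2) (%x. 0 + (-1) *\<^sub>R (2 *\<^sub>R (x - x0)))"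
    by (intro C1g_add C1g_cmult C1g_sqdist C1g_const)
  from C1g_possq[OF this] show ?thesis by (simp add: bump_def[abs_def])
qed

lemma bump_nonneg [simp]: "0 <= bump x0 r x" by (simp add: bump_def)

lemma bump_eq_0_iff: "0 < r ==> bump x0 r x = 0 \<longleftrightarrow> x ~: ball x0 r"
  by (auto simp: bump_def possq_eq_0_iff dist_norm norm_minus_commute power_mono dest: power2_le_imp_le)

lemma C1c_bump: "0 < r ==> cball x0 r \<subseteq> U ==> C1c U (bump x0 r)"
  by (rule C1cI[OF C1g_bump, of "cball x0 r"]) (auto simp: bump_eq_0_iff)

text \<open>The quotient \<open>f / (f + g)\<close>, with \<open>f\<close> positive exactly inside
  the large ball and \<open>g\<close> exactly outside the small closed one; \<open>r < R\<close>
  keeps the denominator positive.\<close>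

lemma C1g_cutoff:
  fixes x0 :: "real^'n"
  assumes "0 < r" "r < R"
  obtains h H where "C1g h H" "!!x. x : cball x0 r ==> h x = 1" "!!x. x ~: ball x0 R ==> h x = 0"
proof -
  let ?d = "%x. (norm (x - x0))^2"
  define f where "f x = possq (R^2 - ?d x)" for x
  define g where "g x = possq (?d x - r^2)" for x
  have rR: "r^2 < R^2" using assms by (intro power_strict_mono) auto
  have "C1g (%x. R^2 + (-1) * ?d x) (%x. 0 + (-1) *\<^sub>R (2 *\<^sub>R (x - x0)))"
    by (intro C1g_add C1g_cmult C1g_sqdist C1g_const)
  from C1g_possq[OF this] obtain F where F: "C1g f F" by (auto simp: f_def[abs_def])
  have "C1g (%x. ?d x + (- r\<^sup>2)) (%x. 2 *\<^sub>R (x - x0) + 0)" by (intro C1g_add C1g_sqdist C1g_const)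
  from C1g_possq[OF this] obtain G where G: "C1g g G" by (auto simp: g_def[abs_def])
  have pos: "f x + g x > 0" for x
  proof -
    have "0 < f x \<or> 0 < g x" using rR by (auto simp: f_def g_def possq_def max_def zero_less_power)
    thus ?thesis by (auto simp: f_def g_def add_pos_nonneg add_nonneg_pos)
  qed
  have "C1g (%x. inverse (f x + g x)) (%x. - ((inverse (f x + g x))^2) *\<^sub>R (F x + G x))"
  proof (rule C1g_compose[OF C1g_add[OF F G], where h=inverse and h'="%z. - ((inverse z)^2)"])
    show "(inverse has_real_derivative - ((inverse (f x + g x))^2)) (at (f x + g x))" for x
      using DERIV_inverse[of "f x + g x"] pos[of x] by (simp add: numeral_2_eq_2)
    show "continuous_on (range (%x. f x + g x)) (%z. - ((inverse z)^2))"
      using pos by (auto intro!: continuous_intros simp: less_imp_neq[symmetric])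
  qed
  from C1g_mult[OF F this] have "C1g (%x. f x * inverse (f x + g x))
     (%x. inverse (f x + g x) *\<^sub>R F x + f x *\<^sub>R (- ((inverse (f x + g x))^2) *\<^sub>R (F x + G x)))" .
  thus ?thesis
  proof (rule that)
    fix x
    show "f x * inverse (f x + g x) = 1" if "x : cball x0 r"
    proof -
      have "?d x <= r^2" using that by (auto simp: dist_norm norm_minus_commute intro: power_mono)
      hence "g x = 0" by (simp add: g_def possq_eq_0_iff)
      thus ?thesis using pos[of x] by simp
    qed
    show "f x * inverse (f x + g x) = 0" if "x ~: ball x0 R"
    proof -
      have "R^2 <= ?d x" using that assms by (auto simp: dist_norm norm_minus_commute intro: power_mono)
      thus ?thesis by (simp add: f_def possq_eq_0_iff)
    qed
  qed
qed

lemma integrable_mult_bounded_borel: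
  fixes u f :: "'a => real"
  assumes "integrable N u" "f : borel_measurable N" "!!y. abs (f y) <= B"
  shows "integrable N (%y. u y * f y)"
proof (rule Lintegrable_bound)
  show "integrable N (%y. u y * B)" using assms by simp
  have "abs (f y) <= abs B" for y using assms(3)[of y] by linarith
  thus "AE y in N. norm (u y * f y) <= norm (u y * B)" by (intro AE_I2) (simp add: abs_mult mult_left_mono)
qed (use assms in auto)

section \<open>Translation and mollification\<close>

text \<open>Lebesgue measurability supplies continuous functions that converge a.e. Clipping them in
  height and in space gives majorants, so that dominated convergence applies twice: for the clipping
  level and for the approximation.\<close>

lemma continuous_approx_Lp:
  fixes u :: "real^'n => real"
  assumes u: "LpV lborel p u" and p: "0 < p" and R: "!!x. R < norm x ==> u x = 0" and e: "0 < e"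
  shows "EX v R'. continuous_on UNIV v & (ALL x. R' < norm x --> v x = 0) & Ipow lborel p (%x. u x - v x) < e"
proof -
  have um [measurable]: "u : borel_measurable borel" using u by (simp add: LpV_def)
  have "u : borel_measurable lebesgue" by (intro measurable_completion) simp
  hence "u measurable_on UNIV" by (rule lebesgue_measurable_imp_measurable_on) simp
  then obtain N g where g: "negligible N" "!!n. continuous_on UNIV (g n)" "!!x. x ~: N ==> (%n. g n x) ----> u x"
    unfolding measurable_on_def by auto
  define cl where "cl B t = max (- B) (min B t)" for B t :: real
  \<comment> \<open>The last factor is 1 on the ball of radius \<open>R\<close>, which carries
    \<open>u\<close>, and 0 beyond radius \<open>R + 1\<close>.\<close>
  define v where "v k n x = cl (real k) (g n x) * max 0 (min 1 (R + 1 - norm x))" for k n x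
  define w where "w k x = cl (real k) (u x)" for k x
  have vc: "continuous_on UNIV (v k n)" for k n unfolding v_def cl_def by (intro continuous_intros g(2))
  have vR: "v k n x = 0" if "R + 1 < norm x" for k n x using that by (simp add: v_def)
  have clb: "abs (cl (real k) t) <= real k" for k t by (auto simp: cl_def)
  have wm [measurable]: "w k : borel_measurable borel" for k unfolding w_def cl_def by measurable
  have [measurable]: "v k n : borel_measurable borel" for k n using vc by (intro borel_measurable_continuous_onI)
  have "(%k. Ipow lborel p (%x. w k x - u x)) ----> 0"
  proof (rule Ipow_tendsto_dominated[OF p _ _ LpV_integrable[OF u]])
    have "(%k. w k x) ----> u x" for x
    proof (rule tendsto_eventually, rule eventually_sequentiallyI[of "nat \<lceil>\<bar>u x\<bar>\<rceil>"])
      fix k assume "nat \<lceil>\<bar>u x\<bar>\<rceil> <= k"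
      hence "abs (u x) <= real k" by linarith
      thus "w k x = u x" by (auto simp: w_def cl_def)
    qed
    thus "AE x in lborel. (%k. w k x) ----> u x" by simp
    show "AE x in lborel. ALL k. norm (w k x) powr p <= norm (u x) powr p"
      using p by (intro AE_I2 allI powr_mono2) (auto simp: w_def cl_def)
  qed auto
  hence "eventually (%k. Ipow lborel p (%x. w k x - u x) < e / (2 * 2 powr p)) sequentially"
    using e by (intro order_tendstoD) auto
  then obtain k where k: "Ipow lborel p (%x. u x - w k x) < e / (2 * 2 powr p)"
    using eventually_happens'[OF sequentially_bot] Ipow_diff_commute[of lborel p u] by auto
  note ball = integrable_indicator_compact[OF compact_cball[of "0::real^'n" "R + 1"]]
  have vb: "norm (v k n x) powr p <= indicator (cball 0 (R + 1)) x * real k powr p" for n x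
  proof -
    have "abs (v k n x) <= real k * 1" unfolding v_def abs_mult by (intro mult_mono clb) auto
    thus ?thesis using p vR[of x k n] by (cases "R + 1 < norm x") (auto intro: powr_mono2)
  qed
  have "(%n. Ipow lborel p (%x. v k n x - w k x)) ----> 0"
  proof (rule Ipow_tendsto_dominated[OF p _ _ ball])
    have "AE x in lebesgue. x ~: N" using g(1) by (intro AE_not_in) (simp add: negligible_iff_null_sets)
    hence "AE x in lborel. x ~: N" by (simp add: AE_completion_iff)
    thus "AE x in lborel. (%n. v k n x) ----> w k x"
    proof eventually_elim
      case (elim x)
      have "(%n. v k n x) ----> w k x * max 0 (min 1 (R + 1 - norm x))"
        unfolding v_def w_def cl_def by (intro tendsto_intros g(3) elim)
      also have "w k x * max 0 (min 1 (R + 1 - norm x)) = w k x"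
        using R[of x] by (cases "R < norm x") (auto simp: w_def cl_def)
      finally show ?case .
    qed
    show "AE x in lborel. ALL n. norm (v k n x) powr p <= indicator (cball 0 (R + 1)) x * real k powr p" using vb by simp
  qed auto
  hence "eventually (%n. Ipow lborel p (%x. v k n x - w k x) < e / (2 * 2 powr p)) sequentially"
    using e by (intro order_tendstoD) auto
  then obtain n where n: "Ipow lborel p (%x. w k x - v k n x) < e / (2 * 2 powr p)"
    using eventually_happens'[OF sequentially_bot] Ipow_diff_commute[of lborel p "w k"] by auto
  have Lw: "LpV lborel p (w k)" by (rule LpV_mono[OF _ u]) (use p in "auto simp: w_def cl_def")
  have Lv: "LpV lborel p (v k n)" by (rule LpV_bound[OF _ ball]) (use vb in auto)
  have "Ipow lborel p (%x. u x - v k n x) <= 2 powr p * (Ipow lborel p (%x. u x - w k x) + Ipow lborel p (%x. w k x - v k n x))"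
    using p by (intro Ipow_diff_triangle u Lw Lv) auto
  also have "... < 2 powr p * (e / (2 * 2 powr p) + e / (2 * 2 powr p))"
    using k n by (intro mult_strict_left_mono add_strict_mono) auto
  also have "... = e" by simp
  finally show ?thesis using vc vR by (intro exI[of _ "v k n"] exI[of _ "R + 1"]) auto
qed

lemma LpV_translate:
  fixes u :: "real^'n => 'b::euclidean_space"
  assumes "LpV lborel p u"
  shows "LpV lborel p (%x. u (x + s))" "Ipow lborel p (%x. u (x + s)) = Ipow lborel p u"
proof -
  have [measurable]: "u : borel_measurable borel" using assms by (simp add: LpV_def)
  show "LpV lborel p (%x. u (x + s))"
    using lborel_integrable_translate[OF LpV_integrable[OF assms], of s] by (simp add: LpV_def add.commute)
  show "Ipow lborel p (%x. u (x + s)) = Ipow lborel p u"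
    unfolding Ipow_def by (rule lborel_integral_translate) measurable
qed

text \<open>Uniform continuity of a compactly supported continuous approximation, transferred to
  \<open>u\<close> by two quasi-triangle inequalities.\<close>

lemma translation_continuous_Lp:
  fixes u :: "real^'n => real"
  assumes u: "LpV lborel p u" and p: "0 < p" and R: "!!x. R < norm x ==> u x = 0" and e: "0 < e"
  shows "EX d>0. ALL s. norm s < d --> Ipow lborel p (%x. u (x + s) - u x) < e"
proof -
  \<comment> \<open>Each quasi-triangle inequality costs a factor \<open>2 powr p\<close>; three
    errors of size \<open>c\<close> then sum to \<open>3 * e / 4\<close>.\<close>
  define c where "c = e / (4 * (2 powr p * 2 powr p))"
  have c: "0 < c" using e by (simp add: c_def)
  obtain v R' where v: "continuous_on UNIV v" "!!x. R' < norm x ==> v x = 0" "Ipow lborel p (%x. u x - v x) < c"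
    using continuous_approx_Lp[OF u p R c] by blast
  have [measurable]: "v : borel_measurable borel" using v(1) by (intro borel_measurable_continuous_onI)
  let ?B = "cball (0::real^'n) (R' + 1)"
  define b where "b = measure lborel ?B + 1"
  have b: "0 < b" by (simp add: b_def add_nonneg_pos)
  note ball = integrable_indicator_compact[OF compact_cball[of "0::real^'n" "R' + 1"]]
  \<comment> \<open>A uniform error \<open>eta\<close> on a ball of measure below \<open>b\<close>
    contributes at most \<open>c\<close> to the p-th power integral.\<close>
  define eta where "eta = (c / b) powr (1 / p)"
  have eta: "0 < eta" "eta powr p = c / b" using b c p by (auto simp: eta_def powr_powr)
  have "uniformly_continuous_on (cball 0 (R' + 2)) v"
    using v(1) by (intro compact_uniformly_continuous) (auto intro: continuous_on_subset)
  then obtain d where d: "d > 0" "!!x y. x : cball 0 (R' + 2) ==> y : cball 0 (R' + 2) ==> dist y x < d ==> dist (v y) (v x) < eta"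
    using eta(1) unfolding uniformly_continuous_on_def by metis
  have vs: "norm (v (x + s) - v x) powr p <= indicator ?B x * (c / b)" if s: "norm s < min d 1" for x s
  proof (cases "x : ?B")
    case True
    have "norm (x + s) <= R' + 2" using True s norm_triangle_ineq[of x s] by simp
    moreover have "dist (x + s) x < d" using s by (simp add: dist_norm)
    ultimately have "dist (v (x + s)) (v x) < eta" using True by (intro d(2)) auto
    hence "norm (v (x + s) - v x) powr p <= eta powr p" using p by (intro powr_mono2) (auto simp: dist_norm)
    thus ?thesis using True eta by simp
  next
    case False
    have "norm x <= norm (x + s) + norm s" using norm_triangle_ineq4[of "x + s" s] by simp
    hence "v (x + s) = 0" "v x = 0" using False s by (auto intro!: v(2))
    thus ?thesis using False by simp
  qed
  have Lv: "LpV lborel p v" using LpV_diff[OF u, of "%x. u x - v x"] p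
  proof -
    obtain A where A: "!!x. norm (v x) <= A"
      using continuous_compact_support_bounded[OF v(1) compact_cball[of 0 R']] v(2) by (auto simp: not_le)
    show ?thesis
    proof (rule LpV_bound[OF _ ball])
      show "AE x in lborel. norm (v x) powr p <= indicator ?B x * A powr p"
        using A p v(2) by (intro AE_I2) (auto simp: indicator_def intro: powr_mono2)
    qed simp
  qed
  have "Ipow lborel p (%x. u (x + s) - u x) < e" if s: "norm s < min d 1" for s
  proof -
    have 1: "Ipow lborel p (%x. v (x + s) - v x) <= c"
    proof -
      have "Ipow lborel p (%x. v (x + s) - v x) <= (LINT x|lborel. indicator ?B x * (c / b))"
        unfolding Ipow_def using vs[OF s] LpV_diff[OF LpV_translate(1)[OF Lv] Lv, of s] p
        by (intro integral_mono ball) (auto simp: LpV_def)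
      also have "... = measure lborel ?B * (c / b)" by simp
      also have "... <= b * (c / b)" using b c by (intro mult_right_mono) (auto simp: b_def)
      finally show ?thesis using b by simp
    qed
    have 2: "Ipow lborel p (%x. u (x + s) - v (x + s)) < c"
      using LpV_translate(2)[OF LpV_diff[OF u Lv], of s] p v(3) by simp
    have 3: "Ipow lborel p (%x. v x - u x) < c" using v(3) by (subst Ipow_diff_commute)
    have "Ipow lborel p (%x. u (x + s) - v x) <= 2 powr p * (Ipow lborel p (%x. u (x + s) - v (x + s)) + Ipow lborel p (%x. v (x + s) - v x))"
      using p by (intro Ipow_diff_triangle LpV_translate u Lv) auto
    also have "... < 2 powr p * (c + c)" using 1 2 by (intro mult_strict_left_mono) auto
    finally have 4: "Ipow lborel p (%x. u (x + s) - v x) < 2 powr p * (2 * c)" by simp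
    have "1 <= 2 powr p" using p by (intro ge_one_powr_ge_zero) auto
    hence "c <= 2 powr p * c" using c by simp
    have "Ipow lborel p (%x. u (x + s) - u x) <= 2 powr p * (Ipow lborel p (%x. u (x + s) - v x) + Ipow lborel p (%x. v x - u x))"
      using p by (intro Ipow_diff_triangle LpV_translate u Lv) auto
    also have "... < 2 powr p * (2 powr p * (2 * c) + 2 powr p * c)"
      using 3 4 \<open>c <= 2 powr p * c\<close> by (intro mult_strict_left_mono add_strict_mono) auto
    also have "... = 3 * (2 powr p * 2 powr p * c)" by simp
    also have "... = 3 * (e / 4)" unfolding c_def by (simp add: field_simps)
    also have "... < e" using e by simp
    finally show ?thesis .
  qed
  thus ?thesis using d(1) by (intro exI[of _ "min d 1"]) auto
qed

section \<open>Mollification on the whole space\<close>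

definition mollifier :: "real => real^'n => real" where
  "mollifier r x = bump 0 r x / (LINT y|(lborel :: (real^'n) measure). bump 0 r y)"

definition mollify :: "real => (real^'n => real) => real^'n => real" where
  "mollify r u x = (LINT y|lborel. u y * mollifier r (x - y))"

lemma bump_measurable: "bump x0 r : borel_measurable borel"
  using C1g_continuous[OF C1g_bump] by (rule borel_measurable_continuous_onI)

lemma bump_le: "bump x0 r x <= r ^ 4"
proof -
  have "max 0 (r^2 - (norm (x - x0))^2) <= r^2" by simp
  hence "(max 0 (r^2 - (norm (x - x0))^2))^2 <= (r^2)^2" by (intro power_mono) auto
  thus ?thesis by (simp add: bump_def possq_def)
qed

lemma integrable_bump:
  assumes "0 < r"
  shows "integrable lborel (bump x0 r)"
  by (rule integrable_lborel_bounded_support[OF bump_measurable compact_cball[of x0 r], where B="r ^ 4"])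
    (use assms bump_le in "auto simp: bump_eq_0_iff")

lemma integral_bump_pos:
  assumes "0 < r"
  shows "0 < (LINT y|(lborel :: (real^'n) measure). bump x0 r y)"
proof -
  let ?I = "(LINT y|(lborel :: (real^'n) measure). bump x0 r y)"
  have "?I ~= 0"
  proof
    assume "?I = 0"
    hence "AE y in lborel. bump x0 r y = 0"
      using integral_nonneg_eq_0_iff_AE[OF integrable_bump[OF assms], of x0] by simp
    hence "AE y in lborel. y ~: ball x0 r" using assms by (simp add: bump_eq_0_iff)
    hence "emeasure lborel (ball x0 r) = 0" by (subst (asm) AE_iff_null_sets[symmetric]) auto
    thus False using emeasure_lborel_ball_finite content_ball_pos[OF assms, of x0] by (simp add: measure_def)
  qed
  moreover have "0 <= ?I" by simp
  ultimately show ?thesis by linarith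
qed

lemma C1g_mollifier:
  "C1g (mollifier r :: real^'n => real) (%x. (1 / (LINT y|(lborel :: (real^'n) measure). bump 0 r y)) *\<^sub>R
     (- (4 * max 0 (r^2 - (norm x)^2)) *\<^sub>R x))"
  using C1g_cmult[OF C1g_bump, of "1 / (LINT y|(lborel :: (real^'n) measure). bump 0 r y)" 0 r]
  unfolding mollifier_def[abs_def] by simp

lemma mollifier_props:
  assumes r: "0 < r"
  shows "0 <= mollifier r x" "r < norm x ==> mollifier r (x::real^'n) = 0"
    "C1c UNIV (mollifier r :: real^'n => real)" "(LINT x|lborel. mollifier r (x::real^'n)) = 1"
    "mollifier r (- x) = mollifier r x" "integrable lborel (mollifier r :: real^'n => real)"
proof -
  note pos = integral_bump_pos[OF r, of "0::real^'n"]
  show "0 <= mollifier r x" using pos by (simp add: mollifier_def)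
  show z: "mollifier r x = 0" if "r < norm x" for x :: "real^'n"
    using that bump_eq_0_iff[OF r, of 0 x] by (simp add: mollifier_def)
  show "C1c UNIV (mollifier r :: real^'n => real)"
    by (rule C1cI[OF C1g_mollifier, of "cball 0 r"]) (use z in "auto simp: not_le")
  show "(LINT x|lborel. mollifier r (x::real^'n)) = 1" using pos by (simp add: mollifier_def)
  show "mollifier r (- x) = mollifier r x" by (simp add: mollifier_def bump_def)
  show "integrable lborel (mollifier r :: real^'n => real)"
    unfolding mollifier_def[abs_def] using integrable_bump[OF r, of "0::real^'n"] by simp
qed

text \<open>A quadratic remainder survives integration, so differentiation under the integral sign
  reduces to a uniform Taylor estimate for the kernel.\<close>

lemma quadratic_has_derivative:
  fixes f :: "real^'n => real"
  assumes "!!h. norm h <= 1 ==> abs (f (x + h) - f x - D \<bullet> h) <= L * (norm h)^2"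
  shows "(f has_derivative (%h. D \<bullet> h)) (at x)" unfolding has_derivative_at
proof
  show "(%h. norm (f (x + h) - f x - D \<bullet> h) / norm h) \<midarrow>0\<rightarrow> 0"
  proof (rule Lim_null_comparison)
    show "((%h. L * norm h) \<longlongrightarrow> 0) (at (0::real^'n))" by (auto intro!: tendsto_eq_intros)
    show "eventually (%h. norm (norm (f (x + h) - f x - D \<bullet> h) / norm h) <= L * norm h) (at 0)"
      unfolding eventually_at
    proof (intro exI[of _ 1] conjI ballI impI)
      fix h :: "real^'n" assume h: "h ~= 0 & dist h 0 < 1"
      hence "norm (f (x + h) - f x - D \<bullet> h) / norm h <= L * (norm h)^2 / norm h"
        using assms[of h] by (intro divide_right_mono) auto
      thus "norm (norm (f (x + h) - f x - D \<bullet> h) / norm h) <= L * norm h"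
        using h by (simp add: power2_eq_square)
    qed simp
  qed
qed (rule bounded_linear_inner_right)

text \<open>The remainder constant is uniform in \<open>z\<close>: for \<open>norm z > r + 1\<close>
  all terms vanish, otherwise \<open>possq_Taylor\<close> applies with increment
  \<open>- (2 * (z \<bullet> h) + (norm h)^2)\<close>. Its quadratic part causes the extra term with
  \<open>r^2\<close>.\<close>

lemma mollifier_Taylor:
  fixes z :: "real^'n"
  assumes r: "0 < r"
  shows "EX L. ALL (z::real^'n) h. norm h <= 1 -->
    abs (mollifier r (z + h) - mollifier r z - cgrad (mollifier r) z \<bullet> h) <= L * (norm h)^2"
proof -
  define c where "c = 1 / (LINT y|(lborel :: (real^'n) measure). bump 0 r y)"
  have c: "0 < c" using integral_bump_pos[OF r, of "0::real^'n"] by (simp add: c_def)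
  have mol: "mollifier r (z::real^'n) = c * possq (r^2 - (norm z)^2)" for z by (simp add: mollifier_def bump_def c_def)
  have gr: "cgrad (mollifier r) (z::real^'n) = c *\<^sub>R (- (4 * max 0 (r^2 - (norm z)^2)) *\<^sub>R z)" for z
    using C1g_cgrad[OF C1g_mollifier, of r] unfolding c_def by metis
  have "abs (mollifier r (z + h) - mollifier r z - cgrad (mollifier r) z \<bullet> h) <= c * ((2 * r + 3)^2 + 2 * r^2) * (norm h)^2"
    if h: "norm h <= 1" for z h :: "real^'n"
  proof (cases "norm z <= r + 1")
    case True
    define a where "a = r^2 - (norm z)^2"
    define b where "b = - (2 * (z \<bullet> h) + (norm h)^2)"
    have ab: "r^2 - (norm (z + h))^2 = a + b"
      by (simp add: a_def b_def power2_norm_eq_inner inner_add_left inner_add_right inner_commute)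
    have "abs b <= 2 * abs (z \<bullet> h) + (norm h)^2"
      using zero_le_power2[of "norm h"] unfolding b_def by linarith
    also have "abs (z \<bullet> h) <= (r + 1) * norm h"
      using Cauchy_Schwarz_ineq2[of z h] True by (meson mult_right_mono norm_ge_zero order_trans)
    also have "(norm h)^2 <= norm h" using h by (simp add: power2_eq_square mult_left_le)
    finally have "abs b <= (2 * r + 3) * norm h" by (simp add: algebra_simps)
    hence "(abs b)^2 <= ((2 * r + 3) * norm h)^2" by (intro power_mono) auto
    hence b2: "b^2 <= (2 * r + 3)^2 * (norm h)^2" by (simp add: power_mult_distrib)
    have "mollifier r (z + h) - mollifier r z - cgrad (mollifier r) z \<bullet> h
       = c * (possq (a + b) - possq a - 2 * max 0 a * b - 2 * max 0 a * (norm h)^2)"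
      unfolding mol gr ab a_def[symmetric] by (simp add: b_def algebra_simps)
    moreover have "abs (possq (a + b) - possq a - 2 * max 0 a * b - 2 * max 0 a * (norm h)^2) <= b^2 + 2 * r^2 * (norm h)^2"
    proof -
      have "2 * max 0 a * (norm h)^2 <= 2 * r^2 * (norm h)^2" "0 <= 2 * max 0 a * (norm h)^2"
        by (auto simp: a_def intro!: mult_right_mono)
      thus ?thesis using possq_Taylor[of a b] by linarith
    qed
    ultimately have "abs (mollifier r (z + h) - mollifier r z - cgrad (mollifier r) z \<bullet> h) <= c * (b^2 + 2 * r^2 * (norm h)^2)"
      using c by (simp add: abs_mult)
    also have "... <= c * ((2 * r + 3)^2 * (norm h)^2 + 2 * r^2 * (norm h)^2)"
      using c b2 by (intro mult_left_mono add_right_mono) auto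
    finally show ?thesis by (simp add: algebra_simps)
  next
    case False
    have "norm z <= norm (z + h) + norm h" using norm_triangle_ineq4[of "z + h" h] by simp
    hence "r < norm (z + h)" "r < norm z" using False h by linarith+
    moreover from this have "r^2 <= (norm z)^2" using r by (intro power_mono) auto
    ultimately show ?thesis using mollifier_props(2)[OF r, of "z + h"] mollifier_props(2)[OF r, of z] c by (simp add: gr)
  qed
  thus ?thesis by blast
qed

lemma C1g_reflect:
  assumes "C1g m H"
  shows "C1g (%y. m (x - y)) (%y. - H (x - y))" unfolding C1g_def
proof (intro conjI allI)
  fix y
  have "((%y. m (x - y)) has_derivative (%h. H (x - y) \<bullet> (- h))) (at y)"
    by (rule has_derivative_compose[where f="%y. x - y" and g=m]) (use assms in "auto simp: C1g_def intro!: derivative_eq_intros")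
  thus "((%y. m (x - y)) has_derivative (%h. - H (x - y) \<bullet> h)) (at y)" by simp
  show "continuous_on UNIV (%y. - H (x - y))"
    by (intro continuous_intros continuous_on_compose2[OF C1g_cont_grad[OF assms]]) auto
qed

text \<open>Borel functions on the whole space with bounded support and a weak gradient there.
  Translation, cutoff and mollification act on such pairs without reference to a domain; zero
  boundary values become a matter of support.\<close>

definition sobolev_pair :: "real => (real^'n => real) => (real^'n => real^'n) => bool" where
  "sobolev_pair p u G \<longleftrightarrow> LpV lborel p u & LpV lborel p G & (EX R. ALL x. R < norm x --> u x = 0 & G x = 0) \<and>
     (ALL phi i. C1c UNIV phi --> (LINT x|lborel. u x * cgrad phi x $ i) = - (LINT x|lborel. G x $ i * phi x))"

lemma integrable_of_LpV_bounded_support: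
  fixes u :: "real^'n => 'b::euclidean_space"
  assumes u: "LpV lborel p u" and p: "1 <= p" and R: "!!x. R < norm x ==> u x = 0"
  shows "integrable lborel u"
proof (rule Lintegrable_bound)
  show "integrable lborel (%x::real^'n. indicator (cball 0 R) x * 1 + norm (u x) powr p)"
    by (intro Lintegrable_add integrable_indicator_compact LpV_integrable[OF u]) simp
  show "AE x in lborel. norm (u x) <= norm (indicator (cball 0 R) x * 1 + norm (u x) powr p)"
  proof (rule AE_I2)
    fix x
    show "norm (u x) <= norm (indicator (cball 0 R) x * 1 + norm (u x) powr p)"
      using le_add_powr[of 1 "norm (u x)" p] p R[of x] by (cases "R < norm x") auto
  qed
qed (use u in "auto simp: LpV_def")

text \<open>Integrating the uniform Taylor remainder of the kernel against \<open>u\<close> leaves a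
  quadratic remainder for the mollified function.\<close>

lemma C1g_mollify:
  fixes u :: "real^'n => real"
  assumes r: "0 < r" and u: "integrable lborel u"
  shows "C1g (mollify r u) (%x. \<chi> i. (LINT y|lborel. u y * cgrad (mollifier r) (x - y) $ i))"
    (is "C1g _ ?D")
proof -
  let ?m = "mollifier r :: real^'n => real"
  note c = mollifier_props(3)[OF r, where 'n='n]
  note g = C1c_C1g[OF c]
  obtain B where B: "0 <= B" "ALL x. abs (?m x) <= B & norm (cgrad ?m x) <= B" using C1c_bounded[OF c] by blast
  have [measurable]: "?m : borel_measurable borel" "cgrad ?m : borel_measurable borel" using C1c_measurable[OF c] by auto
  have um [measurable]: "u : borel_measurable borel" using u by simp
  have bd: "abs (cgrad ?m z $ i) <= B" for z i
    using B(2) component_le_norm_cart[of "cgrad ?m z" i] by (meson order_trans)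
  have int: "integrable lborel (%y. u y * f y)" if "f : borel_measurable borel" "!!y. abs (f y) <= B" for f
  proof (rule Lintegrable_bound)
    show "integrable lborel (%y. u y * B)" using u by simp
    show "AE y in lborel. norm (u y * f y) <= norm (u y * B)"
      using that(2) B(1) by (intro AE_I2) (auto simp: abs_mult intro!: mult_left_mono)
  qed (use that in auto)
  have i1: "integrable lborel (%y. u y * ?m (x - y))" for x using B by (intro int) auto
  have i2: "integrable lborel (%y. u y * cgrad ?m (x - y) $ i)" for x i using bd by (intro int) auto
  have inner: "?D x \<bullet> h = (LINT y|lborel. u y * (cgrad ?m (x - y) \<bullet> h))" for x h
  proof -
    have "?D x \<bullet> h = (LINT y|lborel. (\<Sum>i\<in>UNIV. (u y * cgrad ?m (x - y) $ i) * h $ i))"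
      using i2 by (simp add: inner_vec_def Bochner_Integration.integral_sum)
    thus ?thesis by (simp add: inner_vec_def sum_distrib_left mult.assoc)
  qed
  have i3: "integrable lborel (%y. u y * (cgrad ?m (x - y) \<bullet> h))" for x h
  proof -
    have "integrable lborel (%y. \<Sum>i\<in>UNIV. (u y * cgrad ?m (x - y) $ i) * h $ i)"
      by (intro Bochner_Integration.integrable_sum integrable_mult_left i2)
    thus ?thesis by (simp add: inner_vec_def sum_distrib_left mult.assoc)
  qed
  obtain L where L: "ALL (z::real^'n) h. norm h <= 1 --> abs (?m (z + h) - ?m z - cgrad ?m z \<bullet> h) <= L * (norm h)^2"
    using mollifier_Taylor[OF r] by blast
  show ?thesis unfolding C1g_def
  proof (intro conjI allI)
    fix x
    show "(mollify r u has_derivative (\<bullet>) (?D x)) (at x)"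
    proof (rule quadratic_has_derivative)
      fix h :: "real^'n" assume h: "norm h <= 1"
      let ?q = "%y. ?m (x + h - y) - ?m (x - y) - cgrad ?m (x - y) \<bullet> h"
      have le: "abs (?q y) <= L * (norm h)^2" for y
      proof -
        have "x + h - y = (x - y) + h" by simp
        thus ?thesis using L[rule_format, OF h, of "x - y"] by (simp only:)
      qed
      have eq: "mollify r u (x + h) - mollify r u x - ?D x \<bullet> h = (LINT y|lborel. u y * ?q y)"
        unfolding mollify_def inner using i1 i3 by (simp add: right_diff_distrib)
      have "abs (LINT y|lborel. u y * ?q y) <= (LINT y|lborel. abs (u y) * (L * (norm h)^2))"
      proof (rule integral_abs_bound_integral)
        show "integrable lborel (%y. u y * ?q y)"
          using i1[of "x + h"] i1[of x] i3[of x h] by (simp add: right_diff_distrib)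
        show "abs (u y * ?q y) <= abs (u y) * (L * (norm h)^2)" for y
          unfolding abs_mult by (intro mult_left_mono le) auto
      qed (use u in auto)
      thus "abs (mollify r u (x + h) - mollify r u x - ?D x \<bullet> h) <= ((LINT y|lborel. abs (u y)) * L) * (norm h)^2"
        unfolding eq by (simp add: mult.assoc)
    qed
  next
    show "continuous_on UNIV ?D"
    proof (intro continuous_on_vec_lambda, unfold continuous_on_sequentially, intro allI ballI impI)
      fix i x and xs :: "nat => real^'n" assume "x : UNIV" "(ALL n. xs n : UNIV) & xs ----> x"
      hence xs: "xs ----> x" by simp
      have "(%n. (LINT y|lborel. u y * cgrad ?m (xs n - y) $ i)) ----> (LINT y|lborel. u y * cgrad ?m (x - y) $ i)"
      proof (rule integral_dominated_convergence)
        show "integrable lborel (%y. abs (u y) * B)" using u by simp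
        show "AE y in lborel. (%n. u y * cgrad ?m (xs n - y) $ i) ----> u y * cgrad ?m (x - y) $ i"
        proof (rule AE_I2)
          fix y
          have "(%n. cgrad ?m (xs n - y)) ----> cgrad ?m (x - y)"
            by (rule continuous_on_tendsto_compose[OF C1g_cont_grad[OF g]]) (auto intro!: tendsto_intros xs)
          thus "(%n. u y * cgrad ?m (xs n - y) $ i) ----> u y * cgrad ?m (x - y) $ i"
            by (intro tendsto_intros)
        qed
        show "AE y in lborel. norm (u y * cgrad ?m (xs n - y) $ i) <= abs (u y) * B" for n
          using bd by (intro AE_I2) (auto simp: abs_mult intro!: mult_left_mono)
      qed auto
      thus "((%x. (LINT y|lborel. u y * cgrad ?m (x - y) $ i)) \<circ> xs) ----> (LINT y|lborel. u y * cgrad ?m (x - y) $ i)"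
        by (simp add: o_def)
    qed
  qed
qed

lemma mollify_outside:
  assumes r: "0 < r" and K: "!!y. y ~: K ==> u y = 0" and x: "!!y. y : K ==> r < dist x y"
  shows "mollify r u x = 0"
proof -
  have "u y * mollifier r (x - y) = 0" for y
    using K[of y] x[of y] mollifier_props(2)[OF r, of "x - y"] by (cases "y : K") (auto simp: dist_norm)
  hence "(%y. u y * mollifier r (x - y)) = (%_. 0)" by (rule ext)
  thus ?thesis by (simp add: mollify_def)
qed

text \<open>The tangent line inequality of a convex power, here a rearranged Young inequality with
  exponents \<open>p\<close> and \<open>p / (p - 1)\<close>. It serves in place of Jensen's
  inequality.\<close>

lemma powr_tangent:
  fixes t c p :: real
  assumes "1 <= p" "0 <= t" "0 <= c"
  shows "c powr p + p * c powr (p - 1) * (t - c) <= t powr p"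
proof (cases "p = 1")
  case True
  thus ?thesis using assms by (cases "c = 0") auto
next
  case False
  hence p: "1 < p" using assms by simp
  have q: "1 < p / (p - 1)" "1 / p + 1 / (p / (p - 1)) = 1" using p by (auto simp: field_simps)
  have "t * c powr (p - 1) <= t powr p / p + (c powr (p - 1)) powr (p / (p - 1)) / (p / (p - 1))"
    using assms by (intro Youngs_inequality p q) auto
  also have "(c powr (p - 1)) powr (p / (p - 1)) = c powr p" using p by (simp add: powr_powr)
  finally have "p * (t * c powr (p - 1)) <= t powr p + (p - 1) * c powr p" using p by (simp add: field_simps)
  moreover have "c powr (p - 1) * c = c powr p" using assms(3) p by (cases "c = 0") (auto simp: powr_diff)
  ultimately show ?thesis by (simp add: algebra_simps)
qed

text \<open>The mollification error is an average of translation errors; convexity moves the p-th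
  power inside the average and Fubini exchanges the integrals, so the worst translation of size at
  most \<open>r\<close> bounds it.\<close>

lemma mollify_Lp:
  fixes u :: "real^'n => real"
  assumes r: "0 < r" and p: "1 <= p" and uL: "LpV lborel p u" and u: "integrable lborel u"
    and e: "!!s. norm s <= r ==> Ipow lborel p (%x. u (x + s) - u x) <= e"
  shows "Ipow lborel p (%x. mollify r u x - u x) <= e"
proof -
  let ?m = "mollifier r :: real^'n => real"
  note mp = mollifier_props[OF r, where 'n='n]
  obtain B where B: "ALL x. abs (?m x) <= B & norm (cgrad ?m x) <= B" using C1c_bounded[OF mp(3)] by blast
  have [measurable]: "?m : borel_measurable borel" using C1c_measurable[OF mp(3)] by auto
  have um [measurable]: "u : borel_measurable borel" using u by simp
  have [measurable]: "mollify r u : borel_measurable borel"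
    using C1g_continuous[OF C1g_mollify[OF r u]] by (rule borel_measurable_continuous_onI)
  have e0: "0 <= e" using e[of 0] r by (simp add: Ipow_def)
  have iu: "integrable lborel (%y. ?m y * u (x + y))" for x
  proof (rule Lintegrable_bound)
    show "integrable lborel (%y. B * u (x + y))" by (intro integrable_mult_right lborel_integrable_translate u)
    have "abs (?m y) <= abs B" for y using B by (meson abs_ge_self order_trans)
    thus "AE y in lborel. norm (?m y * u (x + y)) <= norm (B * u (x + y))"
      by (intro AE_I2) (simp add: abs_mult mult_right_mono)
  qed auto
  have diff: "mollify r u x - u x = (LINT y|lborel. ?m y * (u (x + y) - u x))" for x
  proof -
    have "mollify r u x = (LINT t|lborel. u (t + x) * ?m (x - (t + x)))"
      unfolding mollify_def by (rule lborel_integral_translate[symmetric]) measurable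
    also have "... = (LINT y|lborel. ?m y * u (x + y))" using mp(5) by (simp add: mult.commute add.commute)
    finally show ?thesis using iu[of x] mp(4,6) by (simp add: right_diff_distrib)
  qed
  \<comment> \<open>Stated for extended values, so that points where the right side is infinite need
    no separate treatment later.\<close>
  have J: "ennreal (norm (mollify r u x - u x) powr p) <= (\<integral>\<^sup>+y. ennreal (?m y * abs (u (x + y) - u x) powr p) \<partial>lborel)" for x
  proof (cases "(\<integral>\<^sup>+y. ennreal (?m y * abs (u (x + y) - u x) powr p) \<partial>lborel) = \<infinity>")
    case False
    have int: "integrable lborel (%y. ?m y * abs (u (x + y) - u x) powr p)"
      by (rule integrableI_nonneg) (use mp(1) False in "auto simp: top.not_eq_extremum")
    have i1: "integrable lborel (%y. ?m y * (u (x + y) - u x))"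
      using iu[of x] mp(6) by (simp add: right_diff_distrib)
    have i2: "integrable lborel (%y. ?m y * abs (u (x + y) - u x))"
      using integrable_norm[OF i1] mp(1) by (simp add: abs_mult)
    define c where "c = abs (mollify r u x - u x)"
    have cle: "c <= (LINT y|lborel. ?m y * abs (u (x + y) - u x))"
      unfolding c_def diff using integral_norm_bound[of lborel "%y. ?m y * (u (x + y) - u x)"] mp(1) by (simp add: abs_mult)
    \<comment> \<open>The added term is nonnegative, as \<open>c\<close> is at most the mean of the
      absolute differences. The integrand is then the tangent line at \<open>c\<close>.\<close>
    have "c powr p <= c powr p + p * c powr (p - 1) * ((LINT y|lborel. ?m y * abs (u (x + y) - u x)) - c)"
      using cle p by simp
    also have "... = (LINT y|lborel. ?m y * (c powr p - p * c powr (p - 1) * c) + (p * c powr (p - 1)) * (?m y * abs (u (x + y) - u x)))"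
      using i2 mp(4,6) by (simp add: right_diff_distrib)
    also have "... <= (LINT y|lborel. ?m y * abs (u (x + y) - u x) powr p)"
    proof (rule integral_mono)
      fix y
      have "?m y * (c powr p + p * c powr (p - 1) * (abs (u (x + y) - u x) - c)) <= ?m y * abs (u (x + y) - u x) powr p"
        using mp(1) p by (intro mult_left_mono powr_tangent) (auto simp: c_def)
      thus "?m y * (c powr p - p * c powr (p - 1) * c) + (p * c powr (p - 1)) * (?m y * abs (u (x + y) - u x)) <= ?m y * abs (u (x + y) - u x) powr p"
        by (simp add: algebra_simps)
    qed (use i2 int mp(6) in auto)
    finally have "ennreal (c powr p) <= ennreal (LINT y|lborel. ?m y * abs (u (x + y) - u x) powr p)" by (rule ennreal_leI)
    thus ?thesis using int mp(1) by (subst nn_integral_eq_integral) (auto simp: c_def)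
  qed simp
  have "(\<integral>\<^sup>+x. ennreal (norm (mollify r u x - u x) powr p) \<partial>lborel)
      <= (\<integral>\<^sup>+x. (\<integral>\<^sup>+y. ennreal (?m y * abs (u (x + y) - u x) powr p) \<partial>lborel) \<partial>lborel)"
    by (intro nn_integral_mono J)
  also have "... = (\<integral>\<^sup>+y. (\<integral>\<^sup>+x. ennreal (?m y * abs (u (x + y) - u x) powr p) \<partial>lborel) \<partial>lborel)"
    by (rule lborel_pair.Fubini'[symmetric]) measurable
  also have "... <= (\<integral>\<^sup>+y. ennreal (?m y * e) \<partial>lborel)"
  proof (rule nn_integral_mono)
    fix y
    have "integrable lborel (%x. abs (u (x + y) - u x) powr p)"
      using LpV_diff[OF LpV_translate(1)[OF uL] uL, of y] p by (simp add: LpV_def)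
    hence "(\<integral>\<^sup>+x. ennreal (?m y * abs (u (x + y) - u x) powr p) \<partial>lborel) = ennreal (?m y * Ipow lborel p (%x. u (x + y) - u x))"
      using mp(1) by (subst nn_integral_eq_integral) (auto simp: Ipow_def)
    also have "... <= ennreal (?m y * e)"
      using e[of y] mp(1,2)[of y] by (cases "norm y <= r") (auto intro!: ennreal_leI mult_left_mono)
    finally show "(\<integral>\<^sup>+x. ennreal (?m y * abs (u (x + y) - u x) powr p) \<partial>lborel) <= ennreal (?m y * e)" .
  qed
  also have "... = ennreal e" using mp(1,4,6) e0 by (subst nn_integral_eq_integral) auto
  finally have le: "(\<integral>\<^sup>+x. ennreal (norm (mollify r u x - u x) powr p) \<partial>lborel) <= ennreal e" .
  have "integrable lborel (%x. norm (mollify r u x - u x) powr p)"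
    by (rule integrableI_nonneg) (use le in "auto intro: le_less_trans")
  hence "ennreal (Ipow lborel p (%x. mollify r u x - u x)) <= ennreal e"
    using le unfolding Ipow_def by (subst nn_integral_eq_integral[symmetric]) auto
  thus ?thesis using e0 by simp
qed

section \<open>Density of differentiable test functions\<close>

lemma C1c_nonzero_open: "C1c U phi ==> open {x. phi x ~= 0}"
  using C1g_continuous[OF C1c_C1g] by (intro open_Collect_neq) (auto intro: continuous_intros)

lemma C1c_nonzero_subset: "C1c U phi ==> {x. phi x ~= 0} \<subseteq> U"
  using closure_subset unfolding C1c_def by fast

text \<open>By Lindelof, a local property that can be checked after multiplication by one test
  function need only be checked for countably many of them, hence holds a.e.\<close>

lemma open_cover_C1c:
  fixes U :: "(real^'n) set"
  assumes "open U"
  shows "EX F. countable F & (ALL phi:F. C1c U phi) & U = (\<Union>phi\<in>F. {x. phi x ~= 0})"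
proof -
  have "EX phi. C1c U phi & phi x ~= 0" if "x : U" for x
  proof -
    obtain r where r: "r > 0" "cball x r \<subseteq> U" using assms \<open>x : U\<close> open_contains_cball by blast
    thus ?thesis using C1c_bump[OF r] bump_eq_0_iff[OF r(1), of x x] by auto
  qed
  then obtain phi where phi: "!!x. x : U ==> C1c U (phi x) & phi x x ~= 0" by metis
  have op: "!!S. S : (%x. {y. phi x y ~= 0}) ` U ==> open S" using phi by (auto intro: C1c_nonzero_open)
  obtain F' where F': "F' \<subseteq> (%x. {y. phi x y ~= 0}) ` U" "countable F'" "\<Union>F' = \<Union>((%x. {y. phi x y ~= 0}) ` U)"
    using Lindelof[OF op] by blast
  obtain X where X: "X \<subseteq> U" "countable X" "F' = (%x. {y. phi x y ~= 0}) ` X"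
    using countable_subset_image[of F' "%x. {y. phi x y ~= 0}" U] F' by auto
  have "U = (\<Union>x\<in>X. {y. phi x y ~= 0})"
  proof
    show "U \<subseteq> (\<Union>x\<in>X. {y. phi x y ~= 0})" using F'(3) X(3) phi by auto
    show "(\<Union>x\<in>X. {y. phi x y ~= 0}) \<subseteq> U" using X(1) phi C1c_nonzero_subset by blast
  qed
  thus ?thesis using X phi by (intro exI[of _ "phi ` X"]) auto
qed

text \<open>Uniform density of test functions in \<open>C0\<close>, needed to compare representing
  measures on \<open>C0\<close> when they are only known to agree on test functions.\<close>

lemma C0_approx:
  fixes phi :: "real^'n => real"
  assumes U: "open U" and phi: "C0 U phi" and e: "0 < e"
  shows "EX psi. C1c U psi & (ALL x:U. abs (phi x - psi x) <= e)"
proof -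
  define c where "c = e / 2"
  have c: "0 < c" using e by (simp add: c_def)
  obtain K where K: "compact K" "K \<subseteq> U" "!!x. x : U - K ==> abs (phi x) < c" using phi c by (auto simp: C0_def)
  \<comment> \<open>Soft thresholding: it changes \<open>phi\<close> by at most \<open>c\<close>,
    preserves continuity, and vanishes wherever \<open>phi\<close> is smaller than \<open>c\<close>,
    in particular off \<open>K\<close>.\<close>
  define th where "th x = (if x : U then phi x - max (-c) (min c (phi x)) else 0)" for x
  have out: "th x = 0" if "x ~: K" for x using K(3)[of x] that by (auto simp: th_def)
  have "continuous_on (U \<union> - K) th"
  proof (rule continuous_on_open_Un[OF U])
    have "continuous_on U phi" using phi by (simp add: C0_def)
    hence "continuous_on U (%x. phi x - max (-c) (min c (phi x)))" by (intro continuous_intros)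
    thus "continuous_on U th" by (simp add: th_def cong: continuous_on_cong)
    have "continuous_on (- K) th \<longleftrightarrow> continuous_on (- K) (%x. 0::real)" by (rule continuous_on_cong) (use out in auto)
    thus "continuous_on (- K) th" by simp
  qed (use K(1) compact_imp_closed in auto)
  moreover have "U \<union> - K = UNIV" using K(2) by auto
  ultimately have cont: "continuous_on UNIV th" by simp
  have th: "integrable lborel th"
  proof -
    obtain B where "ALL x. norm (th x) <= B" using continuous_compact_support_bounded[OF cont K(1) out] by blast
    thus ?thesis
      by (intro integrable_lborel_bounded_support[OF borel_measurable_continuous_onI[OF cont] K(1) out]) auto
  qed
  obtain R where R: "K \<subseteq> cball 0 R" using compact_imp_bounded[OF K(1)] by (auto simp: bounded_iff subset_iff)
  have "uniformly_continuous_on (cball 0 (R + 1)) th"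
    by (rule compact_uniformly_continuous[OF continuous_on_subset[OF cont]]) auto
  then obtain d where d: "0 < d" "!!x y. x : cball 0 (R + 1) ==> y : cball 0 (R + 1) ==> dist y x < d ==> dist (th y) (th x) < c"
    using c by (auto simp: uniformly_continuous_on_def)
  obtain s where s: "0 < s" "(\<Union>x\<in>K. cball x s) \<subseteq> U"
    by (rule compact_subset_open_imp_cball_epsilon_subset[OF K(1) U K(2)])
  \<comment> \<open>\<open>s\<close> keeps the mollified support inside \<open>U\<close>,
    \<open>d / 2\<close> stays below the modulus of continuity, and 1 keeps all points in the
    enlarged ball.\<close>
  define r where "r = min s (min (d / 2) 1)"
  have r: "0 < r" "r <= s" "r < d" "r <= 1" using d(1) s(1) by (auto simp: r_def)
  have close: "abs (th y - th x) <= c" if "dist y x <= r" for x y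
  proof (cases "x : K \<or> y : K")
    case True
    have "norm x <= R + 1 & norm y <= R + 1"
      using True R that r(4) norm_triangle_sub[of x y] norm_triangle_sub[of y x] by (auto simp: dist_norm norm_minus_commute)
    thus ?thesis using d(2)[of x y] that r(3) by (simp add: dist_real_def)
  qed (use out c in auto)
  let ?psi = "mollify r th" and ?K = "{x + y |x y. x : K & y : cball 0 r}"
  have "C1c U ?psi"
  proof (rule C1cI[OF C1g_mollify[OF r(1) th] compact_sums[OF K(1) compact_cball]])
    show "?K \<subseteq> U"
    proof
      fix x assume "x : ?K"
      then obtain a b where "x = a + b" "a : K" "norm b <= r" by auto
      hence "x : cball a s" using r(2) by (simp add: dist_norm)
      thus "x : U" using s(2) \<open>a : K\<close> by blast
    qed
    show "?psi x = 0" if "x ~: ?K" for x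
    proof (rule mollify_outside[OF r(1)])
      show "th y = 0" if "y ~: K" for y by (rule out[OF that])
      show "r < dist x y" if "y : K" for y
      proof (rule ccontr)
        assume "~ r < dist x y"
        hence "x = y + (x - y) & y : K & x - y : cball 0 r" using \<open>y : K\<close> by (simp add: dist_norm norm_minus_commute)
        thus False using \<open>x ~: ?K\<close> by blast
      qed
    qed
  qed
  moreover have "abs (phi x - ?psi x) <= e" if x: "x : U" for x
  proof -
    let ?m = "%y. mollifier r (x - y)"
    have mb: "mollifier r : borel_measurable (borel :: (real^'n) measure)" using borel_measurable_integrable[OF mollifier_props(6)[OF r(1)]] by simp
    have m1: "?m = (%y. mollifier r (y + (- x)))" using mollifier_props(5)[OF r(1)] by (metis add_uminus_conv_diff minus_diff_eq)
    have im: "integrable lborel ?m"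
      using lborel_integrable_translate[OF mollifier_props(6)[OF r(1)], of "- x"] unfolding m1 by (simp add: add.commute)
    have i1: "(LINT y|lborel. ?m y) = 1" unfolding m1 lborel_integral_translate[OF mb] by (rule mollifier_props(4)[OF r(1)])
    obtain B where B: "!!z. abs (mollifier r (z::real^'n)) <= B" using C1c_bounded[OF mollifier_props(3)[OF r(1)]] by auto
    have it: "integrable lborel (%y. th y * ?m y)"
      by (rule integrable_mult_bounded_borel[OF th, of _ B]) (use B borel_measurable_integrable[OF im] in auto)
    have "?psi x - th x = (LINT y|lborel. (th y - th x) * ?m y)"
      using it im i1 by (simp add: mollify_def left_diff_distrib)
    also have "abs (...) <= (LINT y|lborel. c * ?m y)"
    proof (rule order_trans[OF integral_abs_bound integral_mono])
      show "integrable lborel (%y. abs ((th y - th x) * ?m y))" using it im by (simp add: left_diff_distrib)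
      show "integrable lborel (%y. c * ?m y)" using im by simp
      show "abs ((th y - th x) * ?m y) <= c * ?m y" for y
      proof (cases "dist y x <= r")
        case True
        thus ?thesis using close[OF True] mollifier_props(1)[OF r(1), of "x - y"] by (simp add: abs_mult mult_right_mono)
      next
        case False
        hence "?m y = 0" using mollifier_props(2)[OF r(1), of "x - y"] by (simp add: dist_norm norm_minus_commute)
        thus ?thesis by simp
      qed
    qed
    also have "... = c" using i1 by simp
    finally have "abs (?psi x - th x) <= c" .
    moreover have "abs (phi x - th x) <= c" using x c by (auto simp: th_def)
    ultimately show ?thesis unfolding c_def by linarith
  qed
  ultimately show ?thesis by blast
qed

lemma C1c_mollifier_reflect:
  fixes x :: "real^'n"
  assumes r: "0 < r"
  shows "C1c UNIV (%y. mollifier r (x - y))"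
proof (rule C1cI[OF C1g_reflect[OF C1c_C1g[OF mollifier_props(3)[OF r]]], of "cball x r"])
  show "mollifier r (x - y) = 0" if "y ~: cball x r" for y
    using that by (intro mollifier_props(2)[OF r]) (simp add: dist_norm)
qed auto

text \<open>The reflected mollifier is a test function, so every mollification of \<open>h\<close>
  vanishes; yet mollifications converge to \<open>h\<close> in L^1.\<close>

lemma AE_zero_if_C1c_orthogonal:
  fixes h :: "real^'n => real"
  assumes L: "LpV lborel 1 h" and R: "!!x. R < norm x ==> h x = 0"
    and eq: "!!phi. C1c UNIV phi ==> (LINT x|lborel. h x * phi x) = 0"
  shows "AE x in lborel. h x = 0"
proof -
  have i: "integrable lborel h" by (rule integrable_of_LpV_bounded_support[OF L _ R]) simp_all
  have "Ipow lborel 1 h <= 0 + e" if e: "0 < e" for e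
  proof -
    obtain d where d: "0 < d" "!!s. norm s < d ==> Ipow lborel 1 (%x. h (x + s) - h x) < e"
      using translation_continuous_Lp[OF L zero_less_one R e] by blast
    have "Ipow lborel 1 (%x. mollify (d / 2) h x - h x) <= e"
      by (rule mollify_Lp[OF _ _ L i]) (use d in "auto intro: less_imp_le")
    moreover have "mollify (d / 2) h x = 0" for x
      unfolding mollify_def using d(1) by (intro eq C1c_mollifier_reflect) simp
    ultimately show ?thesis by (simp add: Ipow_def)
  qed
  hence "Ipow lborel 1 h <= 0" by (rule field_le_epsilon)
  hence "(LINT x|lborel. abs (h x)) = 0" using order_antisym[OF _ Ipow_nonneg[of lborel 1 h]] by (simp add: Ipow_def)
  thus ?thesis using integral_nonneg_eq_0_iff_AE[of lborel "%x. abs (h x)"] i by simp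
qed

lemma integrable_lebesgue_on_mono:
  fixes u :: "real^'n => real"
  assumes "S : sets lebesgue" "K : sets lebesgue" "K \<subseteq> S" "integrable (lebesgue_on S) u"
  shows "integrable (lebesgue_on K) u"
proof (rule Lebesgue_Measure.integrable_restrict_UNIV[THEN iffD1, OF assms(2)])
  have "integrable lebesgue (%x. indicator K x *\<^sub>R (if x : S then u x else 0))"
    using assms by (intro integrable_mult_indicator Lebesgue_Measure.integrable_restrict_UNIV[THEN iffD2]) auto
  also have "(%x. indicator K x *\<^sub>R (if x : S then u x else 0)) = (%x. if x : K then u x else 0)"
    using assms(3) by (auto simp: fun_eq_iff indicator_def)
  finally show "integrable lebesgue (%x. if x : K then u x else 0)" .
qed

section \<open>Convergence on finite measure spaces\<close>

text \<open>\<open>C\<close> may depend on \<open>eta\<close>: the limit in \<open>n\<close> is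
  taken before \<open>eta\<close> tends to zero.\<close>

lemma tendsto_zero_eta:
  fixes a b :: "nat => real"
  assumes nn: "!!n. 0 <= a n" and b: "b ----> 0"
    and le: "!!eta. 0 < eta ==> EX C. eventually (%n. a n <= eta * K + C * b n) sequentially"
  shows "a ----> 0"
proof (rule LIMSEQ_I)
  fix e :: real assume e: "0 < e"
  define eta where "eta = e / (2 * (abs K + 1))"
  have eta: "0 < eta" using e by (simp add: eta_def)
  have "eta * K <= eta * (abs K + 1)" using eta by (intro mult_left_mono) auto
  moreover have "e / (2 * k) * k = e / 2" if "k > 0" for k :: real using that by (simp add: field_simps)
  from this[of "abs K + 1"] have "eta * (abs K + 1) = e / 2" by (simp only: eta_def)
  ultimately have etaK: "eta * K <= e / 2" by simp
  obtain C where C: "eventually (%n. a n <= eta * K + C * b n) sequentially" using le[OF eta] by blast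
  have "(%n. C * b n) ----> C * 0" by (intro tendsto_intros b)
  hence "eventually (%n. C * b n < e / 2) sequentially" using e by (intro order_tendstoD) auto
  with C have "eventually (%n. norm (a n - 0) < e) sequentially"
  proof eventually_elim
    case (elim n)
    thus ?case using etaK nn[of n] by simp
  qed
  thus "EX no. ALL n>=no. norm (a n - 0) < e" by (simp add: eventually_sequentially)
qed

lemma powr_lower_le:
  fixes t eta :: real
  assumes "0 < eta" "0 <= t" "0 < r" "r <= p"
  shows "t powr r <= eta + eta powr (1 - p / r) * t powr p"
  using le_add_powr[of eta "t powr r" "p / r"] assms by (simp add: powr_powr)

context finite_measure
begin

lemma LpV_bounded:
  fixes u :: "'a => 'b::euclidean_space"
  assumes "u : borel_measurable M" "AE x in M. norm (u x) <= B" "0 <= p"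
  shows "LpV M p u" by (rule LpV_bound[OF assms(1), where w="%_. B powr p"])
    (use assms(2,3) in "auto elim!: eventually_mono intro: powr_mono2")

lemma LpV_lower:
  fixes u :: "'a => 'b::euclidean_space"
  assumes u: "LpV M p u" and r: "0 < r" "r <= p"
  shows "LpV M r u"
proof (rule LpV_bound)
  show "integrable M (%x. 1 + 1 powr (1 - p / r) * norm (u x) powr p)" using LpV_integrable[OF u] by simp
  show "AE x in M. norm (u x) powr r <= 1 + 1 powr (1 - p / r) * norm (u x) powr p"
    using powr_lower_le[of 1 _ r p] r by (intro AE_I2) auto
qed (use u in "auto simp: LpV_def")

lemma Ipow_tendsto_lower:
  fixes us :: "nat => 'a => 'b::euclidean_space"
  assumes u: "!!n. LpV M p (us n)" and r: "0 < r" "r <= p" and lim: "(%n. Ipow M p (us n)) ----> 0"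
  shows "(%n. Ipow M r (us n)) ----> 0"
proof (rule tendsto_zero_eta[OF _ lim])
  fix eta :: real assume eta: "0 < eta"
  have "Ipow M r (us n) <= eta * measure M (space M) + eta powr (1 - p / r) * Ipow M p (us n)" for n
  proof -
    have "Ipow M r (us n) <= (LINT x|M. eta + eta powr (1 - p / r) * norm (us n x) powr p)"
      unfolding Ipow_def using LpV_lower[OF u r] u eta r
      by (intro integral_mono powr_lower_le) (auto simp: LpV_def)
    thus ?thesis using LpV_integrable[OF u] by (simp add: Ipow_def mult.commute)
  qed
  thus "EX C. eventually (%n. Ipow M r (us n) <= eta * measure M (space M) + C * Ipow M p (us n)) sequentially"
    by (intro exI always_eventually) blast
qed simp

end

text \<open>Continuity of integral functionals of p-growth, through subsequences that converge a.e.
  with a majorant.\<close>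

lemma integral_continuous_Lp:
  fixes F :: "'a => 'b::euclidean_space => real"
  assumes p: "0 < p" and u: "LpV M p u" and us: "!!n. LpV M p (us n)"
    and lim: "(%n. Ipow M p (%x. us n x - u x)) ----> 0"
    and meas: "!!n. (%x. F x (us n x)) : borel_measurable M" "(%x. F x (u x)) : borel_measurable M"
    and cont: "AE x in M. continuous_on UNIV (F x)"
    and v: "integrable M v" and bd: "AE x in M. ALL y. abs (F x y) <= C * norm y powr p + v x"
  shows "(%n. (LINT x|M. F x (us n x))) ----> (LINT x|M. F x (u x))"
proof (rule tendsto_subseq_principle)
  fix r :: "nat => nat" assume r: "strict_mono r"
  have lim': "(%n. Ipow M p (%x. us (r n) x - u x)) ----> 0"
    using LIMSEQ_subseq_LIMSEQ[OF lim r] by (simp add: o_def)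
  obtain s W where s: "strict_mono s" "integrable M W"
    "AE x in M. ALL j. norm (us (r (s j)) x - u x) powr p <= W x"
    "AE x in M. (%j. us (r (s j)) x) ----> u x"
    using Ipow_dominated_subseq[OF p LpV_diff[OF us u] lim'] p by auto
  have "(%j. (LINT x|M. F x (us (r (s j)) x))) ----> (LINT x|M. F x (u x))"
  proof (rule integral_dominated_convergence)
    show "integrable M (%x. abs C * (2 powr p * (W x + norm (u x) powr p)) + abs (v x))"
      using s(2) v LpV_integrable[OF u] by auto
    show "AE x in M. (%j. F x (us (r (s j)) x)) ----> F x (u x)" using s(4) cont
    proof eventually_elim
      case (elim x)
      show ?case using continuous_on_tendsto_compose[OF elim(2,1)] by simp
    qed
    show "AE x in M. norm (F x (us (r (s j)) x)) <= abs C * (2 powr p * (W x + norm (u x) powr p)) + abs (v x)" for j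
      using s(3) bd
    proof eventually_elim
      case (elim x)
      let ?y = "us (r (s j)) x"
      have "norm ?y powr p <= (norm (?y - u x) + norm (u x)) powr p"
        using p norm_triangle_ineq[of "?y - u x" "u x"] by (intro powr_mono2) auto
      also have "... <= 2 powr p * (norm (?y - u x) powr p + norm (u x) powr p)"
        using p by (intro powr_add_le) auto
      also have "... <= 2 powr p * (W x + norm (u x) powr p)"
        using elim(1) by (intro mult_left_mono add_right_mono) auto
      finally have "abs C * norm ?y powr p <= abs C * (2 powr p * (W x + norm (u x) powr p))"
        by (intro mult_left_mono) auto
      moreover have "abs (F x ?y) <= C * norm ?y powr p + v x" using elim(2) by blast
      moreover have "C * norm ?y powr p <= abs C * norm ?y powr p" by (intro mult_right_mono) auto
      ultimately show ?case by simp
    qed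
  qed (use meas in auto)
  thus "EX s. strict_mono s & (%n. (LINT x|M. F x (us (r (s n)) x))) ----> (LINT x|M. F x (u x))"
    using s(1) by auto
qed

lemma LpV_component:
  fixes g :: "'a => real^'n"
  assumes "LpV M p g" "0 <= p"
  shows "LpV M p (%x. g x $ i)"
  by (rule LpV_mono[OF _ assms(1) _ assms(2)]) (use assms component_le_norm_cart in "auto simp: LpV_def")

section \<open>Sobolev functions vanishing on the boundary\<close>

locale bounded_domain =
  fixes U :: "(real^'n) set"
  assumes open_domain: "open U" and bounded_domain: "bounded U"
begin

abbreviation M where "M \<equiv> lebesgue_on U"

sublocale finite_measure M
  using open_domain bounded_domain by (intro finite_measure_lebesgue_on lmeasurable_open)

text \<open>The closure of the test functions with the gradient as explicit argument, since
  \<open>wgrad\<close> is only a choice of one representative.\<close>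

definition W0 :: "real => (real^'n => real) => (real^'n => real^'n) => bool" where
  "W0 p u g \<longleftrightarrow> LpV M p u & LpV M p g \<and>
     (EX phis. (ALL n. C1c U (phis n)) & (%n. Ipow M p (%x. phis n x - u x)) ----> 0 \<and>
       (%n. Ipow M p (%x. cgrad (phis n) x - g x)) ----> 0)"

lemma W0_LpV: "W0 p u g ==> LpV M p u" "W0 p u g ==> LpV M p g" by (auto simp: W0_def)

lemma W0_approx:
  assumes "W0 p u g"
  obtains phis where "ALL n. C1c U (phis n)" "(%n. Ipow M p (%x. phis n x - u x)) ----> 0"
       "(%n. Ipow M p (%x. cgrad (phis n) x - g x)) ----> 0" using assms unfolding W0_def by blast

lemma C1c_LpV:
  assumes "C1c U phi" "0 <= p"
  shows "LpV M p phi" "LpV M p (cgrad phi)"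
proof -
  obtain B where "ALL x. abs (phi x) <= B & norm (cgrad phi x) <= B" using C1c_bounded[OF assms(1)] by blast
  thus "LpV M p phi" "LpV M p (cgrad phi)"
    using C1c_measurable[OF assms(1)] assms(2) by (auto intro!: LpV_bounded[where B=B])
qed

lemma C1c_diff_LpV:
  assumes "C1c U phi" "0 <= p"
  shows "LpV M p u ==> LpV M p (%x. phi x - u x)" "LpV M p g ==> LpV M p (%x. cgrad phi x - g x)"
  using LpV_diff[OF C1c_LpV(1)[OF assms] _ assms(2)] LpV_diff[OF C1c_LpV(2)[OF assms] _ assms(2)] by auto

lemma W0_C1c: "C1c U phi ==> 0 <= p ==> W0 p phi (cgrad phi)"
  unfolding W0_def using C1c_LpV by (auto intro!: exI[of _ "%_. phi"] simp: Ipow_def)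

lemma W0_zero: "0 <= p ==> W0 p (%x. 0) (%x. 0)" using W0_C1c[OF C1c_zero(1), unfolded C1c_zero(2)] .

lemma Ipow_tendsto_add:
  fixes us vs :: "nat => real^'n => 'b::euclidean_space"
  assumes "!!n. LpV M p (us n)" "!!n. LpV M p (vs n)" "0 <= p"
    and "(%n. Ipow M p (us n)) ----> 0" "(%n. Ipow M p (vs n)) ----> 0"
  shows "(%n. Ipow M p (%x. us n x + vs n x)) ----> 0"
proof -
  have h: "(%n. 2 powr p * (Ipow M p (us n) + Ipow M p (vs n))) ----> 0"
    using tendsto_mult_right_zero[OF tendsto_add_zero[OF assms(4,5)]] .
  show ?thesis by (rule Lim_null_comparison[OF _ h]) (auto intro!: always_eventually Ipow_add_le assms)
qed

lemma W0_add:
  assumes u: "W0 p u g" and v: "W0 p v h" and p: "0 <= p"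
  shows "W0 p (%x. u x + v x) (%x. g x + h x)"
proof -
  obtain phi where phi: "ALL n. C1c U (phi n)" "(%n. Ipow M p (%x. phi n x - u x)) ----> 0"
       "(%n. Ipow M p (%x. cgrad (phi n) x - g x)) ----> 0" using u unfolding W0_def by blast
  obtain psi where psi: "ALL n. C1c U (psi n)" "(%n. Ipow M p (%x. psi n x - v x)) ----> 0"
       "(%n. Ipow M p (%x. cgrad (psi n) x - h x)) ----> 0" using v unfolding W0_def by blast
  note L = W0_LpV[OF u] W0_LpV[OF v]
  show ?thesis unfolding W0_def
  proof (intro conjI exI allI)
    show "C1c U (%x. phi n x + psi n x)" for n using phi(1) psi(1) by (intro C1c_add) auto
    have "(%n. Ipow M p (%x. (phi n x - u x) + (psi n x - v x))) ----> 0"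
      using phi psi L p by (intro Ipow_tendsto_add C1c_diff_LpV) auto
    thus "(%n. Ipow M p (%x. phi n x + psi n x - (u x + v x))) ----> 0" by (simp add: algebra_simps)
    have "(%n. Ipow M p (%x. (cgrad (phi n) x - g x) + (cgrad (psi n) x - h x))) ----> 0"
      using phi psi L p by (intro Ipow_tendsto_add C1c_diff_LpV) auto
    moreover have "cgrad (%x. phi n x + psi n x) = (%x. cgrad (phi n) x + cgrad (psi n) x)" for n
      using phi(1) psi(1) by (intro C1c_add(2)[of U]) auto
    ultimately show "(%n. Ipow M p (%x. cgrad (%x. phi n x + psi n x) x - (g x + h x))) ----> 0"
      by (simp add: algebra_simps)
  qed (use L p in "auto intro: LpV_add")
qed

lemma Ipow_scale: "Ipow N p (%x. c *\<^sub>R u x) = abs c powr p * Ipow N p u"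
  by (simp add: Ipow_def powr_mult)

lemma W0_scale:
  assumes u: "W0 p u g"
  shows "W0 p (%x. c * u x) (%x. c *\<^sub>R g x)"
proof -
  obtain phi where phi: "ALL n. C1c U (phi n)" "(%n. Ipow M p (%x. phi n x - u x)) ----> 0"
       "(%n. Ipow M p (%x. cgrad (phi n) x - g x)) ----> 0" using u unfolding W0_def by blast
  show ?thesis unfolding W0_def
  proof (intro conjI exI allI)
    show "C1c U (%x. c * phi n x)" for n using phi(1) by (intro C1c_cmult) auto
    have "(%n. Ipow M p (%x. c *\<^sub>R (phi n x - u x))) ----> 0"
      unfolding Ipow_scale by (rule tendsto_mult_right_zero[OF phi(2)])
    thus "(%n. Ipow M p (%x. c * phi n x - c * u x)) ----> 0" by (simp add: algebra_simps)
    have "(%n. Ipow M p (%x. c *\<^sub>R (cgrad (phi n) x - g x))) ----> 0"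
      unfolding Ipow_scale by (rule tendsto_mult_right_zero[OF phi(3)])
    moreover have "cgrad (%x. c * phi n x) = (%x. c *\<^sub>R cgrad (phi n) x)" for n
      using phi(1) by (intro C1c_cmult(2)[of U]) auto
    ultimately show "(%n. Ipow M p (%x. cgrad (%x. c * phi n x) x - c *\<^sub>R g x)) ----> 0"
      by (simp add: algebra_simps)
  qed (use W0_LpV[OF u] LpV_scale[of M p u c] in "auto intro: LpV_scale")
qed

lemma W0_diff:
  assumes u: "W0 p u g" and v: "W0 p v h" and p: "0 <= p"
  shows "W0 p (%x. u x - v x) (%x. g x - h x)" using W0_add[OF u W0_scale[OF v, of "-1"] p] by simp

lemma W0_closed:
  assumes W: "!!n. W0 p (us n) (gs n)" and p: "0 <= p" and u: "LpV M p u" "LpV M p g"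
    and lim: "(%n. Ipow M p (%x. us n x - u x)) ----> 0" "(%n. Ipow M p (%x. gs n x - g x)) ----> 0"
  shows "W0 p u g"
proof -
  have "EX phi. C1c U phi & Ipow M p (%x. phi x - us n x) < 1 / real (Suc n) \<and>
      Ipow M p (%x. cgrad phi x - gs n x) < 1 / real (Suc n)" for n
  proof -
    obtain phis where phis: "ALL m. C1c U (phis m)" "(%m. Ipow M p (%x. phis m x - us n x)) ----> 0"
        "(%m. Ipow M p (%x. cgrad (phis m) x - gs n x)) ----> 0" using W[of n] unfolding W0_def by blast
    have "eventually (%m. Ipow M p (%x. phis m x - us n x) < 1 / real (Suc n)) sequentially"
      "eventually (%m. Ipow M p (%x. cgrad (phis m) x - gs n x) < 1 / real (Suc n)) sequentially"
      using phis by (auto intro: order_tendstoD)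
    hence "eventually (%m. Ipow M p (%x. phis m x - us n x) < 1 / real (Suc n) \<and>
      Ipow M p (%x. cgrad (phis m) x - gs n x) < 1 / real (Suc n)) sequentially" by eventually_elim simp
    from eventually_happens'[OF sequentially_bot this] phis(1) show ?thesis by blast
  qed
  hence "ALL n. EX phi. C1c U phi & Ipow M p (%x. phi x - us n x) < 1 / real (Suc n) \<and>
      Ipow M p (%x. cgrad phi x - gs n x) < 1 / real (Suc n)" ..
  from choice[OF this] obtain phi where phi0: "ALL n. C1c U (phi n) & Ipow M p (%x. phi n x - us n x) < 1 / real (Suc n) \<and>
      Ipow M p (%x. cgrad (phi n) x - gs n x) < 1 / real (Suc n)" by (rule exE)
  hence phi: "!!n. C1c U (phi n)" "!!n. Ipow M p (%x. phi n x - us n x) < 1 / real (Suc n)"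
      "!!n. Ipow M p (%x. cgrad (phi n) x - gs n x) < 1 / real (Suc n)" by simp_all
  have 0: "(%n. 1 / real (Suc n)) ----> 0" using LIMSEQ_inverse_real_of_nat by (simp add: inverse_eq_divide)
  have l: "(%n. Ipow M p (%x. phi n x - us n x)) ----> 0" "(%n. Ipow M p (%x. cgrad (phi n) x - gs n x)) ----> 0"
    using phi(2,3) by (auto intro!: Lim_null_comparison[OF _ 0] always_eventually intro: less_imp_le)
  show ?thesis unfolding W0_def
  proof (intro conjI exI allI u)
    show "C1c U (phi n)" for n by (rule phi(1))
    have "(%n. Ipow M p (%x. (phi n x - us n x) + (us n x - u x))) ----> 0"
      by (intro Ipow_tendsto_add l lim p C1c_diff_LpV phi(1) W0_LpV(1)[OF W] LpV_diff[OF W0_LpV(1)[OF W] u(1)])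
    thus "(%n. Ipow M p (%x. phi n x - u x)) ----> 0" by simp
    have "(%n. Ipow M p (%x. (cgrad (phi n) x - gs n x) + (gs n x - g x))) ----> 0"
      by (intro Ipow_tendsto_add l lim p C1c_diff_LpV phi(1) W0_LpV(2)[OF W] LpV_diff[OF W0_LpV(2)[OF W] u(2)])
    thus "(%n. Ipow M p (%x. cgrad (phi n) x - g x)) ----> 0" by simp
  qed
qed

lemma W0_cong_AE:
  assumes W: "W0 p u g" and p: "0 <= p" and v: "v : borel_measurable M" "AE x in M. u x = v x"
    and h: "h : borel_measurable M" "AE x in M. g x = h x"
  shows "W0 p v h"
proof (rule W0_closed[of p "%_. u" "%_. g"])
  show vL: "LpV M p v" by (rule LpV_mono[OF v(1) W0_LpV(1)[OF W] _ p]) (use v(2) in "auto elim: eventually_mono")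
  show hL: "LpV M p h" by (rule LpV_mono[OF h(1) W0_LpV(2)[OF W] _ p]) (use h(2) in "auto elim: eventually_mono")
  have m: "u : borel_measurable M" "g : borel_measurable M" using W0_LpV[OF W] by (auto simp: LpV_def)
  have "Ipow M p (%x. u x - v x) = Ipow M p (%x. 0 :: real)"
    by (rule Ipow_cong_AE) (use v m in "auto elim: eventually_mono")
  thus "(%n. Ipow M p (%x. u x - v x)) ----> 0" by (simp add: Ipow_def)
  have "Ipow M p (%x. g x - h x) = Ipow M p (%x. 0 :: real^'n)"
    by (rule Ipow_cong_AE) (use h m in "auto elim: eventually_mono")
  thus "(%n. Ipow M p (%x. g x - h x)) ----> 0" by (simp add: Ipow_def)
qed (use W p in auto)

lemma W0_lower:
  assumes W: "W0 p u g" and r: "0 < r" "r <= p"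
  shows "W0 r u g"
proof -
  obtain phi where phi: "ALL n. C1c U (phi n)" "(%n. Ipow M p (%x. phi n x - u x)) ----> 0"
       "(%n. Ipow M p (%x. cgrad (phi n) x - g x)) ----> 0" using W unfolding W0_def by blast
  have "LpV M p (%x. phi n x - u x)" "LpV M p (%x. cgrad (phi n) x - g x)" for n
    using phi(1) r W0_LpV[OF W] by (auto intro!: C1c_diff_LpV)
  hence "(%n. Ipow M r (%x. phi n x - u x)) ----> 0" "(%n. Ipow M r (%x. cgrad (phi n) x - g x)) ----> 0"
    using Ipow_tendsto_lower[where us="%n x. phi n x - u x", OF _ r phi(2)]
      Ipow_tendsto_lower[where us="%n x. cgrad (phi n) x - g x", OF _ r phi(3)] by simp_all
  thus ?thesis unfolding W0_def
    using phi(1) LpV_lower[OF W0_LpV(1)[OF W] r] LpV_lower[OF W0_LpV(2)[OF W] r] by blast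
qed

lemma integral_tendsto_L1:
  fixes us :: "nat => real^'n => real"
  assumes us: "!!n. LpV M p (us n)" and u: "LpV M p u" and p: "1 <= p"
    and lim: "(%n. Ipow M p (%x. us n x - u x)) ----> 0"
    and b: "b : borel_measurable M" "!!x. abs (b x) <= B"
  shows "(%n. (LINT x|M. us n x * b x)) ----> (LINT x|M. u x * b x)"
proof (rule integral_continuous_Lp[where F="%x y. y * b x" and p=1 and C=B and v="%_. 0"])
  show "(%n. Ipow M 1 (%x. us n x - u x)) ----> 0"
    by (rule Ipow_tendsto_lower[where us="%n x. us n x - u x", OF LpV_diff[OF us u] _ p lim]) (use p in auto)
  show "AE x in M. ALL y. abs (y * b x) <= B * norm y powr 1 + 0"
  proof (intro AE_I2 allI)
    fix x y
    have "abs y * abs (b x) <= abs y * B" by (intro mult_left_mono b) auto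
    thus "abs (y * b x) <= B * norm y powr 1 + 0" by (simp add: abs_mult mult.commute)
  qed
  show "LpV M 1 u" "LpV M 1 (us n)" for n using us u p by (auto intro: LpV_lower[of p])
  have "us n : borel_measurable M" "u : borel_measurable M" for n using us u by (auto simp: LpV_def)
  thus "(%x. us n x * b x) : borel_measurable M" "(%x. u x * b x) : borel_measurable M" for n
    using b(1) by (auto intro: borel_measurable_times)
qed (auto intro!: continuous_intros)

lemma LpV_componentsI:
  fixes g :: "real^'n => real^'n"
  assumes "!!i. LpV M p (%x. g x $ i)" "0 <= p"
  shows "LpV M p g"
proof -
  have sum: "LpV M p (%x. \<Sum>i\<in>I. abs (g x $ i))" if "finite I" for I using that
  proof (induction I rule: finite_induct)
    case (insert i I)
    have "LpV M p (%x. norm (g x $ i))" using assms(1)[of i] unfolding LpV_def by (intro conjI borel_measurable_norm) auto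
    from LpV_add[OF this insert.IH assms(2)] show ?case using insert by (simp add: real_norm_def)
  qed simp
  have m: "g : borel_measurable M" using assms(1) by (intro borel_measurable_vecI) (auto simp: LpV_def)
  show ?thesis by (rule LpV_mono[OF m sum[of UNIV]]) (use assms norm_le_l1_cart in auto)
qed

lemma LpV_Lloc1:
  assumes "LpV M p u" "1 <= p"
  shows "Lloc1 U u" unfolding Lloc1_def
proof (intro allI impI)
  fix K assume K: "compact K & K \<subseteq> U"
  have "integrable M u" using LpV_lower[OF assms(1), of 1] assms(2) unfolding LpV_def by (auto intro: integrable_abs_cancel)
  thus "integrable (lebesgue_on K) u"
    using K open_domain by (intro integrable_lebesgue_on_mono[of U K]) (auto intro: lmeasurable_compact fmeasurableD)
qed

text \<open>The test function need not vanish on the boundary, because the functions approximating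
  \<open>u\<close> do. This is what makes the extension of \<open>u\<close> by zero a Sobolev
  function on the whole space.\<close>

lemma integral_components_by_parts:
  assumes W: "W0 p u g" and p: "1 <= p" and phi: "C1c UNIV phi"
  shows "intO U (%x. u x * pd phi i x) = - intO U (%x. g x $ i * phi x)"
proof -
  obtain psi where psi: "ALL n. C1c U (psi n)" "(%n. Ipow M p (%x. psi n x - u x)) ----> 0"
       "(%n. Ipow M p (%x. cgrad (psi n) x - g x)) ----> 0" using W unfolding W0_def by blast
  obtain B where B: "ALL x. abs (phi x) <= B & norm (cgrad phi x) <= B" using C1c_bounded[OF phi] by blast
  note m = C1c_measurable(3,4)[OF phi, of U]
  have "abs (pd phi i x) <= B" for x
    using B component_le_norm_cart[of "cgrad phi x" i] unfolding pd_eq_cgrad by (meson order_trans)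
  hence 1: "(%n. (LINT x|M. psi n x * pd phi i x)) ----> (LINT x|M. u x * pd phi i x)"
    by (intro integral_tendsto_L1[of p] psi(2) W0_LpV(1)[OF W] p C1c_LpV(1)[OF spec[OF psi(1)]])
      (use p m in "auto simp: pd_eq_cgrad")
  have l: "(%n. Ipow M p (%x. cgrad (psi n) x $ i - g x $ i)) ----> 0"
  proof (rule Lim_null_comparison[OF _ psi(3)], rule always_eventually, rule allI)
    fix n
    have L: "LpV M p (%x. cgrad (psi n) x - g x)" using psi(1) W0_LpV[OF W] p by (intro C1c_diff_LpV) auto
    have "Ipow M p (%x. cgrad (psi n) x $ i - g x $ i) <= Ipow M p (%x. cgrad (psi n) x - g x)"
      unfolding Ipow_def
    proof (rule integral_mono)
      show "norm (cgrad (psi n) x $ i - g x $ i) powr p <= norm (cgrad (psi n) x - g x) powr p" for x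
        using component_le_norm_cart[of "cgrad (psi n) x - g x" i] p by (intro powr_mono2) auto
    qed (use L LpV_component[OF L, of i] p in "auto simp: LpV_def")
    thus "norm (Ipow M p (%x. cgrad (psi n) x $ i - g x $ i)) <= Ipow M p (%x. cgrad (psi n) x - g x)" by simp
  qed
  have 2: "(%n. (LINT x|M. cgrad (psi n) x $ i * phi x)) ----> (LINT x|M. g x $ i * phi x)"
    by (intro integral_tendsto_L1[of p] l LpV_component W0_LpV(2)[OF W] p C1c_LpV(2)[OF spec[OF psi(1)]])
      (use p m B in auto)
  have "(LINT x|M. psi n x * pd phi i x) = - (LINT x|M. cgrad (psi n) x $ i * phi x)" for n
    using integration_by_parts[OF open_domain C1c_C1g[OF phi] spec[OF psi(1)], of n i]
    by (simp add: intO_def pd_eq_cgrad mult.commute)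
  hence "(%n. (LINT x|M. psi n x * pd phi i x)) ----> - (LINT x|M. g x $ i * phi x)"
    using tendsto_minus[OF 2] by simp
  thus ?thesis unfolding intO_def by (rule LIMSEQ_unique[OF 1])
qed

section \<open>Weak gradients: uniqueness, measurability, agreement with the chosen gradient\<close>

lemma W0_weak_grad:
  assumes W: "W0 p u g" and p: "1 <= p"
  shows "weak_grad U u g"
  unfolding weak_grad_def using W0_LpV[OF W] p integral_components_by_parts[OF W p C1c_mono[of U _ UNIV]]
  by (auto intro!: LpV_Lloc1[of p] LpV_component)

lemma integrable_Lloc1_C1c:
  assumes h: "Lloc1 U h" and psi: "C1c U psi"
  shows "integrable M (%x. h x * psi x)"
proof -
  obtain K where K: "compact K" "K \<subseteq> U" "ALL x. x ~: K --> psi x = 0 & cgrad psi x = 0"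
    using C1c_support[OF psi] by blast
  obtain B where B: "ALL x. abs (psi x) <= B & norm (cgrad psi x) <= B" using C1c_bounded[OF psi] by blast
  have hK: "integrable (lebesgue_on K) h" using h K by (auto simp: Lloc1_def)
  have "integrable (lebesgue_on K) (%x. h x * psi x)"
  proof (rule Lintegrable_bound)
    show "integrable (lebesgue_on K) (%x. h x * B)" using hK by simp
    show "AE x in lebesgue_on K. norm (h x * psi x) <= norm (h x * B)"
    proof (rule AE_I2)
      fix x
      have "abs (psi x) <= abs B" using B by (meson abs_ge_self order_trans)
      thus "norm (h x * psi x) <= norm (h x * B)" by (simp add: abs_mult mult_left_mono)
    qed
  qed (use hK C1c_measurable[OF psi] in auto)
  hence "integrable lebesgue (%x. if x : K then h x * psi x else 0)"
    using K(1) by (intro Lebesgue_Measure.integrable_restrict_UNIV[THEN iffD2]) (auto intro: lmeasurable_compact fmeasurableD)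
  also have "(%x. if x : K then h x * psi x else 0) = (%x. if x : U then h x * psi x else 0)"
    using K by (auto simp: fun_eq_iff)
  finally show ?thesis
    by (rule Lebesgue_Measure.integrable_restrict_UNIV[THEN iffD1, rotated]) (use open_domain in auto)
qed

lemma weak_gradD:
  "weak_grad U u g ==> C1c U phi ==> intO U (%x. u x * pd phi i x) = - intO U (%x. g x $ i * phi x)"
  by (simp add: weak_grad_def)

text \<open>A Lebesgue measurable function on the domain gets a Borel representative on the whole
  space, as the arguments by translation and mollification require.\<close>

lemma borel_zero_extension:
  fixes f :: "real^'n => real"
  assumes f: "f : borel_measurable M"
  shows "EX v. v : borel_measurable borel & (ALL x. x ~: U --> v x = 0) & (AE x in M. v x = f x)"
proof -
  have O: "U : sets lebesgue" using open_domain by (auto intro: borel_open)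
  have "(%x. if x : U then f x else 0) : borel_measurable lebesgue"
    using f O by (subst borel_measurable_if) auto
  then obtain b where b: "b : borel_measurable lborel" "AE x in lborel. (if x : U then f x else 0) = b x"
    using completion_ex_borel_measurable_real by blast
  have "AE x in M. b x = f x"
    using AE_completion[OF b(2)] O by (subst AE_restrict_space_iff) (auto elim!: eventually_mono)
  moreover have "AE x in M. x : U" by (rule AE_I2) simp
  ultimately have "AE x in M. b x * indicator U x = f x" by eventually_elim simp
  moreover have "(%x. b x * indicator U x) : borel_measurable borel"
    using b(1) open_domain by (intro borel_measurable_times borel_measurable_indicator) auto
  ultimately show ?thesis by (intro exI[of _ "%x. b x * indicator U x"]) auto
qed

lemma LpV_zero_extension:
  fixes f f' :: "real^'n => 'b::euclidean_space"
  assumes fm: "f : borel_measurable borel" and f0: "!!x. x ~: U ==> f x = 0" and eq: "AE x in M. f x = f' x"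
    and f': "LpV M p f'" and p: "0 < p"
  shows "LpV lborel p f"
proof -
  have O: "U : sets lebesgue" using open_domain by (auto intro: borel_open)
  have "f : borel_measurable M" using fm by (intro measurable_restrict_space1 measurable_completion) simp
  hence "LpV M p f" by (rule LpV_mono[OF _ f']) (use eq p in "auto elim: eventually_mono")
  hence "integrable lebesgue (%x. indicator U x *\<^sub>R (norm (f x) powr p))"
    using O unfolding LpV_def by (subst (asm) integrable_restrict_space) auto
  also have "(%x. indicator U x *\<^sub>R (norm (f x) powr p)) = (%x. norm (f x) powr p)"
    using f0 p by (auto simp: fun_eq_iff indicator_def)
  finally have "integrable lborel (%x. norm (f x) powr p)" using fm by (subst (asm) integrable_completion) auto
  thus ?thesis using fm by (simp add: LpV_def)
qed

text \<open>The difference is only locally integrable. Multiplied by a test function it becomes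
  integrable and extends by zero, so the fundamental lemma on the whole space applies; countably
  many test functions cover the domain.\<close>

lemma weak_grad_unique:
  assumes g: "weak_grad U u g" and h: "weak_grad U u h"
  shows "AE x in M. g x = h x"
proof -
  have "AE x in M. g x $ i = h x $ i" for i
  proof -
    obtain F where F: "countable F" "ALL phi:F. C1c U phi" "U = (\<Union>phi\<in>F. {x. phi x ~= 0})"
      using open_cover_C1c[OF open_domain] by blast
    have L: "Lloc1 U (%x. g x $ i)" "Lloc1 U (%x. h x $ i)" using g h by (auto simp: weak_grad_def)
    have "AE x in M. (g x $ i - h x $ i) * psi x = 0" if psi: "psi : F" for psi
    proof -
      let ?d = "%x. (g x $ i - h x $ i) * psi x"
      have c: "C1c U psi" using F psi by blast
      note i = integrable_Lloc1_C1c[OF L(1)] integrable_Lloc1_C1c[OF L(2)]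
      have id: "integrable M ?d"
        using Bochner_Integration.integrable_diff[OF i(1)[OF c] i(2)[OF c]] by (simp add: left_diff_distrib)
      then obtain v where v: "v : borel_measurable borel" "ALL x. x ~: U --> v x = 0" "AE x in M. v x = ?d x"
        using borel_zero_extension[of ?d] by blast
      have vM: "v : borel_measurable M" using v(1) by (intro measurable_restrict_space1 measurable_completion) simp
      obtain R where R: "ALL x:U. norm x <= R" using bounded_domain by (auto simp: bounded_iff)
      have "AE x in lborel. v x = 0"
      proof (rule AE_zero_if_C1c_orthogonal)
        show "LpV lborel 1 v" by (rule LpV_zero_extension[OF v(1) _ v(3)]) (use v(2) id in "auto simp: LpV_def")
        show "v x = 0" if "R < norm x" for x using v(2) R that by (meson not_le)
        fix phi :: "real^'n => real" assume phi: "C1c UNIV phi"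
        have c': "C1c U (%x. phi x * psi x)" by (rule C1c_mult_C1g(1)[OF c C1c_C1g[OF phi]])
        have "(LINT x|lborel. v x * phi x) = (LINT x|M. v x * phi x)"
          using v(1,2) C1c_measurable[OF phi] open_domain by (intro lebesgue_integral_eq_lborel[symmetric]) auto
        also have "... = (LINT x|M. g x $ i * (phi x * psi x) - h x $ i * (phi x * psi x))"
        proof (rule integral_cong_AE)
          show "AE x in M. v x * phi x = g x $ i * (phi x * psi x) - h x $ i * (phi x * psi x)"
            using v(3) by eventually_elim (simp add: left_diff_distrib right_diff_distrib mult.left_commute mult.commute)
        qed (use vM C1c_measurable[OF phi] i[OF c'] in auto)
        also have "... = 0"
          using trans[OF weak_gradD[OF g c', of i, symmetric] weak_gradD[OF h c', of i]] i[OF c'] by (simp add: intO_def)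
        finally show "(LINT x|lborel. v x * phi x) = 0" .
      qed
      hence "AE x in lebesgue. v x = 0" by (rule AE_completion)
      hence "AE x in M. v x = 0" using open_domain by (subst AE_restrict_space_iff) (auto elim: eventually_mono intro: borel_open)
      with v(3) show ?thesis by eventually_elim simp
    qed
    hence "AE x in M. ALL psi:F. (g x $ i - h x $ i) * psi x = 0" by (intro AE_ball_countable[THEN iffD2, OF F(1)] ballI)
    moreover have "AE x in M. x : U" by (rule AE_I2) simp
    ultimately show ?thesis
    proof eventually_elim
      case (elim x)
      obtain psi where "psi : F" "psi x ~= 0" using elim(2) F(3) by blast
      thus ?case using elim(1) by auto
    qed
  qed
  hence "AE x in M. ALL i:UNIV. g x $ i = h x $ i" by (subst AE_finite_all) auto
  thus ?thesis by eventually_elim (simp add: vec_eq_iff)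
qed

lemma wgrad_AE_eq:
  assumes "W0 p u g" "1 <= p"
  shows "AE x in M. wgrad U u x = g x"
proof -
  note w = W0_weak_grad[OF assms]
  have "weak_grad U u (wgrad U u)" unfolding wgrad_def by (rule someI[where P="weak_grad U u", OF w])
  from weak_grad_unique[OF this w] show ?thesis .
qed

text \<open>A gradient picked by \<open>wgrad\<close> is known only to be integrable on compact
  sets. On the set where a test function \<open>phi\<close> is nonzero, it equals
  \<open>(g * phi) / phi\<close> componentwise.\<close>

lemma weak_grad_measurable:
  assumes "weak_grad U u g"
  shows "g : borel_measurable M"
proof (rule borel_measurable_vecI)
  fix i
  obtain F where F: "countable F" "ALL phi:F. C1c U phi" "U = (\<Union>phi\<in>F. {x. phi x ~= 0})"
    using open_cover_C1c[OF open_domain] by blast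
  have L: "Lloc1 U (%x. g x $ i)" using assms by (auto simp: weak_grad_def)
  show "(%x. g x $ i) : borel_measurable M"
  proof (rule measurable_piecewise_restrict[where C="(%phi. {x : U. phi x ~= 0}) ` F"])
    show "countable ((%phi. {x : U. phi x ~= 0}) ` F)" using F by simp
    show "space M \<subseteq> \<Union>((%phi. {x : U. phi x ~= 0}) ` F)" using F(3) by auto
    fix S assume "S : (%phi. {x : U. phi x ~= 0}) ` F"
    then obtain phi where phi: "phi : F" "S = {x : U. phi x ~= 0}" by auto
    hence c: "C1c U phi" using F by auto
    note m [measurable] = C1c_measurable(3)[OF c, of U]
    have "{x : space M. phi x ~= 0} : sets M" by measurable
    thus S: "S \<inter> space M : sets M" using phi(2) by (simp add: Int_absorb2 subset_iff)
    have "(%x. (g x $ i * phi x) / phi x) : borel_measurable M"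
      using integrable_Lloc1_C1c[OF L c] by (intro borel_measurable_divide) auto
    hence "(%x. (g x $ i * phi x) / phi x) : borel_measurable (restrict_space M S)"
      by (rule measurable_restrict_space1)
    thus "(%x. g x $ i) : borel_measurable (restrict_space M S)"
      by (rule measurable_cong[THEN iffD1, rotated]) (use phi(2) in "auto simp: space_restrict_space")
  qed
qed

lemma W0_wgrad:
  assumes "W0 p u g" "1 <= p"
  shows "W0 p u (wgrad U u)"
proof -
  have w: "weak_grad U u (wgrad U u)" unfolding wgrad_def by (rule someI[where P="weak_grad U u", OF W0_weak_grad[OF assms]])
  show ?thesis using wgrad_AE_eq[OF assms] W0_LpV[OF assms(1)] assms(2) weak_grad_measurable[OF w]
    by (intro W0_cong_AE[OF assms(1)]) (auto simp: LpV_def elim: eventually_mono)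
qed

lemma Lp_eq_LpV: "Lp U p u \<longleftrightarrow> LpV M p u" by (simp add: Lp_def LpV_def)

lemma W1p0_eq_W0:
  assumes "1 <= p"
  shows "W1p0 U p u \<longleftrightarrow> W0 p u (wgrad U u)"
proof
  assume "W1p0 U p u"
  then obtain g phis where "LpV M p u" "ALL i. LpV M p (%x. g x $ i)" "ALL n. C1c U (phis n)"
      "(%n. Ipow M p (%x. phis n x - u x)) ----> 0" "(%n. Ipow M p (%x. cgrad (phis n) x - g x)) ----> 0"
    unfolding W1p0_def Lp_eq_LpV intO_def Ipow_def real_norm_def by blast
  hence "W0 p u g" unfolding W0_def using LpV_componentsI[of p g] assms by auto
  thus "W0 p u (wgrad U u)" using W0_wgrad assms by blast
next
  assume W: "W0 p u (wgrad U u)"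
  show "W1p0 U p u" unfolding W1p0_def Lp_eq_LpV intO_def
    using W W0_weak_grad[OF W assms] LpV_component[OF W0_LpV(2)[OF W]] assms
    by (intro conjI exI[of _ "wgrad U u"]) (auto simp: W0_def Ipow_def)
qed

end

context bounded_domain
begin

subsection \<open>Hilbert space structures\<close>

text \<open>On pairs of function and gradient, so that the linear structure does not depend on the
  choice made by \<open>wgrad\<close>.\<close>

definition ip1 :: "(real^'n => real) \<times> (real^'n => real^'n) => (real^'n => real) \<times> (real^'n => real^'n) => real" where
  "ip1 w v = (LINT x|M. fst w x * fst v x + snd w x \<bullet> snd v x)"

definition ip0 :: "(real^'n => real) => (real^'n => real) => real" where
  "ip0 u v = (LINT x|M. u x * v x)"

lemma LpV2_mult_integrable:
  fixes u v :: "real^'n => real"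
  assumes "LpV M 2 u" "LpV M 2 v"
  shows "integrable M (%x. u x * v x)" using Cauchy_Schwarz_integral(1)[OF assms] by simp

lemma ip0_self: "ip0 u u = Ipow M 2 u"
  by (simp add: ip0_def Ipow_def powr_two power2_eq_square abs_mult_self_eq)

lemma ip1_split:
  assumes "W0 2 (fst w) (snd w)" "W0 2 (fst v) (snd v)"
  shows "ip1 w v = (LINT x|M. fst w x * fst v x) + (LINT x|M. snd w x \<bullet> snd v x)"
  unfolding ip1_def using W0_LpV[OF assms(1)] W0_LpV[OF assms(2)]
  by (intro Bochner_Integration.integral_add LpV2_mult_integrable Cauchy_Schwarz_integral(1))

lemma ip1_self:
  assumes "W0 2 (fst w) (snd w)"
  shows "ip1 w w = Ipow M 2 (fst w) + Ipow M 2 (snd w)"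
  by (simp add: ip1_split[OF assms assms] Ipow_def powr_two power2_eq_square abs_mult_self_eq
      dot_square_norm del: power2_eq_square) (simp add: power2_eq_square)

sublocale L2: semi_hilbert "{u. LpV M 2 u}" ip0
proof
  show "subspace {u. LpV M 2 u}"
    unfolding subspace_def by (auto simp: plus_fun_def zero_fun_def scaleR_fun_def LpV_add LpV_scale simp del: real_scaleR_def)
  show "ip0 (x + y) z = ip0 x z + ip0 y z" if "x : {u. LpV M 2 u}" "y : {u. LpV M 2 u}" "z : {u. LpV M 2 u}" for x y z
    using that LpV2_mult_integrable by (simp add: ip0_def distrib_right)
  show "ip0 (c *\<^sub>R x) y = c * ip0 x y" for c x y by (simp add: ip0_def mult.assoc)
  show "ip0 x y = ip0 y x" for x y by (simp add: ip0_def mult.commute)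
  show "0 <= ip0 x x" for x by (simp add: ip0_self)
  fix X :: "nat => _" assume X: "!!n. X n : {u. LpV M 2 u}"
    and cau: "!!e. 0 < e ==> EX N. ALL m>=N. ALL n>=N. ip0 (X m - X n) (X m - X n) < e"
  obtain u where "LpV M 2 u" "(%n. Ipow M 2 (%x. X n x - u x)) ----> 0"
  proof (rule Ipow_complete[of 2 M X])
    show "EX N. ALL m>=N. ALL n>=N. Ipow M 2 (%x. X m x - X n x) < e" if "0 < e" for e
      using cau[OF that] by (simp add: ip0_self fun_diff_def)
  qed (use X in auto)
  thus "EX x:{u. LpV M 2 u}. (%n. ip0 (X n - x) (X n - x)) ----> 0"
    by (intro bexI[of _ u]) (auto simp: ip0_self fun_diff_def)
qed

sublocale H1: semi_hilbert "{w. W0 2 (fst w) (snd w)}" ip1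
proof
  let ?V = "{w. W0 2 (fst w) (snd w)}"
  show sub: "subspace ?V" unfolding subspace_def
    using W0_zero[of 2] W0_add[of 2] W0_scale[of 2] by (auto simp: plus_fun_def zero_fun_def scaleR_fun_def)
  show "ip1 (x + y) z = ip1 x z + ip1 y z" if "x : ?V" "y : ?V" "z : ?V" for x y z
  proof -
    have xy: "x + y : ?V" using sub that by (simp add: subspace_add del: mem_Collect_eq)
    note i = LpV2_mult_integrable[OF W0_LpV(1) W0_LpV(1)] Cauchy_Schwarz_integral(1)[OF W0_LpV(2) W0_LpV(2)]
    show ?thesis using that xy by (simp add: ip1_split distrib_right inner_add_left i)
  qed
  show "ip1 (c *\<^sub>R x) y = c * ip1 x y" for c x y
  proof -
    have "ip1 (c *\<^sub>R x) y = (LINT r|M. c * (fst x r * fst y r + snd x r \<bullet> snd y r))"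
      by (simp add: ip1_def algebra_simps)
    thus ?thesis by (simp add: ip1_def)
  qed
  show "ip1 x y = ip1 y x" for x y by (simp add: ip1_def mult.commute inner_commute)
  show "0 <= ip1 x x" for x by (auto simp: ip1_def intro!: Bochner_Integration.integral_nonneg)
  fix X :: "nat => _" assume X: "!!n. X n : ?V"
    and cau: "!!e. 0 < e ==> EX N. ALL m>=N. ALL n>=N. ip1 (X m - X n) (X m - X n) < e"
  have d: "ip1 (X m - X n) (X m - X n) = Ipow M 2 (%x. fst (X m) x - fst (X n) x) + Ipow M 2 (%x. snd (X m) x - snd (X n) x)" for m n
    using ip1_self[of "X m - X n"] subspace_diff[OF sub X X] by (simp add: fun_diff_def)
  have LX: "LpV M 2 (fst (X n))" "LpV M 2 (snd (X n))" for n using X[of n] W0_LpV by auto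
  have c: "EX N. ALL m>=N. ALL n>=N. Ipow M 2 (%x. fst (X m) x - fst (X n) x) < e"
    "EX N. ALL m>=N. ALL n>=N. Ipow M 2 (%x. snd (X m) x - snd (X n) x) < e" if e: "0 < e" for e
  proof -
    obtain N where N: "ALL m>=N. ALL n>=N. ip1 (X m - X n) (X m - X n) < e" using cau[OF e] by blast
    have "Ipow M 2 (%x. fst (X m) x - fst (X n) x) < e" "Ipow M 2 (%x. snd (X m) x - snd (X n) x) < e"
      if "N <= m" "N <= n" for m n
    proof -
      have "ip1 (X m - X n) (X m - X n) < e" using N that by blast
      thus "Ipow M 2 (%x. fst (X m) x - fst (X n) x) < e" "Ipow M 2 (%x. snd (X m) x - snd (X n) x) < e"
        using Ipow_nonneg[of M 2 "%x. fst (X m) x - fst (X n) x"] Ipow_nonneg[of M 2 "%x. snd (X m) x - snd (X n) x"]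
        unfolding d by linarith+
    qed
    thus "EX N. ALL m>=N. ALL n>=N. Ipow M 2 (%x. fst (X m) x - fst (X n) x) < e"
      "EX N. ALL m>=N. ALL n>=N. Ipow M 2 (%x. snd (X m) x - snd (X n) x) < e" by blast+
  qed
  obtain u where u: "LpV M 2 u" "(%n. Ipow M 2 (%x. fst (X n) x - u x)) ----> 0"
    by (rule Ipow_complete[of 2 M "%n. fst (X n)"]) (use LX c in auto)
  obtain g where g: "LpV M 2 g" "(%n. Ipow M 2 (%x. snd (X n) x - g x)) ----> 0"
    by (rule Ipow_complete[of 2 M "%n. snd (X n)"]) (use LX c in auto)
  have W: "W0 2 u g" by (rule W0_closed[of 2 "%n. fst (X n)" "%n. snd (X n)"]) (use X u g in auto)
  have "ip1 (X n - (u, g)) (X n - (u, g)) = Ipow M 2 (%x. fst (X n) x - u x) + Ipow M 2 (%x. snd (X n) x - g x)" for n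
    using ip1_self[of "X n - (u, g)"] subspace_diff[OF sub X[of n], of "(u, g)"] W by (simp add: fun_diff_def)
  thus "EX x:?V. (%n. ip1 (X n - x) (X n - x)) ----> 0"
    using W tendsto_add_zero[OF u(2) g(2)] by (intro bexI[of _ "(u, g)"]) auto
qed

lemma energy_integrable:
  fixes u :: "real^'n => 'b::euclidean_space"
  assumes a: "nondec a" "!!t. 0 <= t ==> a t <= A" and u: "LpV M 2 u"
  shows "integrable M (%x. a (norm (u x)) * (norm (u x))^2)"
proof (rule Lintegrable_bound)
  show "integrable M (%x. A * norm (u x) powr 2)" using u by (auto simp: LpV_def)
  have [measurable]: "u : borel_measurable M" using u by (simp add: LpV_def)
  have [measurable]: "(%x. a (norm (u x))) : borel_measurable M" by (rule borel_measurable_nondec_norm[OF a(1)]) simp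
  show "(%x. a (norm (u x)) * (norm (u x))^2) : borel_measurable M" by measurable
  show "AE x in M. norm (a (norm (u x)) * (norm (u x))^2) <= norm (A * norm (u x) powr 2)"
  proof (rule AE_I2)
    fix x
    have "abs (a (norm (u x))) <= abs A" using a(2)[of "norm (u x)"] nondecD(2)[OF a(1), of "norm (u x)"] by simp
    thus "norm (a (norm (u x)) * (norm (u x))^2) <= norm (A * norm (u x) powr 2)"
      by (simp add: powr_two abs_mult mult_right_mono)
  qed
qed

lemma energy_tendsto:
  fixes u :: "real^'n => 'b::euclidean_space"
  assumes a: "nondec a" "!!t. 0 <= t ==> a t <= A" and u: "LpV M 2 u" and us: "!!n. LpV M 2 (us n)"
    and lim: "(%n. Ipow M 2 (%x. us n x - u x)) ----> 0"
  shows "(%n. (LINT x|M. a (norm (us n x)) * (norm (us n x))^2)) ----> (LINT x|M. a (norm (u x)) * (norm (u x))^2)"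
proof (rule integral_continuous_Lp[OF _ u us lim, where C=A and v="%_. 0" and F="%x y. a (norm y) * (norm y)^2"])
  show "AE x in M. continuous_on UNIV (%y::'b. a (norm y) * (norm y)^2)"
    by (intro AE_I2 continuous_intros continuous_on_nondec_norm a(1))
  show "AE x in M. ALL y::'b. abs (a (norm y) * (norm y)^2) <= A * norm y powr 2 + 0"
  proof (intro AE_I2 allI)
    fix y :: 'b
    have "abs (a (norm y)) <= A" using a(2)[of "norm y"] nondecD(2)[OF a(1), of "norm y"] by simp
    thus "abs (a (norm y) * (norm y)^2) <= A * norm y powr 2 + 0"
      by (simp add: powr_two abs_mult mult_right_mono)
  qed
  show "(%x. a (norm (us n x)) * (norm (us n x))^2) : borel_measurable M" for n
    using energy_integrable[OF a us] by (rule borel_measurable_integrable)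
  show "(%x. a (norm (u x)) * (norm (u x))^2) : borel_measurable M"
    using energy_integrable[OF a u] by (rule borel_measurable_integrable)
qed simp_all

subsection \<open>A modular Poincare inequality\<close>

text \<open>With \<open>Th\<close> the primitive of \<open>a (abs t) t\<close>, integrate \<open>Th(phi) = Th(phi) \<partial>\<^sub>i x\<^sub>i\<close> by parts.\<close>

lemma Poincare_C1c:
  assumes a: "modulus D a" "!!t. 0 <= t ==> a t <= A" and phi: "C1c U phi" and R: "!!x. x : U ==> norm x <= R"
  shows "(LINT x|M. a (abs (phi x)) * (phi x)^2) <= 4 * D * R * (LINT x|M. a (abs (phi x)) * abs (phi x) * norm (cgrad phi x))"
proof -
  obtain B where B: "0 <= B" "ALL x. abs (phi x) <= B & norm (cgrad phi x) <= B" using C1c_bounded[OF phi] by blast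
  define f where "f t = a (abs t) * t" for t :: real
  have f_flux: "f = flux a" by (auto simp: fun_eq_iff f_def flux_def)
  have cf: "continuous_on S f" for S
    unfolding f_flux using continuous_on_flux[OF modulusD(1)[OF a(1)]] continuous_on_subset by blast
  have fmono: "0 <= (f s - f r) * (s - r)" for s r
    using flux_monotone_nonneg[OF modulusD(1)[OF a(1)], of s r] by (simp add: f_flux)
  \<comment> \<open>The base point lies strictly below the range of \<open>phi\<close>, so
    \<open>Th\<close> is differentiable at every value taken; the subtracted constant gives
    \<open>Th 0 = 0\<close>.\<close>
  define Th where "Th s = integral {- (B + 1)..s} f - integral {- (B + 1)..0} f" for s
  let ?I = "{- (B + 1)<..<B + 1}"
  have der': "(Th has_real_derivative f s) (at s)" if "s : ?I" for s
  proof -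
    have "((%x. integral {- (B + 1)..x} f) has_real_derivative f s) (at s within {- (B + 1)..B + 1})"
      using that by (intro integral_has_real_derivative cf) auto
    hence "((%x. integral {- (B + 1)..x} f) has_real_derivative f s) (at s)"
      using that by (subst (asm) at_within_interior) auto
    thus ?thesis unfolding Th_def by (auto intro!: derivative_eq_intros)
  qed
  hence der: "(Th has_real_derivative f s) (at s)" if "abs s <= B" for s using that by (auto simp: abs_le_iff)
  have "f r <= f s" if "r <= s" for r s
    using fmono[of s r] that by (cases "r = s") (auto simp: zero_le_mult_iff)
  hence cv: "convex_on ?I Th" by (intro convex_on_realI[where f'=f] der') auto
  have tangent: "f r * (s - r) <= Th s - Th r" if "abs r <= B" "abs s <= B" for r s
    by (rule convex_on_imp_above_tangent[OF cv _ _ _ has_field_derivative_at_within[OF der[OF that(1)]]])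
      (use that in auto)
  have Th0: "Th 0 = 0" by (simp add: Th_def)
  \<comment> \<open>The tangent at \<open>s/2\<close> together with \<open>Th (s/2) >= 0\<close>
    bounds \<open>a (abs (s/2)) * s^2 / 4\<close>, and doubling replaces the weight by the one at
    \<open>s\<close>.\<close>
  have Thlow: "a (abs s) * s^2 <= 4 * D * Th s" if "abs s <= B" for s
  proof -
    have "0 <= Th (s / 2)" using tangent[of 0 "s/2"] that B Th0 by (simp add: f_def)
    moreover have "f (s/2) * (s - s/2) <= Th s - Th (s/2)" using that by (intro tangent) auto
    moreover have "f (s/2) * (s - s/2) = a (abs (s / 2)) * s^2 / 4" by (simp add: f_def power2_eq_square)
    ultimately have "a (abs (s / 2)) * s^2 <= 4 * Th s" by linarith
    hence "D * (a (abs (s / 2)) * s^2) <= D * (4 * Th s)"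
      using modulusD(4)[OF a(1)] by (intro mult_left_mono) auto
    moreover have "a (abs s) * s^2 <= D * a (abs (s / 2)) * s^2"
      using modulusD(5)[OF a(1), of "abs (s / 2)"] by (intro mult_right_mono) auto
    ultimately show ?thesis by (simp add: mult.assoc)
  qed
  have g: "C1g (%x. Th (phi x)) (%x. f (phi x) *\<^sub>R cgrad phi x)"
    by (rule C1g_compose[OF C1c_C1g[OF phi] der cf]) (use B in auto)
  obtain K where K: "compact K" "K \<subseteq> U" "ALL x. x ~: K --> phi x = 0 & cgrad phi x = 0"
    using C1c_support[OF phi] by blast
  have c: "C1c U (%x. Th (phi x))" by (rule C1cI[OF g K(1,2)]) (use K Th0 in auto)
  \<comment> \<open>One arbitrary coordinate direction suffices.\<close>
  fix i :: 'n
  have parts: "(LINT x|M. x $ i * (f (phi x) * cgrad phi x $ i)) = - (LINT x|M. Th (phi x))"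
    using integration_by_parts[OF open_domain C1g_coord c, of i i] C1g_pd[OF g, of i]
    by (simp add: intO_def axis_def)
  have m [measurable]: "phi : borel_measurable M" "cgrad phi : borel_measurable M" "(%x. Th (phi x)) : borel_measurable M"
    using C1c_measurable[OF phi] C1c_measurable[OF c] by auto
  have ma [measurable]: "(%x. a (abs (phi x))) : borel_measurable M"
    using borel_measurable_nondec_norm[OF modulusD(1)[OF a(1)] m(1)] by simp
  have a0: "0 <= a (abs t)" for t using modulusD(3)[OF a(1)] by simp
  have A0: "0 <= A" using a0[of 0] a(2)[of 0] by simp
  have bd: "a (abs (phi x)) * abs (phi x) * norm (cgrad phi x) <= A * B * B" for x
    using a(2)[of "abs (phi x)"] a0 B A0 by (intro mult_mono) auto
  have i1: "integrable M (%x. a (abs (phi x)) * abs (phi x) * norm (cgrad phi x))"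
    by (rule integrable_const_bound[of _ "A * B * B"]) (use bd a0 in "auto simp: abs_mult")
  have i2: "integrable M (%x. Th (phi x))"
    using C1c_LpV(1)[OF c, of 1] unfolding LpV_def by (auto intro: integrable_abs_cancel)
  have i3: "integrable M (%x. a (abs (phi x)) * (phi x)^2)"
    using energy_integrable[OF modulusD(1)[OF a(1)] a(2) C1c_LpV(1)[OF phi]] by simp
  have "(LINT x|M. a (abs (phi x)) * (phi x)^2) <= (LINT x|M. 4 * D * Th (phi x))"
    using i2 i3 B by (intro integral_mono Thlow) auto
  also have "... = 4 * D * - (LINT x|M. x $ i * (f (phi x) * cgrad phi x $ i))" using parts by simp
  also have "- (LINT x|M. x $ i * (f (phi x) * cgrad phi x $ i)) <= (LINT x|M. R * (a (abs (phi x)) * abs (phi x) * norm (cgrad phi x)))"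
  proof -
    have le: "abs (x $ i * (f (phi x) * cgrad phi x $ i)) <= R * (a (abs (phi x)) * abs (phi x) * norm (cgrad phi x))" if "x : U" for x
    proof -
      have "abs (x $ i) <= R" using component_le_norm_cart[of x i] R[OF that] by linarith
      thus ?thesis unfolding f_def abs_mult
        using a0[of "phi x"] component_le_norm_cart[of "cgrad phi x" i] by (intro mult_mono) auto
    qed
    have [measurable]: "(%x. x $ i) : borel_measurable M"
      by (intro measurable_restrict_space1 measurable_completion) simp
    have "(%x. x $ i * (f (phi x) * cgrad phi x $ i)) : borel_measurable M" unfolding f_def by measurable
    hence "integrable M (%x. x $ i * (f (phi x) * cgrad phi x $ i))"
      by (rule Lintegrable_bound[OF integrable_mult_right[OF i1, of R]])
        (use le in "auto intro!: AE_I2 intro: order_trans[OF _ abs_ge_self]")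
    hence "abs (LINT x|M. x $ i * (f (phi x) * cgrad phi x $ i)) <= (LINT x|M. R * (a (abs (phi x)) * abs (phi x) * norm (cgrad phi x)))"
      by (rule integral_abs_bound_integral) (use i1 le in auto)
    thus ?thesis by linarith
  qed
  finally show ?thesis using modulusD(4)[OF a(1)] by (simp add: mult_left_mono mult.assoc)
qed

text \<open>\<open>C\<close> is chosen before the weight and depends on \<open>D\<close> and the
  domain only. The bound \<open>A\<close> merely makes the energies finite and continuous in L^2,
  for the passage from test functions to their closure.\<close>

theorem modular_Poincare:
  "EX C>=0. ALL a A u g. modulus D a --> (ALL t>=0. a t <= A) --> W0 2 u g -->
     (LINT x|M. a (norm (u x)) * (norm (u x))^2) <= C * (LINT x|M. a (norm (g x)) * (norm (g x))^2)"
proof (cases "1 <= D")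
  case True
  obtain R0 where R0: "ALL x:U. norm x <= R0" using bounded_domain by (auto simp: bounded_iff)
  define R where "R = max R0 1"
  have R: "1 <= R" "!!x. x : U ==> norm x <= R" using R0 by (auto simp: R_def le_max_iff_disj)
  \<comment> \<open>With this value \<open>4 * D * R * eta = 1/2\<close>, so the term with
    \<open>phi\<close> is absorbed.\<close>
  define eta where "eta = 1 / (8 * D * R)"
  have eta: "0 < eta" using True R by (simp add: eta_def)
  obtain C where C: "0 <= C" "ALL a s t. modulus D a --> 0 <= s --> 0 <= t --> a s * s * t <= eta * (a s * s^2) + C * (a t * t^2)"
    using modulus_Young[OF eta, of D] by blast
  have key: "(LINT x|M. a (norm (phi x)) * (norm (phi x))^2) <= 8 * D * R * C * (LINT x|M. a (norm (cgrad phi x)) * (norm (cgrad phi x))^2)"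
    if a: "modulus D a" "ALL t>=0. a t <= A" and phi: "C1c U phi" for a A phi
  proof -
    have bd: "a t <= A" if "0 <= t" for t using a(2) that by blast
    note e1 = energy_integrable[OF modulusD(1)[OF a(1)] bd C1c_LpV(1)[OF phi]]
    note e2 = energy_integrable[OF modulusD(1)[OF a(1)] bd C1c_LpV(2)[OF phi]]
    let ?E = "(LINT x|M. a (norm (phi x)) * (norm (phi x))^2)" and ?G = "(LINT x|M. a (norm (cgrad phi x)) * (norm (cgrad phi x))^2)"
    have [measurable]: "phi : borel_measurable M" "cgrad phi : borel_measurable M" using C1c_measurable[OF phi] by auto
    have "(%x. a (norm (phi x))) : borel_measurable M" by (rule borel_measurable_nondec_norm[OF modulusD(1)[OF a(1)]]) simp
    hence [measurable]: "(%x. a (abs (phi x))) : borel_measurable M" by simp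
    have le: "a (norm (phi x)) * norm (phi x) * norm (cgrad phi x)
        <= eta * (a (norm (phi x)) * (norm (phi x))^2) + C * (a (norm (cgrad phi x)) * (norm (cgrad phi x))^2)" for x
      using C(2) a(1) by (meson norm_ge_zero)
    have nn: "0 <= a (norm (phi x)) * norm (phi x) * norm (cgrad phi x)" for x using modulusD(3)[OF a(1)] by simp
    have i: "integrable M (%x. eta * (a (norm (phi x)) * (norm (phi x))^2) + C * (a (norm (cgrad phi x)) * (norm (cgrad phi x))^2))"
      using e1 e2 by simp
    have "?E <= 4 * D * R * (LINT x|M. a (norm (phi x)) * norm (phi x) * norm (cgrad phi x))"
      using Poincare_C1c[OF a(1) bd phi R(2)] by simp
    also have "(LINT x|M. a (norm (phi x)) * norm (phi x) * norm (cgrad phi x)) <= eta * ?E + C * ?G"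
    proof -
      have "(LINT x|M. a (norm (phi x)) * norm (phi x) * norm (cgrad phi x))
        <= (LINT x|M. eta * (a (norm (phi x)) * (norm (phi x))^2) + C * (a (norm (cgrad phi x)) * (norm (cgrad phi x))^2))"
        by (intro integral_mono le i Lintegrable_bound[OF i])
          (use le nn in "auto intro!: AE_I2 intro: order_trans[OF _ abs_ge_self]")
      thus ?thesis using e1 e2 by simp
    qed
    finally have "?E <= 4 * D * R * (eta * ?E + C * ?G)" using True R by (simp add: mult_left_mono)
    also have "... = ?E / 2 + 4 * D * R * C * ?G" using True R by (simp add: eta_def field_simps)
    finally show ?thesis by simp
  qed
  show ?thesis
  proof (intro exI[of _ "8 * D * R * C"] conjI allI impI)
    fix a A u g assume a: "modulus D a" "ALL t>=0. a t <= A" and W: "W0 2 u g"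
    have bd: "a t <= A" if "0 <= t" for t using a(2) that by blast
    obtain phi where phi: "ALL n. C1c U (phi n)" "(%n. Ipow M 2 (%x. phi n x - u x)) ----> 0"
       "(%n. Ipow M 2 (%x. cgrad (phi n) x - g x)) ----> 0" using W unfolding W0_def by blast
    note C1 = spec[OF phi(1)]
    have G: "(%n. 8 * D * R * C * (LINT x|M. a (norm (cgrad (phi n) x)) * (norm (cgrad (phi n) x))^2))
       ----> 8 * D * R * C * (LINT x|M. a (norm (g x)) * (norm (g x))^2)"
      by (intro tendsto_intros energy_tendsto[OF modulusD(1)[OF a(1)] bd W0_LpV(2)[OF W] C1c_LpV(2)[OF C1]] phi(3)) auto
    have E: "(%n. (LINT x|M. a (norm (phi n x)) * (norm (phi n x))^2)) ----> (LINT x|M. a (norm (u x)) * (norm (u x))^2)"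
      by (intro energy_tendsto[OF modulusD(1)[OF a(1)] bd W0_LpV(1)[OF W] C1c_LpV(1)[OF C1]] phi(2)) auto
    show "(LINT x|M. a (norm (u x)) * (norm (u x))^2) <= 8 * D * R * C * (LINT x|M. a (norm (g x)) * (norm (g x))^2)"
      by (rule LIMSEQ_le[OF E G]) (use key[OF a C1] in blast)
  qed (use True R C in simp)
qed (auto simp: modulus_def intro: exI[of _ 0])

lemma Poincare_L2:
  "EX C>=0. ALL u g. W0 2 u g --> Ipow M 2 u <= C * Ipow M 2 g"
proof -
  have "modulus 1 (%_. 1)" by (simp add: modulus_def nondec_def)
  moreover obtain C where C: "0 <= C" "ALL a A u g. modulus 1 a --> (ALL t>=0. a t <= A) --> W0 2 u g -->
     (LINT x|M. a (norm (u x)) * (norm (u x))^2) <= C * (LINT x|M. a (norm (g x)) * (norm (g x))^2)"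
    using modular_Poincare[of 1] by blast
  ultimately have "ALL u g. W0 2 u g --> Ipow M 2 u <= C * Ipow M 2 g"
    using C(2)[rule_format, of "%_. 1" 1] by (simp add: Ipow_def powr_two)
  thus ?thesis using C(1) by blast
qed

end

section \<open>Zero boundary values on Lipschitz domains\<close>

lemma norm_powr_le_components:
  fixes v :: "real^'n"
  assumes "0 <= p"
  shows "norm v powr p <= real CARD('n) powr p * (\<Sum>i\<in>UNIV. abs (v $ i) powr p)"
proof -
  obtain j where j: "abs (v $ j) = Max (range (%i. abs (v $ i)))"
    using Max_in[of "range (%i. abs (v $ i))"] by fastforce
  have "norm v <= (\<Sum>i\<in>UNIV. abs (v $ i))" by (rule norm_le_l1_cart)
  also have "... <= (\<Sum>i\<in>(UNIV::'n set). abs (v $ j))" unfolding j by (intro sum_mono Max_ge) auto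
  finally have "norm v powr p <= (real CARD('n) * abs (v $ j)) powr p" using assms by (intro powr_mono2) auto
  also have "... = real CARD('n) powr p * abs (v $ j) powr p" by (simp add: powr_mult)
  also have "abs (v $ j) powr p <= (\<Sum>i\<in>UNIV. abs (v $ i) powr p)" by (rule member_le_sum) auto
  finally show ?thesis by (simp add: mult_left_mono)
qed

lemma Ipow_le_components:
  fixes g :: "'a => real^'n"
  assumes "LpV N p g" "0 <= p"
  shows "Ipow N p g <= real CARD('n) powr p * (\<Sum>i\<in>UNIV. Ipow N p (%x. g x $ i))"
proof -
  have i: "integrable N (%x. abs (g x $ i) powr p)" for i using LpV_component[OF assms, of i] by (simp add: LpV_def)
  have "Ipow N p g <= (LINT x|N. real CARD('n) powr p * (\<Sum>i\<in>UNIV. abs (g x $ i) powr p))"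
    unfolding Ipow_def using i assms by (intro integral_mono norm_powr_le_components) (auto simp: LpV_def)
  thus ?thesis using i by (simp add: Ipow_def)
qed

lemma translation_continuous_Lp_vec:
  fixes G :: "real^'n => real^'n"
  assumes G: "LpV lborel p G" and p: "0 < p" and R: "!!x. R < norm x ==> G x = 0" and e: "0 < e"
  shows "EX d>0. ALL s. norm s < d --> Ipow lborel p (%x. G (x + s) - G x) < e"
proof -
  define c where "c = e / (real CARD('n) powr p * real CARD('n))"
  have c: "0 < c" using e by (simp add: c_def)
  have "ALL i. EX d>0. ALL s. norm s < d --> Ipow lborel p (%x. G (x + s) $ i - G x $ i) < c"
    using p R by (intro allI translation_continuous_Lp[OF LpV_component[OF G] p _ c, where R=R]) auto
  from choice[OF this] obtain d where "ALL i. 0 < d i & (ALL s. norm s < d i --> Ipow lborel p (%x. G (x + s) $ i - G x $ i) < c)"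
    by (rule exE)
  hence d: "!!i. 0 < d i" "!!i s. norm s < d i ==> Ipow lborel p (%x. G (x + s) $ i - G x $ i) < c" by simp_all
  have "Ipow lborel p (%x. G (x + s) - G x) < e" if s: "norm s < Min (range d)" for s
  proof -
    have "Ipow lborel p (%x. G (x + s) - G x) <= real CARD('n) powr p * (\<Sum>i\<in>UNIV. Ipow lborel p (%x. G (x + s) $ i - G x $ i))"
      using Ipow_le_components[OF LpV_diff[OF LpV_translate(1)[OF G] G], of s] p by simp
    also have "... < real CARD('n) powr p * (\<Sum>i\<in>(UNIV::'n set). c)"
      using s d by (intro mult_strict_left_mono sum_strict_mono) auto
    also have "... = e" by (simp add: c_def)
    finally show ?thesis .
  qed
  thus ?thesis using d(1) by (intro exI[of _ "Min (range d)"]) auto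
qed

lemma C1g_locally_constant:
  assumes "C1g h H" "open S" "!!x. x : S ==> h x = c" "y : S"
  shows "H y = 0"
proof -
  have "(h has_derivative (%v. 0)) (at y)"
    by (rule has_derivative_transform_within_open[of "%_. c" _ _ _ S]) (use assms in auto)
  moreover have "(h has_derivative (%v. H y \<bullet> v)) (at y)" using assms(1) by (simp add: C1g_def)
  ultimately have "(%v. H y \<bullet> v) = (%v. 0)" by (rule has_derivative_unique[symmetric])
  from fun_cong[OF this, of "H y"] show ?thesis by simp
qed

lemma sobolev_pairD:
  assumes "sobolev_pair p u G" "1 <= p"
  shows "LpV lborel p u" "LpV lborel p G" "u : borel_measurable borel" "G : borel_measurable borel"
    "integrable lborel u" "integrable lborel (%x. G x $ i)"
    "C1c UNIV phi ==> (LINT x|lborel. u x * cgrad phi x $ i) = - (LINT x|lborel. G x $ i * phi x)"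
proof -
  obtain R where R: "ALL x. R < norm x --> u x = 0 & G x = 0" using assms by (auto simp: sobolev_pair_def)
  show L: "LpV lborel p u" "LpV lborel p G" and "C1c UNIV phi ==> (LINT x|lborel. u x * cgrad phi x $ i) = - (LINT x|lborel. G x $ i * phi x)"
    using assms(1) by (auto simp: sobolev_pair_def)
  thus "u : borel_measurable borel" "G : borel_measurable borel" by (auto simp: LpV_def)
  show "integrable lborel u" "integrable lborel (%x. G x $ i)"
    using R assms(2) by (auto intro!: integrable_of_LpV_bounded_support[of p _ R] L LpV_component)
qed

lemma sobolev_pair_translate:
  assumes S: "sobolev_pair p u G" and p: "1 <= p"
  shows "sobolev_pair p (%x. u (x + v)) (%x. G (x + v))" unfolding sobolev_pair_def
proof (intro conjI allI impI)
  note D = sobolev_pairD[OF S p]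
  have [measurable]: "u : borel_measurable borel" "G : borel_measurable borel" by (fact D)+
  show "LpV lborel p (%x. u (x + v))" "LpV lborel p (%x. G (x + v))" using D by (auto intro: LpV_translate)
  obtain R where R: "ALL x. R < norm x --> u x = 0 & G x = 0" using S by (auto simp: sobolev_pair_def)
  have "u (x + v) = 0 & G (x + v) = 0" if "R + norm v < norm x" for x
    using R norm_triangle_ineq4[of "x + v" v] that by auto
  thus "EX R. ALL x. R < norm x --> u (x + v) = 0 & G (x + v) = 0" by blast
  fix phi :: "real^'a => real" and i assume phi: "C1c UNIV phi"
  have [measurable]: "phi : borel_measurable borel" "cgrad phi : borel_measurable borel" using C1c_measurable[OF phi] by auto
  obtain K where K: "compact K" "ALL x. x ~: K --> phi x = 0 & cgrad phi x = 0" using C1c_support[OF phi] by blast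
  have g: "C1g (%x. phi (x - v)) (%x. cgrad phi (x - v))" unfolding C1g_def
  proof (intro conjI allI)
    show "((%x. phi (x - v)) has_derivative (\<bullet>) (cgrad phi (x - v))) (at x)" for x
      by (rule has_derivative_compose[where f="%x. x - v" and g=phi])
        (use C1c_C1g[OF phi] in "auto simp: C1g_def intro!: derivative_eq_intros")
    show "continuous_on UNIV (%x. cgrad phi (x - v))"
      by (intro continuous_on_compose2[OF C1g_cont_grad[OF C1c_C1g[OF phi]]] continuous_intros) auto
  qed
  have c: "C1c UNIV (%x. phi (x - v))"
  proof (rule C1cI[OF g, of "(%x. x + v) ` K"])
    show "compact ((%x. x + v) ` K)" using K(1) by (intro compact_continuous_image continuous_intros)
    show "phi (x - v) = 0" if "x ~: (%x. x + v) ` K" for x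
    proof -
      have "x - v ~: K" using that by (metis diff_add_cancel imageI)
      thus ?thesis using K(2) by simp
    qed
  qed auto
  have "(LINT x|lborel. u (x + v) * cgrad phi x $ i) = (LINT x|lborel. u (x + v) * cgrad phi (x + v - v) $ i)" by simp
  also have "... = (LINT x|lborel. u x * cgrad phi (x - v) $ i)"
    by (rule lborel_integral_translate[where f="%x. u x * cgrad phi (x - v) $ i"]) measurable
  also have "... = - (LINT x|lborel. G x $ i * phi (x - v))" using D(7)[OF c] C1g_cgrad[OF g] by simp
  also have "(LINT x|lborel. G x $ i * phi (x - v)) = (LINT x|lborel. G (x + v) $ i * phi (x + v - v))"
    by (rule lborel_integral_translate[where f="%x. G x $ i * phi (x - v)", symmetric]) measurable
  finally show "(LINT x|lborel. u (x + v) * cgrad phi x $ i) = - (LINT x|lborel. G (x + v) $ i * phi x)" by simp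
qed

lemma sobolev_pair_cutoff:
  assumes S: "sobolev_pair p u G" and p: "1 <= p" and h: "C1c UNIV h"
  shows "sobolev_pair p (%x. h x * u x) (%x. h x *\<^sub>R G x + u x *\<^sub>R cgrad h x)"
  unfolding sobolev_pair_def
proof (intro conjI allI impI)
  note D = sobolev_pairD[OF S p]
  have [measurable]: "u : borel_measurable borel" "G : borel_measurable borel" by (fact D)+
  have [measurable]: "h : borel_measurable borel" "cgrad h : borel_measurable borel" using C1c_measurable[OF h] by auto
  obtain B where B: "0 <= B" "ALL x. abs (h x) <= B & norm (cgrad h x) <= B" using C1c_bounded[OF h] by blast
  have bd: "LpV lborel p (%x. B *\<^sub>R u x)" "LpV lborel p (%x. B *\<^sub>R G x)" by (rule LpV_scale[OF D(1)] LpV_scale[OF D(2)])+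
  show "LpV lborel p (%x. h x * u x)"
    by (rule LpV_mono[OF _ bd(1)]) (use B p in "auto simp: abs_mult intro!: mult_right_mono AE_I2")
  have "LpV lborel p (%x. h x *\<^sub>R G x)"
    by (rule LpV_mono[OF _ bd(2)]) (use B p in "auto intro!: mult_right_mono AE_I2")
  moreover have "LpV lborel p (%x. u x *\<^sub>R cgrad h x)"
    by (rule LpV_mono[OF _ bd(1)]) (use B p in "auto simp: abs_mult mult.commute[of B] intro!: mult_left_mono AE_I2")
  ultimately show "LpV lborel p (%x. h x *\<^sub>R G x + u x *\<^sub>R cgrad h x)" using p by (intro LpV_add) auto
  obtain R where "ALL x. R < norm x --> u x = 0 & G x = 0" using S by (auto simp: sobolev_pair_def)
  thus "EX R. ALL x. R < norm x --> h x * u x = 0 & h x *\<^sub>R G x + u x *\<^sub>R cgrad h x = 0"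
    by (intro exI[of _ R]) auto
  fix phi :: "real^'a => real" and i assume phi: "C1c UNIV phi"
  have [measurable]: "phi : borel_measurable borel" "cgrad phi : borel_measurable borel" using C1c_measurable[OF phi] by auto
  obtain C where C: "0 <= C" "ALL x. abs (phi x) <= C & norm (cgrad phi x) <= C" using C1c_bounded[OF phi] by blast
  have comp: "abs (cgrad phi x $ i) <= C" "abs (cgrad h x $ i) <= B" for x
    using B(2) C(2) component_le_norm_cart[of "cgrad phi x" i] component_le_norm_cart[of "cgrad h x" i]
    by (meson order_trans)+
  have i1: "integrable lborel (%x. u x * (h x * cgrad phi x $ i))" "integrable lborel (%x. u x * (phi x * cgrad h x $ i))"
    "integrable lborel (%x. G x $ i * (h x * phi x))"
  proof -
    have "abs (h x * cgrad phi x $ i) <= B * C" "abs (phi x * cgrad h x $ i) <= C * B" "abs (h x * phi x) <= B * C" for x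
      unfolding abs_mult using comp B C by (auto intro!: mult_mono)
    thus "integrable lborel (%x. u x * (h x * cgrad phi x $ i))" "integrable lborel (%x. u x * (phi x * cgrad h x $ i))"
      "integrable lborel (%x. G x $ i * (h x * phi x))"
      by (auto intro!: integrable_mult_bounded_borel[OF D(5)] integrable_mult_bounded_borel[OF D(6)])
  qed
  note c = C1c_mult_C1g[OF phi C1c_C1g[OF h]]
  have "(LINT x|lborel. u x * (h x * cgrad phi x $ i) + u x * (phi x * cgrad h x $ i)) = - (LINT x|lborel. G x $ i * (h x * phi x))"
    using D(7)[OF c(1), of i] unfolding c(2) by (simp add: algebra_simps)
  hence "(LINT x|lborel. u x * (h x * cgrad phi x $ i))
      = - ((LINT x|lborel. G x $ i * (h x * phi x)) + (LINT x|lborel. u x * (phi x * cgrad h x $ i)))"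
    using i1 by simp
  also have "... = - (LINT x|lborel. G x $ i * (h x * phi x) + u x * (phi x * cgrad h x $ i))" using i1 by simp
  finally show "(LINT x|lborel. h x * u x * cgrad phi x $ i) = - (LINT x|lborel. (h x *\<^sub>R G x + u x *\<^sub>R cgrad h x) $ i * phi x)"
    by (simp add: algebra_simps)
qed

lemma sobolev_pair_diff:
  assumes S: "sobolev_pair p u G" "sobolev_pair p v H" and p: "1 <= p"
  shows "sobolev_pair p (%x. u x - v x) (%x. G x - H x)" unfolding sobolev_pair_def
proof (intro conjI allI impI)
  note D = sobolev_pairD[OF S(1) p] and E = sobolev_pairD[OF S(2) p]
  show "LpV lborel p (%x. u x - v x)" "LpV lborel p (%x. G x - H x)" using D E p by (auto intro!: LpV_diff)
  obtain R where R: "ALL x. R < norm x --> u x = 0 & G x = 0" using S by (auto simp: sobolev_pair_def)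
  obtain R' where R': "ALL x. R' < norm x --> v x = 0 & H x = 0" using S by (auto simp: sobolev_pair_def)
  show "EX R. ALL x. R < norm x --> u x - v x = 0 & G x - H x = 0" using R R' by (intro exI[of _ "max R R'"]) auto
  fix phi :: "real^'a => real" and i assume phi: "C1c UNIV phi"
  have [measurable]: "phi : borel_measurable borel" "cgrad phi : borel_measurable borel" using C1c_measurable[OF phi] by auto
  obtain C where C: "ALL x. abs (phi x) <= C & norm (cgrad phi x) <= C" using C1c_bounded[OF phi] by blast
  have comp: "abs (cgrad phi x $ i) <= C" for x
    using C component_le_norm_cart[of "cgrad phi x" i] by (meson order_trans)
  have "integrable lborel (%x. f x * cgrad phi x $ i)" "integrable lborel (%x. f x * phi x)"
    if "integrable lborel f" for f :: "real^'a => real"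
    using that comp C by (auto intro!: integrable_mult_bounded_borel[where B=C])
  thus "(LINT x|lborel. (u x - v x) * cgrad phi x $ i) = - (LINT x|lborel. (G x - H x) $ i * phi x)"
    using D(5,6,7) E(5,6,7) phi by (simp add: left_diff_distrib)
qed

lemma LpV_compact_support:
  fixes f :: "real^'n => 'b::euclidean_space"
  assumes "f : borel_measurable borel" "compact K" "!!x. x ~: K ==> f x = 0" "!!x. norm (f x) <= B" "0 <= p"
  shows "LpV lborel p f" unfolding LpV_def
proof
  show "integrable lborel (%x. norm (f x) powr p)"
    by (rule integrable_lborel_bounded_support[OF _ assms(2), where B="B powr p"])
      (use assms in "auto intro!: powr_mono2")
qed (use assms in simp)

context bounded_domain
begin

lemma LpV_domain:
  fixes f :: "real^'n => 'b::euclidean_space"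
  assumes "LpV lborel p f"
  shows "LpV M p f" "Ipow M p f <= Ipow lborel p f"
proof -
  have [measurable]: "f : borel_measurable borel" using assms by (simp add: LpV_def)
  have i: "integrable lebesgue (%x. norm (f x) powr p)"
    using LpV_integrable[OF assms] by (simp add: integrable_completion)
  have O: "U : sets lebesgue" using open_domain by (auto intro: borel_open)
  hence i2: "integrable lebesgue (%x. indicator U x *\<^sub>R (norm (f x) powr p))" by (intro integrable_mult_indicator i)
  hence i3: "integrable M (%x. norm (f x) powr p)" using O by (subst integrable_restrict_space) auto
  moreover have "f : borel_measurable M" by (intro measurable_restrict_space1 measurable_completion) simp
  ultimately show "LpV M p f" by (simp add: LpV_def)
  have "Ipow M p f = (LINT x|lebesgue. indicator U x *\<^sub>R (norm (f x) powr p))"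
    unfolding Ipow_def using O by (subst integral_restrict_space) auto
  also have "... <= (LINT x|lebesgue. norm (f x) powr p)"
    by (intro integral_mono i i2) (auto simp: indicator_def)
  finally show "Ipow M p f <= Ipow lborel p f" by (simp add: Ipow_def integral_completion)
qed

section \<open>From the whole space back to the domain\<close>

lemma sobolev_pair_limit_W0:
  assumes S: "sobolev_pair p u G" and p: "1 <= p"
    and lim: "!!e. 0 < e ==> EX v H. W0 p v H & LpV lborel p v & LpV lborel p H \<and>
       Ipow lborel p (%x. v x - u x) <= e & Ipow lborel p (%x. H x - G x) <= e"
  shows "W0 p u G"
proof -
  note D = sobolev_pairD[OF S p]
  have "ALL n. EX w. W0 p (fst w) (snd w) & LpV lborel p (fst w) & LpV lborel p (snd w) \<and>
       Ipow lborel p (%x. fst w x - u x) <= 1 / real (Suc n) & Ipow lborel p (%x. snd w x - G x) <= 1 / real (Suc n)"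
  proof
    fix n
    have "0 < 1 / real (Suc n)" by simp
    from lim[OF this] obtain v H where "W0 p v H" "LpV lborel p v" "LpV lborel p H"
      "Ipow lborel p (%x. v x - u x) <= 1 / real (Suc n)" "Ipow lborel p (%x. H x - G x) <= 1 / real (Suc n)"
      by blast
    thus "EX w. W0 p (fst w) (snd w) & LpV lborel p (fst w) & LpV lborel p (snd w) \<and>
       Ipow lborel p (%x. fst w x - u x) <= 1 / real (Suc n) & Ipow lborel p (%x. snd w x - G x) <= 1 / real (Suc n)"
      by (intro exI[of _ "(v, H)"]) simp
  qed
  from choice[OF this] obtain w where w: "ALL n. W0 p (fst (w n)) (snd (w n)) & LpV lborel p (fst (w n)) & LpV lborel p (snd (w n)) \<and>
       Ipow lborel p (%x. fst (w n) x - u x) <= 1 / real (Suc n) & Ipow lborel p (%x. snd (w n) x - G x) <= 1 / real (Suc n)"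
    by (rule exE)
  have 0: "(%n. 1 / real (Suc n)) ----> 0" using LIMSEQ_inverse_real_of_nat by (simp add: inverse_eq_divide)
  have le: "Ipow M p (%x. fst (w n) x - u x) <= 1 / real (Suc n)" "Ipow M p (%x. snd (w n) x - G x) <= 1 / real (Suc n)" for n
  proof -
    have w1: "LpV lborel p (fst (w n))" "LpV lborel p (snd (w n))" "Ipow lborel p (%x. fst (w n) x - u x) <= 1 / real (Suc n)"
      "Ipow lborel p (%x. snd (w n) x - G x) <= 1 / real (Suc n)" using w by simp_all
    have p0: "0 <= p" using p by simp
    show "Ipow M p (%x. fst (w n) x - u x) <= 1 / real (Suc n)"
      by (rule order_trans[OF LpV_domain(2)[OF LpV_diff[OF w1(1) D(1) p0]] w1(3)])
    show "Ipow M p (%x. snd (w n) x - G x) <= 1 / real (Suc n)"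
      by (rule order_trans[OF LpV_domain(2)[OF LpV_diff[OF w1(2) D(2) p0]] w1(4)])
  qed
  show ?thesis
  proof (rule W0_closed[of p "%n. fst (w n)" "%n. snd (w n)"])
    show "(%n. Ipow M p (%x. fst (w n) x - u x)) ----> 0" "(%n. Ipow M p (%x. snd (w n) x - G x)) ----> 0"
      using le by (auto intro!: Lim_null_comparison[OF _ 0] always_eventually)
  qed (use w D p LpV_domain in auto)
qed

text \<open>Mollification at a radius below the distance from \<open>K\<close> to the complement of
  \<open>U\<close> yields test functions, and their gradients are the mollified gradients.\<close>

lemma W0_of_compact_support:
  assumes S: "sobolev_pair p u G" and p: "1 <= p" and K: "compact K" "K \<subseteq> U"
    and out: "!!x. x ~: K ==> u x = 0 & G x = 0"
  shows "W0 p u G"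
proof (rule sobolev_pair_limit_W0[OF S p])
  note D = sobolev_pairD[OF S p]
  fix e :: real assume e: "0 < e"
  \<comment> \<open>The loss incurred when the vector error is estimated component by
    component.\<close>
  define c where "c = real CARD('n) powr p * real CARD('n)"
  have c: "0 < c" by (simp add: c_def)
  obtain R where R: "ALL x. R < norm x --> u x = 0 & G x = 0" using S by (auto simp: sobolev_pair_def)
  have Ru: "R < norm x ==> u x = 0" and RG: "R < norm x ==> G x = 0" for x using R by auto
  obtain d1 where d1: "0 < d1" "ALL s. norm s < d1 --> Ipow lborel p (%x. u (x + s) - u x) < e"
    using translation_continuous_Lp[OF D(1) _ Ru e] p by auto
  obtain d2 where d2: "0 < d2" "ALL s. norm s < d2 --> Ipow lborel p (%x. G (x + s) - G x) < e / c"
    using translation_continuous_Lp_vec[OF D(2) _ RG, where e="e / c"] p e c by auto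
  obtain d3 where d3: "0 < d3" "(\<Union>x\<in>K. cball x d3) \<subseteq> U"
    using compact_subset_open_imp_cball_epsilon_subset[OF K(1) open_domain K(2)] by auto
  define r where "r = min (min d1 d2) d3 / 2"
  have r: "0 < r" "r < d1" "r < d2" "r < d3" using d1(1) d2(1) d3(1) by (auto simp: r_def min_def)
  define phi where "phi = mollify r u"
  have g: "C1g phi (cgrad phi)" unfolding phi_def C1g_cgrad[OF C1g_mollify[OF r(1) D(5)]] by (rule C1g_mollify[OF r(1) D(5)])
  have outphi: "phi x = 0" if "x ~: (\<Union>x\<in>K. cball x d3)" for x unfolding phi_def
  proof (rule mollify_outside[OF r(1), of K])
    show "u y = 0" if "y ~: K" for y using out[OF that] by simp
    show "r < dist x y" if "y : K" for y
    proof (rule ccontr)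
      assume "~ r < dist x y"
      hence "x : cball y d3" using r(4) by (simp add: dist_commute)
      thus False using \<open>x ~: (\<Union>x\<in>K. cball x d3)\<close> \<open>y : K\<close> by blast
    qed
  qed
  have cs: "compact (\<Union>x\<in>K. cball x d3)" using K(1) d3(1) by (intro compact_minkowski_sum_cball)
  have C: "C1c U phi" by (rule C1cI[OF g cs d3(2)]) (use outphi in auto)
  \<comment> \<open>The weak gradient identity is tested with the reflected mollifier; the
    reflection accounts for the two signs that cancel.\<close>
  have grad: "cgrad phi x $ i = mollify r (%y. G y $ i) x" for x i
  proof -
    note mc = mollifier_props(3)[OF r(1), where 'n='n] and rc = C1c_mollifier_reflect[OF r(1), of x]
    have "cgrad phi x $ i = (LINT y|lborel. u y * cgrad (mollifier r) (x - y) $ i)"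
      unfolding phi_def C1g_cgrad[OF C1g_mollify[OF r(1) D(5)]] by simp
    also have "... = - (LINT y|lborel. u y * cgrad (%y. mollifier r (x - y)) y $ i)"
      unfolding C1g_cgrad[OF C1g_reflect[OF C1c_C1g[OF mc]]] by simp
    also have "... = mollify r (%y. G y $ i) x" unfolding D(7)[OF rc] mollify_def by simp
    finally show ?thesis .
  qed
  have L: "LpV lborel p phi" "LpV lborel p (cgrad phi)"
  proof -
    obtain K' where K': "compact K'" "ALL x. x ~: K' --> phi x = 0 & cgrad phi x = 0" using C1c_support[OF C] by blast
    obtain B where B: "ALL x. abs (phi x) <= B & norm (cgrad phi x) <= B" using C1c_bounded[OF C] by blast
    show "LpV lborel p phi" "LpV lborel p (cgrad phi)"
      using C1c_measurable(1,2)[OF C] K'(2) B p by (auto intro!: LpV_compact_support[OF _ K'(1), where B=B])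
  qed
  have 1: "Ipow lborel p (%x. phi x - u x) <= e"
    unfolding phi_def using d1(2) r by (intro mollify_Lp r(1) p D(1,5)) (auto intro: less_imp_le)
  have 2: "Ipow lborel p (%x. cgrad phi x $ i - G x $ i) <= e / c" for i unfolding grad
  proof (rule mollify_Lp[OF r(1) p])
    fix s :: "real^'n" assume "norm s <= r"
    hence "Ipow lborel p (%x. G (x + s) - G x) <= e / c" using d2(2) r(3) by (auto intro: less_imp_le)
    moreover have "Ipow lborel p (%x. G (x + s) $ i - G x $ i) <= Ipow lborel p (%x. G (x + s) - G x)"
    proof -
      have L: "LpV lborel p (%x. G (x + s) - G x)" using D(2) p by (intro LpV_diff LpV_translate) auto
      have "LpV lborel p (%x. G (x + s) $ i - G x $ i)" using LpV_component[OF L, of i] p by simp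
      thus ?thesis unfolding Ipow_def using L p component_le_norm_cart[of "G (_ + s) - G _" i]
        by (intro integral_mono) (auto simp: LpV_def intro!: powr_mono2)
    qed
    ultimately show "Ipow lborel p (%x. G (x + s) $ i - G x $ i) <= e / c" by linarith
  qed (use D p in "auto intro: LpV_component")
  have "Ipow lborel p (%x. cgrad phi x - G x) <= real CARD('n) powr p * (\<Sum>i\<in>UNIV. Ipow lborel p (%x. cgrad phi x $ i - G x $ i))"
    using Ipow_le_components[OF LpV_diff[OF L(2) D(2)]] p by simp
  also have "... <= real CARD('n) powr p * (\<Sum>i\<in>(UNIV::'n set). e / c)"
    by (intro mult_left_mono sum_mono 2) auto
  also have "... = e" by (simp add: c_def)
  finally have "Ipow lborel p (%x. cgrad phi x - G x) <= e" .
  thus "EX v H. W0 p v H & LpV lborel p v & LpV lborel p H \<and>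
       Ipow lborel p (%x. v x - u x) <= e & Ipow lborel p (%x. H x - G x) <= e"
    using W0_C1c[OF C] L 1 p by (intro exI[of _ phi] exI[of _ "cgrad phi"]) auto
qed

definition locally_W0 :: "real => real^'n => real => bool" where
  "locally_W0 p x0 r \<longleftrightarrow> (ALL u G. sobolev_pair p u G -->
     (ALL x. x ~: closure U \<inter> cball x0 r --> u x = 0 & G x = 0) --> W0 p u G)"

text \<open>Near a boundary point, moving the support against the graph direction \<open>e\<close> pushes it into \<open>U\<close>.\<close>

lemma locally_W0_exists:
  assumes lip: "lipschitz_boundary U" and x0: "x0 : closure U" and p: "1 <= p"
  shows "EX r>0. locally_W0 p x0 r"
proof (cases "x0 : U")
  case True
  then obtain r where r: "r > 0" "cball x0 r \<subseteq> U" using open_domain open_contains_cball by blast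
  have "W0 p u G" if S: "sobolev_pair p u G" and out: "ALL x. x ~: closure U \<inter> cball x0 r --> u x = 0 & G x = 0" for u G
    by (rule W0_of_compact_support[OF S p compact_cball r(2)]) (use out in auto)
  thus ?thesis using r(1) unfolding locally_W0_def by blast
next
  case False
  hence "x0 : frontier U" using x0 open_domain by (simp add: frontier_def interior_open)
  with lip obtain e r g C where e: "norm e = 1" "r > 0" "C-lipschitz_on UNIV g"
      "ALL x. g x = g (x - (x \<bullet> e) *\<^sub>R e)" "U \<inter> ball x0 r = {x : ball x0 r. x \<bullet> e < g x}"
    unfolding lipschitz_boundary_def by (elim ballE exE conjE) auto
  have cg: "continuous_on UNIV g" using e(3) by (rule lipschitz_on_continuous_on)
  let ?K = "closure U \<inter> cball x0 (r / 2)"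
  have K: "compact ?K" using bounded_domain by (intro compact_Int) (auto simp: compact_closure)
  \<comment> \<open>A point strictly above the graph would have a neighbourhood above it inside the
    ball; being in the closure, the point would have points of \<open>U\<close> in that
    neighbourhood.\<close>
  have graph: "z \<bullet> e <= g z" if z: "z : ?K" for z
  proof (rule ccontr)
    assume "~ z \<bullet> e <= g z"
    hence zU: "z : {x : ball x0 r. g x < x \<bullet> e}" using z e(2) by auto
    have "{x : ball x0 r. g x < x \<bullet> e} = ball x0 r \<inter> {x. g x < x \<bullet> e}" by auto
    hence "open {x : ball x0 r. g x < x \<bullet> e}"
      using cg by (auto intro!: open_Int open_Collect_less continuous_intros)
    then obtain y where "y : U" "y : {x : ball x0 r. g x < x \<bullet> e}"
      using zU z open_Int_closure_eq_empty[of "{x : ball x0 r. g x < x \<bullet> e}" U] by blast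
    hence "y : U \<inter> ball x0 r" "g y < y \<bullet> e" by auto
    thus False unfolding e(5) by simp
  qed
  have "W0 p u G" if S: "sobolev_pair p u G" and out: "ALL x. x ~: ?K --> u x = 0 & G x = 0" for u G
  proof (rule sobolev_pair_limit_W0[OF S p])
    note D = sobolev_pairD[OF S p]
    obtain R where R: "ALL x. R < norm x --> u x = 0 & G x = 0" using S by (auto simp: sobolev_pair_def)
    have Ru: "R < norm x ==> u x = 0" and RG: "R < norm x ==> G x = 0" for x using R by auto
    fix eps :: real assume eps: "0 < eps"
    obtain d1 where d1: "0 < d1" "ALL s. norm s < d1 --> Ipow lborel p (%x. u (x + s) - u x) < eps"
      using translation_continuous_Lp[OF D(1) _ Ru eps] p by auto
    obtain d2 where d2: "0 < d2" "ALL s. norm s < d2 --> Ipow lborel p (%x. G (x + s) - G x) < eps"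
      using translation_continuous_Lp_vec[OF D(2) _ RG eps] p by auto
    define t where "t = min (min d1 d2) (r / 2) / 2"
    have t: "0 < t" "t < d1" "t < d2" "t < r / 2" using d1(1) d2(1) e(2) by (auto simp: t_def min_def)
    have nt: "norm (t *\<^sub>R e) = t" using t e by simp
    have S': "sobolev_pair p (%x. u (x + t *\<^sub>R e)) (%x. G (x + t *\<^sub>R e))" by (rule sobolev_pair_translate[OF S p])
    have "W0 p (%x. u (x + t *\<^sub>R e)) (%x. G (x + t *\<^sub>R e))"
    proof (rule W0_of_compact_support[OF S' p, of "(%z. z - t *\<^sub>R e) ` ?K"])
      show "compact ((%z. z - t *\<^sub>R e) ` ?K)" by (intro compact_continuous_image K continuous_intros)
      show "(%z. z - t *\<^sub>R e) ` ?K \<subseteq> U"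
      proof (rule image_subsetI)
        fix z assume z: "z : ?K"
        let ?x = "z - t *\<^sub>R e"
        have xe: "?x \<bullet> e = z \<bullet> e - t" using e(1) by (simp add: inner_diff_left dot_square_norm)
        \<comment> \<open>\<open>g\<close> is constant along \<open>e\<close>, so the shift lowers
          the height by \<open>t\<close> and leaves the graph height unchanged: weak inequality
          becomes strict.\<close>
        have "g ?x = g (?x - (?x \<bullet> e) *\<^sub>R e)" using e(4) by blast
        also have "?x - (?x \<bullet> e) *\<^sub>R e = z - (z \<bullet> e) *\<^sub>R e" unfolding xe by (simp add: algebra_simps)
        also have "g ... = g z" using e(4) by metis
        finally have "?x \<bullet> e < g ?x" using graph[OF z] t(1) xe by linarith
        moreover have "dist x0 ?x < r"
        proof -
          have "dist x0 ?x <= dist x0 z + dist z ?x" by (rule dist_triangle)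
          also have "dist z ?x = t" using nt by (simp add: dist_norm)
          finally show ?thesis using z t(4) by simp
        qed
        ultimately have "?x : {x : ball x0 r. x \<bullet> e < g x}" by simp
        thus "?x : U" using e(5) by blast
      qed
      show "u (x + t *\<^sub>R e) = 0 & G (x + t *\<^sub>R e) = 0" if "x ~: (%z. z - t *\<^sub>R e) ` ?K" for x
      proof -
        have "x + t *\<^sub>R e ~: ?K"
        proof
          assume "x + t *\<^sub>R e : ?K"
          hence "x + t *\<^sub>R e - t *\<^sub>R e : (%z. z - t *\<^sub>R e) ` ?K" by (rule imageI)
          thus False using that by simp
        qed
        thus ?thesis using out by blast
      qed
    qed
    moreover have "Ipow lborel p (%x. u (x + t *\<^sub>R e) - u x) <= eps" "Ipow lborel p (%x. G (x + t *\<^sub>R e) - G x) <= eps"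
      using d1(2) d2(2) nt t by (auto intro: less_imp_le)
    ultimately show "EX v H. W0 p v H & LpV lborel p v & LpV lborel p H \<and>
       Ipow lborel p (%x. v x - u x) <= eps & Ipow lborel p (%x. H x - G x) <= eps"
      using LpV_translate(1)[OF D(1), of "t *\<^sub>R e"] LpV_translate(1)[OF D(2), of "t *\<^sub>R e"]
      by (intro exI[of _ "%x. u (x + t *\<^sub>R e)"] exI[of _ "%x. G (x + t *\<^sub>R e)"]) auto
  qed
  thus ?thesis using e(2) unfolding locally_W0_def by (intro exI[of _ "r / 2"]) auto
qed

text \<open>Induction on the cover in place of a partition of unity: with \<open>h = 1\<close> on
  the half ball, \<open>h u\<close> is handled locally, and \<open>u - h u\<close> vanishes there,
  so the remaining half balls cover it.\<close>

lemma W0_of_finite_cover: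
  assumes F: "finite F" and p: "1 <= p"
    and loc: "!!x r. (x, r) : F ==> 0 < r & locally_W0 p x r"
    and S: "sobolev_pair p u G" and out: "!!x. x ~: closure U ==> u x = 0 & G x = 0"
    and cov: "!!x. x ~: (\<Union>(y, r)\<in>F. ball y (r / 2)) ==> u x = 0 & G x = 0"
  shows "W0 p u G" using F loc S out cov
proof (induction F arbitrary: u G rule: finite_induct)
  case empty
  hence "u = (%x. 0)" "G = (%x. 0)" by auto
  thus ?case using W0_zero p by auto
next
  case (insert a F)
  obtain y r where a: "a = (y, r)" by (cases a)
  have r: "0 < r" "locally_W0 p y r" using insert.prems(1)[of y r] a by auto
  obtain h H where h: "C1g h H" "!!x. x : cball y (r / 2) ==> h x = 1" "!!x. x ~: ball y r ==> h x = 0"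
    using C1g_cutoff[of "r / 2" r y] r by auto
  have hc: "C1c UNIV h" by (rule C1cI[OF h(1), of "cball y r"]) (use h(3) in auto)
  have H: "cgrad h = H" by (rule C1g_cgrad[OF h(1)])
  let ?u = "%x. h x * u x" and ?G = "%x. h x *\<^sub>R G x + u x *\<^sub>R cgrad h x"
  have S1: "sobolev_pair p ?u ?G" by (rule sobolev_pair_cutoff[OF insert.prems(2) p hc])
  have Hout: "H x = 0" if "x ~: cball y r" for x
    by (rule C1g_locally_constant[OF h(1), of "- cball y r" 0]) (use that h(3) in auto)
  have W1: "W0 p ?u ?G"
  proof (rule r(2)[unfolded locally_W0_def, rule_format, OF S1])
    fix x assume "x ~: closure U \<inter> cball y r"
    then consider "x ~: closure U" | "x ~: cball y r" by blast
    thus "?u x = 0 & ?G x = 0"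
    proof cases
      case 2
      hence "h x = 0" "cgrad h x = 0" using h(3)[of x] Hout[of x] H by auto
      thus ?thesis by simp
    qed (use insert.prems(3)[of x] in simp)
  qed
  have "W0 p (%x. u x - ?u x) (%x. G x - ?G x)"
  proof (rule insert.IH)
    show "0 < r & locally_W0 p x r" if "(x, r) : F" for x r using insert.prems(1) that by auto
    show "sobolev_pair p (%x. u x - ?u x) (%x. G x - ?G x)" by (rule sobolev_pair_diff[OF insert.prems(2) S1 p])
    show "u x - ?u x = 0 & G x - ?G x = 0" if "x ~: closure U" for x using insert.prems(3)[OF that] by simp
    show "u x - ?u x = 0 & G x - ?G x = 0" if x: "x ~: (\<Union>(y, r)\<in>F. ball y (r / 2))" for x
    proof (cases "x : ball y (r / 2)")
      case True
      have "H x = 0" by (rule C1g_locally_constant[OF h(1), of "ball y (r / 2)" 1]) (use True h(2) in auto)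
      thus ?thesis using h(2)[of x] True H by auto
    next
      case False
      hence "u x = 0 & G x = 0" using x by (intro insert.prems(4)) (auto simp: a)
      thus ?thesis by simp
    qed
  qed
  from W0_add[OF this W1] p show ?case by simp
qed

text \<open>Membership in H^1_0 provides the integration by parts across the boundary; the
  integrability exponent of the extension is then that of \<open>y\<close> and
  \<open>g\<close>.\<close>

lemma W0_extension:
  assumes W: "W0 2 y g" and p: "1 <= p" and L: "LpV M p y" "LpV M p g"
  obtains u G where "sobolev_pair p u G" "!!x. x ~: U ==> u x = 0 & G x = 0" "AE x in M. u x = y x" "AE x in M. G x = g x"
proof -
  have ym: "y : borel_measurable M" and gm: "!!i. (%x. g x $ i) : borel_measurable M"
    using L LpV_component[OF L(2)] p by (auto simp: LpV_def)
  obtain u where u: "u : borel_measurable borel" "ALL x. x ~: U --> u x = 0" "AE x in M. u x = y x" using borel_zero_extension[OF ym] by blast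
  have "ALL i. EX v. v : borel_measurable borel & (ALL x. x ~: U --> v x = 0) & (AE x in M. v x = g x $ i)" using borel_zero_extension[OF gm] by blast
  from choice[OF this] obtain v where v: "ALL i. v i : borel_measurable borel & (ALL x. x ~: U --> v i x = 0) & (AE x in M. v i x = g x $ i)"
    by (rule exE)
  define G where "G x = (\<chi> i. v i x)" for x
  have Gm [measurable]: "G : borel_measurable borel" by (rule borel_measurable_vecI) (use v in "simp add: G_def")
  have um [measurable]: "u : borel_measurable borel" by (fact u(1))
  have G0: "G x = 0" if "x ~: U" for x using v that by (simp add: G_def vec_eq_iff)
  have "AE x in M. ALL i:UNIV. v i x = g x $ i" using v by (subst AE_finite_all) auto
  hence AEG: "AE x in M. G x = g x" by eventually_elim (simp add: G_def vec_eq_iff)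
  have mM: "f : borel_measurable M" if "f : borel_measurable borel" for f :: "real^'n => 'b::euclidean_space"
    using that by (intro measurable_restrict_space1 measurable_completion) simp
  have "sobolev_pair p u G" unfolding sobolev_pair_def
  proof (intro conjI allI impI)
    show "LpV lborel p u" "LpV lborel p G" using LpV_zero_extension[OF um _ u(3) L(1)] LpV_zero_extension[OF Gm _ AEG L(2)] u(2) G0 p by auto
    obtain R where "ALL x:U. norm x <= R" using bounded_domain by (auto simp: bounded_iff)
    thus "EX R. ALL x. R < norm x --> u x = 0 & G x = 0" using u(2) G0 by (intro exI[of _ R]) (metis not_le)
    fix phi :: "real^'n => real" and i assume phi: "C1c UNIV phi"
    have [measurable]: "phi : borel_measurable borel" "cgrad phi : borel_measurable borel" using C1c_measurable[OF phi] by auto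
    note mm = mM[OF um] mM[OF Gm] C1c_measurable(3,4)[OF phi, of U] ym gm
    have "(LINT x|lborel. u x * cgrad phi x $ i) = intO U (%x. u x * cgrad phi x $ i)"
      unfolding intO_def using u(2) open_domain by (intro lebesgue_integral_eq_lborel[symmetric]) auto
    also have "... = intO U (%x. y x * pd phi i x)"
      unfolding intO_def pd_eq_cgrad using u(3) mm by (intro integral_cong_AE) (auto elim: eventually_mono)
    also have "... = - intO U (%x. g x $ i * phi x)" by (rule integral_components_by_parts[OF W _ phi]) simp
    also have "intO U (%x. g x $ i * phi x) = intO U (%x. G x $ i * phi x)"
      unfolding intO_def using AEG mm by (intro integral_cong_AE) (auto elim: eventually_mono)
    also have "... = (LINT x|lborel. G x $ i * phi x)"
      unfolding intO_def using G0 open_domain by (intro lebesgue_integral_eq_lborel) auto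
    finally show "(LINT x|lborel. u x * cgrad phi x $ i) = - (LINT x|lborel. G x $ i * phi x)" .
  qed
  thus ?thesis using that u(2,3) G0 AEG by blast
qed

text \<open>The given approximations of \<open>y\<close> converge in L^2 only. Extension by zero
  forgets them, and localization near the Lipschitz boundary builds new ones that converge in
  L^p.\<close>

theorem W0_of_Lipschitz:
  assumes lip: "lipschitz_boundary U" and p: "1 <= p" and W: "W0 2 y g" and L: "LpV M p y" "LpV M p g"
  shows "W0 p y g"
proof -
  obtain u G where S: "sobolev_pair p u G" and out: "!!x. x ~: U ==> u x = 0 & G x = 0"
    and AE: "AE x in M. u x = y x" "AE x in M. G x = g x" by (rule W0_extension[OF W p L]) (rule that)
  have "ALL x:closure U. EX r. 0 < r & locally_W0 p x r" using locally_W0_exists[OF lip _ p] by blast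
  then obtain r where r: "!!x. x : closure U ==> 0 < r x & locally_W0 p x (r x)" by metis
  have "compact (closure U)" using bounded_domain by (simp add: compact_closure)
  then obtain D where D: "D \<subseteq> closure U" "finite D" "closure U \<subseteq> (\<Union>x\<in>D. ball x (r x / 2))"
    by (rule compactE_image[where C="closure U" and f="%x. ball x (r x / 2)"]) (use r in "force+")
  have "W0 p u G"
  proof (rule W0_of_finite_cover[of "(%x. (x, r x)) ` D"])
    show "u x = 0 & G x = 0" if "x ~: (\<Union>(y, r)\<in>(%x. (x, r x)) ` D. ball y (r / 2))" for x
    proof -
      have "x ~: closure U" using that D(3) by auto
      hence "x ~: U" using closure_subset[of U] by blast
      thus ?thesis by (rule out)
    qed
    show "u x = 0 & G x = 0" if "x ~: closure U" for x using that closure_subset[of U] by (intro out) blast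
    show "0 < s & locally_W0 p x s" if "(x, s) : (%x. (x, r x)) ` D" for x s using that r D(1) by auto
  qed (use D(2) S p in auto)
  thus ?thesis using W0_cong_AE[of p u G y g] AE L p by (auto simp: LpV_def)
qed

end

section \<open>Solvability of the regularized problems\<close>

locale elliptic = bounded_domain U + cutoff Fk p dlt
  for U :: "(real^'n) set" and Fk p dlt +
  fixes f :: "real^'n => real" and al Lam :: real
  assumes al: "0 < al" and Lam: "0 <= Lam" and f: "LpV (lebesgue_on U) 2 f"
begin

text \<open>Bounds for the root \<open>S\<close> of the matrix, so they are linear in
  \<open>xi\<close>. Symmetry is not part of the notion; where \<open>S\<close> is moved to the
  other factor, the product \<open>v*\<close> does it.\<close>

definition ell :: "(real^'n => real^'n^'n) => bool" where
  "ell S \<longleftrightarrow> (ALL i j. (%x. S x $ i $ j) : borel_measurable M) \<and>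
     (AE x in M. ALL xi. al * norm xi <= norm (S x *v xi) & norm (S x *v xi) <= Lam * norm xi)"

lemma ellD: "ell S ==> AE x in M. ALL xi. al * norm xi <= norm (S x *v xi) & norm (S x *v xi) <= Lam * norm xi"
  by (simp add: ell_def)

lemma matrix_measurable:
  fixes S :: "real^'n => real^'n^'n" and g :: "real^'n => real^'n"
  assumes "!!i j. (%x. S x $ i $ j) : borel_measurable M" and [measurable]: "g : borel_measurable M"
  shows "(%x. S x *v g x) : borel_measurable M"
proof (rule borel_measurable_vecI)
  fix i
  note [measurable] = assms(1)
  show "(%x. (S x *v g x) $ i) : borel_measurable M"
    unfolding matrix_vector_mult_def vec_lambda_beta by measurable
qed

lemma ell_measurable: "ell S ==> g : borel_measurable M ==> (%x. S x *v g x) : borel_measurable M"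
  by (rule matrix_measurable) (simp_all add: ell_def)

lemma ell_LpV:
  assumes "ell S" "LpV M r g" "0 <= r"
  shows "LpV M r (%x. S x *v g x)"
proof (rule LpV_mono[OF ell_measurable[OF assms(1) LpV_measurable[OF assms(2)]] LpV_scale[OF assms(2), of Lam]])
  show "AE x in M. norm (S x *v g x) <= norm (Lam *\<^sub>R g x)"
    using ellD[OF assms(1)] Lam by (auto simp: abs_of_nonneg)
qed fact

lemma ell_Ipow2:
  assumes "ell S" "LpV M 2 g"
  shows "Ipow M 2 (%x. S x *v g x) <= Lam^2 * Ipow M 2 g" "al^2 * Ipow M 2 g <= Ipow M 2 (%x. S x *v g x)"
proof -
  note L = ell_LpV[OF assms, simplified]
  have "AE x in M. norm (S x *v g x) powr 2 <= Lam^2 * norm (g x) powr 2 & al^2 * norm (g x) powr 2 <= norm (S x *v g x) powr 2"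
    using ellD[OF assms(1)]
  proof eventually_elim
    case (elim x)
    have "(al * norm (g x))^2 <= (norm (S x *v g x))^2" "(norm (S x *v g x))^2 <= (Lam * norm (g x))^2"
      using elim al by (auto intro!: power_mono)
    thus ?case by (simp add: power_mult_distrib powr_two)
  qed
  hence "AE x in M. norm (S x *v g x) powr 2 <= Lam^2 * norm (g x) powr 2"
    "AE x in M. al^2 * norm (g x) powr 2 <= norm (S x *v g x) powr 2" by auto
  from integral_mono_AE[OF LpV_integrable[OF L] integrable_mult_right[OF LpV_integrable[OF assms(2)]] this(1)]
    integral_mono_AE[OF integrable_mult_right[OF LpV_integrable[OF assms(2)]] LpV_integrable[OF L] this(2)]
  show "Ipow M 2 (%x. S x *v g x) <= Lam^2 * Ipow M 2 g" "al^2 * Ipow M 2 g <= Ipow M 2 (%x. S x *v g x)"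
    by (simp_all add: Ipow_def)
qed

lemma flux_aw_LpV2:
  fixes u :: "real^'n => 'b::euclidean_space"
  assumes eps: "0 < eps" and u: "LpV M 2 u"
  shows "LpV M 2 (%x. flux (aw eps k) (u x))"
proof (rule LpV_mono[OF borel_measurable_flux[OF nondec_aw[OF eps] LpV_measurable[OF u]]
      LpV_scale[OF u, of "(eps + real k ^ 2 + 1) powr ((p - 2) / 2)"]])
  show "AE x in M. norm (flux (aw eps k) (u x)) <= norm ((eps + real k ^ 2 + 1) powr ((p - 2) / 2) *\<^sub>R u x)"
    using aw_le_const[OF eps] by (auto simp: norm_flux[OF nondec_aw[OF eps]] intro!: mult_right_mono)
qed simp

text \<open>The weak equation written with the root \<open>S\<close>: both arguments of the matrix
  form are multiplied by \<open>S\<close>, so the flux is that of a radial weight and the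
  monotonicity lemmas apply pointwise.\<close>

definition state :: "(real => real) => (real^'n => real^'n^'n) => (real^'n => real) => (real^'n => real^'n) => bool" where
  "state a S y g \<longleftrightarrow> W0 2 y g \<and>
     (ALL v h. W0 2 v h --> (LINT x|M. flux a (S x *v g x) \<bullet> (S x *v h x)) = (LINT x|M. f x * v x))"

text \<open>For fixed parameters the weight lies between two positive constants, which makes the
  operator strongly monotone and Lipschitz on H^1_0.\<close>

theorem state_exists:
  assumes S: "ell S" and eps: "0 < eps"
  shows "EX y g. state (aw eps k) S y g"
proof -
  let ?V = "{w. W0 2 (fst w) (snd w)}" and ?T = "%u x. S x *v snd u x" and ?F = "flux (aw eps k)"
  define A where "A u v = (LINT x|M. ?F (S x *v snd u x) \<bullet> (S x *v snd v x))" for u v :: "(real^'n => real) \<times> (real^'n => real^'n)"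
  define l where "l v = (LINT x|M. f x * fst v x)" for v :: "(real^'n => real) \<times> (real^'n => real^'n)"
  define c0 where "c0 = eps powr ((p - 2) / 2)"
  have c0: "0 < c0" using eps by (simp add: c0_def)
  obtain L where L: "0 <= L" "!!x y::real^'n. norm (?F x - ?F y) <= L * norm (x - y)"
    using flux_aw_Lipschitz[OF eps, of k, where 'b="real^'n"] by blast
  obtain C where C: "0 <= C" "!!u g. W0 2 u g ==> Ipow M 2 u <= C * Ipow M 2 g" using Poincare_L2 by blast
  have LT: "LpV M 2 (?T u)" "LpV M 2 (%x. ?F (?T u x))" if "u : ?V" for u
    using that ell_LpV[OF S, of 2 "snd u"] flux_aw_LpV2[OF eps, of "?T u" k] by (auto dest: W0_LpV)
  note iT = Cauchy_Schwarz_integral(1)[OF LT(2) LT(1)]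
  have nrm: "sqrt (Ipow M 2 (?T u)) <= Lam * H1.nrm u" "sqrt (Ipow M 2 (fst u)) <= H1.nrm u" if u: "u : ?V" for u
  proof -
    have "Ipow M 2 (snd u) <= (H1.nrm u)^2" "Ipow M 2 (fst u) <= (H1.nrm u)^2"
      using H1.nrm_sq[OF u] ip1_self[of u] u by auto
    moreover have "Ipow M 2 (?T u) <= Lam^2 * Ipow M 2 (snd u)" using ell_Ipow2(1)[OF S, of "snd u"] u W0_LpV by auto
    ultimately have "Ipow M 2 (?T u) <= (Lam * H1.nrm u)^2" "Ipow M 2 (fst u) <= (H1.nrm u)^2"
      by (auto simp: power_mult_distrib intro: order_trans[OF _ mult_left_mono])
    thus "sqrt (Ipow M 2 (?T u)) <= Lam * H1.nrm u" "sqrt (Ipow M 2 (fst u)) <= H1.nrm u"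
      using Lam H1.nrm_nonneg[OF u] by (auto intro: real_le_lsqrt)
  qed
  have T_diff: "?T (u - v) x = ?T u x - ?T v x" for u v x by (simp add: matrix_vector_mult_diff_distrib)
  have A: "H1.bdlin (A u)" if u: "u : ?V" for u
  proof (rule H1.bdlinI)
    fix v w assume "v : ?V" "w : ?V"
    thus "A u (v + w) = A u v + A u w"
      by (simp add: A_def matrix_vector_right_distrib inner_add_right iT[OF u] Bochner_Integration.integral_add)
  next
    fix c v assume "v : ?V"
    thus "A u (c *\<^sub>R v) = c * A u v" by (simp add: A_def matrix_vector_mult_scaleR)
  next
    fix v assume v: "v : ?V"
    have "abs (A u v) <= sqrt (Ipow M 2 (%x. ?F (?T u x))) * sqrt (Ipow M 2 (?T v))"
      unfolding A_def by (rule Cauchy_Schwarz_integral(2)[OF LT(2)[OF u] LT(1)[OF v]])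
    also have "... <= sqrt (Ipow M 2 (%x. ?F (?T u x))) * (Lam * H1.nrm v)"
      by (rule mult_left_mono[OF nrm(1)[OF v]]) simp
    finally show "abs (A u v) <= (sqrt (Ipow M 2 (%x. ?F (?T u x))) * Lam) * H1.nrm v" by (simp add: mult.assoc)
  qed
  have l: "H1.bdlin l"
  proof (rule H1.bdlinI)
    fix v w assume "v : ?V" "w : ?V"
    thus "l (v + w) = l v + l w" using LpV2_mult_integrable[OF f] by (simp add: l_def distrib_left W0_LpV)
  next
    fix c v assume "v : ?V"
    thus "l (c *\<^sub>R v) = c * l v" by (simp add: l_def mult.left_commute)
  next
    fix v assume v: "v : ?V"
    have "abs (l v) <= sqrt (Ipow M 2 f) * sqrt (Ipow M 2 (fst v))"
      using Cauchy_Schwarz_integral(2)[OF f, of "fst v"] v by (auto simp: l_def W0_LpV)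
    also have "... <= sqrt (Ipow M 2 f) * H1.nrm v" by (rule mult_left_mono[OF nrm(2)[OF v]]) simp
    finally show "abs (l v) <= sqrt (Ipow M 2 f) * H1.nrm v" .
  qed
  have A_diff: "A u w - A v w = (LINT x|M. (?F (?T u x) - ?F (?T v x)) \<bullet> ?T w x)" if "u : ?V" "v : ?V" "w : ?V" for u v w
    unfolding A_def using iT[OF that(1,3)] iT[OF that(2,3)] by (simp add: inner_diff_left)
  \<comment> \<open>The factor \<open>1 + C\<close> is the price of the full norm: by Poincare it is
    controlled by the gradient part.\<close>
  have mono: "c0 * al^2 / (1 + C) * (H1.nrm (u - v))^2 <= A u (u - v) - A v (u - v)" if u: "u : ?V" and v: "v : ?V" for u v
  proof -
    have w: "u - v : ?V" by (rule H1.V_diff[OF u v])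
    hence w': "W0 2 (fst (u - v)) (snd (u - v))" by simp
    have "c0 * (norm (a - b))^2 <= (?F a - ?F b) \<bullet> (a - b)" for a b :: "real^'n"
    proof -
      have "c0 * (norm (a - b))^2 <= 1/2 * (aw eps k (norm a) + aw eps k (norm b)) * (norm (a - b))^2"
        using aw_ge_eps[OF eps, of k "norm a"] aw_ge_eps[OF eps, of k "norm b"] unfolding c0_def[symmetric]
        by (intro mult_right_mono) auto
      thus ?thesis using flux_monotone[OF nondec_aw[OF eps], of k a b] by linarith
    qed
    hence "(LINT x|M. c0 * norm (?T (u - v) x) powr 2) <= A u (u - v) - A v (u - v)"
      unfolding A_diff[OF u v w] using iT[OF u w] iT[OF v w]
      by (intro integral_mono integrable_mult_right LpV_integrable[OF LT(1)[OF w]])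
        (auto simp: inner_diff_left powr_two T_diff simp del: snd_diff)
    hence "c0 * Ipow M 2 (?T (u - v)) <= A u (u - v) - A v (u - v)" by (simp add: Ipow_def)
    moreover have "c0 * (al^2 * Ipow M 2 (snd (u - v))) <= c0 * Ipow M 2 (?T (u - v))"
      using ell_Ipow2(2)[OF S W0_LpV(2)[OF w']] c0 by (intro mult_left_mono) auto
    moreover have "(H1.nrm (u - v))^2 <= (1 + C) * Ipow M 2 (snd (u - v))"
      using H1.nrm_sq[OF w] ip1_self[OF w'] C(2)[OF w'] by (simp add: algebra_simps)
    hence "(H1.nrm (u - v))^2 / (1 + C) <= Ipow M 2 (snd (u - v))" using C(1) by (simp add: field_simps)
    hence "c0 * al^2 * ((H1.nrm (u - v))^2 / (1 + C)) <= c0 * al^2 * Ipow M 2 (snd (u - v))"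
      using c0 by (intro mult_left_mono) auto
    ultimately show ?thesis by (simp add: algebra_simps)
  qed
  have lip: "abs (A u w - A v w) <= L * Lam^2 * H1.nrm (u - v) * H1.nrm w" if u: "u : ?V" and v: "v : ?V" and w: "w : ?V" for u v w
  proof -
    have d: "u - v : ?V" by (rule H1.V_diff[OF u v])
    note LD = LpV_diff[OF LT(2)[OF u] LT(2)[OF v], simplified]
    have "Ipow M 2 (%x. ?F (?T u x) - ?F (?T v x)) <= (LINT x|M. L^2 * norm (?T (u - v) x) powr 2)"
      unfolding Ipow_def
    proof (rule integral_mono[OF LpV_integrable[OF LD] integrable_mult_right[OF LpV_integrable[OF LT(1)[OF d]]]])
      fix x show "norm (?F (?T u x) - ?F (?T v x)) powr 2 <= L^2 * norm (?T (u - v) x) powr 2"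
        using power_mono[OF L(2)[of "?T u x" "?T v x"], of 2] unfolding T_diff by (simp add: powr_two power_mult_distrib)
    qed
    also have "... = L^2 * Ipow M 2 (?T (u - v))" by (simp add: Ipow_def)
    finally have "sqrt (Ipow M 2 (%x. ?F (?T u x) - ?F (?T v x))) <= L * sqrt (Ipow M 2 (?T (u - v)))"
      using L(1) real_sqrt_le_mono by (fastforce simp: real_sqrt_mult)
    also have "... <= L * (Lam * H1.nrm (u - v))" by (rule mult_left_mono[OF nrm(1)[OF d] L(1)])
    finally have 1: "sqrt (Ipow M 2 (%x. ?F (?T u x) - ?F (?T v x))) <= L * (Lam * H1.nrm (u - v))" .
    have "abs (A u w - A v w) <= sqrt (Ipow M 2 (%x. ?F (?T u x) - ?F (?T v x))) * sqrt (Ipow M 2 (?T w))"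
      unfolding A_diff[OF u v w] by (rule Cauchy_Schwarz_integral(2)[OF LD LT(1)[OF w]])
    also have "... <= (L * (Lam * H1.nrm (u - v))) * (Lam * H1.nrm w)"
      using 1 nrm(1)[OF w] L(1) Lam H1.nrm_nonneg[OF d] by (intro mult_mono) auto
    finally show ?thesis by (simp add: power2_eq_square algebra_simps)
  qed
  have pos: "0 < c0 * al^2 / (1 + C)" using c0 al C(1) by simp
  obtain u where "u : ?V" "!!v. v : ?V ==> A u v = l v"
    by (rule H1.strongly_monotone_solvable[OF A l pos mono lip]) (assumption | rule that)+
  hence "state (aw eps k) S (fst u) (snd u)" by (auto simp: state_def A_def l_def)
  thus ?thesis by blast
qed

end

section \<open>Solvability of the regularized Hammerstein equation\<close>

locale hammerstein = elliptic U Fk p dlt f al Lam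
  for U :: "(real^'n) set" and Fk p dlt f al Lam +
  fixes K :: "real^'n => real^'n => real" and q :: real
  assumes q: "q = p / (p - 1)"
    and K_meas: "(%(x,t). K x t) : borel_measurable (lebesgue_on U \<Otimes>\<^sub>M lebesgue_on U)"
    and K_int: "integrable (lebesgue_on U \<Otimes>\<^sub>M lebesgue_on U) (%(x,t). abs (K x t) powr p)"
    and K_pos: "!!u. LpV (lebesgue_on U) q u ==> 0 <= (LINT x|lebesgue_on U. Bop U K u x * u x)"
begin

lemma q_facts: "1 < q" "q <= 2" "1 / p + 1 / q = 1" "1 < p" "(p - 1) * q = p"
  using p by (auto simp: q field_simps)

lemma L2_Lq: "LpV M 2 u ==> LpV M q u" using LpV_lower[of 2 u q] q_facts by simp

lemma Bop_measurable:
  assumes [measurable]: "u : borel_measurable M"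
  shows "Bop U K u : borel_measurable M"
proof -
  have [measurable]: "(%z. K (fst z) (snd z)) : borel_measurable (M \<Otimes>\<^sub>M M)"
    using K_meas by (simp add: case_prod_beta')
  show ?thesis unfolding Bop_def intO_def by measurable
qed

text \<open>Hoelder in the second variable; \<open>kap x\<close> is the L^r norm of the section
  \<open>K x\<close>, and Fubini puts it in L^r. The bound is pointwise in \<open>x\<close>, and
  \<open>u\<close> enters through its norm alone.\<close>

lemma Bop_bound:
  assumes r: "1 < r" "r <= p" and s: "1 < s" "1 / r + 1 / s = 1"
  shows "EX kap. LpV M r kap & (ALL x. 0 <= kap x) & (ALL u. LpV M s u -->
     (AE x in M. integrable M (%t. K x t * u t) & abs (Bop U K u x) <= kap x * Ipow M s u powr (1/s)))"
proof -
  interpret P: finite_measure "M \<Otimes>\<^sub>M M" by (rule finite_measure_pair_measure) unfold_locales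
  interpret PP: pair_sigma_finite M M ..
  have "LpV (M \<Otimes>\<^sub>M M) p (%(x, t). K x t)"
    using K_meas K_int by (simp add: LpV_def case_prod_beta')
  hence KL: "LpV (M \<Otimes>\<^sub>M M) r (%(x, t). K x t)" using P.LpV_lower r by fastforce
  hence Ki: "integrable (M \<Otimes>\<^sub>M M) (%z. norm (K (fst z) (snd z)) powr r)"
    using LpV_integrable by (fastforce simp: case_prod_beta')
  define kap where "kap x = Ipow M r (K x) powr (1/r)" for x
  have kapr: "norm (kap x) powr r = (LINT t|M. norm (K x t) powr r)" for x
    using r by (simp add: kap_def powr_powr Ipow_def)
  have Kx: "K x : borel_measurable M" if "x : space M" for x using measurable_Pair2[OF K_meas that] by simp
  have m: "(%x. Ipow M r (K x)) : borel_measurable M"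
    using borel_measurable_integrable[OF PP.integrable_fst'[OF Ki]] by (simp add: Ipow_def)
  have "LpV M r kap"
    unfolding LpV_def kapr using PP.integrable_fst'[OF Ki] m by (simp add: kap_def[abs_def])
  moreover have "AE x in M. integrable M (%t. K x t * u t) & abs (Bop U K u x) <= kap x * Ipow M s u powr (1/s)"
    if u: "LpV M s u" for u using PP.AE_integrable_fst'[OF Ki] AE_space
  proof eventually_elim
    case (elim x)
    have k: "LpV M r (K x)" using elim Kx by (simp add: LpV_def)
    note Hol = Holder_ineq[OF r(1) s k u]
    have "abs (Bop U K u x) <= (LINT t|M. abs (K x t * u t))"
      unfolding Bop_def intO_def by (rule integral_abs_bound)
    also note Hol(2)
    finally show ?case using Hol(1) by (simp add: kap_def)
  qed
  ultimately show ?thesis by (intro exI[of _ kap]) (auto simp: kap_def)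
qed

text \<open>Only a.e., since for exceptional \<open>x\<close> the section of the kernel may fail to
  be integrable against \<open>u\<close>, and such an integral has the default value 0.\<close>

lemma Bop_add:
  assumes "LpV M q u" "LpV M q v"
  shows "AE x in M. Bop U K (%t. u t + v t) x = Bop U K u x + Bop U K v x"
proof -
  have "AE x in M. integrable M (%t. K x t * u t)" if "LpV M q u" for u
    using Bop_bound[of p q] q_facts that by auto
  from this[OF assms(1)] this[OF assms(2)] show ?thesis
    by eventually_elim (simp add: Bop_def intO_def distrib_left)
qed

lemma Bop_scale: "Bop U K (%t. c * u t) x = c * Bop U K u x" by (simp add: Bop_def intO_def mult.left_commute)

lemma Bop_diff:
  assumes "LpV M q u" "LpV M q v"
  shows "AE x in M. Bop U K (%t. u t - v t) x = Bop U K u x - Bop U K v x"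
  using Bop_add[OF assms(1) LpV_scale[OF assms(2), of "-1"]] Bop_scale[of "-1" v] by simp

lemma Bop_cong_AE:
  assumes "AE x in M. u x = v x" "u : borel_measurable M" "v : borel_measurable M"
  shows "x : U ==> Bop U K u x = Bop U K v x" unfolding Bop_def intO_def
proof (rule integral_cong_AE)
  assume "x : U"
  hence [measurable]: "K x : borel_measurable M" using measurable_Pair2[OF K_meas, of x] by simp
  show "(%t. K x t * u t) : borel_measurable M" "(%t. K x t * v t) : borel_measurable M"
    using assms by measurable
  show "AE t in M. K x t * u t = K x t * v t" using assms(1) by auto
qed

lemma Bop_L2: "EX C>=0. ALL u. LpV M 2 u --> LpV M 2 (Bop U K u) & Ipow M 2 (Bop U K u) <= C * Ipow M 2 u"
proof -
  obtain kap where kap: "LpV M 2 kap" "!!x. 0 <= kap x" "!!u. LpV M 2 u ==> AE x in M. abs (Bop U K u x) <= kap x * Ipow M 2 u powr (1/2)"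
    using Bop_bound[of 2 2] p by auto
  have "LpV M 2 (Bop U K u) & Ipow M 2 (Bop U K u) <= Ipow M 2 kap * Ipow M 2 u" if u: "LpV M 2 u" for u
  proof -
    have le: "AE x in M. norm (Bop U K u x) powr 2 <= Ipow M 2 u * norm (kap x) powr 2"
      using kap(3)[OF u]
    proof eventually_elim
      case (elim x)
      have "(abs (Bop U K u x))^2 <= (kap x * Ipow M 2 u powr (1/2))^2" using elim by (rule power_mono) simp
      also have "... = Ipow M 2 u * (kap x)^2" by (simp add: power_mult_distrib powr_half_sqrt)
      finally show ?case by (simp add: powr_two)
    qed
    have i: "integrable M (%x. Ipow M 2 u * norm (kap x) powr 2)" using LpV_integrable[OF kap(1)] by simp
    have L: "LpV M 2 (Bop U K u)" by (rule LpV_bound[OF Bop_measurable[OF LpV_measurable[OF u]] i le])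
    from integral_mono_AE[OF LpV_integrable[OF L] i le] L show ?thesis by (simp add: Ipow_def mult.commute)
  qed
  thus ?thesis by (intro exI[of _ "Ipow M 2 kap"]) simp
qed

text \<open>The scalar flux is strongly monotone and Lipschitz; its inverse therefore has both
  properties too, with the constants exchanged.\<close>

lemma flux_inverse:
  assumes eps: "0 < eps"
  obtains H :: "real => real" and c L where "!!s. flux (aw eps k) (H s) = s" "0 < c" "0 < L"
    "!!s t. abs (H s - H t) <= L * abs (s - t)" "!!s t. c * (s - t)^2 <= (H s - H t) * (s - t)" "!!s. abs (H s) <= L * abs s"
proof -
  define G :: "real => real" where "G = flux (aw eps k)"
  define c0 where "c0 = eps powr ((p - 2) / 2)"
  have c0: "0 < c0" using eps by (simp add: c0_def)
  obtain L0 where L0: "0 <= L0" "!!x y::real. abs (G x - G y) <= L0 * abs (x - y)"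
    using flux_aw_Lipschitz[OF eps, of k] unfolding G_def real_norm_def[symmetric] by blast
  have mono: "c0 * (x - y)^2 <= (G x - G y) * (x - y)" for x y
  proof -
    have "c0 * (norm (x - y))^2 <= 1/2 * (aw eps k (norm x) + aw eps k (norm y)) * (norm (x - y))^2"
      using aw_ge_eps[OF eps, of k "norm x"] aw_ge_eps[OF eps, of k "norm y"] unfolding c0_def[symmetric]
      by (intro mult_right_mono) auto
    thus ?thesis using flux_monotone[OF nondec_aw[OF eps], of k x y] by (simp add: G_def)
  qed
  have "EX x. G x = s" for s
  proof -
    \<comment> \<open>The weight is at least \<open>c0\<close>, so the flux at \<open>t\<close>
      reaches \<open>abs s\<close>, and the intermediate value theorem applies on
      \<open>{-t..t}\<close>.\<close>
    define t where "t = abs s / c0"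
    have t: "0 <= t" "c0 * t = abs s" using c0 by (auto simp: t_def)
    have a: "abs s <= aw eps k t * t" using aw_ge_eps[OF eps, of k t] t c0_def mult_right_mono by metis
    have "continuous_on UNIV G" unfolding G_def by (rule continuous_on_flux[OF nondec_aw[OF eps]])
    moreover have "G (-t) <= s" "s <= G t" using a t(1) by (auto simp: G_def flux_def)
    ultimately have "G (-t) <= s" "s <= G t" "continuous_on {-t..t} G" by (auto intro: continuous_on_subset)
    thus ?thesis using IVT'[of G "-t" s t] t(1) by auto
  qed
  then obtain H where H: "!!s. G (H s) = s" by metis
  have 1: "c0 * abs (H s - H t) <= abs (s - t)" for s t
  proof (cases "H s = H t")
    case False
    have "(c0 * abs (H s - H t)) * abs (H s - H t) <= abs (s - t) * abs (H s - H t)"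
      using mono[of "H s" "H t"] abs_ge_self[of "(s - t) * (H s - H t)"] unfolding H abs_mult
      by (simp add: power2_eq_square abs_mult_self_eq mult.assoc flip: abs_mult)
    thus ?thesis using False by simp
  qed simp
  have "G 0 = 0" by (simp add: G_def flux_def)
  hence "c0 * (H 0)^2 <= 0" using mono[of "H 0" 0] by (simp add: H)
  hence "H 0 = 0" using c0 by (simp add: mult_le_0_iff)
  have 2: "abs (H s - H t) <= 1 / c0 * abs (s - t)" for s t using 1[of s t] c0 by (simp add: field_simps)
  \<comment> \<open>\<open>L0\<close> may be zero a priori; adding 1 makes the constant
    meaningful.\<close>
  have 3: "1 / (L0 + 1) * (s - t)^2 <= (H s - H t) * (s - t)" for s t
  proof -
    have nn: "0 <= (H s - H t) * (s - t)"
      using mono[of "H s" "H t"] c0 unfolding H by (smt (verit) mult.commute mult_nonneg_nonneg zero_le_power2)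
    have "(s - t)^2 = abs (G (H s) - G (H t)) * abs (s - t)" unfolding H by (simp add: power2_eq_square flip: abs_mult)
    also have "... <= (L0 + 1) * abs (H s - H t) * abs (s - t)"
      using L0(2)[of "H s" "H t"] by (intro mult_right_mono) (auto simp: distrib_right)
    also have "... = (L0 + 1) * ((H s - H t) * (s - t))" using nn by (simp add: mult.assoc abs_mult[symmetric])
    finally show ?thesis using L0(1) by (simp add: field_simps)
  qed
  show ?thesis
    by (rule that[of H "1 / (L0 + 1)" "1 / c0"]) (use H 2 3 2[of _ 0] \<open>H 0 = 0\<close> c0 L0(1) in "auto simp: G_def")
qed

definition hstate :: "(real => real) => (real^'n => real) => (real^'n => real) => bool" where
  "hstate a y z \<longleftrightarrow> LpV M 2 z & (AE x in M. z x + Bop U K (%t. flux a (y t) + flux a (z t)) x = 0)"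

text \<open>In the unknown \<open>w = F(y, z)\<close> the equation reads \<open>G\<^sup>-\<^sup>1(w - G(y)) + B w = 0\<close> with \<open>G\<close> the
  bi-Lipschitz function \<open>flux (aw eps k)\<close>, which is strongly monotone.\<close>

theorem hstate_exists:
  assumes eps: "0 < eps" and y: "LpV M 2 y"
  shows "EX z. hstate (aw eps k) y z"
proof -
  let ?V = "{u. LpV M 2 u}" and ?G = "flux (aw eps k) :: real => real"
  obtain H c L where H: "!!s. ?G (H s) = s" and c: "0 < c" and L: "0 < L"
    and lip: "!!s t. abs (H s - H t) <= L * abs (s - t)" and mono: "!!s t. c * (s - t)^2 <= (H s - H t) * (s - t)"
    and bd: "!!s. abs (H s) <= L * abs s" by (rule flux_inverse[OF eps, of k]) (rule that)
  obtain C where C: "0 <= C" "!!u. LpV M 2 u ==> LpV M 2 (Bop U K u)" "!!u. LpV M 2 u ==> Ipow M 2 (Bop U K u) <= C * Ipow M 2 u"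
    using Bop_L2 by blast
  define N where "N w x = H (w x - ?G (y x))" for w :: "real^'n => real" and x
  have Gy: "LpV M 2 (%x. ?G (y x))" by (rule flux_aw_LpV2[OF eps y])
  have "continuous_on UNIV H"
    by (rule lipschitz_on_continuous_on[where L=L], rule lipschitz_onI) (use lip L in "auto simp: dist_real_def")
  hence Hm: "H : borel_measurable borel" by (rule borel_measurable_continuous_onI)
  have N: "LpV M 2 (N w)" if w: "LpV M 2 w" for w
  proof (rule LpV_mono)
    note d = LpV_diff[OF w Gy, simplified]
    show "N w : borel_measurable M" unfolding N_def[abs_def] by (rule measurable_compose[OF LpV_measurable[OF d] Hm])
    show "LpV M 2 (%x. L *\<^sub>R (w x - ?G (y x)))" by (rule LpV_scale[OF d])
    show "AE x in M. norm (N w x) <= norm (L *\<^sub>R (w x - ?G (y x)))" using bd L by (simp add: N_def abs_mult)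
  qed simp
  define A where "A w v = (LINT x|M. (N w x + Bop U K w x) * v x)" for w v :: "real^'n => real"
  have NB: "LpV M 2 (%x. N w x + Bop U K w x)" if "LpV M 2 w" for w
    using LpV_add[OF N[OF that] C(2)[OF that]] by simp
  have nrm: "L2.nrm u = sqrt (Ipow M 2 u)" for u by (simp add: L2.nrm_def ip0_self)
  have CS: "abs (LINT x|M. u x * v x) <= sqrt (Ipow M 2 u) * L2.nrm v" if "LpV M 2 u" "LpV M 2 v" for u v
    using Cauchy_Schwarz_integral(2)[OF that] by (simp add: nrm)
  have A: "L2.bdlin (A u)" if "u : ?V" for u
  proof (rule L2.bdlinI)
    have u: "LpV M 2 u" using that by simp
    fix v w :: "real^'n => real" assume "v : ?V" "w : ?V"
    thus "A u (v + w) = A u v + A u w"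
      using LpV2_mult_integrable[OF NB[OF u]] by (simp add: A_def distrib_left)
  next
    fix c and v :: "real^'n => real" show "A u (c *\<^sub>R v) = c * A u v" by (simp add: A_def mult.left_commute)
  next
    fix v :: "real^'n => real" assume "v : ?V"
    thus "abs (A u v) <= sqrt (Ipow M 2 (%x. N u x + Bop U K u x)) * L2.nrm v"
      using CS[OF NB] that by (simp add: A_def)
  qed
  have A_diff: "A u w - A v w = (LINT x|M. (N u x - N v x) * w x) + (LINT x|M. Bop U K (u - v) x * w x)"
    if u: "LpV M 2 u" and v: "LpV M 2 v" and w: "LpV M 2 w" for u v w
  proof -
    have d: "LpV M 2 (u - v)" using LpV_diff[OF u v] by (simp add: fun_diff_def)
    have "AE x in M. Bop U K (u - v) x = Bop U K u x - Bop U K v x"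
      using Bop_diff[OF L2_Lq[OF u] L2_Lq[OF v]] by (simp add: fun_diff_def)
    hence e: "(LINT x|M. Bop U K (u - v) x * w x) = (LINT x|M. Bop U K u x * w x - Bop U K v x * w x)"
      using C(2)[OF d] C(2)[OF u] C(2)[OF v] w
      by (intro integral_cong_AE) (auto simp: LpV_def left_diff_distrib)
    show ?thesis unfolding e A_def using LpV2_mult_integrable[OF N[OF u] w] LpV2_mult_integrable[OF N[OF v] w]
        LpV2_mult_integrable[OF C(2)[OF u] w] LpV2_mult_integrable[OF C(2)[OF v] w]
      by (simp add: distrib_right left_diff_distrib)
  qed
  have monoA: "c * (L2.nrm (u - v))^2 <= A u (u - v) - A v (u - v)" if "u : ?V" "v : ?V" for u v
  proof -
    have u: "LpV M 2 u" and v: "LpV M 2 v" using that by auto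
    have d: "LpV M 2 (u - v)" using L2.V_diff[OF that] by simp
    have "c * (L2.nrm (u - v))^2 = (LINT x|M. c * norm ((u - v) x) powr 2)" by (simp add: nrm Ipow_def)
    also have "... <= (LINT x|M. (N u x - N v x) * (u - v) x)"
    proof (rule integral_mono[OF integrable_mult_right[OF LpV_integrable[OF d]]])
      show "integrable M (%x. (N u x - N v x) * (u - v) x)"
        using LpV2_mult_integrable[OF LpV_diff[OF N[OF u] N[OF v]] d] by simp
      fix x show "c * norm ((u - v) x) powr 2 <= (N u x - N v x) * (u - v) x"
        using mono[of "u x - ?G (y x)" "v x - ?G (y x)"] by (simp add: N_def powr_two)
    qed
    finally show ?thesis using A_diff[OF u v d] K_pos[OF L2_Lq[OF d]] by simp
  qed
  have lipA: "abs (A u w - A v w) <= (L + sqrt C) * L2.nrm (u - v) * L2.nrm w" if "u : ?V" "v : ?V" "w : ?V" for u v w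
  proof -
    have u: "LpV M 2 u" and v: "LpV M 2 v" and w: "LpV M 2 w" using that by auto
    have d: "LpV M 2 (u - v)" using L2.V_diff[OF that(1,2)] by simp
    note ND = LpV_diff[OF N[OF u] N[OF v], simplified]
    have "Ipow M 2 (%x. N u x - N v x) <= (LINT x|M. L^2 * norm ((u - v) x) powr 2)" unfolding Ipow_def
    proof (rule integral_mono[OF LpV_integrable[OF ND] integrable_mult_right[OF LpV_integrable[OF d]]])
      fix x show "norm (N u x - N v x) powr 2 <= L^2 * norm ((u - v) x) powr 2"
        using power_mono[OF lip[of "u x - ?G (y x)" "v x - ?G (y x)"], of 2] by (simp add: N_def powr_two power_mult_distrib)
    qed
    also have "... = L^2 * Ipow M 2 (u - v)" by (simp add: Ipow_def)
    finally have 1: "sqrt (Ipow M 2 (%x. N u x - N v x)) <= L * L2.nrm (u - v)"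
      using L real_sqrt_le_mono by (fastforce simp: real_sqrt_mult nrm)
    have 2: "sqrt (Ipow M 2 (Bop U K (u - v))) <= sqrt C * L2.nrm (u - v)"
      using real_sqrt_le_mono[OF C(3)[OF d]] by (simp add: real_sqrt_mult nrm)
    have "abs (A u w - A v w) <= sqrt (Ipow M 2 (%x. N u x - N v x)) * L2.nrm w + sqrt (Ipow M 2 (Bop U K (u - v))) * L2.nrm w"
      unfolding A_diff[OF u v w] by (intro order_trans[OF abs_triangle_ineq] add_mono CS ND C(2) d w)
    also have "... <= L * L2.nrm (u - v) * L2.nrm w + sqrt C * L2.nrm (u - v) * L2.nrm w"
      using 1 2 L2.nrm_nonneg[OF that(3)] by (intro add_mono mult_right_mono)
    finally show ?thesis by (simp add: algebra_simps)
  qed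
  have l: "L2.bdlin (%x. 0)" by (rule L2.bdlinI[where C=0]) auto
  obtain w where "w : ?V" and eq: "!!v. v : ?V ==> A w v = 0"
    by (rule L2.strongly_monotone_solvable[OF A l c monoA lipA]) (assumption | rule that)+
  hence w: "LpV M 2 w" by simp
  let ?r = "%x. N w x + Bop U K w x"
  \<comment> \<open>The residual itself is an admissible test function.\<close>
  have "Ipow M 2 ?r = 0" using eq[of ?r] NB[OF w] by (simp add: A_def flip: ip0_self) (simp add: ip0_def)
  hence AE: "AE x in M. ?r x = 0" by (rule Ipow_eq_0D[OF NB[OF w]])
  have "(%t. ?G (y t) + ?G (N w t)) = w" by (simp add: N_def H)
  thus ?thesis using AE N[OF w] by (auto simp: hstate_def)
qed

end

section \<open>Passage to the limit in the state equation\<close>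

context elliptic
begin

definition en :: "(real => real) => (real^'n => 'b::euclidean_space) => real" where
  "en a u = (LINT x|M. a (norm (u x)) * (norm (u x))^2)"

lemma aw_energy_integrable:
  assumes "0 < eps" "LpV M 2 u"
  shows "integrable M (%x. aw eps k (norm (u x)) * (norm (u x))^2)"
  using energy_integrable[OF nondec_aw[OF assms(1)] aw_le_const[OF assms(1)] assms(2)] .

lemma pw_min_energy_integrable:
  assumes "0 <= m" "LpV M 2 u"
  shows "integrable M (%x. pw p (min (norm (u x)) m) * (norm (u x))^2)"
proof (rule energy_integrable[OF modulusD(1)[OF modulus_pw_min[OF p assms(1)]] _ assms(2)])
  show "pw p (min t m) <= pw p m" if "0 <= t" for t
    using that assms(1) by (intro nondecD(1)[OF nondec_pw[OF p]]) auto
qed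

lemma en_nonneg: "0 < eps ==> 0 <= en (aw eps k) u"
  unfolding en_def using nondecD(2)[OF nondec_aw] by (intro Bochner_Integration.integral_nonneg) auto

lemma en_add:
  assumes eps: "0 < eps" "1 <= k" and L: "LpV M 2 u" "LpV M 2 v"
  shows "en (aw eps k) (%x. u x + v x) <= 4 * 8 powr ((p - 2) / 2) * (en (aw eps k) u + en (aw eps k) v)"
proof -
  note i = aw_energy_integrable[OF eps(1)]
  note Luv = LpV_add[OF L, simplified]
  have "en (aw eps k) (%x. u x + v x) <= (LINT x|M. 4 * 8 powr ((p - 2) / 2) *
      (aw eps k (norm (u x)) * (norm (u x))^2 + aw eps k (norm (v x)) * (norm (v x))^2))"
    unfolding en_def using modulus_energy_norm_add[OF modulus_aw[OF eps]]
    by (intro integral_mono i[OF Luv] integrable_mult_right Lintegrable_add i[OF L(1)] i[OF L(2)])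
  also have "... = 4 * 8 powr ((p - 2) / 2) * (en (aw eps k) u + en (aw eps k) v)"
    using i[OF L(1), of k] i[OF L(2), of k] by (simp add: en_def)
  finally show ?thesis .
qed

lemma en_le_Ipow:
  assumes eps: "0 < eps" "eps <= 1" "1 <= k" and L: "LpV M 2 u" "LpV M p u"
  shows "en (aw eps k) u <= 3 powr ((p - 2) / 2) * (Ipow M 2 u + Ipow M p u)"
proof -
  have "en (aw eps k) u <= (LINT x|M. 3 powr ((p - 2) / 2) * (norm (u x) powr 2 + norm (u x) powr p))"
    unfolding en_def
  proof (intro integral_mono aw_energy_integrable[OF eps(1) L(1)] integrable_mult_right
      Lintegrable_add LpV_integrable L)
    fix x
    have "aw eps k (norm (u x)) * (norm (u x))^2 <= 3 powr ((p - 2) / 2) * (1 + pw p (norm (u x))) * (norm (u x))^2"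
      using aw_le_pw[OF eps] by (intro mult_right_mono) auto
    also have "... = 3 powr ((p - 2) / 2) * (norm (u x) powr 2 + norm (u x) powr p)"
      using pw_energy[of "norm (u x)" p] by (simp add: algebra_simps powr_two)
    finally show "aw eps k (norm (u x)) * (norm (u x))^2 <= ..." .
  qed
  also have "... = 3 powr ((p - 2) / 2) * (Ipow M 2 u + Ipow M p u)"
    using LpV_integrable[OF L(1)] LpV_integrable[OF L(2)] by (simp add: Ipow_def)
  finally show ?thesis .
qed

lemma pw_pos: "0 < t ==> 0 < pw p t" by (simp add: pw_def)

text \<open>The weights degenerate near zero, so L^2 is controlled only up to the set where
  \<open>norm (u x) <= eta\<close>. Elsewhere the weight is at least \<open>pw p eta\<close>,
  because \<open>eta <= 1 <= k\<close>.\<close>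

lemma Ipow2_le_en:
  assumes eps: "0 < eps" "1 <= k" and eta: "0 < eta" "eta <= 1" and u: "LpV M 2 u"
  shows "Ipow M 2 u <= eta^2 * measure M (space M) + en (aw eps k) u / pw p eta"
proof -
  note i = aw_energy_integrable[OF eps(1) u, of k]
  have "Ipow M 2 u <= (LINT x|M. eta^2 + aw eps k (norm (u x)) * (norm (u x))^2 / pw p eta)"
    unfolding Ipow_def
  proof (intro integral_mono LpV_integrable u Lintegrable_add integrable_const integrable_divide i)
    fix x
    let ?t = "norm (u x)"
    have nn: "0 <= aw eps k ?t * ?t^2" using nondecD(2)[OF nondec_aw[OF eps(1)]] by simp
    show "?t powr 2 <= eta^2 + aw eps k ?t * ?t^2 / pw p eta"
    proof (cases "?t <= eta")
      case True
      hence "?t^2 <= eta^2" by (rule power_mono) simp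
      thus ?thesis using nn pw_pos[OF eta(1)] by (simp add: powr_two add_increasing2)
    next
      case False
      have "pw p eta <= pw p (min ?t (real k))"
        using False eta eps(2) by (intro nondecD(1)[OF nondec_pw[OF p]]) auto
      also have "... <= aw eps k ?t" by (rule aw_ge_pw[OF eps(1)]) simp
      finally have "pw p eta * ?t^2 <= aw eps k ?t * ?t^2" by (rule mult_right_mono) simp
      hence "?t^2 <= aw eps k ?t * ?t^2 / pw p eta" using pw_pos[OF eta(1)] by (simp add: field_simps)
      thus ?thesis by (simp add: powr_two add_increasing)
    qed
  qed
  also have "... = eta^2 * measure M (space M) + en (aw eps k) u / pw p eta" using i by (simp add: en_def)
  finally show ?thesis .
qed

text \<open>Transfers energies from \<open>S g\<close> to \<open>g\<close>. The halved argument
  matches the lower bound in \<open>flux_monotone_half\<close>, and the constant does not depend on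
  the parameters or on \<open>S\<close>.\<close>

lemma ell_energy:
  "EX C>0. ALL eps k S g. 0 < eps --> 1 <= k --> ell S --> LpV M 2 g -->
     integrable M (%x. aw eps k (norm (S x *v g x) / 2) * (norm (S x *v g x))^2) \<and>
     en (aw eps k) g <= C * (LINT x|M. aw eps k (norm (S x *v g x) / 2) * (norm (S x *v g x))^2)"
proof -
  let ?D = "8 powr ((p - 2) / 2)"
  obtain C where C: "0 < C" "!!a t. modulus ?D a ==> 0 <= t ==> a t * t^2 <= C * (a (al / 2 * t) * (al / 2 * t)^2)"
    using modulus_energy_dominates[of "al / 2" ?D] al by auto
  show ?thesis
  proof (intro exI[of _ C] conjI allI impI)
    fix eps :: real and k :: nat and S and g :: "real^'n => real^'n"
    assume A: "0 < eps" "1 <= k" "ell S" "LpV M 2 g"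
    note m = modulus_aw[OF A(1,2)]
    note LS = ell_LpV[OF A(3,4), simplified]
    have "integrable M (%x. 4 * (aw eps k (norm ((1/2) *\<^sub>R (S x *v g x))) * (norm ((1/2) *\<^sub>R (S x *v g x)))^2))"
      by (intro integrable_mult_right aw_energy_integrable[OF A(1)] LpV_scale LS)
    thus i: "integrable M (%x. aw eps k (norm (S x *v g x) / 2) * (norm (S x *v g x))^2)"
      by (simp add: power_divide)
    have "en (aw eps k) g <= (LINT x|M. C * (aw eps k (norm (S x *v g x) / 2) * (norm (S x *v g x))^2))"
      unfolding en_def
    proof (rule integral_mono_AE[OF aw_energy_integrable[OF A(1,4)] integrable_mult_right[OF i]])
      show "AE x in M. aw eps k (norm (g x)) * (norm (g x))^2 <= C * (aw eps k (norm (S x *v g x) / 2) * (norm (S x *v g x))^2)"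
        using ellD[OF A(3)]
      proof eventually_elim
        case (elim x)
        let ?s = "norm (S x *v g x)"
        have "aw eps k (norm (g x)) * (norm (g x))^2 <= C * (aw eps k (al / 2 * norm (g x)) * (al / 2 * norm (g x))^2)"
          by (rule C(2)[OF m]) simp
        also have "... <= C * (aw eps k (?s / 2) * (?s / 2)^2)"
          using elim al C(1) by (intro mult_left_mono modulus_energy_le[OF m]) auto
        also have "... <= C * (aw eps k (?s / 2) * ?s^2)"
          using C(1) modulusD(3)[OF m] by (intro mult_left_mono) (auto simp: power_divide)
        finally show ?case .
      qed
    qed
    thus "en (aw eps k) g <= C * (LINT x|M. aw eps k (norm (S x *v g x) / 2) * (norm (S x *v g x))^2)" by simp
  qed fact
qed

lemma en_Poincare: "EX C>=0. ALL eps k u g. 0 < eps --> 1 <= k --> W0 2 u g --> en (aw eps k) u <= C * en (aw eps k) g"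
proof -
  obtain C where C: "0 <= C" "ALL a A u g. modulus (8 powr ((p - 2) / 2)) a --> (ALL t>=0. a t <= A) --> W0 2 u g -->
     (LINT x|M. a (norm (u x)) * (norm (u x))^2) <= C * (LINT x|M. a (norm (g x)) * (norm (g x))^2)"
    using modular_Poincare[of "8 powr ((p - 2) / 2)"] by (elim exE conjE) (rule that)
  show ?thesis by (intro exI[of _ C] conjI allI impI)
      (use C(1) in simp, unfold en_def, rule C(2)[rule_format], rule modulus_aw, assumption+, rule aw_le_const, assumption+)
qed

text \<open>The equation is tested with its own solution; the energy in turn controls the L^2 norm
  of \<open>S g\<close> up to the measure of the domain, which closes the estimate.\<close>

lemma state_bounds:
  "EX B. ALL eps k S y g. 0 < eps --> 1 <= k --> ell S --> state (aw eps k) S y g -->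
     Ipow M 2 y <= B & Ipow M 2 g <= B & en (aw eps k) y <= B & en (aw eps k) g <= B"
proof -
  obtain C where C: "0 <= C" "!!u g. W0 2 u g ==> Ipow M 2 u <= C * Ipow M 2 g" using Poincare_L2 by blast
  obtain C2 where C2: "0 < C2" "!!eps k S g. 0 < eps ==> 1 <= k ==> ell S ==> LpV M 2 g ==>
     integrable M (%x. aw eps k (norm (S x *v g x) / 2) * (norm (S x *v g x))^2) \<and>
     en (aw eps k) g <= C2 * (LINT x|M. aw eps k (norm (S x *v g x) / 2) * (norm (S x *v g x))^2)"
    using ell_energy by blast
  obtain C3 where C3: "0 <= C3" "!!eps k u g. 0 < eps ==> 1 <= k ==> W0 2 u g ==> en (aw eps k) u <= C3 * en (aw eps k) g"
    using en_Poincare by blast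
  \<comment> \<open>With \<open>X\<close> the squared L^2 norm of \<open>S g\<close> and
    \<open>e\<close> its energy, \<open>e <= (b + X) / 2\<close> and \<open>X <= |U| + e\<close>,
    where \<open>|U|\<close> is the measure of the domain. Hence \<open>X <= X0\<close> and
    \<open>e <= e0\<close>.\<close>
  define b where "b = Ipow M 2 f * (C / al^2)"
  define X0 where "X0 = 2 * measure M (space M) + b"
  define e0 where "e0 = (b + X0) / 2"
  have b: "0 <= b" using C by (simp add: b_def)
  have nn: "0 <= X0" "0 <= e0" using b by (simp_all add: X0_def e0_def)
  let ?B = "(C + 1) * (X0 / al^2) + (C3 + 1) * (C2 * e0)"
  show ?thesis
  proof (intro exI[of _ ?B] allI impI)
    fix eps :: real and k :: nat and S y g
    assume A: "0 < eps" "1 <= k" "ell S" and st: "state (aw eps k) S y g"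
    hence W: "W0 2 y g" by (simp add: state_def)
    let ?X = "Ipow M 2 (%x. S x *v g x)" and ?e = "en (aw eps k) (%x. S x *v g x)"
    note LS = ell_LpV[OF A(3) W0_LpV(2)[OF W], simplified]
    have g: "Ipow M 2 g <= ?X / al^2" using ell_Ipow2(2)[OF A(3) W0_LpV(2)[OF W]] al by (simp add: field_simps)
    have y: "Ipow M 2 y <= C * (?X / al^2)" using C(2)[OF W] mult_left_mono[OF g C(1)] by simp
    have "(LINT x|M. flux (aw eps k) (S x *v g x) \<bullet> (S x *v g x)) = (LINT x|M. f x * y x)"
      using st W by (simp add: state_def)
    hence "?e = (LINT x|M. f x * y x)" by (simp add: en_def flux_inner_self)
    also have "... <= sqrt (Ipow M 2 f) * sqrt (Ipow M 2 y)"
      using Cauchy_Schwarz_integral(2)[OF f W0_LpV(1)[OF W]] by simp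
    also have "... <= sqrt (Ipow M 2 f) * sqrt (C * (?X / al^2))" using y by (intro mult_left_mono) auto
    also have "... = sqrt b * sqrt ?X" by (simp add: b_def flip: real_sqrt_mult)
    also have "... <= (b + ?X) / 2" using arith_geo_mean_sqrt[OF b Ipow_nonneg] by (simp add: real_sqrt_mult)
    finally have e: "?e <= (b + ?X) / 2" .
    have "?X <= measure M (space M) + ?e"
      using Ipow2_le_en[OF A(1,2) _ _ LS, of 1] by (simp add: pw_def split: if_splits)
    with e have X: "?X <= X0" by (simp add: X0_def)
    have e': "?e <= e0" using e X by (simp add: e0_def)
    have "(LINT x|M. aw eps k (norm (S x *v g x) / 2) * (norm (S x *v g x))^2) <= ?e"
      unfolding en_def using C2(2)[OF A W0_LpV(2)[OF W]] modulusD(2)[OF modulus_aw[OF A(1,2)]]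
      by (intro integral_mono aw_energy_integrable[OF A(1) LS] mult_right_mono) auto
    with e' have "C2 * (LINT x|M. aw eps k (norm (S x *v g x) / 2) * (norm (S x *v g x))^2) <= C2 * e0"
      using C2(1) by (intro mult_left_mono) auto
    hence eg: "en (aw eps k) g <= C2 * e0" using C2(2)[OF A W0_LpV(2)[OF W]] by linarith
    hence ey: "en (aw eps k) y <= C3 * (C2 * e0)"
      using C3(2)[OF A(1,2) W] mult_left_mono[OF eg C3(1)] by linarith
    have q: "?X / al^2 <= X0 / al^2" by (rule divide_right_mono[OF X]) simp
    have "0 <= C * (X0 / al^2)" "0 <= X0 / al^2" "0 <= C3 * (C2 * e0)" "0 <= C2 * e0" using C(1) C2(1) C3(1) nn by auto
    moreover have "C * (?X / al^2) <= C * (X0 / al^2)" by (rule mult_left_mono[OF q C(1)])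
    ultimately show "Ipow M 2 y <= ?B & Ipow M 2 g <= ?B & en (aw eps k) y <= ?B & en (aw eps k) g <= ?B"
      using g y q eg ey unfolding distrib_right by linarith
  qed
qed

lemma LpV_of_truncated_energy:
  fixes u :: "real^'n => 'b::euclidean_space"
  assumes u: "LpV M 2 u" and B: "!!m::nat. (LINT x|M. pw p (min (norm (u x)) (real m)) * (norm (u x))^2) <= B"
  shows "LpV M p u"
proof -
  let ?F = "%(m::nat) x. pw p (min (norm (u x)) (real m)) * (norm (u x))^2"
  have i: "integrable M (?F m)" for m by (rule pw_min_energy_integrable[OF _ u]) simp
  have mo: "?F m x <= ?F n x" if "m <= n" for m n x
    using that by (intro mult_right_mono nondecD(1)[OF nondec_pw[OF p]]) auto
  have inc: "incseq (%m. (LINT x|M. ?F m x))" by (intro incseq_SucI integral_mono i mo) simp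
  obtain l where l: "(%m. (LINT x|M. ?F m x)) ----> l" using incseq_convergent[OF inc, of B] B by blast
  have lim: "(%m. ?F m x) ----> norm (u x) powr p" for x
  proof (rule tendsto_eventually)
    obtain N :: nat where "norm (u x) <= real N" using real_arch_simple by blast
    thus "eventually (%m. ?F m x = norm (u x) powr p) sequentially"
      by (intro eventually_sequentiallyI[of N]) (auto simp: min_absorb1 pw_energy)
  qed
  have "integrable M (%x. norm (u x) powr p)" by (rule integrable_monotone_convergence[OF i _ _ l])
      (use lim mo LpV_measurable[OF u] in "auto simp: mono_def")
  thus ?thesis using LpV_measurable[OF u] by (simp add: LpV_def)
qed

section \<open>The limit equation\<close>

definition pstate :: "(real^'n => real^'n^'n) => (real^'n => real) => (real^'n => real^'n) => bool" where
  "pstate S y g \<longleftrightarrow> W0 p y g \<and>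
     (ALL v h. W0 p v h --> (LINT x|M. flux (pw p) (S x *v g x) \<bullet> (S x *v h x)) = (LINT x|M. f x * v x))"

lemma pform_bound:
  fixes xi eta :: "real^'n"
  assumes "norm (A *v xi) <= Lam * norm xi" "norm (A *v eta) <= Lam * norm eta"
  shows "abs (flux (pw p) (A *v xi) \<bullet> (A *v eta)) <= Lam powr p * norm (xi, eta) powr p"
proof -
  let ?N = "norm (xi, eta)"
  have N: "norm xi <= ?N" "norm eta <= ?N" using norm_fst_le[of xi eta] norm_snd_le[of eta xi] by simp_all
  have le: "norm (A *v xi) <= Lam * ?N" "norm (A *v eta) <= Lam * ?N"
    using assms mult_left_mono[OF N(1) Lam] mult_left_mono[OF N(2) Lam] by linarith+
  have "abs (flux (pw p) (A *v xi) \<bullet> (A *v eta)) <= norm (flux (pw p) (A *v xi)) * norm (A *v eta)" by (rule Cauchy_Schwarz_ineq2)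
  also have "... <= (Lam * ?N) powr (p - 1) * (Lam * ?N)"
    unfolding pw_flux_tendsto_norm_le[OF p] using le Lam p by (intro mult_mono powr_mono2) auto
  also have "... = (Lam * ?N) powr p"
    using Lam p by (cases "Lam * ?N = 0") (auto simp: powr_mult_base mult.commute)
  also have "... = Lam powr p * ?N powr p" using Lam by (simp add: powr_mult)
  finally show ?thesis .
qed

lemma LpV_Pair:
  fixes u :: "real^'n => 'b::euclidean_space" and v :: "real^'n => 'c::euclidean_space"
  assumes L: "LpV M p u" "LpV M p v"
  shows "LpV M p (%x. (u x, v x))" "Ipow M p (%x. (u x, v x)) <= 2 powr p * (Ipow M p u + Ipow M p v)"
proof -
  let ?w = "%x. 2 powr p * (norm (u x) powr p + norm (v x) powr p)"
  have i: "integrable M ?w" using LpV_integrable[OF L(1)] LpV_integrable[OF L(2)] by simp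
  have le: "norm (u x, v x) powr p <= ?w x" for x
  proof -
    have "norm (u x, v x) powr p <= (norm (u x) + norm (v x)) powr p"
      using norm_Pair_le[of "u x" "v x"] p by (intro powr_mono2) auto
    also have "... <= ?w x" using p by (intro powr_add_le) auto
    finally show ?thesis .
  qed
  have m: "(%x. (u x, v x)) : borel_measurable M" using L[THEN LpV_measurable] by (rule borel_measurable_Pair)
  show P: "LpV M p (%x. (u x, v x))" by (rule LpV_bound[OF m i]) (use le in auto)
  show "Ipow M p (%x. (u x, v x)) <= 2 powr p * (Ipow M p u + Ipow M p v)"
    using integral_mono[OF LpV_integrable[OF P] i le] LpV_integrable[OF L(1)] LpV_integrable[OF L(2)] by (simp add: Ipow_def)
qed

text \<open>The form is an integral functional of p-growth in the single variable
  \<open>(g, h)\<close>, so continuity in both arguments comes at once.\<close>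

lemma pform_tendsto:
  assumes S: "ell S" and L: "LpV M p g" "LpV M p h" "!!n. LpV M p (gs n)" "!!n. LpV M p (hs n)"
    and lim: "(%n. Ipow M p (%x. gs n x - g x)) ----> 0" "(%n. Ipow M p (%x. hs n x - h x)) ----> 0"
  shows "(%n. (LINT x|M. flux (pw p) (S x *v gs n x) \<bullet> (S x *v hs n x))) ---->
    (LINT x|M. flux (pw p) (S x *v g x) \<bullet> (S x *v h x))"
proof -
  let ?F = "%x (w::(real^'n) \<times> (real^'n)). flux (pw p) (S x *v fst w) \<bullet> (S x *v snd w)"
  have meas: "(%x. ?F x (u x, v x)) : borel_measurable M" if "LpV M p u" "LpV M p v" for u v
    using borel_measurable_flux[OF nondec_pw[OF p] ell_measurable[OF S LpV_measurable[OF that(1)]]]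
      ell_measurable[OF S LpV_measurable[OF that(2)]] by (simp add: borel_measurable_inner)
  have "(%n. (LINT x|M. ?F x (gs n x, hs n x))) ----> (LINT x|M. ?F x (g x, h x))"
  proof (rule integral_continuous_Lp[where us="%n x. (gs n x, hs n x)" and u="%x. (g x, h x)" and p=p
        and C="Lam powr p" and v="%_. 0" and F="?F"])
    show "0 < p" using p by simp
    show "LpV M p (%x. (g x, h x))" "!!n. LpV M p (%x. (gs n x, hs n x))" using LpV_Pair(1) L by auto
    have p0: "0 <= p" using p by simp
    have "(%n. 2 powr p * (Ipow M p (%x. gs n x - g x) + Ipow M p (%x. hs n x - h x))) ----> 2 powr p * (0 + 0)"
      by (intro tendsto_intros lim)
    hence "(%n. 2 powr p * (Ipow M p (%x. gs n x - g x) + Ipow M p (%x. hs n x - h x))) ----> 0" by simp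
    thus "(%n. Ipow M p (%x. (gs n x, hs n x) - (g x, h x))) ----> 0"
      by (rule tendsto_sandwich[OF _ _ tendsto_const, rotated 2])
        (use LpV_Pair(2)[OF LpV_diff[OF L(3) L(1) p0] LpV_diff[OF L(4) L(2) p0]] in auto)
    show "!!n. (%x. ?F x (gs n x, hs n x)) : borel_measurable M" "(%x. ?F x (g x, h x)) : borel_measurable M"
      using meas L by auto
    have "continuous_on UNIV (?F x)" for x
    proof -
      have 1: "continuous_on UNIV (%w::(real^'n) \<times> (real^'n). S x *v fst w)"
        and 2: "continuous_on UNIV (%w::(real^'n) \<times> (real^'n). S x *v snd w)"
        by (intro linear_continuous_on_compose[OF _ matrix_vector_mul_linear] continuous_intros)+
      show ?thesis
        by (intro continuous_on_inner 2 continuous_on_compose2[OF continuous_on_flux[OF nondec_pw[OF p]] 1]) auto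
    qed
    thus "AE x in M. continuous_on UNIV (?F x)" by simp
    show "AE x in M. ALL w. abs (?F x w) <= Lam powr p * norm w powr p + 0" using ellD[OF S]
    proof eventually_elim
      case (elim x)
      thus ?case using pform_bound[of "S x"] by auto
    qed
  qed simp
  thus ?thesis by simp
qed

lemma pform_integrable:
  assumes S: "ell S" and L: "LpV M p g" "LpV M p h"
  shows "integrable M (%x. flux (pw p) (S x *v g x) \<bullet> (S x *v h x))"
proof (rule Lintegrable_bound[OF integrable_mult_right[OF LpV_integrable[OF LpV_Pair(1)[OF L]]]])
  show "(%x. flux (pw p) (S x *v g x) \<bullet> (S x *v h x)) : borel_measurable M"
    using borel_measurable_flux[OF nondec_pw[OF p] ell_measurable[OF S LpV_measurable[OF L(1)]]]
      ell_measurable[OF S LpV_measurable[OF L(2)]] by simp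
  show "AE x in M. norm (flux (pw p) (S x *v g x) \<bullet> (S x *v h x)) <= norm (Lam powr p * norm (g x, h x) powr p)"
    using ellD[OF S]
  proof eventually_elim
    case (elim x)
    thus ?case using pform_bound[of "S x" "g x" "h x"] by simp
  qed
qed

lemma source_tendsto:
  assumes "LpV M p v" "!!n. LpV M p (vs n)" "(%n. Ipow M p (%x. vs n x - v x)) ----> 0"
  shows "(%n. (LINT x|M. f x * vs n x)) ----> (LINT x|M. f x * v x)"
proof -
  have p2: "2 <= p" "0 <= p" using p by auto
  have L: "LpV M 2 u" if "LpV M p u" for u :: "real^'n => real" using LpV_lower[OF that, of 2] p by simp
  have "(%n. Ipow M 2 (%x. vs n x - v x)) ----> 0"
    by (rule Ipow_tendsto_lower[OF LpV_diff[OF assms(2,1) p2(2)] _ p2(1) assms(3)]) simp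
  hence "(%n. ip0 (vs n - v) (vs n - v)) ----> 0" by (simp add: ip0_self fun_diff_def)
  from L2.ip_tendsto[OF _ _ _ this, of f] show ?thesis using L assms f by (simp add: ip0_def mult.commute)
qed

text \<open>Testing with the difference makes the integral of a nonnegative monotonicity term
  vanish; its lower bound by the energy of the difference forces the gradients, and by Poincare the
  functions, to agree.\<close>

lemma pstate_unique:
  assumes S: "ell S" and y: "pstate S y g" and y': "pstate S y' g'"
  shows "AE x in M. y x = y' x" "AE x in M. g x = g' x"
proof -
  have p0: "0 <= p" using p by simp
  have W: "W0 p y g" "W0 p y' g'" using y y' by (auto simp: pstate_def)
  let ?d = "%x. g x - g' x"
  have Wd: "W0 p (%x. y x - y' x) ?d" by (rule W0_diff[OF W p0])
  have Ld: "LpV M p ?d" by (rule W0_LpV(2)[OF Wd])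
  have e: "(LINT x|M. flux (pw p) (S x *v g x) \<bullet> (S x *v ?d x)) = (LINT x|M. flux (pw p) (S x *v g' x) \<bullet> (S x *v ?d x))"
    using y y' Wd by (simp add: pstate_def)
  note i = pform_integrable[OF S W0_LpV(2)[OF W(1)] Ld] pform_integrable[OF S W0_LpV(2)[OF W(2)] Ld]
  let ?G = "%x. (flux (pw p) (S x *v g x) - flux (pw p) (S x *v g' x)) \<bullet> (S x *v g x - S x *v g' x)"
  have G: "?G x = flux (pw p) (S x *v g x) \<bullet> (S x *v ?d x) - flux (pw p) (S x *v g' x) \<bullet> (S x *v ?d x)" for x
    by (simp add: matrix_vector_mult_diff_distrib inner_diff_left)
  have "integrable M ?G" "(LINT x|M. ?G x) = 0" unfolding G using i e by auto
  moreover have "AE x in M. 0 <= ?G x" by (rule AE_I2, rule flux_monotone_nonneg[OF nondec_pw[OF p]])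
  ultimately have "AE x in M. ?G x = 0" using integral_nonneg_eq_0_iff_AE[of M ?G] by simp
  thus g: "AE x in M. g x = g' x" using ellD[OF S]
  proof eventually_elim
    case (elim x)
    let ?D = "S x *v g x - S x *v g' x"
    have "1/2 * pw p (norm ?D / 2) * (norm ?D)^2 <= 0"
      using flux_monotone_half[OF nondec_pw[OF p], of "S x *v g x" "S x *v g' x"] elim(1) by linarith
    hence "?D = 0" using pw_pos[of "norm ?D / 2"] by (cases "?D = 0") (simp_all add: mult_le_0_iff)
    hence "S x *v ?d x = 0" by (simp add: matrix_vector_mult_diff_distrib)
    hence "al * norm (?d x) <= 0" using elim(2)[rule_format, of "?d x"] by simp
    thus ?case using al by (simp add: mult_le_0_iff)
  qed
  have W2: "W0 2 (%x. y x - y' x) ?d" using W0_lower[OF Wd, of 2] p by simp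
  obtain C where "Ipow M 2 (%x. y x - y' x) <= C * Ipow M 2 ?d" using Poincare_L2 W2 by blast
  moreover have "Ipow M 2 ?d = Ipow M 2 (%x. 0::real^'n)"
    by (rule Ipow_cong_AE) (use g W0_LpV(2)[OF W2] in "auto dest: LpV_measurable")
  moreover have "Ipow M 2 (%x. 0::real^'n) = 0" by (simp add: Ipow_def)
  ultimately have "Ipow M 2 (%x. y x - y' x) <= 0" by simp
  hence "Ipow M 2 (%x. y x - y' x) = 0" by (rule antisym) (rule Ipow_nonneg)
  from Ipow_eq_0D[OF W0_LpV(1)[OF W2] this] show "AE x in M. y x = y' x" by simp
qed

end

section \<open>Sequences of regularized states\<close>

context elliptic
begin

text \<open>The parameter restrictions hold from the first index on, so that the uniform estimates
  apply to every term. The coefficients converge a.e., a property that passes to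
  subsequences.\<close>

definition approx :: "(nat => real) => (nat => nat) => (nat => real^'n => real^'n^'n) => (real^'n => real^'n^'n)
    => (nat => real^'n => real) => (nat => real^'n => real^'n) => bool" where
  "approx epss ks Ss S ys gs \<longleftrightarrow> (ALL n. 0 < epss n & epss n <= 1 & 1 <= ks n) & epss ----> 0 \<and>
     filterlim ks at_top sequentially & (ALL n. ell (Ss n)) & ell S \<and>
     (AE x in M. ALL i j. (%n. Ss n x $ i $ j) ----> S x $ i $ j) \<and>
     (ALL n. state (aw (epss n) (ks n)) (Ss n) (ys n) (gs n))"

lemma approxD:
  assumes "approx epss ks Ss S ys gs"
  shows "0 < epss n" "epss n <= 1" "1 <= ks n" "epss ----> 0" "filterlim ks at_top sequentially" "ell (Ss n)" "ell S"
    "AE x in M. ALL i j. (%n. Ss n x $ i $ j) ----> S x $ i $ j" "state (aw (epss n) (ks n)) (Ss n) (ys n) (gs n)"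
    "W0 2 (ys n) (gs n)" using assms by (auto simp: approx_def state_def)

lemma approx_subseq:
  assumes a: "approx epss ks Ss S ys gs" and r: "strict_mono r"
  shows "approx (%n. epss (r n)) (%n. ks (r n)) (%n. Ss (r n)) S (%n. ys (r n)) (%n. gs (r n))"
  unfolding approx_def
proof (intro conjI allI)
  note r' = filterlim_subseq[OF r]
  show "(%n. epss (r n)) ----> 0" by (rule filterlim_compose[OF approxD(4)[OF a] r'])
  show "filterlim (%n. ks (r n)) at_top sequentially" by (rule filterlim_compose[OF approxD(5)[OF a] r'])
  show "AE x in M. ALL i j. (%n. Ss (r n) x $ i $ j) ----> S x $ i $ j" using approxD(8)[OF a]
  proof eventually_elim
    case (elim x)
    thus ?case by (auto intro!: filterlim_compose[OF _ r'])
  qed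
qed (use approxD[OF a] in auto)

text \<open>The functionals against which weak limits are tested: the first term carries the flux of
  a test function, the second the source.\<close>

definition lf :: "(real^'n => real^'n) => (real^'n => real) => (real^'n => real) \<times> (real^'n => real^'n) => real" where
  "lf P u v = (LINT x|M. P x \<bullet> snd v x) - (LINT x|M. u x * fst v x)"

lemma lf_bdlin:
  assumes P: "LpV M 2 P" and u: "LpV M 2 u"
  shows "H1.bdlin (lf P u)"
proof (rule H1.bdlinI)
  note i = Cauchy_Schwarz_integral(1)[OF P] LpV2_mult_integrable[OF u]
  fix v w assume "v : {w. W0 2 (fst w) (snd w)}" "w : {w. W0 2 (fst w) (snd w)}"
  hence "LpV M 2 (fst v)" "LpV M 2 (snd v)" "LpV M 2 (fst w)" "LpV M 2 (snd w)" by (auto dest: W0_LpV)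
  thus "lf P u (v + w) = lf P u v + lf P u w" by (simp add: lf_def inner_add_right distrib_left i)
next
  fix c and v :: "(real^'n => real) \<times> (real^'n => real^'n)"
  show "lf P u (c *\<^sub>R v) = c * lf P u v" by (simp add: lf_def mult.left_commute right_diff_distrib)
next
  fix v assume v: "v : {w. W0 2 (fst w) (snd w)}"
  hence L: "LpV M 2 (fst v)" "LpV M 2 (snd v)" by (auto dest: W0_LpV)
  have "Ipow M 2 (snd v) <= (H1.nrm v)^2" "Ipow M 2 (fst v) <= (H1.nrm v)^2"
    using H1.nrm_sq[OF v] ip1_self[of v] v by auto
  hence n: "sqrt (Ipow M 2 (snd v)) <= H1.nrm v" "sqrt (Ipow M 2 (fst v)) <= H1.nrm v"
    using H1.nrm_nonneg[OF v] by (auto intro: real_le_lsqrt)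
  have "abs (lf P u v) <= sqrt (Ipow M 2 P) * sqrt (Ipow M 2 (snd v)) + sqrt (Ipow M 2 u) * sqrt (Ipow M 2 (fst v))"
    using Cauchy_Schwarz_integral(2)[OF P L(2)] Cauchy_Schwarz_integral(2)[OF u L(1)] unfolding lf_def by simp
  also have "... <= sqrt (Ipow M 2 P) * H1.nrm v + sqrt (Ipow M 2 u) * H1.nrm v"
    using n by (intro add_mono mult_left_mono) auto
  finally show "abs (lf P u v) <= (sqrt (Ipow M 2 P) + sqrt (Ipow M 2 u)) * H1.nrm v" by (simp add: algebra_simps)
qed

lemma norm_vector_matrix_mult_le:
  fixes A :: "real^'n^'n"
  assumes "!!xi. norm (A *v xi) <= Lam * norm xi"
  shows "norm (F v* A) <= Lam * norm F"
proof (cases "F v* A = 0")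
  case False
  have "(norm (F v* A))^2 = F \<bullet> (A *v (F v* A))" using dot_lmul_matrix[of F A "F v* A"] by (simp add: power2_norm_eq_inner)
  also have "... <= norm F * norm (A *v (F v* A))" by (rule norm_cauchy_schwarz)
  also have "... <= norm F * (Lam * norm (F v* A))" by (intro mult_left_mono assms) simp
  finally show ?thesis using False by (simp add: power2_eq_square mult.commute)
qed (use Lam in simp)

lemma vector_matrix_measurable:
  assumes "ell S" "F : borel_measurable M"
  shows "(%x. F x v* S x) : borel_measurable M"
proof (rule borel_measurable_vecI)
  fix i
  have [measurable]: "(%x. S x $ j $ i) : borel_measurable M" "(%x. F x $ j) : borel_measurable M" for j
    using assms by (simp_all add: ell_def borel_measurable_vec_nth')
  show "(%x. (F x v* S x) $ i) : borel_measurable M"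
    unfolding vector_matrix_mult_def vec_lambda_beta by measurable
qed

text \<open>A test gradient is bounded, so its fluxes are bounded uniformly in \<open>n\<close> and
  converge a.e., hence in L^2. With the matrix transposed onto the flux, weak convergence of the
  bare gradients \<open>gs n\<close> is enough.\<close>

lemma test_flux_tendsto:
  assumes a: "approx epss ks Ss S ys gs" and phi: "C1c U phi"
  defines "Pn \<equiv> %n x. flux (aw (epss n) (ks n)) (Ss n x *v cgrad phi x) v* Ss n x"
    and "P \<equiv> %x. flux (pw p) (S x *v cgrad phi x) v* S x"
  shows "LpV M 2 P" "!!n. LpV M 2 (Pn n)" "(%n. Ipow M 2 (%x. Pn n x - P x)) ----> 0"
proof -
  note D = approxD[OF a]
  obtain B where B: "0 <= B" "!!x. norm (cgrad phi x) <= B" using C1c_bounded[OF phi] by blast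
  define R where "R = Lam * B"
  define R2 where "R2 = Lam * (3 powr ((p - 2) / 2) * (1 + pw p R) * R)"
  have R: "0 <= R" using Lam B by (simp add: R_def)
  note G = C1c_measurable(4)[OF phi, of U]
  have mn: "Pn n : borel_measurable M" for n
    unfolding Pn_def by (intro vector_matrix_measurable D borel_measurable_flux nondec_aw ell_measurable G)
  have m: "P : borel_measurable M"
    unfolding P_def by (intro vector_matrix_measurable D borel_measurable_flux nondec_pw p ell_measurable G)
  have bdn: "AE x in M. norm (Pn n x) <= R2" for n using ellD[OF D(6), of n]
  proof eventually_elim
    case (elim x)
    let ?t = "norm (Ss n x *v cgrad phi x)"
    have t: "?t <= R" unfolding R_def using elim mult_left_mono[OF B(2) Lam] order_trans by blast
    have "aw (epss n) (ks n) ?t <= 3 powr ((p - 2) / 2) * (1 + pw p ?t)" by (rule aw_le_pw[OF D(1-3)]) simp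
    also have "... <= 3 powr ((p - 2) / 2) * (1 + pw p R)"
      using nondecD(1)[OF nondec_pw[OF p] _ t] by (intro mult_left_mono) auto
    finally have "aw (epss n) (ks n) ?t * ?t <= 3 powr ((p - 2) / 2) * (1 + pw p R) * R"
      using t nondecD(2)[OF nondec_pw[OF p] R] by (intro mult_mono) auto
    hence "Lam * norm (flux (aw (epss n) (ks n)) (Ss n x *v cgrad phi x)) <= R2"
      unfolding R2_def norm_flux[OF nondec_aw[OF D(1)]] using Lam by (intro mult_left_mono) auto
    thus ?case unfolding Pn_def using norm_vector_matrix_mult_le[of "Ss n x"] elim by (meson order_trans)
  qed
  have lim: "AE x in M. (%n. Pn n x) ----> P x" using D(8)
  proof eventually_elim
    case (elim x)
    have Sx: "(%n. Ss n x) ----> S x" using elim by (intro vec_tendstoI) auto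
    have "(%n. Ss n x *v cgrad phi x) ----> S x *v cgrad phi x"
      by (rule vec_tendstoI) (auto simp: matrix_vector_mult_def intro!: tendsto_intros Sx)
    hence F: "(%n. flux (aw (epss n) (ks n)) (Ss n x *v cgrad phi x)) ----> flux (pw p) (S x *v cgrad phi x)"
      by (rule flux_aw_tendsto[OF D(1,4,5)])
    show ?case unfolding Pn_def P_def
      by (rule vec_tendstoI) (auto simp: vector_matrix_mult_def intro!: tendsto_intros Sx F)
  qed
  have bd: "AE x in M. norm (P x) <= R2"
  proof -
    have "AE x in M. ALL n. norm (Pn n x) <= R2" using bdn by (simp add: AE_all_countable)
    with lim show ?thesis
    proof eventually_elim
      case (elim x)
      thus ?case using LIMSEQ_le_const2[OF tendsto_norm[OF elim(1)]] by blast
    qed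
  qed
  show P: "LpV M 2 P" by (rule LpV_bounded[OF m bd]) simp
  show "LpV M 2 (Pn n)" for n by (rule LpV_bounded[OF mn bdn]) simp
  show "(%n. Ipow M 2 (%x. Pn n x - P x)) ----> 0"
  proof (rule Ipow_tendsto_dominated[where w="%_. R2^2", OF _ mn m _ lim])
    have "AE x in M. ALL n. norm (Pn n x) <= R2" using bdn by (simp add: AE_all_countable)
    thus "AE x in M. ALL n. norm (Pn n x) powr 2 <= R2^2" by eventually_elim (simp add: powr_two power_mono)
  qed simp_all
qed

text \<open>The monotonicity integrand \<open>T n\<close> is evaluated through the equation tested
  with \<open>ys n - phi\<close>; replacing the n-th test flux by its limit costs the error
  \<open>e n\<close>. Nonnegativity of \<open>T n\<close> leads to Minty's argument, its lower bound
  by energies to strong convergence.\<close>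

lemma test_inequality:
  assumes a: "approx epss ks Ss S ys gs" and phi: "C1c U phi"
  defines "P \<equiv> %x. flux (pw p) (S x *v cgrad phi x) v* S x"
    and "T \<equiv> %n x. (flux (aw (epss n) (ks n)) (Ss n x *v gs n x) - flux (aw (epss n) (ks n)) (Ss n x *v cgrad phi x))
          \<bullet> (Ss n x *v gs n x - Ss n x *v cgrad phi x)"
  shows "!!n. integrable M (T n)"
    "EX e. e ----> 0 & (ALL n. integral\<^sup>L M (T n) <= lf P f (phi, cgrad phi) - lf P f (ys n, gs n) + e n)"
proof -
  note D = approxD[OF a]
  define Pn where "Pn n x = flux (aw (epss n) (ks n)) (Ss n x *v cgrad phi x) v* Ss n x" for n x
  have P_eq: "flux (pw p) (S x *v cgrad phi x) v* S x = P x" for x by (simp add: P_def)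
  note t = test_flux_tendsto[OF a phi, unfolded P_eq, folded Pn_def]
  have Lphi: "LpV M 2 phi" "LpV M 2 (cgrad phi)" using C1c_LpV[OF phi] by auto
  obtain B where "ALL eps k S y g. 0 < eps --> 1 <= k --> ell S --> state (aw eps k) S y g -->
     Ipow M 2 y <= B & Ipow M 2 g <= B & en (aw eps k) y <= B & en (aw eps k) g <= B"
    using state_bounds by (rule exE)
  hence B: "Ipow M 2 (gs n) <= B" for n using D(1)[of n] D(3)[of n] D(6)[of n] D(9)[of n] by blast
  let ?B' = "2 powr 2 * (B + Ipow M 2 (cgrad phi))"
  let ?e = "%n. sqrt (Ipow M 2 (%x. Pn n x - P x)) * sqrt ?B'"
  have "?e ----> sqrt 0 * sqrt ?B'" by (intro tendsto_mult tendsto_real_sqrt tendsto_const) (rule t(3))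
  hence e: "?e ----> 0" by simp
  have main: "integrable M (T n) & integral\<^sup>L M (T n) <= lf P f (phi, cgrad phi) - lf P f (ys n, gs n) + ?e n" for n
  proof -
    note Lg = W0_LpV(2)[OF D(10)[of n]] and Ly = W0_LpV(1)[OF D(10)[of n]]
    have Wd: "W0 2 (%x. ys n x - phi x) (%x. gs n x - cgrad phi x)" by (rule W0_diff[OF D(10) W0_C1c[OF phi]]) auto
    let ?d = "%x. gs n x - cgrad phi x"
    note Ld = W0_LpV(2)[OF Wd]
    note LSd = ell_LpV[OF D(6)[of n] Ld, simplified]
    let ?F = "%x. flux (aw (epss n) (ks n)) (Ss n x *v gs n x)"
    have i1: "integrable M (%x. ?F x \<bullet> (Ss n x *v ?d x))"
      by (rule Cauchy_Schwarz_integral(1)[OF flux_aw_LpV2[OF D(1) ell_LpV[OF D(6) Lg, simplified]] LSd])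
    have i2: "integrable M (%x. Pn n x \<bullet> ?d x)" "integrable M (%x. P x \<bullet> ?d x)"
      by (rule Cauchy_Schwarz_integral(1)[OF t(2) Ld], rule Cauchy_Schwarz_integral(1)[OF t(1) Ld])
    have T: "T n = (%x. ?F x \<bullet> (Ss n x *v ?d x) - Pn n x \<bullet> ?d x)"
      by (simp add: T_def Pn_def fun_eq_iff dot_lmul_matrix matrix_vector_mult_diff_distrib inner_diff_left)
    have "abs (LINT x|M. (Pn n x - P x) \<bullet> ?d x) <= sqrt (Ipow M 2 (%x. Pn n x - P x)) * sqrt (Ipow M 2 ?d)"
      by (rule Cauchy_Schwarz_integral(2)[OF LpV_diff[OF t(2,1)] Ld]) simp
    also have "Ipow M 2 ?d <= ?B'"
      using Ipow_add_le[OF Lg LpV_scale[OF Lphi(2), of "-1"]] Ipow_scale[of M 2 "-1" "cgrad phi"] B[of n]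
      by simp
    hence "sqrt (Ipow M 2 (%x. Pn n x - P x)) * sqrt (Ipow M 2 ?d) <= ?e n" by (intro mult_left_mono) auto
    finally have "abs ((LINT x|M. Pn n x \<bullet> ?d x) - (LINT x|M. P x \<bullet> ?d x)) <= ?e n"
      using i2 by (simp add: inner_diff_left)
    moreover have "integral\<^sup>L M (T n) = (LINT x|M. f x * (ys n x - phi x)) - (LINT x|M. Pn n x \<bullet> ?d x)"
      unfolding T using i1 i2(1) D(9)[of n] Wd by (simp add: state_def)
    moreover have "(LINT x|M. f x * (ys n x - phi x)) = (LINT x|M. f x * ys n x) - (LINT x|M. f x * phi x)"
      using LpV2_mult_integrable[OF f Ly] LpV2_mult_integrable[OF f Lphi(1)] by (simp add: right_diff_distrib)
    moreover have "(LINT x|M. P x \<bullet> ?d x) = (LINT x|M. P x \<bullet> gs n x) - (LINT x|M. P x \<bullet> cgrad phi x)"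
      using Cauchy_Schwarz_integral(1)[OF t(1) Lg] Cauchy_Schwarz_integral(1)[OF t(1) Lphi(2)] by (simp add: inner_diff_right)
    moreover have "integrable M (T n)" unfolding T using i1 i2(1) by simp
    ultimately show ?thesis unfolding lf_def fst_conv snd_conv by linarith
  qed
  show "!!n. integrable M (T n)" using main by blast
  show "EX e. e ----> 0 & (ALL n. integral\<^sup>L M (T n) <= lf P f (phi, cgrad phi) - lf P f (ys n, gs n) + e n)"
    using e main by (intro exI[of _ ?e]) blast
qed

text \<open>The inequality is used at \<open>y - t v\<close>; dividing by \<open>t\<close> and
  letting \<open>t\<close> tend to 0 gives one inequality, and \<open>- v\<close> the other.\<close>

lemma Minty:
  assumes S: "ell S" and W: "W0 p y g"
    and le: "!!v h. W0 p v h ==> (LINT x|M. flux (pw p) (S x *v h x) \<bullet> (S x *v g x)) - (LINT x|M. f x * y x)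
       <= (LINT x|M. flux (pw p) (S x *v h x) \<bullet> (S x *v h x)) - (LINT x|M. f x * v x)"
  shows "pstate S y g"
proof -
  have p0: "0 <= p" using p by simp
  have Lf: "integrable M (%x. f x * v x)" if "W0 p v h" for v h
    using LpV2_mult_integrable[OF f] W0_LpV(1)[OF W0_lower[OF that, of 2]] p by simp
  have *: "(LINT x|M. flux (pw p) (S x *v g x) \<bullet> (S x *v h x)) <= (LINT x|M. f x * v x)" if V: "W0 p v h" for v h
  proof -
    define t where "t n = 1 / real (Suc n)" for n
    have t: "0 < t n" for n by (simp add: t_def)
    have t0: "t ----> 0" unfolding t_def by (rule LIMSEQ_Suc[OF lim_1_over_n])
    define gt where "gt n x = g x - t n *\<^sub>R h x" for n x
    have Wt: "W0 p (%x. y x - t n * v x) (gt n)" for n unfolding gt_def by (rule W0_diff[OF W W0_scale[OF V] p0])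
    have "(LINT x|M. flux (pw p) (S x *v gt n x) \<bullet> (S x *v h x)) <= (LINT x|M. f x * v x)" for n
    proof -
      note i1 = pform_integrable[OF S W0_LpV(2)[OF Wt] W0_LpV(2)[OF W], of n]
      note i2 = pform_integrable[OF S W0_LpV(2)[OF Wt] W0_LpV(2)[OF V], of n]
      have "(LINT x|M. flux (pw p) (S x *v gt n x) \<bullet> (S x *v gt n x))
          = (LINT x|M. flux (pw p) (S x *v gt n x) \<bullet> (S x *v g x) - t n * (flux (pw p) (S x *v gt n x) \<bullet> (S x *v h x)))"
        by (rule Bochner_Integration.integral_cong)
          (auto simp: gt_def matrix_vector_mult_diff_distrib inner_diff_right matrix_vector_mult_scaleR)
      also have "... = (LINT x|M. flux (pw p) (S x *v gt n x) \<bullet> (S x *v g x)) - t n * (LINT x|M. flux (pw p) (S x *v gt n x) \<bullet> (S x *v h x))"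
        using i1 i2 by simp
      finally have 1: "(LINT x|M. flux (pw p) (S x *v gt n x) \<bullet> (S x *v gt n x)) = ..." .
      have "(LINT x|M. f x * (y x - t n * v x)) = (LINT x|M. f x * y x - t n * (f x * v x))"
        by (simp add: algebra_simps)
      also have "... = (LINT x|M. f x * y x) - t n * (LINT x|M. f x * v x)" using Lf[OF W] Lf[OF V] by simp
      finally have "t n * (LINT x|M. flux (pw p) (S x *v gt n x) \<bullet> (S x *v h x)) <= t n * (LINT x|M. f x * v x)"
        using le[OF Wt, of n] 1 by linarith
      thus ?thesis using t[of n] by simp
    qed
    moreover have "(%n. (LINT x|M. flux (pw p) (S x *v gt n x) \<bullet> (S x *v h x))) ----> (LINT x|M. flux (pw p) (S x *v g x) \<bullet> (S x *v h x))"
    proof (rule pform_tendsto[OF S])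
      have "gt n x - g x = (- t n) *\<^sub>R h x" for n x by (simp add: gt_def)
      hence "Ipow M p (%x. gt n x - g x) = t n powr p * Ipow M p h" for n
        using t[of n] by (simp only: Ipow_scale) simp
      moreover have "(%n. t n powr p * Ipow M p h) ----> 0 * Ipow M p h"
        using p t by (intro tendsto_mult tendsto_const tendsto_zero_powrI[OF t0 tendsto_const]) (auto simp: less_imp_le)
      ultimately show "(%n. Ipow M p (%x. gt n x - g x)) ----> 0" by simp
    qed (use W0_LpV(2)[OF W] W0_LpV(2)[OF V] W0_LpV(2)[OF Wt] in "simp_all add: Ipow_def")
    ultimately show ?thesis by (intro LIMSEQ_le_const2) auto
  qed
  have "(LINT x|M. flux (pw p) (S x *v g x) \<bullet> (S x *v h x)) = (LINT x|M. f x * v x)" if V: "W0 p v h" for v h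
  proof (rule antisym[OF *[OF V]])
    show "(LINT x|M. f x * v x) <= (LINT x|M. flux (pw p) (S x *v g x) \<bullet> (S x *v h x))"
      using *[OF W0_scale[OF V, of "-1"]] unfolding matrix_vector_mult_scaleR inner_scaleR_right by simp
  qed
  thus ?thesis using W by (simp add: pstate_def)
qed

end

context elliptic
begin

lemma dual_flux_integral:
  assumes S: "ell S"
  shows "(LINT x|M. (flux (pw p) (S x *v h x) v* S x) \<bullet> g x) = (LINT x|M. flux (pw p) (S x *v h x) \<bullet> (S x *v g x))"
  by (simp add: dot_lmul_matrix)

lemma ip1_bounded:
  assumes a: "approx epss ks Ss S ys gs"
  shows "EX B>=0. ALL n. ip1 (ys n, gs n) (ys n, gs n) <= B & en (aw (epss n) (ks n)) (gs n) <= B & en (aw (epss n) (ks n)) (ys n) <= B"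
proof -
  note D = approxD[OF a]
  obtain B where B: "ALL eps k S y g. 0 < eps --> 1 <= k --> ell S --> state (aw eps k) S y g -->
     Ipow M 2 y <= B & Ipow M 2 g <= B & en (aw eps k) y <= B & en (aw eps k) g <= B"
    using state_bounds by (rule exE)
  have b: "Ipow M 2 (ys n) <= B & Ipow M 2 (gs n) <= B & en (aw (epss n) (ks n)) (ys n) <= B & en (aw (epss n) (ks n)) (gs n) <= B" for n
    using B D(1)[of n] D(3)[of n] D(6)[of n] D(9)[of n] by blast
  have "0 <= B" using b[of 0] Ipow_nonneg[of M 2 "ys 0"] by linarith
  moreover have "ip1 (ys n, gs n) (ys n, gs n) <= 2 * B" for n using b[of n] ip1_self[of "(ys n, gs n)"] D(10)[of n] by simp
  moreover have "en (aw (epss n) (ks n)) (gs n) <= 2 * B & en (aw (epss n) (ks n)) (ys n) <= 2 * B" for n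
    using b[of n] \<open>0 <= B\<close> by linarith
  ultimately show ?thesis by (intro exI[of _ "2 * B"]) simp
qed

text \<open>Testing the weak limit against \<open>pw p (min |g| m) g\<close> turns the uniform energy bound into \<open>g : L\<^sup>p\<close>.\<close>

lemma cluster_LpV:
  assumes a: "approx epss ks Ss S ys gs" and W: "W0 2 y g"
    and half: "ALL l c. H1.bdlin l --> eventually (%n. l (ys n, gs n) <= c) sequentially --> l (y, g) <= c"
  shows "LpV M p y" "LpV M p g"
proof -
  note D = approxD[OF a]
  let ?D = "2 powr (p - 2) :: real" and ?w = "%m::nat. %t. pw p (min t (real m))"
  obtain B where B: "0 <= B" "!!n. en (aw (epss n) (ks n)) (gs n) <= B" using ip1_bounded[OF a] by blast
  obtain C where C: "0 <= C" "ALL a s t. modulus ?D a --> 0 <= s --> 0 <= t --> a s * s * t <= 1/2 * (a s * s^2) + C * (a t * t^2)"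
    using modulus_Young[of "1/2" ?D] by (auto simp del: mult_le_cancel_left)
  note Lg = W0_LpV(2)[OF W] and Ly = W0_LpV(1)[OF W]
  have wb: "?w m t <= pw p (real m)" if "0 <= t" for m t using that by (intro nondecD(1)[OF nondec_pw[OF p]]) auto
  have mw: "modulus ?D (?w m)" for m by (rule modulus_pw_min[OF p]) simp
  have E: "(LINT x|M. ?w m (norm (g x)) * (norm (g x))^2) <= 2 * (C * B)" for m
  proof -
    let ?P = "%x. flux (?w m) (g x)"
    have LP: "LpV M 2 ?P"
    proof (rule LpV_mono[OF borel_measurable_flux[OF modulusD(1)[OF mw] LpV_measurable[OF Lg]] LpV_scale[OF Lg, of "pw p (real m)"]])
      show "AE x in M. norm (?P x) <= norm (pw p (real m) *\<^sub>R g x)"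
        using wb nondecD(2)[OF nondec_pw[OF p], of "real m"]
        by (auto simp: norm_flux[OF modulusD(1)[OF mw]] intro!: mult_right_mono)
    qed simp
    let ?E = "(LINT x|M. ?w m (norm (g x)) * (norm (g x))^2)"
    have iE: "integrable M (%x. ?w m (norm (u x)) * (norm (u x))^2)" if "LpV M 2 u" for u :: "real^'n => real^'n"
      by (rule pw_min_energy_integrable[OF _ that]) simp
    have bl: "H1.bdlin (lf ?P (%_. 0))" by (rule lf_bdlin[OF LP]) simp
    \<comment> \<open>From this index on the weight truncated at \<open>m\<close> lies below the
      regularized weight, so the uniform energy bound applies to it.\<close>
    have "eventually (%n. m <= ks n) sequentially" using D(5) by (simp add: filterlim_at_top)
    hence "eventually (%n. lf ?P (%_. 0) (ys n, gs n) <= 1/2 * ?E + C * B) sequentially"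
    proof eventually_elim
      case (elim n)
      note Ln = W0_LpV(2)[OF D(10)[of n]]
      have "lf ?P (%_. 0) (ys n, gs n) = (LINT x|M. ?P x \<bullet> gs n x)" by (simp add: lf_def)
      also have "... <= (LINT x|M. 1/2 * (?w m (norm (g x)) * (norm (g x))^2) + C * (?w m (norm (gs n x)) * (norm (gs n x))^2))"
      proof (intro integral_mono Cauchy_Schwarz_integral(1)[OF LP Ln] Lintegrable_add integrable_mult_right iE Lg Ln)
        fix x
        have "?P x \<bullet> gs n x <= norm (?P x) * norm (gs n x)" by (rule norm_cauchy_schwarz)
        also have "... <= 1/2 * (?w m (norm (g x)) * (norm (g x))^2) + C * (?w m (norm (gs n x)) * (norm (gs n x))^2)"
          unfolding norm_flux[OF modulusD(1)[OF mw]] by (rule C(2)[rule_format, OF mw]) auto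
        finally show "?P x \<bullet> gs n x <= ..." .
      qed
      also have "... = 1/2 * ?E + C * (LINT x|M. ?w m (norm (gs n x)) * (norm (gs n x))^2)"
        using iE[OF Lg] iE[OF Ln] by simp
      also have "(LINT x|M. ?w m (norm (gs n x)) * (norm (gs n x))^2) <= en (aw (epss n) (ks n)) (gs n)"
        unfolding en_def
      proof (intro integral_mono iE Ln aw_energy_integrable D(1) mult_right_mono)
        fix x
        have "?w m (norm (gs n x)) <= ?w (ks n) (norm (gs n x))" using elim by (intro nondecD(1)[OF nondec_pw[OF p]]) auto
        also have "... <= aw (epss n) (ks n) (norm (gs n x))" by (rule aw_ge_pw[OF D(1)]) simp
        finally show "?w m (norm (gs n x)) <= aw (epss n) (ks n) (norm (gs n x))" .
      qed simp
      also have "... <= B" by (rule B(2))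
      finally show ?case using C(1) by (simp add: mult_left_mono)
    qed
    from half[rule_format, OF bl this] have "lf ?P (%_. 0) (y, g) <= 1/2 * ?E + C * B" .
    moreover have "lf ?P (%_. 0) (y, g) = ?E" by (simp add: lf_def flux_inner_self)
    \<comment> \<open>Half of \<open>?E\<close> is absorbed; this is legitimate because the
      truncation makes \<open>?E\<close> a finite energy of an L^2 function.\<close>
    ultimately show ?thesis by simp
  qed
  show "LpV M p g" by (rule LpV_of_truncated_energy[OF Lg E])
  obtain C' where C': "0 <= C'" "ALL a A u g. modulus ?D a --> (ALL t>=0. a t <= A) --> W0 2 u g -->
     (LINT x|M. a (norm (u x)) * (norm (u x))^2) <= C' * (LINT x|M. a (norm (g x)) * (norm (g x))^2)"
    using modular_Poincare[of ?D] by (elim exE conjE) (rule that)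
  have "(LINT x|M. ?w m (norm (y x)) * (norm (y x))^2) <= C' * (2 * (C * B))" for m
  proof -
    have "ALL t>=0. ?w m t <= pw p (real m)" using wb by blast
    from C'(2)[rule_format, OF mw this[rule_format] W] mult_left_mono[OF E C'(1), of m] show ?thesis by linarith
  qed
  thus "LpV M p y" by (rule LpV_of_truncated_energy[OF Ly])
qed

lemma W0_p_approx:
  assumes W: "W0 p y g" and S: "ell S"
  obtains phis where "!!j. C1c U (phis j)" "!!j. W0 p (phis j) (cgrad (phis j))"
    "(%j. Ipow M p (%x. cgrad (phis j) x - g x)) ----> 0"
    "(%j. (LINT x|M. f x * phis j x)) ----> (LINT x|M. f x * y x)"
    "!!h. LpV M p h ==> (%j. (LINT x|M. flux (pw p) (S x *v cgrad (phis j) x) \<bullet> (S x *v h x)))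
        ----> (LINT x|M. flux (pw p) (S x *v g x) \<bullet> (S x *v h x))"
    "(%j. (LINT x|M. flux (pw p) (S x *v cgrad (phis j) x) \<bullet> (S x *v cgrad (phis j) x)))
        ----> (LINT x|M. flux (pw p) (S x *v g x) \<bullet> (S x *v g x))"
proof -
  obtain phis where phi: "ALL n. C1c U (phis n)" "(%n. Ipow M p (%x. phis n x - y x)) ----> 0"
    "(%n. Ipow M p (%x. cgrad (phis n) x - g x)) ----> 0" by (rule W0_approx[OF W])
  have p0: "0 <= p" using p by simp
  have c: "C1c U (phis j)" for j using phi(1) by simp
  have L: "LpV M p (phis j)" "LpV M p (cgrad (phis j))" for j using C1c_LpV[OF c p0] by auto
  show ?thesis
  proof (rule that[OF c W0_C1c[OF c p0] phi(3)])
    show "(%j. (LINT x|M. f x * phis j x)) ----> (LINT x|M. f x * y x)"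
      by (rule source_tendsto[OF W0_LpV(1)[OF W] L(1) phi(2)])
    show "(%j. (LINT x|M. flux (pw p) (S x *v cgrad (phis j) x) \<bullet> (S x *v h x)))
        ----> (LINT x|M. flux (pw p) (S x *v g x) \<bullet> (S x *v h x))" if "LpV M p h" for h
      by (rule pform_tendsto[OF S W0_LpV(2)[OF W] that L(2) that phi(3)]) (simp add: Ipow_def)
    show "(%j. (LINT x|M. flux (pw p) (S x *v cgrad (phis j) x) \<bullet> (S x *v cgrad (phis j) x)))
        ----> (LINT x|M. flux (pw p) (S x *v g x) \<bullet> (S x *v g x))"
      by (rule pform_tendsto[OF S W0_LpV(2)[OF W] W0_LpV(2)[OF W] L(2) L(2) phi(3,3)])
  qed
qed

lemma lf_test:
  assumes "ell S"
  shows "lf (%x. flux (pw p) (S x *v h x) v* S x) f (v, g) = (LINT x|M. flux (pw p) (S x *v h x) \<bullet> (S x *v g x)) - (LINT x|M. f x * v x)"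
  by (simp add: lf_def dual_flux_integral[OF assms])

theorem state_limit:
  assumes a: "approx epss ks Ss S ys gs" and lip: "lipschitz_boundary U"
  shows "EX y g. pstate S y g \<and>
    (ALL l c. H1.bdlin l --> eventually (%n. l (ys n, gs n) <= c) sequentially --> l (y, g) <= c)"
proof -
  note D = approxD[OF a]
  obtain B where B: "!!n. ip1 (ys n, gs n) (ys n, gs n) <= B" using ip1_bounded[OF a] by blast
  have X: "(ys n, gs n) : {w. W0 2 (fst w) (snd w)}" for n using D(10) by simp
  obtain w where w: "w : {w. W0 2 (fst w) (snd w)}"
    and half': "!!l c. H1.bdlin l ==> eventually (%n. l (ys n, gs n) <= c) sequentially ==> l w <= c"
    by (rule H1.weak_cluster_point[OF X B]) (assumption | rule that)+
  obtain y g where yg: "w = (y, g)" by fastforce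
  have W2: "W0 2 y g" using w by (simp add: yg)
  have half: "ALL l c. H1.bdlin l --> eventually (%n. l (ys n, gs n) <= c) sequentially --> l (y, g) <= c"
    using half'[unfolded yg] by (intro allI impI)
  have W: "W0 p y g" by (rule W0_of_Lipschitz[OF lip _ W2 cluster_LpV[OF a W2 half]]) (use p in auto)
  have C1: "(LINT x|M. flux (pw p) (S x *v cgrad phi x) \<bullet> (S x *v g x)) - (LINT x|M. f x * y x)
       <= (LINT x|M. flux (pw p) (S x *v cgrad phi x) \<bullet> (S x *v cgrad phi x)) - (LINT x|M. f x * phi x)" if phi: "C1c U phi" for phi
  proof -
    let ?P = "%x. flux (pw p) (S x *v cgrad phi x) v* S x"
    let ?T = "%n x. (flux (aw (epss n) (ks n)) (Ss n x *v gs n x) - flux (aw (epss n) (ks n)) (Ss n x *v cgrad phi x))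
          \<bullet> (Ss n x *v gs n x - Ss n x *v cgrad phi x)"
    obtain e where e: "e ----> 0" "!!n. integral\<^sup>L M (?T n) <= lf ?P f (phi, cgrad phi) - lf ?P f (ys n, gs n) + e n"
      using test_inequality(2)[OF a phi] by blast
    have T: "0 <= integral\<^sup>L M (?T n)" for n
      by (rule Bochner_Integration.integral_nonneg, rule flux_monotone_nonneg[OF nondec_aw[OF D(1)]])
    \<comment> \<open>The cluster point property needs a fixed right side, so the slack
      \<open>c\<close> absorbs the vanishing error \<open>e n\<close>.\<close>
    have "lf ?P f (y, g) <= lf ?P f (phi, cgrad phi) + c" if c: "0 < c" for c
    proof (rule half[rule_format, OF lf_bdlin[OF test_flux_tendsto(1)[OF a phi] f]])
      have "eventually (%n. e n < c) sequentially" using order_tendstoD(2)[OF e(1) c] .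
      thus "eventually (%n. lf ?P f (ys n, gs n) <= lf ?P f (phi, cgrad phi) + c) sequentially"
      proof eventually_elim
        case (elim n)
        thus ?case using e(2)[of n] T[of n] by linarith
      qed
    qed
    hence "lf ?P f (y, g) <= lf ?P f (phi, cgrad phi)" by (rule field_le_epsilon)
    thus ?thesis unfolding lf_test[OF D(7)] .
  qed
  have "pstate S y g"
  proof (rule Minty[OF D(7) W])
    fix v h assume V: "W0 p v h"
    obtain phis where phi: "!!j. C1c U (phis j)" 
      "(%j. (LINT x|M. f x * phis j x)) ----> (LINT x|M. f x * v x)"
      "!!h'. LpV M p h' ==> (%j. (LINT x|M. flux (pw p) (S x *v cgrad (phis j) x) \<bullet> (S x *v h' x)))
        ----> (LINT x|M. flux (pw p) (S x *v h x) \<bullet> (S x *v h' x))"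
      "(%j. (LINT x|M. flux (pw p) (S x *v cgrad (phis j) x) \<bullet> (S x *v cgrad (phis j) x)))
        ----> (LINT x|M. flux (pw p) (S x *v h x) \<bullet> (S x *v h x))"
      by (rule W0_p_approx[OF V D(7)]) (rule that)
    show "(LINT x|M. flux (pw p) (S x *v h x) \<bullet> (S x *v g x)) - (LINT x|M. f x * y x)
       <= (LINT x|M. flux (pw p) (S x *v h x) \<bullet> (S x *v h x)) - (LINT x|M. f x * v x)"
      by (rule LIMSEQ_le[OF tendsto_diff[OF phi(3)[OF W0_LpV(2)[OF W]] tendsto_const] tendsto_diff[OF phi(4,2)]])
        (use C1[OF phi(1)] in auto)
  qed
  with half show ?thesis by (intro exI[of _ y] exI[of _ g] conjI)
qed

lemma bdlin_cong_AE:
  assumes l: "H1.bdlin l" and W: "W0 2 y g" "W0 2 y' g'" and AE: "AE x in M. y x = y' x" "AE x in M. g x = g' x"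
  shows "l (y, g) = l (y', g')"
proof -
  let ?V = "{w. W0 2 (fst w) (snd w)}"
  have V: "(y, g) : ?V" "(y', g') : ?V" using W by auto
  have d: "(y, g) - (y', g') : ?V" by (rule H1.V_diff[OF V])
  have "Ipow M 2 (%x. y x - y' x) = Ipow M 2 (%x. 0::real)" "Ipow M 2 (%x. g x - g' x) = Ipow M 2 (%x. 0::real^'n)"
    by (rule Ipow_cong_AE; use AE W[THEN W0_LpV(1)] W[THEN W0_LpV(2)] in "auto dest!: LpV_measurable")+
  hence "ip1 ((y, g) - (y', g')) ((y, g) - (y', g')) = 0"
    using ip1_self[of "(y, g) - (y', g')"] d by (simp add: fun_diff_def) (simp add: Ipow_def)
  hence n: "H1.nrm ((y, g) - (y', g')) = 0" by (simp add: H1.nrm_def)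
  obtain C where C: "!!x. x : ?V ==> abs (l x) <= C * H1.nrm x" using l unfolding H1.bdlin_def by blast
  have "abs (l ((y, g) - (y', g'))) <= 0" using C[OF d] n by simp
  thus ?thesis using H1.bdlin_diff[OF l V] by simp
qed

lemma W0_p_2: "W0 p y g ==> W0 2 y g" by (rule W0_lower[where p=p]) (use p in auto)

text \<open>The cluster point construction gives no convergent subsequence. If a functional stayed
  away from its limit value along a subsequence, a cluster point of that subsequence would solve the
  same limit equation, against uniqueness.\<close>

lemma state_weak_limit:
  assumes a: "approx epss ks Ss S ys gs" and lip: "lipschitz_boundary U" and y: "pstate S y g" and l: "H1.bdlin l"
  shows "(%n. l (ys n, gs n)) ----> l (y, g)"
proof -
  have *: "eventually (%n. l (ys n, gs n) < c) sequentially" if l: "H1.bdlin l" and c: "l (y, g) < c" for l c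
  proof (rule ccontr)
    assume "~ ?thesis"
    from strict_mono_subseq_frequently[OF this]
    obtain r :: "nat => nat" where r: "strict_mono r" "ALL j. ~ l (ys (r j), gs (r j)) < c" by blast
    obtain y' g' where y': "pstate S y' g'" and half: "ALL l c. H1.bdlin l -->
        eventually (%n. l (ys (r n), gs (r n)) <= c) sequentially --> l (y', g') <= c"
      using state_limit[OF approx_subseq[OF a r(1)] lip] by (elim exE conjE) (rule that)
    have "- l (y', g') <= - c"
      by (rule half[rule_format, OF H1.bdlin_minus[OF l]]) (use r(2) in "simp add: not_less")
    moreover have "l (y, g) = l (y', g')"
      using pstate_unique[OF approxD(7)[OF a] y y'] y y' unfolding pstate_def
      by (intro bdlin_cong_AE[OF l]) (auto intro: W0_p_2)
    ultimately show False using c by linarith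
  qed
  show ?thesis
  proof (rule order_tendstoI)
    show "eventually (%n. l (ys n, gs n) < c) sequentially" if "l (y, g) < c" for c by (rule *[OF l that])
    show "eventually (%n. c < l (ys n, gs n)) sequentially" if "c < l (y, g)" for c
      using *[OF H1.bdlin_minus[OF l], of "- c"] that by simp
  qed
qed

lemma Ipow2_tendsto_of_en:
  assumes eps: "!!n. 0 < epss n" "!!n. 1 <= ks n" and u: "!!n. LpV M 2 (us n)"
    and lim: "(%n. en (aw (epss n) (ks n)) (us n)) ----> 0"
  shows "(%n. Ipow M 2 (us n)) ----> 0"
proof (rule tendsto_zero_eta[where K="measure M (space M)" and b="%n. en (aw (epss n) (ks n)) (us n)"])
  fix eta :: real assume eta: "0 < eta"
  \<comment> \<open>Gives \<open>s^2 <= eta\<close>, and \<open>s <= 1\<close> as the splitting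
    level requires.\<close>
  define s where "s = min 1 (sqrt eta)"
  have s: "0 < s" "s <= 1" using eta by (auto simp: s_def)
  have "s^2 <= (sqrt eta)^2" using s by (intro power_mono) (auto simp: s_def)
  hence s2: "s^2 <= eta" using eta by simp
  have "Ipow M 2 (us n) <= eta * measure M (space M) + 1 / pw p s * en (aw (epss n) (ks n)) (us n)" for n
    using Ipow2_le_en[OF eps(1,2) s u, of n n n] mult_right_mono[OF s2, of "measure M (space M)"] by simp
  thus "EX C. eventually (%n. Ipow M 2 (us n) <= eta * measure M (space M) + C * en (aw (epss n) (ks n)) (us n)) sequentially"
    by (intro exI[of _ "1 / pw p s"]) simp
qed (use lim in auto)

text \<open>The limit gradient is replaced by test gradients: for fixed \<open>j\<close> the excess
  of \<open>gs n\<close> over the j-th one tends to at most \<open>T j\<close>, and the energy of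
  the j-th one minus \<open>g\<close> is bounded in terms of L^p and L^2 norms, uniformly in
  \<open>n\<close>. The limit in \<open>n\<close> precedes that in \<open>j\<close>.\<close>

theorem state_strong_limit:
  assumes a: "approx epss ks Ss S ys gs" and lip: "lipschitz_boundary U" and y: "pstate S y g"
  shows "(%n. en (aw (epss n) (ks n)) (%x. gs n x - g x)) ----> 0"
    "(%n. en (aw (epss n) (ks n)) (%x. ys n x - y x)) ----> 0"
    "(%n. Ipow M 2 (%x. gs n x - g x)) ----> 0" "(%n. Ipow M 2 (%x. ys n x - y x)) ----> 0"
proof -
  note D = approxD[OF a]
  let ?a = "%n. aw (epss n) (ks n)" and ?D = "8 powr ((p - 2) / 2)"
  have W: "W0 p y g" using y by (simp add: pstate_def)
  have Wd: "W0 2 (%x. ys n x - y x) (%x. gs n x - g x)" for n by (rule W0_diff[OF D(10) W0_p_2[OF W]]) simp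
  note Lg = W0_LpV(2)[OF W0_p_2[OF W]]
  have p0: "0 <= p" using p by simp
  obtain C2 where C2: "0 < C2" "!!eps k S g. 0 < eps ==> 1 <= k ==> ell S ==> LpV M 2 g ==>
     integrable M (%x. aw eps k (norm (S x *v g x) / 2) * (norm (S x *v g x))^2) \<and>
     en (aw eps k) g <= C2 * (LINT x|M. aw eps k (norm (S x *v g x) / 2) * (norm (S x *v g x))^2)"
    using ell_energy by blast
  obtain C3 where C3: "0 <= C3" "!!eps k u g. 0 < eps ==> 1 <= k ==> W0 2 u g ==> en (aw eps k) u <= C3 * en (aw eps k) g"
    using en_Poincare by blast
  obtain phis where phi: "!!j. C1c U (phis j)" "!!j. W0 p (phis j) (cgrad (phis j))"
    and lim: "(%j. Ipow M p (%x. cgrad (phis j) x - g x)) ----> 0"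
      "(%j. (LINT x|M. f x * phis j x)) ----> (LINT x|M. f x * y x)"
      "!!h'. LpV M p h' ==> (%j. (LINT x|M. flux (pw p) (S x *v cgrad (phis j) x) \<bullet> (S x *v h' x)))
        ----> (LINT x|M. flux (pw p) (S x *v g x) \<bullet> (S x *v h' x))"
      "(%j. (LINT x|M. flux (pw p) (S x *v cgrad (phis j) x) \<bullet> (S x *v cgrad (phis j) x)))
        ----> (LINT x|M. flux (pw p) (S x *v g x) \<bullet> (S x *v g x))"
    by (rule W0_p_approx[OF W D(7)]) (rule that)
  define P where "P j x = flux (pw p) (S x *v cgrad (phis j) x) v* S x" for j x
  define T where "T j = lf (P j) f (phis j, cgrad (phis j)) - lf (P j) f (y, g)" for j
  define dl where "dl j = 3 powr ((p - 2) / 2) * (Ipow M 2 (%x. cgrad (phis j) x - g x) + Ipow M p (%x. cgrad (phis j) x - g x))" for j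
  \<comment> \<open>Collects the quasi-triangle factor, the transfer constant \<open>C2\<close> with
    the factor 2 from \<open>flux_monotone_half\<close>, and a slack \<open>1 / real (Suc j)\<close>
    that makes an eventual inequality out of a limit.\<close>
  define tau where "tau j = 4 * ?D * (2 * C2 * (T j + 1 / real (Suc j)) + dl j)" for j
  have Lpphi: "LpV M p (%x. cgrad (phis j) x - g x)" "LpV M 2 (%x. cgrad (phis j) x - g x)" for j
    using LpV_diff[OF W0_LpV(2)[OF phi(2)] W0_LpV(2)[OF W] p0] LpV_diff[OF W0_LpV(2)[OF W0_p_2[OF phi(2)]] Lg] by auto
  have "T ----> ((LINT x|M. flux (pw p) (S x *v g x) \<bullet> (S x *v g x)) - (LINT x|M. f x * y x))
      - ((LINT x|M. flux (pw p) (S x *v g x) \<bullet> (S x *v g x)) - (LINT x|M. f x * y x))"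
    unfolding T_def[abs_def] P_def[abs_def] lf_test[OF D(7)]
    by (intro tendsto_diff lim tendsto_const W0_LpV(2)[OF W])
  hence T0: "T ----> 0" by simp
  have "(%j. Ipow M 2 (%x. cgrad (phis j) x - g x)) ----> 0"
    by (rule Ipow_tendsto_lower[OF Lpphi(1) _ p lim(1)]) simp
  hence "dl ----> 3 powr ((p - 2) / 2) * (0 + 0)" unfolding dl_def[abs_def] by (intro tendsto_intros lim)
  hence dl0: "dl ----> 0" by simp
  have "tau ----> 4 * ?D * (2 * C2 * (0 + 0) + 0)"
    unfolding tau_def[abs_def] by (intro tendsto_intros T0 dl0 LIMSEQ_Suc[OF lim_1_over_n])
  hence tau0: "tau ----> 0" by simp
  have ev: "eventually (%n. en (?a n) (%x. gs n x - g x) <= tau j) sequentially" for j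
  proof -
    let ?T = "%n x. (flux (?a n) (Ss n x *v gs n x) - flux (?a n) (Ss n x *v cgrad (phis j) x))
          \<bullet> (Ss n x *v gs n x - Ss n x *v cgrad (phis j) x)"
    note LP = test_flux_tendsto(1)[OF a phi(1), of j, folded P_def]
    obtain e where e: "e ----> 0" "!!n. integral\<^sup>L M (?T n) <= lf (P j) f (phis j, cgrad (phis j)) - lf (P j) f (ys n, gs n) + e n"
      using test_inequality(2)[OF a phi(1)[of j]] unfolding P_def[abs_def] by blast
    have "(%n. lf (P j) f (phis j, cgrad (phis j)) - lf (P j) f (ys n, gs n) + e n)
        ----> lf (P j) f (phis j, cgrad (phis j)) - lf (P j) f (y, g) + 0"
      by (intro tendsto_intros e(1) state_weak_limit[OF a lip y lf_bdlin[OF LP f]])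
    hence "eventually (%n. lf (P j) f (phis j, cgrad (phis j)) - lf (P j) f (ys n, gs n) + e n < T j + 1 / real (Suc j)) sequentially"
      by (rule order_tendstoD(2)) (simp add: T_def)
    thus ?thesis
    proof eventually_elim
      case (elim n)
      let ?h = "%x. gs n x - cgrad (phis j) x"
      have Lh: "LpV M 2 ?h" by (rule LpV_diff[OF W0_LpV(2)[OF D(10)] W0_LpV(2)[OF W0_p_2[OF phi(2)]]]) simp
      note c = C2(2)[OF D(1)[of n] D(3)[of n] D(6)[of n] Lh]
      let ?I = "%x. ?a n (norm (Ss n x *v ?h x) / 2) * (norm (Ss n x *v ?h x))^2"
      have "(LINT x|M. 1/2 * ?I x) <= integral\<^sup>L M (?T n)"
      proof (intro integral_mono integrable_mult_right conjunct1[OF c] test_inequality(1)[OF a phi(1)])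
        show "1/2 * ?I x <= ?T n x" for x
          using flux_monotone_half[OF nondec_aw[OF D(1)], of n "ks n" "Ss n x *v gs n x" "Ss n x *v cgrad (phis j) x"]
          by (simp add: matrix_vector_mult_diff_distrib mult.assoc)
      qed
      hence "integral\<^sup>L M ?I <= 2 * (T j + 1 / real (Suc j))" using e(2)[of n] elim by simp
      hence "C2 * integral\<^sup>L M ?I <= C2 * (2 * (T j + 1 / real (Suc j)))" using C2(1) by (intro mult_left_mono) auto
      from order_trans[OF conjunct2[OF c] this]
      have 1: "en (?a n) ?h <= 2 * C2 * (T j + 1 / real (Suc j))" by (simp only: mult.assoc mult.left_commute)
      have 2: "en (?a n) (%x. cgrad (phis j) x - g x) <= dl j"
        unfolding dl_def by (rule en_le_Ipow[OF D(1-3) Lpphi(2,1)])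
      have "en (?a n) (%x. gs n x - g x) <= 4 * ?D * (en (?a n) ?h + en (?a n) (%x. cgrad (phis j) x - g x))"
        using en_add[OF D(1,3) Lh Lpphi(2), of n n j] by simp
      also have "... <= tau j" unfolding tau_def using 1 2 by (intro mult_left_mono add_mono) auto
      finally show ?case .
    qed
  qed
  show g: "(%n. en (?a n) (%x. gs n x - g x)) ----> 0"
  proof (rule order_tendstoI)
    fix c :: real
    show "eventually (%n. c < en (?a n) (%x. gs n x - g x)) sequentially" if "c < 0"
      using that en_nonneg[OF D(1)] by (intro always_eventually allI) (rule order_less_le_trans)
    assume "0 < c"
    then obtain j where "tau j < c" using order_tendstoD(2)[OF tau0] by (meson eventually_sequentially order_refl)
    thus "eventually (%n. en (?a n) (%x. gs n x - g x) < c) sequentially"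
      using ev[of j] by (auto elim!: eventually_mono)
  qed
  have "(%n. C3 * en (?a n) (%x. gs n x - g x)) ----> C3 * 0" by (intro tendsto_intros g)
  hence "(%n. C3 * en (?a n) (%x. gs n x - g x)) ----> 0" by simp
  thus y: "(%n. en (?a n) (%x. ys n x - y x)) ----> 0"
    by (rule tendsto_sandwich[OF _ _ tendsto_const, rotated 2])
      (use en_nonneg[OF D(1)] C3(2)[OF D(1,3) Wd] in "auto intro!: always_eventually")
  show "(%n. Ipow M 2 (%x. gs n x - g x)) ----> 0" "(%n. Ipow M 2 (%x. ys n x - y x)) ----> 0"
    by (rule Ipow2_tendsto_of_en[OF D(1,3) W0_LpV(2)[OF Wd] g], rule Ipow2_tendsto_of_en[OF D(1,3) W0_LpV(1)[OF Wd] y])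
qed

end

section \<open>Passage to the limit in the Hammerstein equation\<close>

text \<open>Cases \<open>t <= 2 * s\<close> and \<open>s < t / 2\<close>; monotonicity alone
  suffices. The coefficient 1/2 permits absorption of the second energy.\<close>

lemma nondec_mixed_le:
  assumes a: "nondec a" and st: "0 <= s" "0 <= t"
  shows "a s * s * t <= 2 * (a s * s^2) + 1/2 * (a t * t^2)"
proof -
  note nd = nondecD(1,2)[OF a]
  have nn: "0 <= a s * s^2" "0 <= a t * t^2" using nd(2) st by auto
  show ?thesis
  proof (cases "t <= 2 * s")
    case True
    hence "a s * s * t <= a s * s * (2 * s)" using nd(2) st by (intro mult_left_mono) auto
    thus ?thesis using nn by (simp add: power2_eq_square mult_ac)
  next
    case False
    hence "a s * s * t <= a t * (1/2 * t) * t" using nd st by (intro mult_mono) auto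
    thus ?thesis using nn by (simp add: power2_eq_square mult_ac)
  qed
qed

context hammerstein
begin

definition hp :: "(real^'n => real) => (real^'n => real) => bool" where
  "hp y z \<longleftrightarrow> LpV M p z & (AE x in M. z x + Bop U K (%t. flux (pw p) (y t) + flux (pw p) (z t)) x = 0)"

abbreviation G :: "real => real" where "G \<equiv> flux (pw p)"

lemma G_powr: "norm (G t) powr q = abs t powr p"
  unfolding pw_flux_tendsto_norm_le[OF p] using q_facts by (simp add: powr_powr)

lemma G_Lq: "LpV M p u ==> LpV M q (%x. G (u x))"
  unfolding LpV_def G_powr using borel_measurable_flux[OF nondec_pw[OF p]] by auto

lemma G_monotone: "2 * (1/2) powr p * abs (s - t) powr p <= (G s - G t) * (s - t)"
proof -
  let ?u = "abs (s - t)"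
  have "2 * (1/2) powr p * ?u powr p = 2 * (?u / 2) powr p" using powr_mult[of "1/2" ?u p] by simp
  also have "... = 1/2 * pw p (?u / 2) * ?u^2" using pw_energy[of "?u / 2" p] by (simp add: power_divide)
  also have "... <= (G s - G t) * (s - t)" using flux_monotone_half[OF nondec_pw[OF p], of s t] by simp
  finally show ?thesis .
qed

text \<open>The difference of the two equations, paired with \<open>w - w'\<close>, equals minus the
  quadratic form of \<open>B\<close>. It yields uniqueness, the energy bound for \<open>z_n\<close>,
  and the Cauchy estimate.\<close>

lemma monotone_pairing:
  assumes w: "LpV M q w" "LpV M q w'"
    and e: "AE x in M. z x + Bop U K w x = 0" "AE x in M. z' x + Bop U K w' x = 0"
    and m: "z : borel_measurable M" "z' : borel_measurable M"
  shows "(LINT x|M. (w x - w' x) * (z x - z' x)) <= 0"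
proof -
  have d: "LpV M q (%x. w x - w' x)" using LpV_diff[OF w] q_facts by simp
  note [measurable] = LpV_measurable[OF w(1)] LpV_measurable[OF w(2)] Bop_measurable[OF LpV_measurable[OF d]] m
  have "(LINT x|M. (w x - w' x) * (z x - z' x)) = (LINT x|M. - (Bop U K (%x. w x - w' x) x * (w x - w' x)))"
  proof (rule integral_cong_AE)
    show "AE x in M. (w x - w' x) * (z x - z' x) = - (Bop U K (%x. w x - w' x) x * (w x - w' x))"
      using e Bop_diff[OF w]
    proof eventually_elim
      case (elim x)
      hence "z x - z' x = - Bop U K (%x. w x - w' x) x" by simp
      thus ?case by simp
    qed
  qed measurable
  thus ?thesis using K_pos[OF d] by simp
qed

lemma hp_unique:
  assumes y: "LpV M p y" "LpV M p y'" "AE x in M. y x = y' x" and h: "hp y z" "hp y' z'"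
  shows "AE x in M. z x = z' x"
proof -
  have L: "LpV M p z" "LpV M p z'" using h by (auto simp: hp_def)
  have w: "LpV M q (%t. G (y t) + G (z t))" "LpV M q (%t. G (y' t) + G (z' t))"
    by (intro LpV_add G_Lq y L; use q_facts in simp)+
  let ?I = "%x. (G (z x) - G (z' x)) * (z x - z' x)"
  have Ld: "LpV M p (%x. z x - z' x)" using LpV_diff[OF L] p by simp
  have i: "integrable M ?I"
    by (rule Holder_ineq(1)[of q p]) (use q_facts Ld LpV_diff[OF G_Lq[OF L(1)] G_Lq[OF L(2)]] in auto)
  have "(LINT x|M. ?I x) = (LINT x|M. (G (y x) + G (z x) - (G (y' x) + G (z' x))) * (z x - z' x))"
    by (rule integral_cong_AE)
      (use y(3) w[THEN LpV_measurable] L[THEN LpV_measurable] L[THEN G_Lq, THEN LpV_measurable] in auto)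
  also have "... <= 0" by (rule monotone_pairing[OF w]) (use h L in "auto simp: hp_def dest: LpV_measurable")
  finally have I0: "(LINT x|M. ?I x) <= 0" .
  have "2 * (1/2) powr p * Ipow M p (%x. z x - z' x) <= (LINT x|M. ?I x)"
    unfolding Ipow_def Bochner_Integration.integral_mult_right_zero[symmetric] using G_monotone
    by (intro integral_mono i integrable_mult_right LpV_integrable[OF Ld]) auto
  with I0 have "2 * (1/2) powr p * Ipow M p (%x. z x - z' x) <= 0" by linarith
  hence "Ipow M p (%x. z x - z' x) = 0" using Ipow_nonneg[of M p "%x. z x - z' x"] by (simp add: mult_le_0_iff)
  from Ipow_eq_0D[OF Ld this] show ?thesis by simp
qed

text \<open>For \<open>abs t > 1\<close> the flux is at most \<open>c * abs t powr (p - 1)\<close>;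
  since \<open>(p - 1) * (q - 1) = 1\<close>, its power \<open>q - 1\<close> costs one factor
  \<open>abs t\<close>, and the remaining factor completes an energy. Energy bounds thus become L^q
  bounds of fluxes, uniformly in the parameters.\<close>

lemma aw_flux_powr:
  "EX C>=0. ALL eps k t. 0 < eps --> eps <= 1 --> 1 <= k --> norm (flux (aw eps k) (t::real)) powr q <= C * (1 + aw eps k (abs t) * (abs t)^2)"
proof -
  define c where "c = 2 * 3 powr ((p - 2) / 2)"
  have c: "0 < c" by (simp add: c_def)
  have "norm (flux (aw eps k) t) powr q <= (c powr q + c powr (q - 1)) * (1 + aw eps k (abs t) * (abs t)^2)"
    if eps: "0 < eps" "eps <= 1" "1 <= k" for eps k and t :: real
  proof -
    let ?t = "abs t" and ?a = "aw eps k (abs t)"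
    have a0: "0 <= ?a" using nondecD(2)[OF nondec_aw[OF eps(1)]] by simp
    have a: "?a <= 3 powr ((p - 2) / 2) * (1 + pw p ?t)" by (rule aw_le_pw[OF eps]) simp
    have n: "norm (flux (aw eps k) t) = ?a * ?t" unfolding norm_flux[OF nondec_aw[OF eps(1)]] by simp
    have nn: "0 <= ?a * ?t^2" "0 <= ?a * ?t" using a0 by auto
    show ?thesis
    proof (cases "?t <= 1")
      case True
      have "pw p ?t <= pw p 1" using True by (intro nondecD(1)[OF nondec_pw[OF p]]) auto
      hence "3 powr ((p - 2) / 2) * (1 + pw p ?t) <= 3 powr ((p - 2) / 2) * 2" by (intro mult_left_mono) (auto simp: pw_def split: if_splits)
      hence "?a <= c" using a unfolding c_def by linarith
      hence "?a * ?t <= c * 1" using a0 True c by (intro mult_mono) auto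
      hence "(?a * ?t) powr q <= c powr q" using nn q_facts by (intro powr_mono2) auto
      also have "... <= (c powr q + c powr (q - 1)) * 1" by simp
      also have "... <= (c powr q + c powr (q - 1)) * (1 + ?a * ?t^2)" using nn by (intro mult_left_mono) auto
      finally show ?thesis unfolding n .
    next
      case False
      have "pw p 1 <= pw p ?t" using False by (intro nondecD(1)[OF nondec_pw[OF p]]) auto
      hence "1 + pw p ?t <= 2 * pw p ?t" by (simp add: pw_def split: if_splits)
      hence "3 powr ((p - 2) / 2) * (1 + pw p ?t) <= 3 powr ((p - 2) / 2) * (2 * pw p ?t)" by (intro mult_left_mono) auto
      hence "?a <= c * pw p ?t" using a unfolding c_def by linarith
      hence "?a * ?t <= c * pw p ?t * ?t" by (intro mult_right_mono) auto
      hence "?a * ?t <= c * ?t powr (p - 1)" by (simp add: mult.assoc pw_mult_self)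
      hence "(?a * ?t) powr (q - 1) <= (c * ?t powr (p - 1)) powr (q - 1)" using nn q_facts by (intro powr_mono2) auto
      also have "... = c powr (q - 1) * ?t powr ((p - 1) * (q - 1))" using c by (simp add: powr_mult powr_powr)
      also have "(p - 1) * (q - 1) = 1" using q_facts by (simp add: algebra_simps)
      finally have "(?a * ?t) powr (q - 1) * (?a * ?t) <= c powr (q - 1) * ?t * (?a * ?t)"
        using nn by (intro mult_right_mono) auto
      moreover have "(?a * ?t) powr q = (?a * ?t) powr (q - 1) * (?a * ?t)"
        using nn(2) by (cases "?a * ?t = 0") (auto simp: powr_diff)
      moreover have "c powr (q - 1) * ?t * (?a * ?t) = c powr (q - 1) * (?a * ?t^2)" by (simp add: power2_eq_square)
      ultimately have "(?a * ?t) powr q <= c powr (q - 1) * (?a * ?t^2)" by linarith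
      also have "... <= (c powr q + c powr (q - 1)) * (1 + ?a * ?t^2)" using nn by (intro mult_mono) auto
      finally show ?thesis unfolding n .
    qed
  qed
  thus ?thesis by (intro exI[of _ "c powr q + c powr (q - 1)"]) simp
qed

text \<open>The fluxes are bounded in L^q, and the kernel estimate turns this into a pointwise bound
  of \<open>z_n\<close> by a multiple of \<open>kap\<close>: one majorant for all
  \<open>n\<close>.\<close>

lemma hstate_bound:
  assumes a: "approx epss ks Ss S ys gs" and h: "!!n. hstate (aw (epss n) (ks n)) (ys n) (zs n)"
  shows "EX tau. LpV M p tau & (AE x in M. ALL n. abs (zs n x) <= tau x)"
proof -
  note D = approxD[OF a]
  let ?a = "%n. aw (epss n) (ks n)" and ?m = "measure M (space M)"
  obtain B where B: "!!n. en (?a n) (ys n) <= B" using ip1_bounded[OF a] by blast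
  obtain C where C: "0 <= C" "!!eps k t. 0 < eps ==> eps <= 1 ==> 1 <= k ==>
      norm (flux (aw eps k) (t::real)) powr q <= C * (1 + aw eps k (abs t) * (abs t)^2)" using aw_flux_powr by blast
  obtain kap where kap: "LpV M p kap" "!!x. 0 <= kap x"
    "!!u. LpV M q u ==> AE x in M. abs (Bop U K u x) <= kap x * Ipow M q u powr (1/q)"
    using Bop_bound[of p q] q_facts by auto
  have Lz: "LpV M 2 (zs n)" and eq: "AE x in M. zs n x + Bop U K (%t. flux (?a n) (ys n t) + flux (?a n) (zs n t)) x = 0" for n
    using h[of n] by (auto simp: hstate_def)
  have Ly: "LpV M 2 (ys n)" for n by (rule W0_LpV(1)[OF D(10)])
  note F = flux_aw_LpV2[OF D(1)]
  \<comment> \<open>The energies are at most \<open>B\<close> for \<open>y_n\<close> and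
    \<open>4 * B\<close> for \<open>z_n\<close>, and each flux adds one measure of the
    domain.\<close>
  define R where "R = 2 powr q * (C * (2 * ?m + 5 * B))"
  have "AE x in M. abs (zs n x) <= kap x * R powr (1/q)" for n
  proof -
    let ?w = "%t. flux (?a n) (ys n t) + flux (?a n) (zs n t)"
    have Lw: "LpV M 2 ?w" using LpV_add[OF F[OF Ly] F[OF Lz]] by simp
    have qq: "Ipow M q (%x. flux (?a n) (u x)) <= C * (?m + en (?a n) u)" if "LpV M 2 u" for u :: "real^'n => real"
    proof -
      note i = aw_energy_integrable[OF D(1)[of n] that, of "ks n", unfolded real_norm_def]
      have "Ipow M q (%x. flux (?a n) (u x)) <= (LINT x|M. C * (1 + ?a n (abs (u x)) * (abs (u x))^2))"
        unfolding Ipow_def using C(2)[OF D(1-3)]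
        by (intro integral_mono LpV_integrable L2_Lq F that integrable_mult_right Lintegrable_add i) auto
      also have "... = C * (?m + en (?a n) u)" using i by (simp add: en_def)
      finally show ?thesis .
    qed
    have iy: "integrable M (%x. flux (?a n) (ys n x) * zs n x)" by (rule LpV2_mult_integrable[OF F[OF Ly] Lz])
    have iz: "integrable M (%x. flux (?a n) (zs n x) * zs n x)" by (rule LpV2_mult_integrable[OF F[OF Lz] Lz])
    \<comment> \<open>Comparison with the trivial pair \<open>w' = 0\<close>,
      \<open>z' = 0\<close>.\<close>
    have "(LINT x|M. (?w x - 0) * (zs n x - 0)) <= 0" by (rule monotone_pairing[OF L2_Lq[OF Lw] LpV_zero eq])
        (use LpV_measurable[OF Lz] in "auto simp: Bop_def intO_def")
    hence "en (?a n) (zs n) <= (LINT x|M. - (flux (?a n) (ys n x) * zs n x))"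
      using iy iz flux_inner_self[of "?a n" "zs n _"] by (simp add: distrib_right en_def)
    also have "... <= (LINT x|M. 2 * (?a n (norm (ys n x)) * (norm (ys n x))^2) + 1/2 * (?a n (norm (zs n x)) * (norm (zs n x))^2))"
    proof (intro integral_mono integrable_minus iy Lintegrable_add integrable_mult_right aw_energy_integrable[OF D(1)] Ly Lz)
      fix x
      let ?s = "norm (ys n x)" and ?t = "norm (zs n x)"
      have "- (flux (?a n) (ys n x) * zs n x) <= norm (flux (?a n) (ys n x)) * ?t"
        by (metis abs_ge_minus_self abs_mult real_norm_def)
      also have "... = ?a n ?s * ?s * ?t" unfolding norm_flux[OF nondec_aw[OF D(1)]] ..
      also have "... <= 2 * (?a n ?s * ?s^2) + 1/2 * (?a n ?t * ?t^2)"
        by (rule nondec_mixed_le[OF nondec_aw[OF D(1)]]) auto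
      finally show "- (flux (?a n) (ys n x) * zs n x) <= ..." .
    qed
    also have "... = 2 * en (?a n) (ys n) + 1/2 * en (?a n) (zs n)"
      using aw_energy_integrable[OF D(1) Ly, of n "ks n" n] aw_energy_integrable[OF D(1) Lz, of n "ks n" n] by (simp add: en_def)
    finally have ez: "en (?a n) (zs n) <= 4 * B" using B[of n] by simp
    have "Ipow M q ?w <= 2 powr q * (Ipow M q (%x. flux (?a n) (ys n x)) + Ipow M q (%x. flux (?a n) (zs n x)))"
      by (rule Ipow_add_le[OF L2_Lq[OF F[OF Ly]] L2_Lq[OF F[OF Lz]]]) (use q_facts in simp)
    also have "... <= 2 powr q * (C * (?m + en (?a n) (ys n)) + C * (?m + en (?a n) (zs n)))"
      by (intro mult_left_mono add_mono qq Ly Lz) simp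
    also have "... <= R"
      unfolding R_def using B[of n] ez C(1) by (auto simp: distrib_left[symmetric] intro!: mult_left_mono)
    finally have "Ipow M q ?w powr (1/q) <= R powr (1/q)" using q_facts by (intro powr_mono2) auto
    hence "kap x * Ipow M q ?w powr (1/q) <= kap x * R powr (1/q)" for x by (rule mult_left_mono[OF _ kap(2)])
    note le = this
    show ?thesis using eq[of n] kap(3)[OF L2_Lq[OF Lw]]
    proof eventually_elim
      case (elim x)
      have "abs (zs n x) = abs (Bop U K ?w x)" using elim(1) by linarith
      thus ?case using elim(2) le[of x] by linarith
    qed
  qed
  moreover have "LpV M p (%x. kap x * R powr (1/q))" using LpV_scale[OF kap(1), of "R powr (1/q)"] by (simp add: mult.commute)
  ultimately show ?thesis by (intro exI[of _ "%x. kap x * R powr (1/q)"]) (simp add: AE_all_countable)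
qed

text \<open>By doubling, the energies of \<open>ys n - y\<close> and of \<open>y\<close> majorize
  that of \<open>ys n\<close>, hence the q-th power of its flux.\<close>

lemma source_flux_tendsto:
  assumes a: "approx epss ks Ss S ys gs" and y: "LpV M p y"
    and lim: "AE x in M. (%n. ys n x) ----> y x" and W: "integrable M W"
    and dom: "AE x in M. ALL n. aw (epss n) (ks n) (abs (ys n x - y x)) * (abs (ys n x - y x))^2 <= W x"
  shows "(%n. Ipow M q (%x. flux (aw (epss n) (ks n)) (ys n x) - G (y x))) ----> 0"
proof -
  note D = approxD[OF a]
  let ?a = "%n. aw (epss n) (ks n)" and ?D = "8 powr ((p - 2) / 2)" and ?c = "3 powr ((p - 2) / 2)"
  obtain C where C: "0 <= C" "!!eps k t. 0 < eps ==> eps <= 1 ==> 1 <= k ==>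
      norm (flux (aw eps k) (t::real)) powr q <= C * (1 + aw eps k (abs t) * (abs t)^2)" using aw_flux_powr by blast
  let ?w = "%x. C * (1 + 4 * ?D * (W x + ?c * (abs (y x) powr 2 + abs (y x) powr p)))"
  have y2: "LpV M 2 y" using LpV_lower[OF y, of 2] p by simp
  show ?thesis
  proof (rule Ipow_tendsto_dominated[where w="?w"])
    show "integrable M ?w" using W LpV_integrable[OF y] LpV_integrable[OF y2]
      by (intro integrable_mult_right Lintegrable_add integrable_const) auto
    show "AE x in M. (%n. flux (?a n) (ys n x)) ----> G (y x)"
      using lim by eventually_elim (rule flux_aw_tendsto[OF D(1,4,5)])
    show "AE x in M. ALL n. norm (flux (?a n) (ys n x)) powr q <= ?w x" using dom
    proof (eventually_elim, intro allI)
      fix x n assume e: "ALL n. ?a n (abs (ys n x - y x)) * (abs (ys n x - y x))^2 <= W x"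
      let ?t = "abs (y x)"
      have "?a n ?t * ?t^2 <= ?c * (1 + pw p ?t) * ?t^2" using aw_le_pw[OF D(1-3)] by (intro mult_right_mono) auto
      also have "... = ?c * (?t powr 2 + ?t powr p)" using pw_energy[of ?t p] by (simp add: algebra_simps powr_two)
      finally have 1: "?a n ?t * ?t^2 <= ?c * (?t powr 2 + ?t powr p)" .
      have "?a n (abs (ys n x)) * (abs (ys n x))^2 <= 4 * ?D * (?a n (abs (ys n x - y x)) * (abs (ys n x - y x))^2 + ?a n ?t * ?t^2)"
        using modulus_energy_norm_add[OF modulus_aw[OF D(1,3)], of n n "ys n x - y x" "y x"] by simp
      also have "... <= 4 * ?D * (W x + ?c * (?t powr 2 + ?t powr p))"
        using 1 e by (intro mult_left_mono add_mono) auto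
      finally have "C * (1 + ?a n (abs (ys n x)) * (abs (ys n x))^2) <= ?w x" using C(1) by (intro mult_left_mono) auto
      thus "norm (flux (?a n) (ys n x)) powr q <= ?w x" using C(2)[OF D(1-3), of n n "ys n x"] by linarith
    qed
    show "!!n. (%x. flux (?a n) (ys n x)) : borel_measurable M" "(%x. G (y x)) : borel_measurable M"
      using borel_measurable_flux[OF nondec_aw[OF D(1)] LpV_measurable[OF W0_LpV(1)[OF D(10)]]]
        borel_measurable_flux[OF nondec_pw[OF p] LpV_measurable[OF y]] by auto
  qed (use q_facts in simp)
qed

text \<open>Both fluxes are taken at the same point \<open>zs n x\<close>, so no convergence of
  \<open>zs n\<close> is involved: boundedness by \<open>tau x\<close> is enough.\<close>

lemma flux_defect_tendsto:
  assumes a: "approx epss ks Ss S ys gs" and z: "!!n. zs n : borel_measurable M"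
    and tau: "LpV M p tau" "AE x in M. ALL n. abs (zs n x) <= tau x"
  shows "(%n. Ipow M q (%x. flux (aw (epss n) (ks n)) (zs n x) - G (zs n x))) ----> 0"
proof -
  note D = approxD[OF a]
  let ?a = "%n. aw (epss n) (ks n)" and ?c = "3 powr ((p - 2) / 2)"
  obtain C where C: "0 <= C" "!!eps k t. 0 < eps ==> eps <= 1 ==> 1 <= k ==>
      norm (flux (aw eps k) (t::real)) powr q <= C * (1 + aw eps k (abs t) * (abs t)^2)" using aw_flux_powr by blast
  let ?v = "%x. C * (1 + ?c * (abs (tau x) powr 2 + abs (tau x) powr p))"
  let ?w = "%x. 2 powr q * (?v x + abs (tau x) powr p)"
  have t2: "LpV M 2 tau" using LpV_lower[OF tau(1), of 2] p by simp
  have "(%n. Ipow M q (%x. (flux (?a n) (zs n x) - G (zs n x)) - 0)) ----> 0"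
  proof (rule Ipow_tendsto_dominated[where w="?w"])
    show "integrable M ?w" using LpV_integrable[OF tau(1)] LpV_integrable[OF t2]
      by (intro integrable_mult_right Lintegrable_add integrable_const) auto
    show "AE x in M. (%n. flux (?a n) (zs n x) - G (zs n x)) ----> 0" using tau(2)
    proof eventually_elim
      case (elim x)
      have "(%n. ?a n (abs (zs n x)) - pw p (abs (zs n x))) ----> 0"
        by (rule aw_diff_tendsto[OF D(1,4,5), where R="tau x"]) (use elim in auto)
      hence "(%n. abs (?a n (abs (zs n x)) - pw p (abs (zs n x))) * tau x) ----> 0 * tau x"
        by (intro tendsto_mult tendsto_const) (simp add: tendsto_rabs_zero)
      hence l: "(%n. abs (?a n (abs (zs n x)) - pw p (abs (zs n x))) * tau x) ----> 0" by simp
      show ?case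
      proof (rule Lim_null_comparison[OF always_eventually l], intro allI)
        fix n
        have "flux (?a n) (zs n x) - G (zs n x) = (?a n (abs (zs n x)) - pw p (abs (zs n x))) * zs n x"
          by (simp add: flux_def left_diff_distrib)
        thus "norm (flux (?a n) (zs n x) - G (zs n x)) <= abs (?a n (abs (zs n x)) - pw p (abs (zs n x))) * tau x"
          using elim by (simp add: abs_mult mult_left_mono)
      qed
    qed
    show "AE x in M. ALL n. norm (flux (?a n) (zs n x) - G (zs n x)) powr q <= ?w x" using tau(2)
    proof (eventually_elim, intro allI)
      fix x n assume "ALL n. abs (zs n x) <= tau x"
      hence z: "abs (zs n x) <= abs (tau x)" using abs_ge_self order_trans by blast
      let ?t = "abs (tau x)"
      have "?a n (abs (zs n x)) * (abs (zs n x))^2 <= ?a n ?t * ?t^2" using z by (intro modulus_energy_le[OF modulus_aw[OF D(1,3)]]) auto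
      also have "... <= ?c * (1 + pw p ?t) * ?t^2" using aw_le_pw[OF D(1-3)] by (intro mult_right_mono) auto
      also have "... = ?c * (?t powr 2 + ?t powr p)" using pw_energy[of ?t p] by (simp add: algebra_simps powr_two)
      finally have "C * (1 + ?a n (abs (zs n x)) * (abs (zs n x))^2) <= ?v x" using C(1) by (intro mult_left_mono) auto
      hence 1: "norm (flux (?a n) (zs n x)) powr q <= ?v x" using C(2)[OF D(1-3), of n n "zs n x"] by linarith
      have 2: "norm (G (zs n x)) powr q <= ?t powr p" unfolding G_powr using z p by (intro powr_mono2) auto
      have "norm (flux (?a n) (zs n x) - G (zs n x)) powr q <= (norm (flux (?a n) (zs n x)) + norm (G (zs n x))) powr q"
        by (rule powr_mono2[OF _ norm_ge_zero norm_triangle_ineq4]) (use q_facts in simp)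
      also have "... <= 2 powr q * (norm (flux (?a n) (zs n x)) powr q + norm (G (zs n x)) powr q)"
        using q_facts by (intro powr_add_le) auto
      also have "... <= ?w x" using 1 2 by (intro mult_left_mono add_mono) auto
      finally show "norm (flux (?a n) (zs n x) - G (zs n x)) powr q <= ?w x" .
    qed
    show "!!n. (%x. flux (?a n) (zs n x) - G (zs n x)) : borel_measurable M"
      using borel_measurable_flux[OF nondec_aw[OF D(1)] z] borel_measurable_flux[OF nondec_pw[OF p] z] by simp
  qed (use q_facts in simp_all)
  thus ?thesis by simp
qed

lemma Bop_tendsto:
  assumes w: "LpV M q w" "!!n. LpV M q (ws n)" and lim: "(%n. Ipow M q (%x. ws n x - w x)) ----> 0"
  shows "AE x in M. (%n. Bop U K (ws n) x) ----> Bop U K w x"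
proof -
  obtain kap where kap: "!!u. LpV M q u ==> AE x in M. abs (Bop U K u x) <= kap x * Ipow M q u powr (1/q)"
    using Bop_bound[of p q] q_facts by auto
  have "AE x in M. ALL n. abs (Bop U K (%x. ws n x - w x) x) <= kap x * Ipow M q (%x. ws n x - w x) powr (1/q)"
    unfolding AE_all_countable by (intro allI kap LpV_diff w) (use q_facts in simp)
  moreover have "AE x in M. ALL n. Bop U K (%x. ws n x - w x) x = Bop U K (ws n) x - Bop U K w x"
    unfolding AE_all_countable by (intro allI Bop_diff w)
  ultimately show ?thesis
  proof eventually_elim
    case (elim x)
    have "(%n. Ipow M q (%x. ws n x - w x) powr (1/q)) ----> 0"
      by (rule tendsto_zero_powrI[OF lim tendsto_const]) (use q_facts in auto)
    hence "(%n. kap x * Ipow M q (%x. ws n x - w x) powr (1/q)) ----> kap x * 0" by (intro tendsto_intros)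
    hence "(%n. kap x * Ipow M q (%x. ws n x - w x) powr (1/q)) ----> 0" by simp
    hence "(%n. Bop U K (ws n) x - Bop U K w x) ----> 0"
      by (rule Lim_null_comparison[rotated]) (use elim in auto)
    thus ?case by (rule LIM_zero_cancel)
  qed
qed

text \<open>The equations for indices \<open>m\<close> and \<open>n\<close> are paired. Up to the
  defects \<open>d m\<close>, \<open>d n\<close> the unknowns differ by
  \<open>G (zs m x) - G (zs n x)\<close>, so monotonicity of \<open>G\<close> makes
  \<open>zs\<close> a Cauchy sequence in L^p.\<close>

theorem hstate_limit:
  assumes a: "approx epss ks Ss S ys gs" and y: "LpV M p y"
    and lim: "AE x in M. (%n. ys n x) ----> y x" and W: "integrable M W"
    and dom: "AE x in M. ALL n. aw (epss n) (ks n) (abs (ys n x - y x)) * (abs (ys n x - y x))^2 <= W x"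
    and h: "!!n. hstate (aw (epss n) (ks n)) (ys n) (zs n)"
  shows "EX z. hp y z & (%n. Ipow M 2 (%x. zs n x - z x)) ----> 0"
proof -
  note D = approxD[OF a]
  let ?a = "%n. aw (epss n) (ks n)"
  have pq0: "0 <= q" "0 <= p" "0 < p" "1 <= p" "0 < q" using q_facts by auto
  obtain tau where tau: "LpV M p tau" "AE x in M. ALL n. abs (zs n x) <= tau x" using hstate_bound[OF a h] by blast
  have Lz2: "LpV M 2 (zs n)" and eq: "AE x in M. zs n x + Bop U K (%t. flux (?a n) (ys n t) + flux (?a n) (zs n t)) x = 0" for n
    using h[of n] by (auto simp: hstate_def)
  have Lz: "LpV M p (zs n)" for n
    by (rule LpV_mono[OF LpV_measurable[OF Lz2] tau(1)]) (use tau(2) pq0 in "auto elim!: eventually_mono intro: order_trans[OF _ abs_ge_self]")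
  have Ly: "LpV M 2 (ys n)" for n by (rule W0_LpV(1)[OF D(10)])
  have F: "LpV M q (%x. flux (?a n) (u x))" if "LpV M 2 u" for n and u :: "real^'n => real"
    by (rule L2_Lq[OF flux_aw_LpV2[OF D(1) that]])
  define w where "w n x = flux (?a n) (ys n x) + flux (?a n) (zs n x)" for n x
  define d where "d n x = (flux (?a n) (ys n x) - G (y x)) + (flux (?a n) (zs n x) - G (zs n x))" for n x
  have wd: "w n x = d n x + (G (y x) + G (zs n x))" for n x by (simp add: w_def d_def)
  have Lw: "LpV M q (w n)" for n unfolding w_def[abs_def] by (intro LpV_add F Ly Lz2 pq0)
  have L1: "LpV M q (%x. flux (?a n) (ys n x) - G (y x))" "LpV M q (%x. flux (?a n) (zs n x) - G (zs n x))" for n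
    by (intro LpV_diff F Ly Lz2 G_Lq Lz y pq0)+
  have Ld: "LpV M q (d n)" for n unfolding d_def[abs_def] by (intro LpV_add L1 pq0)
  have d0: "(%n. Ipow M q (d n)) ----> 0" unfolding d_def[abs_def]
    by (rule Ipow_tendsto_add[OF L1 pq0(1) source_flux_tendsto[OF a y lim W dom] flux_defect_tendsto[OF a LpV_measurable[OF Lz2] tau]])
  \<comment> \<open>\<open>2 * tau\<close> majorizes every difference \<open>zs m - zs n\<close>, so
    the defect term is small by Hoelder without knowledge of the limit.\<close>
  define c where "c n = (LINT x|M. abs (d n x) * (2 * tau x))" for n
  have hol: "1 < q" "1 < p" "1 / q + 1 / p = 1" using q_facts by auto
  have Ldn: "LpV M q (%x. abs (d n x))" for n using Ld[of n] by (auto simp: LpV_def)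
  have L2tau: "LpV M p (%x. 2 * tau x)" using LpV_scale[OF tau(1), of 2] by simp
  note ic = Holder_ineq(1)[OF hol Ldn L2tau]
  have c0: "c ----> 0"
  proof (rule Lim_null_comparison[OF always_eventually], intro allI)
    show "norm (c n) <= Ipow M q (d n) powr (1/q) * Ipow M p (%x. 2 * tau x) powr (1/p)" for n
      using order_trans[OF integral_abs_bound Holder_ineq(2)[OF hol Ldn[of n] L2tau]] by (simp add: c_def Ipow_def)
    have "(%n. Ipow M q (d n) powr (1/q)) ----> 0"
      by (rule tendsto_zero_powrI[OF d0 tendsto_const]) (use pq0 in auto)
    from tendsto_mult_right[OF this] show "(%n. Ipow M q (d n) powr (1/q) * Ipow M p (%x. 2 * tau x) powr (1/p)) ----> 0" by simp
  qed
  define k0 where "k0 = 2 * (1/2) powr p"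
  have k0: "0 < k0" by (simp add: k0_def)
  have cau: "k0 * Ipow M p (%x. zs m x - zs n x) <= c m + c n" for m n
  proof -
    have Lzd: "LpV M p (%x. zs m x - zs n x)" by (intro LpV_diff Lz pq0)
    have iw: "integrable M (%x. (w m x - w n x) * (zs m x - zs n x))"
      by (rule Holder_ineq(1)[OF hol _ Lzd]) (intro LpV_diff Lw pq0)
    have "k0 * Ipow M p (%x. zs m x - zs n x) = (LINT x|M. k0 * norm (zs m x - zs n x) powr p)" by (simp add: Ipow_def)
    also have "... <= (LINT x|M. (w m x - w n x) * (zs m x - zs n x) + (abs (d m x) * (2 * tau x) + abs (d n x) * (2 * tau x)))"
    proof (intro integral_mono_AE integrable_mult_right LpV_integrable Lzd Lintegrable_add iw ic)
      show "AE x in M. k0 * norm (zs m x - zs n x) powr p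
          <= (w m x - w n x) * (zs m x - zs n x) + (abs (d m x) * (2 * tau x) + abs (d n x) * (2 * tau x))"
        using tau(2)
      proof eventually_elim
        case (elim x)
        have "abs (zs m x - zs n x) <= 2 * tau x" using elim[rule_format, of m] elim[rule_format, of n] by linarith
        hence "abs (d m x - d n x) * abs (zs m x - zs n x) <= (abs (d m x) + abs (d n x)) * (2 * tau x)"
          by (intro mult_mono) auto
        moreover have "- ((d m x - d n x) * (zs m x - zs n x)) <= abs (d m x - d n x) * abs (zs m x - zs n x)"
          by (metis abs_ge_minus_self abs_mult)
        moreover have "k0 * norm (zs m x - zs n x) powr p <= (G (zs m x) - G (zs n x)) * (zs m x - zs n x)"
          using G_monotone[of "zs m x" "zs n x"] by (simp add: k0_def)
        moreover have "(G (zs m x) - G (zs n x)) * (zs m x - zs n x)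
            = (w m x - w n x) * (zs m x - zs n x) - (d m x - d n x) * (zs m x - zs n x)"
          by (simp add: wd algebra_simps)
        ultimately show ?case by (simp only: distrib_right)
      qed
    qed
    also have "... = (LINT x|M. (w m x - w n x) * (zs m x - zs n x)) + (c m + c n)" using iw ic by (simp add: c_def)
    also have "... <= c m + c n"
      using monotone_pairing[OF Lw[of m] Lw[of n] _ _ LpV_measurable[OF Lz[of m]] LpV_measurable[OF Lz[of n]]] eq
      by (simp add: w_def[abs_def])
    finally show ?thesis .
  qed
  have "EX N. ALL m>=N. ALL n>=N. Ipow M p (%x. zs m x - zs n x) < e" if e: "0 < e" for e
  proof -
    have "eventually (%n. c n < k0 * e / 2) sequentially" using k0 e by (intro order_tendstoD(2)[OF c0]) simp
    then obtain N where N: "!!n. N <= n ==> c n < k0 * e / 2" by (auto simp: eventually_sequentially)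
    have "Ipow M p (%x. zs m x - zs n x) < e" if "N <= m" "N <= n" for m n
    proof -
      have "k0 * Ipow M p (%x. zs m x - zs n x) < k0 * e" using cau[of m n] N[OF that(1)] N[OF that(2)] by linarith
      thus ?thesis using k0 by simp
    qed
    thus ?thesis by blast
  qed
  then obtain z where z: "LpV M p z" "(%n. Ipow M p (%x. zs n x - z x)) ----> 0"
    by (rule Ipow_complete[OF pq0(4) Lz]) (assumption | rule that)+
  \<comment> \<open>A subsequence suffices for the equation of the limit; the convergence of the
    whole sequence in L^p is already established.\<close>
  obtain r V where r: "strict_mono r" "AE x in M. (%j. zs (r j) x) ----> z x"
    by (rule Ipow_dominated_subseq[OF pq0(3) LpV_diff[OF Lz z(1) pq0(2)] z(2)]) (rule that)
  have Gz: "(%j. Ipow M q (%x. G (zs (r j) x) - G (z x))) ----> 0"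
  proof (rule Ipow_tendsto_dominated[OF pq0(5) LpV_measurable[OF G_Lq[OF Lz]] LpV_measurable[OF G_Lq[OF z(1)]] LpV_integrable[OF tau(1)]])
    show "AE x in M. (%j. G (zs (r j) x)) ----> G (z x)" using r(2)
    proof eventually_elim
      case (elim x)
      show ?case by (rule continuous_on_tendsto_compose[OF continuous_on_flux[OF nondec_pw[OF p]] elim]) auto
    qed
    show "AE x in M. ALL j. norm (G (zs (r j) x)) powr q <= norm (tau x) powr p"
      unfolding G_powr using tau(2)
    proof (eventually_elim, intro allI)
      fix x j assume "ALL n. abs (zs n x) <= tau x"
      thus "abs (zs (r j) x) powr p <= norm (tau x) powr p"
        using pq0(2) by (intro powr_mono2) (auto intro: order_trans)
    qed
  qed
  have "AE x in M. (%j. Bop U K (w (r j)) x) ----> Bop U K (%x. G (y x) + G (z x)) x"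
  proof (rule Bop_tendsto[OF LpV_add[OF G_Lq[OF y] G_Lq[OF z(1)] pq0(1)] Lw])
    have "(%j. Ipow M q (%x. d (r j) x + (G (zs (r j) x) - G (z x)))) ----> 0"
      by (rule Ipow_tendsto_add[OF Ld LpV_diff[OF G_Lq[OF Lz] G_Lq[OF z(1)] pq0(1)] pq0(1)
            filterlim_compose[OF d0 filterlim_subseq[OF r(1)]] Gz])
    thus "(%j. Ipow M q (%x. w (r j) x - (G (y x) + G (z x)))) ----> 0" by (simp add: wd algebra_simps)
  qed
  moreover have "AE x in M. ALL n. zs n x + Bop U K (w n) x = 0" using eq by (simp add: AE_all_countable w_def[abs_def])
  ultimately have "AE x in M. z x + Bop U K (%x. G (y x) + G (z x)) x = 0" using r(2)
  proof eventually_elim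
    case (elim x)
    have "(%j. zs (r j) x + Bop U K (w (r j)) x) ----> z x + Bop U K (%x. G (y x) + G (z x)) x"
      by (intro tendsto_add elim)
    thus ?case using elim(2) by (simp add: LIMSEQ_const_iff)
  qed
  hence "hp y z" using z(1) by (simp add: hp_def)
  moreover have "(%n. Ipow M 2 (%x. zs n x - z x)) ----> 0"
    by (rule Ipow_tendsto_lower[OF LpV_diff[OF Lz z(1) pq0(2)] _ p z(2)]) simp
  ultimately show ?thesis by blast
qed

end

section \<open>Functions of bounded variation\<close>

lemma C0_integral_close:
  fixes phi :: "real^'n => real"
  assumes fin: "finite_measure mu" and s: "sets mu = sets (restrict_space borel U)"
    and phi: "C0 U phi" and psi: "C1c U psi" and e: "!!x. x : U ==> abs (phi x - psi x) <= e"
  shows "abs (integral\<^sup>L mu phi - integral\<^sup>L mu psi) <= e * measure mu (space mu)"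
proof -
  interpret finite_measure mu by fact
  have sp: "space mu = U" using sets_eq_imp_space_eq[OF s] by (simp add: space_restrict_space)
  have m: "phi : borel_measurable mu" "psi : borel_measurable mu"
    unfolding measurable_cong_sets[OF s refl]
    using phi C1c_measurable(1)[OF psi] by (auto simp: C0_def intro: measurable_restrict_space1 borel_measurable_continuous_on_restrict)
  obtain B where B: "!!x. abs (psi x) <= B" using C1c_bounded[OF psi] by blast
  have i: "integrable mu psi" by (rule integrable_const_bound[where B=B]) (use B m in auto)
  have d: "integrable mu (%x. phi x - psi x)"
    by (rule integrable_const_bound[where B=e]) (use e m in "auto simp: sp")
  have "integral\<^sup>L mu phi - integral\<^sup>L mu psi = (LINT x|mu. phi x - psi x)"
    using Bochner_Integration.integral_add[OF d i] by simp
  also have "abs (...) <= (LINT x|mu. e)"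
    by (rule order_trans[OF integral_abs_bound integral_mono]) (use d e in "auto simp: sp")
  finally show ?thesis by (simp add: mult.commute)
qed

text \<open>Representing pairs agree on test functions by definition; uniform approximation and
  finiteness of the measures extend this to \<open>C0\<close>.\<close>

lemma Drep_unique:
  assumes U: "open U" and D: "Drep U u l mu nu" "Drep U u l mu' nu'" and phi: "C0 U phi"
  shows "integral\<^sup>L mu phi - integral\<^sup>L nu phi = integral\<^sup>L mu' phi - integral\<^sup>L nu' phi"
proof -
  let ?m = "%mu. measure mu (space mu)"
  define C where "C = ?m mu + ?m nu + ?m mu' + ?m nu'"
  let ?d = "abs ((integral\<^sup>L mu phi - integral\<^sup>L nu phi) - (integral\<^sup>L mu' phi - integral\<^sup>L nu' phi))"
  have *: "?d <= e * C" if e: "0 < e" for e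
  proof -
    obtain psi where psi: "C1c U psi" "!!x. x : U ==> abs (phi x - psi x) <= e" using C0_approx[OF U phi e] by blast
    have "abs (integral\<^sup>L kap phi - integral\<^sup>L kap psi) <= e * ?m kap" if "kap : {mu, nu, mu', nu'}" for kap
      by (rule C0_integral_close[OF _ _ phi psi]) (use that D in "auto simp: Drep_def")
    hence b: "abs (integral\<^sup>L mu phi - integral\<^sup>L mu psi) <= e * ?m mu" "abs (integral\<^sup>L nu phi - integral\<^sup>L nu psi) <= e * ?m nu"
      "abs (integral\<^sup>L mu' phi - integral\<^sup>L mu' psi) <= e * ?m mu'" "abs (integral\<^sup>L nu' phi - integral\<^sup>L nu' psi) <= e * ?m nu'" by simp_all
    have "integral\<^sup>L mu psi - integral\<^sup>L nu psi = integral\<^sup>L mu' psi - integral\<^sup>L nu' psi" using D psi(1) unfolding Drep_def by (metis neg_equal_iff_equal)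
    thus ?thesis using b unfolding C_def distrib_left by linarith
  qed
  have "?d <= 0"
  proof (rule field_le_epsilon)
    fix e :: real assume e: "0 < e"
    have C: "0 <= C" by (simp add: C_def)
    have "?d <= e / (C + 1) * C" using e C by (intro *) auto
    also have "... <= e" using e C by (simp add: divide_le_eq mult_left_mono)
    finally show "?d <= 0 + e" by simp
  qed
  thus ?thesis by simp
qed

text \<open>Not trivial even for a constant family: the pair of measures representing a derivative
  may vary with the index, as the decomposition is not unique.\<close>

lemma wstar_BV_const:
  assumes U: "open U" and u: "BV U u"
  shows "wstar_BV U (%_. u) F u" unfolding wstar_BV_def
proof (intro conjI allI impI)
  fix l mus nus mu nu phi
  assume D: "eventually (%n. Drep U u l (mus n) (nus n)) F" "Drep U u l mu nu" and phi: "C0 U phi"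
  show "((%n. integral\<^sup>L (mus n) phi - integral\<^sup>L (nus n) phi) \<longlongrightarrow> integral\<^sup>L mu phi - integral\<^sup>L nu phi) F"
    using D(1) by (intro tendsto_eventually) (auto elim!: eventually_mono intro: Drep_unique[OF U _ D(2) phi])
qed (use u in "auto simp: intO_def")

lemma sum_liminf_le:
  fixes x :: "'i => nat => ereal"
  assumes "finite I" "!!i n. i : I ==> 0 <= x i n"
  shows "(\<Sum>i\<in>I. liminf (x i)) <= liminf (%n. \<Sum>i\<in>I. x i n)" using assms
proof (induction I rule: finite_induct)
  case (insert i I)
  have nn: "0 <= liminf (x i)" "0 <= liminf (%n. \<Sum>i\<in>I. x i n)"
    using insert.prems by (auto intro!: Liminf_bounded always_eventually sum_nonneg)
  have "(\<Sum>i\<in>insert i I. liminf (x i)) <= liminf (x i) + liminf (%n. \<Sum>i\<in>I. x i n)"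
    using insert by (auto intro!: add_left_mono)
  also have "... <= liminf (%n. x i n + (\<Sum>i\<in>I. x i n))" by (rule ereal_liminf_add_mono) (use nn in auto)
  finally show ?case using insert.hyps by simp
qed (simp add: Liminf_const)

lemma TV_nonneg: "0 <= TV U u"
  unfolding TV_def by (rule SUP_upper2[where i="%_. 0"]) (auto simp: C1c_zero(1) pd_eq_cgrad C1c_zero(2) intO_def)

context bounded_domain
begin

text \<open>A supremum of functionals that are continuous in L^1, since the divergence of each test
  field is bounded.\<close>

lemma TV_lsc:
  assumes u: "LpV M 1 u" and us: "!!n. LpV M 1 (us n)" and lim: "(%n. intO U (%x. abs (us n x - u x))) ----> 0"
  shows "TV U u <= liminf (%n. TV U (us n))" unfolding TV_def[of U u]
proof (rule SUP_least)
  fix phi :: "real^'n => real^'n" assume phi': "phi : {phi. (ALL i. C1c U (%x. phi x $ i)) & (ALL x. norm (phi x) <= 1)}"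
  let ?b = "%x. \<Sum>i\<in>UNIV. pd (%y. phi y $ i) i x"
  have phi: "C1c U (%x. phi x $ i)" for i using phi' by simp
  hence "ALL i. EX B. ALL x. abs (pd (%y. phi y $ i) i x) <= B"
    unfolding pd_eq_cgrad using C1c_bounded[OF phi] component_le_norm_cart order_trans by meson
  then obtain B where B: "!!i x. abs (pd (%y. phi y $ i) i x) <= B i" by metis
  have "(%n. (LINT x|M. us n x * ?b x)) ----> (LINT x|M. u x * ?b x)"
  proof (rule integral_tendsto_L1[OF us u])
    show "?b : borel_measurable M"
      unfolding pd_eq_cgrad by (intro borel_measurable_sum borel_measurable_vec_nth' C1c_measurable(4)[OF phi])
    show "abs (?b x) <= (\<Sum>i\<in>UNIV. B i)" for x by (rule order_trans[OF sum_abs sum_mono[OF B]])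
    show "(%n. Ipow M 1 (%x. us n x - u x)) ----> 0" using lim by (simp add: Ipow_def intO_def)
  qed simp
  hence "ereal (intO U (%x. u x * ?b x)) = liminf (%n. ereal (intO U (%x. us n x * ?b x)))"
    unfolding intO_def by (intro lim_imp_Liminf[symmetric] tendsto_ereal) auto
  also have "... <= liminf (%n. TV U (us n))"
    unfolding TV_def by (intro Liminf_mono always_eventually allI SUP_upper[OF phi'])
  finally show "ereal (intO U (%x. u x * ?b x)) <= liminf (%n. TV U (us n))" .
qed

text \<open>Summing the errors of all entries yields a single subsequence for the whole
  matrix.\<close>

lemma matrix_AE_subseq:
  fixes Ss :: "nat => real^'n => real^'n^'n"
  assumes L: "!!n i j. LpV M 1 (%x. Ss n x $ i $ j)" "!!i j. LpV M 1 (%x. S x $ i $ j)"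
    and lim: "!!i j. (%n. intO U (%x. abs (Ss n x $ i $ j - S x $ i $ j))) ----> 0"
  obtains r where "strict_mono r" "AE x in M. ALL i j. (%n. Ss (r n) x $ i $ j) ----> S x $ i $ j"
proof -
  define e where "e n x = (\<Sum>i\<in>UNIV. \<Sum>j\<in>UNIV. abs (Ss n x $ i $ j - S x $ i $ j))" for n x
  have i: "integrable M (%x. abs (Ss n x $ i $ j - S x $ i $ j))" for n i j
    using LpV_integrable[OF LpV_diff[OF L]] by simp
  have e0: "0 <= e n x" for n x by (simp add: e_def sum_nonneg)
  have ie: "integrable M (e n)" for n unfolding e_def[abs_def] by (intro Bochner_Integration.integrable_sum i)
  have "(%n. \<Sum>i\<in>UNIV. \<Sum>j\<in>UNIV. intO U (%x. abs (Ss n x $ i $ j - S x $ i $ j))) ----> (\<Sum>i\<in>(UNIV::'n set). \<Sum>j\<in>(UNIV::'n set). 0)"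
    by (intro tendsto_sum lim)
  hence l: "(%n. Ipow M 1 (%x. e n x - 0)) ----> 0"
    using e0 i by (simp add: Ipow_def e_def intO_def sum_nonneg Bochner_Integration.integral_sum)
  have Le: "LpV M 1 (%x. e n x - 0)" for n using ie[of n] e0 by (simp add: LpV_def)
  obtain r V where r: "strict_mono r" "AE x in M. (%j. e (r j) x) ----> 0"
    by (rule Ipow_dominated_subseq[OF _ Le l]) (auto intro: that)
  have le: "abs (Ss n x $ i $ j - S x $ i $ j) <= e n x" for n x i j
  proof -
    have "abs (Ss n x $ i $ j - S x $ i $ j) <= (\<Sum>j\<in>UNIV. abs (Ss n x $ i $ j - S x $ i $ j))" by (rule member_le_sum) auto
    also have "... <= e n x" unfolding e_def by (rule member_le_sum) (auto simp: sum_nonneg)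
    finally show ?thesis .
  qed
  have "AE x in M. ALL i j. (%n. Ss (r n) x $ i $ j) ----> S x $ i $ j" using r(2)
  proof (eventually_elim, intro allI)
    fix x i j assume "(%j. e (r j) x) ----> 0"
    hence "(%n. Ss (r n) x $ i $ j - S x $ i $ j) ----> 0"
      by (rule Lim_null_comparison[rotated]) (use le in auto)
    thus "(%n. Ss (r n) x $ i $ j) ----> S x $ i $ j" by (rule LIM_zero_cancel)
  qed
  thus ?thesis using r(1) that by blast
qed

end

section \<open>The variational limit\<close>

context hammerstein
begin

lemma pstate_cong_AE:
  assumes P: "pstate S y g" and S: "ell S" and W: "W0 2 y' g'" and AE: "AE x in M. y x = y' x" "AE x in M. g x = g' x"
  shows "pstate S y' g'"
proof -
  note m = LpV_measurable[OF W0_LpV(1)[OF W]] LpV_measurable[OF W0_LpV(2)[OF W]]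
  have Wp: "W0 p y g" using P by (simp add: pstate_def)
  have p0: "0 <= p" using p by simp
  have W': "W0 p y' g'" by (rule W0_cong_AE[OF Wp p0 m(1) AE(1) m(2) AE(2)])
  have "(LINT x|M. flux (pw p) (S x *v g' x) \<bullet> (S x *v h x)) = (LINT x|M. flux (pw p) (S x *v g x) \<bullet> (S x *v h x))" if "W0 p v h" for v h
    by (rule integral_cong_AE)
      (use AE(2) pform_integrable[OF S W0_LpV(2)[OF W'] W0_LpV(2)[OF that]] pform_integrable[OF S W0_LpV(2)[OF Wp] W0_LpV(2)[OF that]] in auto)
  thus ?thesis using P W' by (simp add: pstate_def)
qed

lemma hp_cong_AE:
  assumes h: "hp y z" and L: "LpV M p y" "y' : borel_measurable M" "z' : borel_measurable M"
    and AE: "AE x in M. y x = y' x" "AE x in M. z x = z' x"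
  shows "hp y' z'"
proof -
  have Lz: "LpV M p z" using h by (simp add: hp_def)
  have b: "x : U ==> Bop U K (%t. G (y t) + G (z t)) x = Bop U K (%t. G (y' t) + G (z' t)) x" for x
    by (rule Bop_cong_AE) (use AE L Lz in "auto intro!: borel_measurable_add borel_measurable_flux nondec_pw p dest: LpV_measurable")
  have "AE x in M. z' x + Bop U K (%t. G (y' t) + G (z' t)) x = 0"
    using h[unfolded hp_def, THEN conjunct2] AE(2) AE_space by eventually_elim (use b in auto)
  moreover have "LpV M p z'" by (rule LpV_mono[OF L(3) Lz]) (use AE(2) p in auto)
  ultimately show ?thesis by (simp add: hp_def)
qed

text \<open>Successive subsequences provide what the Hammerstein limit needs: an integrable majorant
  of the energies of \<open>ys n - y\<close>, then a.e. convergence of \<open>ys n\<close>.\<close>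

theorem compactness:
  assumes eps: "!!n. 0 < epss n" "epss ----> 0" and k: "filterlim ks at_top sequentially" and lip: "lipschitz_boundary U"
    and S: "!!n. ell (Ss n)" "ell S" "AE x in M. ALL i j. (%n. Ss n x $ i $ j) ----> S x $ i $ j"
    and st: "!!n. state (aw (epss n) (ks n)) (Ss n) (ys n) (gs n)" "!!n. hstate (aw (epss n) (ks n)) (ys n) (zs n)"
  shows "EX (r::nat => nat) y g z. strict_mono r & pstate S y g & hp y z & (%n. Ipow M 2 (%x. ys (r n) x - y x)) ----> 0 \<and>
    (%n. Ipow M 2 (%x. gs (r n) x - g x)) ----> 0 & (%n. Ipow M 2 (%x. zs (r n) x - z x)) ----> 0"
proof -
  have "eventually (%n. epss n <= 1 & 1 <= ks n) sequentially"
    using order_tendstoD(2)[OF eps(2), of 1] k[unfolded filterlim_at_top, rule_format, of 1]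
    by (auto elim: eventually_elim2)
  then obtain N where N: "!!n. N <= n ==> epss n <= 1 & 1 <= ks n" by (auto simp: eventually_sequentially)
  \<comment> \<open>Shifts the sequence so that \<open>epss n <= 1\<close> and
    \<open>1 <= ks n\<close> hold throughout.\<close>
  define r0 where "r0 n = n + N" for n
  have r0: "strict_mono r0" "!!n. N <= r0 n" by (auto simp: r0_def strict_mono_def)
  note f0 = filterlim_subseq[OF r0(1)]
  have S0: "AE x in M. ALL i j. (%n. Ss (r0 n) x $ i $ j) ----> S x $ i $ j" using S(3)
  proof eventually_elim
    case (elim x)
    thus ?case by (auto intro!: filterlim_compose[OF _ f0])
  qed
  have a0: "approx (%n. epss (r0 n)) (%n. ks (r0 n)) (%n. Ss (r0 n)) S (%n. ys (r0 n)) (%n. gs (r0 n))"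
    unfolding approx_def using eps(1) N[OF r0(2)] S(1,2) S0 st(1) filterlim_compose[OF eps(2) f0] filterlim_compose[OF k f0]
    by simp
  obtain y g where y: "pstate S y g" using state_limit[OF a0 lip] by blast
  hence W: "W0 p y g" by (simp add: pstate_def)
  let ?e = "%n x. aw (epss (r0 n)) (ks (r0 n)) (abs (ys (r0 n) x - y x)) * (abs (ys (r0 n) x - y x))^2"
  note s0 = state_strong_limit[OF a0 lip y]
  have p0: "0 <= p" using p by simp
  have Ld: "LpV M 2 (%x. ys n x - y x)" for n
    using LpV_diff[OF W0_LpV(1)[of 2 "ys n" "gs n"] W0_LpV(1)[OF W0_p_2[OF W]]] st(1) by (simp add: state_def)
  have e0: "0 <= ?e n x" for n x using nondecD(2)[OF nondec_aw[OF eps(1)]] by simp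
  have lim1: "(%n. Ipow M 1 (%x. ?e n x - 0)) ----> 0" using s0(2) e0 by (simp add: Ipow_def en_def)
  have L1: "LpV M 1 (%x. ?e n x - 0)" for n
    using aw_energy_integrable[OF eps(1) Ld, of "r0 n" "ks (r0 n)" "r0 n"] e0 by (simp add: LpV_def borel_measurable_integrable)
  \<comment> \<open>The energy densities themselves converge to zero in L^1, so a subsequence of
    them has an integrable majorant.\<close>
  obtain r1 :: "nat => nat" and V where r1: "strict_mono r1" "integrable M V" "AE x in M. ALL j. norm (?e (r1 j) x - 0) powr 1 <= V x"
    by (rule Ipow_dominated_subseq[where us="?e" and u="%_. 0", OF zero_less_one L1 lim1]) (rule that)
  have lim2: "(%n. Ipow M 2 (%x. ys (r0 (r1 n)) x - y x)) ----> 0"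
    by (rule filterlim_compose[OF s0(4) filterlim_subseq[OF r1(1)]])
  obtain r2 :: "nat => nat" where r2: "strict_mono r2" "AE x in M. (%j. ys (r0 (r1 (r2 j))) x) ----> y x"
    by (rule Ipow_dominated_subseq[OF zero_less_numeral Ld lim2]) (rule that)
  define r where "r j = r1 (r2 j)" for j
  have r: "strict_mono r" using r1(1) r2(1) by (auto simp: r_def strict_mono_def)
  have dom: "AE x in M. ALL n. ?e (r n) x <= V x" using r1(3)
  proof (eventually_elim, intro allI)
    fix x n assume "ALL j. norm (?e (r1 j) x - 0) powr 1 <= V x"
    thus "?e (r n) x <= V x" using e0[of "r n" x] unfolding r_def by (smt (verit) powr_one real_norm_def)
  qed
  obtain z where z: "hp y z" "(%n. Ipow M 2 (%x. zs (r0 (r n)) x - z x)) ----> 0"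
    using hstate_limit[OF approx_subseq[OF a0 r] W0_LpV(1)[OF W] r2(2)[folded r_def] r1(2) dom st(2)] by blast
  have "strict_mono (%n. r0 (r n))" using r0(1) r by (auto simp: strict_mono_def)
  thus ?thesis
    using y z filterlim_compose[OF s0(3) filterlim_subseq[OF r]] filterlim_compose[OF s0(4) filterlim_subseq[OF r]]
    by (intro exI[of _ "%n. r0 (r n)"] exI[of _ y] exI[of _ g] exI[of _ z] conjI)
qed

text \<open>Under weak convergence the last term vanishes and the middle one is nonnegative, giving
  lower semicontinuity; under strong convergence the middle one vanishes too, giving convergence of
  the costs.\<close>

lemma Icost_expand:
  assumes L: "LpV M 2 z'" "LpV M 2 z" "LpV M 2 zd"
  shows "Icost U zd z' = Icost U zd z + Ipow M 2 (%x. z' x - z x)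
    + 2 * (intO U (%x. z' x * (z x - zd x)) - intO U (%x. z x * (z x - zd x)))"
proof -
  have L2: "LpV M 2 (%x. z x - zd x)" "LpV M 2 (%x. z' x - z x)" by (intro LpV_diff L; simp)+
  note i = LpV2_mult_integrable[OF L2(1) L2(1)] LpV2_mult_integrable[OF L2(2) L2(2)] LpV2_mult_integrable[OF L(1) L2(1)] LpV2_mult_integrable[OF L(2) L2(1)]
  have "Icost U zd z' = (LINT x|M. (z x - zd x) * (z x - zd x) + (z' x - z x) * (z' x - z x) + 2 * (z' x * (z x - zd x) - z x * (z x - zd x)))"
    unfolding Icost_def intO_def by (intro Bochner_Integration.integral_cong) (auto simp: power2_eq_square algebra_simps)
  also have "... = (LINT x|M. (z x - zd x) * (z x - zd x)) + (LINT x|M. (z' x - z x) * (z' x - z x))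
      + 2 * ((LINT x|M. z' x * (z x - zd x)) - (LINT x|M. z x * (z x - zd x)))" using i by simp
  finally show ?thesis by (simp add: Icost_def intO_def Ipow_def powr_two power2_eq_square)
qed

text \<open>Reconciles the weak limit that is given with the strong subsequential limit that
  compactness finds: both are tested against their difference.\<close>

lemma weak_H10_limit_unique:
  assumes w: "weak_H10 U ys sequentially y" and r: "strict_mono r" and W: "W0 2 y' g'" and Ws: "!!n. W0 2 (ys n) (wgrad U (ys n))"
    and lim: "(%n. Ipow M 2 (%x. ys (r n) x - y' x)) ----> 0" "(%n. Ipow M 2 (%x. wgrad U (ys (r n)) x - g' x)) ----> 0"
  shows "AE x in M. y' x = y x" "AE x in M. g' x = wgrad U y x"
proof -
  have Wy: "W0 2 y (wgrad U y)" using w W1p0_eq_W0[of 2] by (simp add: weak_H10_def)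
  let ?v = "%x. y x - y' x"
  let ?h = "wgrad U ?v" and ?d = "%x. wgrad U y x - g' x"
  have Wd: "W0 2 ?v ?d" by (rule W0_diff[OF Wy W]) simp
  have Wv: "W0 2 ?v ?h" by (rule W0_wgrad[OF Wd]) simp
  have AE: "AE x in M. ?h x = ?d x" by (rule wgrad_AE_eq[OF Wd]) simp
  have "(%n. ip1 (ys (r n), wgrad U (ys (r n))) (?v, ?h)) ----> ip1 (y', g') (?v, ?h)"
  proof (rule H1.ip_tendsto)
    have "(%n. Ipow M 2 (%x. ys (r n) x - y' x) + Ipow M 2 (%x. wgrad U (ys (r n)) x - g' x)) ----> 0 + 0"
      by (intro tendsto_add lim)
    thus "(%n. ip1 ((ys (r n), wgrad U (ys (r n))) - (y', g')) ((ys (r n), wgrad U (ys (r n))) - (y', g'))) ----> 0"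
      using W0_diff[OF Ws W] by (simp add: ip1_self fun_diff_def)
  qed (use Ws W Wv in auto)
  moreover have "(%n. ip1 (ys (r n), wgrad U (ys (r n))) (?v, ?h)) ----> ip1 (y, wgrad U y) (?v, ?h)"
    using filterlim_compose[OF _ filterlim_subseq[OF r]] w Wv W1p0_eq_W0[of 2 ?v] by (fastforce simp: weak_H10_def ip1_def intO_def)
  ultimately have e: "ip1 (y', g') (?v, ?h) = ip1 (y, wgrad U y) (?v, ?h)" by (rule LIMSEQ_unique)
  have "ip1 (?v, ?h) (?v, ?h) = ip1 ((y, wgrad U y) - (y', g')) (?v, ?h)" unfolding ip1_def
    by (rule integral_cong_AE) (use AE LpV_measurable[OF W0_LpV(1)[OF Wv]] LpV_measurable[OF W0_LpV(2)[OF Wv]]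
      LpV_measurable[OF W0_LpV(2)[OF Wd]] in "auto simp: fun_diff_def intro!: borel_measurable_add borel_measurable_times borel_measurable_inner")
  also have "... = 0" using H1.ip_diff[of "(y, wgrad U y)" "(y', g')" "(?v, ?h)"] Wy W Wv e by simp
  finally have "Ipow M 2 ?v + Ipow M 2 ?h = 0" using ip1_self[of "(?v, ?h)"] Wv by simp
  hence z: "Ipow M 2 ?v = 0" "Ipow M 2 ?h = 0" using Ipow_nonneg[of M 2 ?v] Ipow_nonneg[of M 2 ?h] by linarith+
  show "AE x in M. y' x = y x" using Ipow_eq_0D[OF W0_LpV(1)[OF Wv] z(1)] by auto
  show "AE x in M. g' x = wgrad U y x" using Ipow_eq_0D[OF W0_LpV(2)[OF Wv] z(2)] AE by auto
qed

lemma weak_L2_limit_unique: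
  assumes w: "weak_L2 U zs sequentially z" and r: "strict_mono r" and L: "LpV M 2 z'" "!!n. LpV M 2 (zs n)"
    and lim: "(%n. Ipow M 2 (%x. zs (r n) x - z' x)) ----> 0"
  shows "AE x in M. z' x = z x"
proof -
  have Lz: "LpV M 2 z" using w by (simp add: weak_L2_def Lp_eq_LpV)
  let ?v = "%x. z x - z' x"
  have Lv: "LpV M 2 ?v" using LpV_diff[OF Lz L(1)] by simp
  have "(%n. ip0 (zs (r n)) ?v) ----> ip0 z' ?v"
    by (rule L2.ip_tendsto) (use L Lv lim in "auto simp: ip0_self fun_diff_def")
  moreover have "(%n. ip0 (zs (r n)) ?v) ----> ip0 z ?v"
    using filterlim_compose[OF _ filterlim_subseq[OF r]] w Lv by (fastforce simp: weak_L2_def ip0_def intO_def Lp_eq_LpV)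
  ultimately have "ip0 z' ?v = ip0 z ?v" by (rule LIMSEQ_unique)
  hence "ip0 ?v ?v = 0" using L2.ip_diff[of z z' ?v] Lz L Lv by (simp add: fun_diff_def)
  hence "Ipow M 2 ?v = 0" by (simp add: ip0_self)
  from Ipow_eq_0D[OF Lv this] show ?thesis by auto
qed

end

section \<open>Admissible matrices and the two halves of the variational limit\<close>

locale control_problem = hammerstein U Fk p dlt f al Lam K q
  for U :: "(real^'n::{finite,linorder}) set" and Fk p dlt f al Lam K q +
  fixes xi1 xi2 zd :: "real^'n::{finite,linorder} => real" and gam :: real
  assumes xi: "AE x in lebesgue_on U. al <= xi1 x & xi1 x <= xi2 x & xi2 x <= Lam"
    and lip: "lipschitz_boundary U" and zd: "LpV (lebesgue_on U) p zd"
begin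

abbreviation adm where "adm \<equiv> Aad U xi1 xi2 gam"
abbreviation sq where "sq A \<equiv> %x. psqrt (A x)"

lemma adm_BV: "adm A ==> BV U (%x. sq A x $ i $ j)" by (simp add: Aad_def)

lemma BV_L1: "BV U u ==> LpV M 1 u" by (simp add: BV_def Lp_eq_LpV)

lemma adm_psd:
  assumes "adm A"
  shows "AE x in M. psd (A x)"
proof -
  have "AE x in M. ALL eta. (xi1 x)^2 * (norm eta)^2 <= eta \<bullet> (A x *v eta)" "AE x in M. transpose (A x) = A x"
    using assms by (auto simp: Aad_def LinfSym_def)
  thus ?thesis
    by eventually_elim (auto simp: psd_def intro: order_trans[OF mult_nonneg_nonneg[OF zero_le_power2 zero_le_power2]])
qed

lemma adm_ell:
  assumes A: "adm A"
  shows "ell (sq A)" unfolding ell_def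
proof (intro conjI allI)
  show "(%x. sq A x $ i $ j) : borel_measurable M" for i j by (rule LpV_measurable[OF BV_L1[OF adm_BV[OF A]]])
  have "AE x in M. ALL eta. (xi1 x)^2 * (norm eta)^2 <= eta \<bullet> (A x *v eta) & eta \<bullet> (A x *v eta) <= (xi2 x)^2 * (norm eta)^2"
    using A by (simp add: Aad_def)
  with xi adm_psd[OF A] show "AE x in M. ALL xi. al * norm xi <= norm (sq A x *v xi) & norm (sq A x *v xi) <= Lam * norm xi"
  proof (eventually_elim, intro allI)
    fix x eta
    assume x: "al <= xi1 x & xi1 x <= xi2 x & xi2 x <= Lam" "psd (A x)"
      "ALL eta. (xi1 x)^2 * (norm eta)^2 <= eta \<bullet> (A x *v eta) & eta \<bullet> (A x *v eta) <= (xi2 x)^2 * (norm eta)^2"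
    let ?s = "norm (sq A x *v eta)"
    have s: "(xi1 x * norm eta)^2 <= ?s^2" "?s^2 <= (xi2 x * norm eta)^2"
      using x(3)[rule_format, of eta] psd_psqrt_vector(3)[OF x(2), of eta] by (simp_all add: power_mult_distrib)
    have "xi1 x * norm eta <= ?s" "?s <= xi2 x * norm eta"
      using x(1) al by (auto intro: power2_le_imp_le[OF s(1)] power2_le_imp_le[OF s(2)])
    moreover have "al * norm eta <= xi1 x * norm eta" "xi2 x * norm eta <= Lam * norm eta" using x(1) by (auto intro: mult_right_mono)
    ultimately show "al * norm eta <= ?s & ?s <= Lam * norm eta" by linarith
  qed
qed

text \<open>\<open>b\<close> is the weight as the problem writes it, \<open>a\<close> its continuous
  version. They need agree only after multiplication by the vector, which hides the value at 0 in
  the case \<open>p = 2\<close>.\<close>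

lemma weak_form_eq:
  assumes A: "adm A" and W: "W0 r v h" "1 <= r" and g: "g : borel_measurable M" and a: "nondec a"
    and ab: "!!xi::(real, 'n) vec. b (norm xi) *\<^sub>R xi = flux a xi" and b: "!!u :: (real, 'n) vec => (real, 'n) vec. u : borel_measurable M ==> (%x. b (norm (u x))) : borel_measurable M"
  shows "intO U (%x. b (norm (psqrt (A x) *v g x)) * ((A x *v g x) \<bullet> wgrad U v x))
    = (LINT x|M. flux a (sq A x *v g x) \<bullet> (sq A x *v h x))" unfolding intO_def
proof (rule integral_cong_AE)
  note S = adm_ell[OF A]
  have "(%x. A x $ i $ j) : borel_measurable M" for i j using A by (auto simp: Aad_def LinfSym_def Linf_def)
  thus "(%x. b (norm (psqrt (A x) *v g x)) * ((A x *v g x) \<bullet> wgrad U v x)) : borel_measurable M"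
    by (intro borel_measurable_times borel_measurable_inner b matrix_measurable ell_measurable[OF S] g
        LpV_measurable[OF W0_LpV(2)[OF W0_wgrad[OF W]]])
  show "(%x. flux a (sq A x *v g x) \<bullet> (sq A x *v h x)) : borel_measurable M"
    by (intro borel_measurable_inner borel_measurable_flux[OF a] ell_measurable[OF S] g LpV_measurable[OF W0_LpV(2)[OF W(1)]])
  show "AE x in M. b (norm (psqrt (A x) *v g x)) * ((A x *v g x) \<bullet> wgrad U v x) = flux a (sq A x *v g x) \<bullet> (sq A x *v h x)"
    using adm_psd[OF A] wgrad_AE_eq[OF W]
  proof eventually_elim
    case (elim x)
    thus ?case by (simp add: psd_psqrt_vector(2) flip: ab)
  qed
qed

lemma W0_wgrad_iff: "1 <= r ==> W0 r v h ==> W1p0 U r v" using W1p0_eq_W0 W0_wgrad by blast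

text \<open>Passes between tests by functions, with their chosen gradient, and tests by pairs with
  any valid gradient.\<close>

lemma weak_form_cong:
  assumes r: "1 <= r" and eq: "!!v h. W0 r v h ==> L v = (R h :: real)"
  shows "(ALL v. W1p0 U r v --> L v = intO U (%x. f x * v x)) \<longleftrightarrow> (ALL v h. W0 r v h --> R h = (LINT x|M. f x * v x))"
proof (intro iffI allI impI)
  fix v h assume "ALL v. W1p0 U r v --> L v = intO U (%x. f x * v x)" and W: "W0 r v h"
  thus "R h = (LINT x|M. f x * v x)" using W0_wgrad_iff[OF r W] eq[OF W] by (simp add: intO_def)
next
  fix v assume R: "ALL v h. W0 r v h --> R h = (LINT x|M. f x * v x)" and "W1p0 U r v"
  hence W: "W0 r v (wgrad U v)" using W1p0_eq_W0[OF r] by simp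
  show "L v = intO U (%x. f x * v x)" using R[rule_format, OF W] eq[OF W] by (simp add: intO_def)
qed

lemma Xi_ek_iff:
  assumes eps: "0 < eps"
  shows "Xi_ek U xi1 xi2 gam p K f Fk eps k A y z \<longleftrightarrow> adm A & state (aw eps k) (sq A) y (wgrad U y) & hstate (aw eps k) y z"
proof -
  have eq: "intO U (%x. (eps + Fk k ((norm (psqrt (A x) *v wgrad U y x))^2)) powr ((p - 2) / 2) * ((A x *v wgrad U y x) \<bullet> wgrad U v x))
      = (LINT x|M. flux (aw eps k) (sq A x *v wgrad U y x) \<bullet> (sq A x *v h x))"
    if "adm A" "W0 2 v h" "W0 2 y (wgrad U y)" for v h unfolding aw_def[symmetric]
    by (rule weak_form_eq[OF that(1,2)]) (use LpV_measurable[OF W0_LpV(2)[OF that(3)]] nondec_aw[OF eps]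
      in "auto simp: flux_def intro: borel_measurable_nondec_norm")
  have F: "(%t. Fek p Fk eps k (y t) (z t)) = (%t. flux (aw eps k) (y t) + flux (aw eps k) (z t))"
    by (simp add: Fek_def flux_def aw_def)
  show ?thesis
  proof (cases "adm A & W0 2 y (wgrad U y)")
    case True
    thus ?thesis unfolding Xi_ek_def state_def hstate_def F Lp_eq_LpV W1p0_eq_W0[OF one_le_numeral, of _ y]
      using weak_form_cong[OF one_le_numeral eq] by (simp add: conj_ac)
  qed (use W1p0_eq_W0[of 2 y] in "auto simp: Xi_ek_def state_def")
qed

lemma Xi_iff: "Xi U xi1 xi2 gam p K f A y z \<longleftrightarrow> adm A & pstate (sq A) y (wgrad U y) & hp y z"
proof -
  have p1: "1 <= p" using p by simp
  have eq: "intO U (%x. norm (psqrt (A x) *v wgrad U y x) powr (p - 2) * ((A x *v wgrad U y x) \<bullet> wgrad U v x))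
      = (LINT x|M. flux (pw p) (sq A x *v wgrad U y x) \<bullet> (sq A x *v h x))"
    if "adm A" "W0 p v h" "W0 p y (wgrad U y)" for v h
    by (rule weak_form_eq[where b="%t. t powr (p - 2)", OF that(1,2) p1]) (use LpV_measurable[OF W0_LpV(2)[OF that(3)]] nondec_pw[OF p]
      in "auto simp: pw_scaleR")
  have F: "(%t. Fnl p (y t) (z t)) = (%t. G (y t) + G (z t))" by (simp add: Fnl_def pw_mult)
  show ?thesis
  proof (cases "adm A & W0 p y (wgrad U y)")
    case True
    thus ?thesis unfolding Xi_def pstate_def hp_def F Lp_eq_LpV W1p0_eq_W0[OF p1, of y]
      using weak_form_cong[OF p1 eq] by (simp add: conj_ac)
  qed (use W1p0_eq_W0[OF p1, of y] in "auto simp: Xi_def pstate_def")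
qed

lemma Xi_of_pstate:
  assumes A: "adm A" and y: "pstate (sq A) y' g'" "hp y' z'" and W: "W0 2 y (wgrad U y)" and z: "z : borel_measurable M"
    and AE: "AE x in M. y' x = y x" "AE x in M. g' x = wgrad U y x" "AE x in M. z' x = z x"
  shows "Xi U xi1 xi2 gam p K f A y z" unfolding Xi_iff
proof (intro conjI A)
  show "pstate (sq A) y (wgrad U y)" by (rule pstate_cong_AE[OF y(1) adm_ell[OF A] W AE(1,2)])
  have "LpV M p y'" using y(1) W0_LpV(1) by (auto simp: pstate_def)
  thus "hp y z" by (rule hp_cong_AE[OF y(2) _ LpV_measurable[OF W0_LpV(1)[OF W]] z AE(1,3)])
qed

lemma zd2: "LpV M 2 zd" by (rule LpV_lower[OF zd]) (use p in auto)

lemma hp_L2: "hp y z ==> LpV M 2 z"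
  unfolding hp_def by (elim conjE, rule LpV_lower[where p=p]) (use p in auto)

text \<open>The quadratic bounds are bounds for \<open>(norm (sq A x *v eta))^2\<close>, so they
  pass to the limit a.e. along a subsequence; the bound on the total variations passes by lower
  semicontinuity.\<close>

lemma adm_limit:
  assumes As: "!!n. adm (As n)" and A: "LinfSym U A" "AE x in M. psd (A x)"
    and BV: "!!i j. BV U (%x. sq A x $ i $ j)"
    and lim: "!!i j. (%n. intO U (%x. abs (sq (As n) x $ i $ j - sq A x $ i $ j))) ----> 0"
  shows "adm A"
proof -
  note L = BV_L1[OF adm_BV[OF As]] BV_L1[OF BV]
  obtain r where r: "AE x in M. ALL i j. (%n. sq (As (r n)) x $ i $ j) ----> sq A x $ i $ j"
    by (rule matrix_AE_subseq[OF L lim]) (rule that)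
  have "AE x in M. ALL n. psd (As (r n) x)" "AE x in M. ALL n eta. (xi1 x)^2 * (norm eta)^2 <= eta \<bullet> (As (r n) x *v eta) \<and>
      eta \<bullet> (As (r n) x *v eta) <= (xi2 x)^2 * (norm eta)^2"
    using adm_psd[OF As] As by (auto simp: AE_all_countable Aad_def)
  with r A(2) have bd: "AE x in M. ALL eta. (xi1 x)^2 * (norm eta)^2 <= eta \<bullet> (A x *v eta) & eta \<bullet> (A x *v eta) <= (xi2 x)^2 * (norm eta)^2"
  proof (eventually_elim, intro allI)
    fix x eta
    assume x: "ALL i j. (%n. sq (As (r n)) x $ i $ j) ----> sq A x $ i $ j" "psd (A x)" "ALL n. psd (As (r n) x)"
      "ALL n eta. (xi1 x)^2 * (norm eta)^2 <= eta \<bullet> (As (r n) x *v eta) & eta \<bullet> (As (r n) x *v eta) <= (xi2 x)^2 * (norm eta)^2"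
    have "(%n. sq (As (r n)) x *v eta) ----> sq A x *v eta"
      by (rule vec_tendstoI) (use x(1) in "auto simp: matrix_vector_mult_def intro!: tendsto_sum tendsto_mult_right")
    hence l: "(%n. eta \<bullet> (As (r n) x *v eta)) ----> eta \<bullet> (A x *v eta)"
      using x(2,3) by (simp add: psd_psqrt_vector(3) tendsto_norm tendsto_power)
    show "(xi1 x)^2 * (norm eta)^2 <= eta \<bullet> (A x *v eta) & eta \<bullet> (A x *v eta) <= (xi2 x)^2 * (norm eta)^2"
      using LIMSEQ_le_const[OF l] LIMSEQ_le_const2[OF l] x(4) by blast
  qed
  let ?I = "{(i, j). i <= j} :: ('n \<times> 'n) set" and ?T = "%n ij. TV U (%x. sq (As n) x $ fst ij $ snd ij)"
  have "(\<Sum>ij\<in>?I. TV U (%x. sq A x $ fst ij $ snd ij)) <= (\<Sum>ij\<in>?I. liminf (%n. ?T n ij))"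
    by (intro sum_mono TV_lsc L lim)
  also have "... <= liminf (%n. \<Sum>ij\<in>?I. ?T n ij)" by (rule sum_liminf_le) (auto simp: TV_nonneg)
  also have "... <= liminf (%n. ereal gam)"
    using As by (intro Liminf_mono always_eventually) (simp add: Aad_def case_prod_beta')
  finally show ?thesis using A(1) bd BV by (simp add: Aad_def Liminf_const case_prod_beta')
qed

text \<open>Subsequences identify the limit and show it admissible. The cost estimate uses the weak
  convergence of the full sequence, so no subsequence remains in the liminf.\<close>

lemma limit_admissible:
  assumes eps: "!!n. 0 < epss n" "epss ----> 0" and k: "filterlim ks at_top sequentially"
    and X: "!!n. Xi_ek U xi1 xi2 gam p K f Fk (epss n) (ks n) (As n) (ys n) (zs n)" and t: "tau1 U As ys zs sequentially A y z"
  shows "Xi U xi1 xi2 gam p K f A y z" "ereal (Icost U zd z) <= liminf (%n. ereal (Icost U zd (zs n)))"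
proof -
  have X': "adm (As n)" "state (aw (epss n) (ks n)) (sq (As n)) (ys n) (wgrad U (ys n))" "hstate (aw (epss n) (ks n)) (ys n) (zs n)" for n
    using X[of n] unfolding Xi_ek_iff[OF eps(1)] by auto
  have w: "weak_H10 U ys sequentially y" "weak_L2 U zs sequentially z" using t by (auto simp: tau1_def)
  have BV: "BV U (%x. sq A x $ i $ j)" and lim: "(%n. intO U (%x. abs (sq (As n) x $ i $ j - sq A x $ i $ j))) ----> 0" for i j
    using t by (simp_all add: tau1_def wstar_BVm_def wstar_BV_def)
  have A: "adm A" by (rule adm_limit[OF X'(1) _ _ BV lim]) (use t in "auto simp: tau1_def")
  have Wy: "W0 2 y (wgrad U y)" using w(1) W1p0_eq_W0[of 2] by (simp add: weak_H10_def)
  have Lz: "LpV M 2 z" using w(2) by (simp add: weak_L2_def Lp_eq_LpV)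
  have Lzn: "LpV M 2 (zs n)" and Wn: "W0 2 (ys n) (wgrad U (ys n))" for n
    using X'(2,3)[of n] by (auto simp: hstate_def state_def)
  obtain r where r: "strict_mono r" "AE x in M. ALL i j. (%n. sq (As (r n)) x $ i $ j) ----> sq A x $ i $ j"
    by (rule matrix_AE_subseq[OF BV_L1[OF adm_BV[OF X'(1)]] BV_L1[OF BV] lim]) (rule that)
  note fr = filterlim_subseq[OF r(1)]
  obtain s :: "nat => nat" and y' g' z' where s: "strict_mono s" "pstate (sq A) y' g'" "hp y' z'"
    "(%n. Ipow M 2 (%x. ys (r (s n)) x - y' x)) ----> 0"
    "(%n. Ipow M 2 (%x. wgrad U (ys (r (s n))) x - g' x)) ----> 0" "(%n. Ipow M 2 (%x. zs (r (s n)) x - z' x)) ----> 0"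
    using compactness[OF eps(1) filterlim_compose[OF eps(2) fr] filterlim_compose[OF k fr] lip adm_ell[OF X'(1)] adm_ell[OF A] r(2) X'(2,3)]
    by blast
  have rs: "strict_mono (%n. r (s n))" using r(1) s(1) by (auto simp: strict_mono_def)
  have W': "W0 2 y' g'" using s(2) W0_p_2 by (auto simp: pstate_def)
  show "Xi U xi1 xi2 gam p K f A y z"
    by (rule Xi_of_pstate[OF A s(2,3) Wy LpV_measurable[OF Lz] weak_H10_limit_unique[OF w(1) rs W' Wn s(4,5)]
          weak_L2_limit_unique[OF w(2) rs hp_L2[OF s(3)] Lzn s(6)]])
  let ?v = "%x. z x - zd x"
  have Lv: "LpV M 2 ?v" using LpV_diff[OF Lz zd2] by simp
  \<comment> \<open>The cost without its nonnegative quadratic term: a convergent lower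
    bound.\<close>
  let ?b = "%n. Icost U zd z + 2 * (intO U (%x. zs n x * ?v x) - intO U (%x. z x * ?v x))"
  have "?b ----> Icost U zd z + 2 * (intO U (%x. z x * ?v x) - intO U (%x. z x * ?v x))"
    using w(2) Lv by (intro tendsto_intros) (simp add: weak_L2_def Lp_eq_LpV)
  hence "liminf (%n. ereal (?b n)) = ereal (Icost U zd z)" by (intro lim_imp_Liminf) (auto intro: tendsto_ereal)
  moreover have "liminf (%n. ereal (?b n)) <= liminf (%n. ereal (Icost U zd (zs n)))"
    by (intro Liminf_mono always_eventually allI) (simp add: Icost_expand[OF Lzn Lz zd2])
  ultimately show "ereal (Icost U zd z) <= liminf (%n. ereal (Icost U zd (zs n)))" by simp
qed

text \<open>Any failure of convergence along the product filter produces a sequence of parameters to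
  which compactness applies; uniqueness of both limit equations then contradicts the
  failure.\<close>

lemma recovery:
  assumes X: "Xi U xi1 xi2 gam p K f A y z"
  shows "EX (As::real \<times> nat => (real, 'n) vec => ((real, 'n) vec, 'n) vec) ys zs.
    (ALL eps k. eps > 0 --> Xi_ek U xi1 xi2 gam p K f Fk eps k (As (eps,k)) (ys (eps,k)) (zs (eps,k))) \<and>
    tau1 U As ys zs (at_right 0 \<times>\<^sub>F sequentially) A y z \<and>
    ereal (Icost U zd z) >= Limsup (at_right 0 \<times>\<^sub>F sequentially) (%ek. ereal (Icost U zd (zs ek)))"
proof -
  let ?F = "at_right (0::real) \<times>\<^sub>F (sequentially :: nat filter)"
  have A: "adm A" and y: "pstate (sq A) y (wgrad U y)" "hp y z" using X unfolding Xi_iff by auto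
  note S = adm_ell[OF A]
  have Wp: "W0 p y (wgrad U y)" using y by (simp add: pstate_def)
  note W = W0_p_2[OF Wp]
  note Lz = hp_L2[OF y(2)]
  have "EX w. W0 2 (fst w) (wgrad U (fst w)) & LpV M 2 (snd w) \<and>
      (0 < eps --> Xi_ek U xi1 xi2 gam p K f Fk eps k A (fst w) (snd w))" for eps k
  proof (cases "0 < eps")
    case True
    obtain y' g' where st: "state (aw eps k) (sq A) y' g'" using state_exists[OF S True] by blast
    hence W': "W0 2 y' g'" by (simp add: state_def)
    have Wg: "W0 2 y' (wgrad U y')" by (rule W0_wgrad[OF W']) simp
    have AE: "AE x in M. wgrad U y' x = g' x" by (rule wgrad_AE_eq[OF W']) simp
    have "(LINT x|M. flux (aw eps k) (sq A x *v wgrad U y' x) \<bullet> (sq A x *v h x)) = (LINT x|M. flux (aw eps k) (sq A x *v g' x) \<bullet> (sq A x *v h x))"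
      if "W0 2 v h" for v h
    proof (rule integral_cong_AE)
      have "(%x. flux (aw eps k) (sq A x *v g x) \<bullet> (sq A x *v h x)) : borel_measurable M" if "LpV M 2 g" for g
        by (intro borel_measurable_inner borel_measurable_flux[OF nondec_aw[OF True]] ell_measurable[OF S]
            LpV_measurable[OF that] LpV_measurable[OF W0_LpV(2)[OF \<open>W0 2 v h\<close>]])
      thus "(%x. flux (aw eps k) (sq A x *v wgrad U y' x) \<bullet> (sq A x *v h x)) : borel_measurable M"
        "(%x. flux (aw eps k) (sq A x *v g' x) \<bullet> (sq A x *v h x)) : borel_measurable M"
        using W0_LpV(2)[OF Wg] W0_LpV(2)[OF W'] by auto
    qed (use AE in auto)
    hence "state (aw eps k) (sq A) y' (wgrad U y')" using st Wg by (simp add: state_def)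
    moreover obtain z' where "hstate (aw eps k) y' z'" using hstate_exists[OF True W0_LpV(1)[OF W']] by blast
    ultimately show ?thesis using Wg A
      by (intro exI[of _ "(y', z')"]) (simp add: Xi_ek_iff[OF True], simp add: hstate_def)
  \<comment> \<open>For \<open>eps <= 0\<close> the limit itself is the default value, so that all
    members of the family have the integrability used below.\<close>
  qed (use W Lz in \<open>auto intro!: exI[of _ "(y, z)"]\<close>)
  hence "ALL ek. EX w. W0 2 (fst w) (wgrad U (fst w)) & LpV M 2 (snd w) \<and>
      (0 < fst ek --> Xi_ek U xi1 xi2 gam p K f Fk (fst ek) (snd ek) A (fst w) (snd w))" by blast
  from choice[OF this] obtain w where w: "ALL ek. W0 2 (fst (w ek)) (wgrad U (fst (w ek))) & LpV M 2 (snd (w ek)) \<and>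
      (0 < fst ek --> Xi_ek U xi1 xi2 gam p K f Fk (fst ek) (snd ek) A (fst (w ek)) (snd (w ek)))" by (rule exE)
  define ys where "ys ek = fst (w ek)" for ek
  define zs where "zs ek = snd (w ek)" for ek
  have Ws: "W0 2 (ys ek) (wgrad U (ys ek))" and Ls: "LpV M 2 (zs ek)" for ek using w[rule_format, of ek] by (simp_all add: ys_def zs_def)
  have Xs: "Xi_ek U xi1 xi2 gam p K f Fk eps k A (ys (eps, k)) (zs (eps, k))" if "0 < eps" for eps k
    using w[rule_format, of "(eps, k)"] that by (simp add: ys_def zs_def)
  \<comment> \<open>All three strong errors in one nonnegative quantity, so that a single
    subsequence argument covers them.\<close>
  define Phi where "Phi ek = Ipow M 2 (%x. ys ek x - y x) + Ipow M 2 (%x. wgrad U (ys ek) x - wgrad U y x) + Ipow M 2 (%x. zs ek x - z x)" for ek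
  have Phi0: "0 <= Phi ek" for ek by (simp add: Phi_def)
  have "eventually (%ek. Phi ek < c) ?F" if c: "0 < c" for c
  proof (rule ccontr)
    assume n: "~ ?thesis"
    \<comment> \<open>Otherwise the rectangle of parameters with
      \<open>0 < eps < 1 / real (Suc n)\<close> and \<open>k >= n\<close> would witness the eventual
      bound.\<close>
    have "EX ek. 0 < fst ek & fst ek < 1 / real (Suc n) & n <= snd ek & c <= Phi ek" for n
    proof (rule ccontr)
      assume "\<nexists>ek. 0 < fst ek & fst ek < 1 / real (Suc n) & n <= snd ek & c <= Phi ek"
      hence "ALL eps k. 0 < eps & eps < 1 / real (Suc n) --> n <= k --> Phi (eps, k) < c" by (metis fst_conv snd_conv not_le)
      moreover have "eventually (%eps. 0 < eps & eps < 1 / real (Suc n)) (at_right (0::real))"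
        unfolding eventually_at_right_field by (intro exI[of _ "1 / real (Suc n)"]) auto
      ultimately have "eventually (%ek. Phi ek < c) ?F"
        unfolding eventually_prod_filter using eventually_ge_at_top[of n]
        by (intro exI[of _ "%eps. 0 < eps & eps < 1 / real (Suc n)"] exI[of _ "%k. n <= k"]) auto
      thus False using \<open>~ eventually (%ek. Phi ek < c) ?F\<close> by simp
    qed
    hence "EX e. ALL n. 0 < fst (e n) & fst (e n) < 1 / real (Suc n) & n <= snd (e n) & c <= Phi (e n)" by (intro choice allI)
    then obtain e where e: "ALL n. 0 < fst (e n) & fst (e n) < 1 / real (Suc n) & n <= snd (e n) & c <= Phi (e n)" by (rule exE)
    define epss where "epss n = fst (e n)" for n
    define ks where "ks n = snd (e n)" for n
    have eps: "0 < epss n" "epss n < 1 / real (Suc n)" "n <= ks n" "c <= Phi (epss n, ks n)" for n using e by (simp_all add: epss_def ks_def)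
    have "epss ----> 0"
      by (rule tendsto_sandwich[OF _ _ tendsto_const LIMSEQ_Suc[OF lim_1_over_n]]) (use eps(1,2) in "auto intro!: always_eventually less_imp_le")
    moreover have "filterlim ks at_top sequentially" by (rule filterlim_at_top_mono[OF filterlim_ident]) (use eps(3) in auto)
    moreover have st: "state (aw (epss n) (ks n)) (sq A) (ys (epss n, ks n)) (wgrad U (ys (epss n, ks n)))"
      "hstate (aw (epss n) (ks n)) (ys (epss n, ks n)) (zs (epss n, ks n))" for n
      using Xs[OF eps(1), of n] unfolding Xi_ek_iff[OF eps(1)] by auto
    ultimately have "EX (r::nat => nat) y' g' z'. strict_mono r & pstate (sq A) y' g' & hp y' z' \<and>
       (%n. Ipow M 2 (%x. ys (epss (r n), ks (r n)) x - y' x)) ----> 0 \<and>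
       (%n. Ipow M 2 (%x. wgrad U (ys (epss (r n), ks (r n))) x - g' x)) ----> 0 & (%n. Ipow M 2 (%x. zs (epss (r n), ks (r n)) x - z' x)) ----> 0"
      by (intro compactness[OF eps(1) _ _ lip S S _ st]) auto
    then obtain r :: "nat => nat" and y' g' z' where r: "pstate (sq A) y' g'" "hp y' z'"
       "(%n. Ipow M 2 (%x. ys (epss (r n), ks (r n)) x - y' x)) ----> 0"
       "(%n. Ipow M 2 (%x. wgrad U (ys (epss (r n), ks (r n))) x - g' x)) ----> 0" "(%n. Ipow M 2 (%x. zs (epss (r n), ks (r n)) x - z' x)) ----> 0" by blast
    have Wp': "W0 p y' g'" using r(1) by (simp add: pstate_def)
    note u = pstate_unique[OF S r(1) y(1)]
    note uz = hp_unique[OF W0_LpV(1)[OF Wp'] W0_LpV(1)[OF Wp] u(1) r(2) y(2)]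
    note m = LpV_measurable[OF W0_LpV(1)[OF Wp']] LpV_measurable[OF W0_LpV(2)[OF Wp']] LpV_measurable[OF hp_L2[OF r(2)]]
      LpV_measurable[OF W0_LpV(1)[OF W]] LpV_measurable[OF W0_LpV(2)[OF W]] LpV_measurable[OF Lz]
    have "Ipow M 2 (%x. ys ek x - y' x) = Ipow M 2 (%x. ys ek x - y x)"
      "Ipow M 2 (%x. wgrad U (ys ek) x - g' x) = Ipow M 2 (%x. wgrad U (ys ek) x - wgrad U y x)"
      "Ipow M 2 (%x. zs ek x - z' x) = Ipow M 2 (%x. zs ek x - z x)" for ek
      by (rule Ipow_cong_AE; use u uz m LpV_measurable[OF W0_LpV(1)[OF Ws]] LpV_measurable[OF W0_LpV(2)[OF Ws]] LpV_measurable[OF Ls] in auto)+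
    hence "(%n. Phi (epss (r n), ks (r n))) ----> 0 + 0 + 0" using r(3-5) unfolding Phi_def by (intro tendsto_add) auto
    hence "eventually (%n. Phi (epss (r n), ks (r n)) < c) sequentially" using c by (intro order_tendstoD(2)) auto
    thus False using eps(4) by (auto simp: eventually_sequentially not_less[symmetric])
  qed
  note small_ev = this
  have Phi: "(Phi \<longlongrightarrow> 0) ?F"
  proof (rule order_tendstoI)
    show "eventually (%ek. a < Phi ek) ?F" if "a < 0" for a
      using less_le_trans[OF that Phi0] by (intro always_eventually allI)
  qed (rule small_ev)
  have small: "((%ek. sqrt (Phi ek) * C) \<longlongrightarrow> 0) ?F" for C
    using tendsto_mult_right[OF tendsto_real_sqrt[OF Phi], of C] by simp
  have wH: "weak_H10 U ys ?F y" unfolding weak_H10_def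
  proof (intro conjI allI impI)
    show "eventually (%n. H10 U (ys n)) ?F" "H10 U y" using Ws W W1p0_eq_W0[of 2] by auto
    fix v assume "H10 U v"
    hence Wv: "W0 2 v (wgrad U v)" using W1p0_eq_W0[of 2] by simp
    let ?V = "{w. W0 2 (fst w) (snd w)}" and ?X = "%ek. (ys ek, wgrad U (ys ek))" and ?y = "(y, wgrad U y)" and ?v = "(v, wgrad U v)"
    have V: "?X ek : ?V" "?y : ?V" "?v : ?V" for ek using Ws W Wv by auto
    have le: "norm (ip1 (?X ek) ?v - ip1 ?y ?v) <= sqrt (Phi ek) * H1.nrm ?v" for ek
    proof -
      have d: "?X ek - ?y : ?V" by (rule H1.V_diff[OF V(1,2)])
      have "H1.nrm (?X ek - ?y) <= sqrt (Phi ek)"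
        unfolding H1.nrm_def using ip1_self[of "?X ek - ?y"] d by (simp add: Phi_def fun_diff_def)
      hence "H1.nrm (?X ek - ?y) * H1.nrm ?v <= sqrt (Phi ek) * H1.nrm ?v" by (rule mult_right_mono[OF _ H1.nrm_nonneg[OF V(3)]])
      thus ?thesis using H1.Cauchy_Schwarz[OF d V(3)] H1.ip_diff[OF V(1,2,3), of ek] by simp
    qed
    have "((%ek. ip1 (?X ek) ?v - ip1 ?y ?v) \<longlongrightarrow> 0) ?F"
      by (rule Lim_null_comparison[OF always_eventually small[of "H1.nrm ?v"]]) (use le in blast)
    from LIM_zero_cancel[OF this] show "((%n. intO U (%x. ys n x * v x + wgrad U (ys n) x \<bullet> wgrad U v x)) \<longlongrightarrow>
        intO U (%x. y x * v x + wgrad U y x \<bullet> wgrad U v x)) ?F" by (simp add: ip1_def intO_def)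
  qed
  have zlim: "((%n. intO U (%x. zs n x * v x)) \<longlongrightarrow> intO U (%x. z x * v x)) ?F" if Lv: "LpV M 2 v" for v
  proof -
    have "norm (ip0 (zs ek) v - ip0 z v) <= sqrt (Phi ek) * sqrt (Ipow M 2 v)" for ek
    proof -
      have d: "LpV M 2 (%x. zs ek x - z x)" using LpV_diff[OF Ls Lz] by simp
      have "abs (ip0 (zs ek) v - ip0 z v) <= sqrt (Ipow M 2 (%x. zs ek x - z x)) * sqrt (Ipow M 2 v)"
        using Cauchy_Schwarz_integral(2)[OF d Lv] LpV2_mult_integrable[OF Ls Lv] LpV2_mult_integrable[OF Lz Lv]
        by (simp add: ip0_def left_diff_distrib)
      also have "... <= sqrt (Phi ek) * sqrt (Ipow M 2 v)" by (intro mult_right_mono real_sqrt_le_mono) (simp_all add: Phi_def)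
      finally show ?thesis by simp
    qed
    hence "((%ek. ip0 (zs ek) v - ip0 z v) \<longlongrightarrow> 0) ?F"
      by (intro Lim_null_comparison[OF always_eventually small[of "sqrt (Ipow M 2 v)"]]) blast
    from LIM_zero_cancel[OF this] show ?thesis by (simp add: ip0_def intO_def)
  qed
  have wL: "weak_L2 U zs ?F z" using zlim Ls Lz by (simp add: weak_L2_def Lp_eq_LpV)
  have "wstar_BV U (%_ x. sq A x $ i $ j) ?F (%x. sq A x $ i $ j)" for i j
    by (rule wstar_BV_const[OF open_domain adm_BV[OF A]])
  hence t: "tau1 U (%_. A) ys zs ?F A y z"
    unfolding tau1_def wstar_BVm_def using wH wL A adm_psd[OF A] by (simp add: Aad_def)
  have "((%ek. Ipow M 2 (%x. zs ek x - z x)) \<longlongrightarrow> 0) ?F"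
    by (rule Lim_null_comparison[OF always_eventually Phi]) (simp add: Phi_def)
  hence "((%ek. Icost U zd z + Ipow M 2 (%x. zs ek x - z x) + 2 * (intO U (%x. zs ek x * (z x - zd x)) - intO U (%x. z x * (z x - zd x))))
      \<longlongrightarrow> Icost U zd z + 0 + 2 * (intO U (%x. z x * (z x - zd x)) - intO U (%x. z x * (z x - zd x)))) ?F"
    using LpV_diff[OF Lz zd2] by (intro tendsto_intros zlim) auto
  hence "((%ek. Icost U zd (zs ek)) \<longlongrightarrow> Icost U zd z) ?F" unfolding Icost_expand[OF Ls Lz zd2] by simp
  hence "Limsup ?F (%ek. ereal (Icost U zd (zs ek))) = ereal (Icost U zd z)"
    by (intro lim_imp_Limsup tendsto_ereal) (auto simp: prod_filter_eq_bot trivial_limit_at_right_real)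
  thus ?thesis using Xs t by (intro exI[of _ "%_. A"] exI[of _ ys] exI[of _ zs]) simp
qed

end

theorem mainTheorem15:
  fixes \<Omega> :: "(real^'n::{finite,linorder}) set"
    and p q \<gamma> \<alpha> \<delta> :: real
    and \<xi>1 \<xi>2 f zd :: "real^'n::{finite,linorder} \<Rightarrow> real"
    and K :: "real^'n::{finite,linorder} \<Rightarrow> real^'n::{finite,linorder} \<Rightarrow> real"
    and Fk :: "nat \<Rightarrow> real \<Rightarrow> real"
  assumes \<Omega>: "open \<Omega>" "bounded \<Omega>" "lipschitz_boundary \<Omega>"
    and p: "2 \<le> p" "q = p / (p - 1)"
    and \<xi>: "Linf \<Omega> \<xi>1" "BV \<Omega> \<xi>1" "Linf \<Omega> \<xi>2" "BV \<Omega> \<xi>2" "0 < \<alpha>"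
           "AE x in lebesgue_on \<Omega>. \<alpha> \<le> \<xi>1 x \<and> \<xi>1 x \<le> \<xi>2 x"
    and \<gamma>: "\<gamma> > 0"
    and Fk: "0 < \<delta>" "\<delta> < 1"
       "\<And>k. mono_on {0..} (Fk k)"
       "\<And>k. \<exists>F'. (\<forall>t\<ge>0. (Fk k has_real_derivative F' t) (at t within {0..})) \<and> continuous_on {0..} F'"
       "\<And>k t. 0 \<le> t \<Longrightarrow> 0 \<le> Fk k t"
       "\<And>k t. 0 \<le> t \<Longrightarrow> t \<le> real k ^ 2 \<Longrightarrow> Fk k t = t"
       "\<And>k t. t > real k ^ 2 + 1 \<Longrightarrow> Fk k t = real k ^ 2 + 1"
       "\<And>k t. real k ^ 2 \<le> t \<Longrightarrow> t < real k ^ 2 + 1 \<Longrightarrow> t \<le> Fk k t \<and> Fk k t \<le> t + \<delta>"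
    and K: "(\<lambda>(x,t). K x t) \<in> borel_measurable (lebesgue_on \<Omega> \<Otimes>\<^sub>M lebesgue_on \<Omega>)"
           "integrable (lebesgue_on \<Omega> \<Otimes>\<^sub>M lebesgue_on \<Omega>) (\<lambda>(x,t). \<bar>K x t\<bar> powr p)"
           "\<And>u. Lp \<Omega> q u \<Longrightarrow> \<not> (AE x in lebesgue_on \<Omega>. u x = 0) \<Longrightarrow>
                 intO \<Omega> (\<lambda>x. Bop \<Omega> K u x * u x) > 0"
    and f: "Lp \<Omega> 2 f"
    and zd: "Lp \<Omega> p zd"
  shows
    "(\<forall>(\<epsilon>s::nat \<Rightarrow> real) (ks::nat \<Rightarrow> nat) As ys zs A y z.
        (\<forall>n. \<epsilon>s n > 0) \<and> \<epsilon>s \<longlonglongrightarrow> 0 \<and> filterlim ks at_top sequentially \<and>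
        (\<forall>n. Xi_ek \<Omega> \<xi>1 \<xi>2 \<gamma> p K f Fk (\<epsilon>s n) (ks n) (As n) (ys n) (zs n)) \<and>
        tau1 \<Omega> As ys zs sequentially A y z
        \<longrightarrow> Xi \<Omega> \<xi>1 \<xi>2 \<gamma> p K f A y z \<and>
            ereal (Icost \<Omega> zd z) \<le> liminf (\<lambda>n. ereal (Icost \<Omega> zd (zs n))))
     \<and>
     (\<forall>A y z. Xi \<Omega> \<xi>1 \<xi>2 \<gamma> p K f A y z \<longrightarrow>
        (\<exists>(As::real \<times> nat \<Rightarrow> real^'n::{finite,linorder} \<Rightarrow> real^'n::{finite,linorder}^'n::{finite,linorder}) ys zs.
           (\<forall>\<epsilon> k. \<epsilon> > 0 \<longrightarrow> Xi_ek \<Omega> \<xi>1 \<xi>2 \<gamma> p K f Fk \<epsilon> k (As (\<epsilon>,k)) (ys (\<epsilon>,k)) (zs (\<epsilon>,k))) \<and>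
           tau1 \<Omega> As ys zs (at_right 0 \<times>\<^sub>F sequentially) A y z \<and>
           ereal (Icost \<Omega> zd z) \<ge>
             Limsup (at_right 0 \<times>\<^sub>F sequentially) (\<lambda>ek. ereal (Icost \<Omega> zd (zs ek)))))"
proof -
  obtain C where C: "AE x in lebesgue_on \<Omega>. \<bar>\<xi>2 x\<bar> \<le> C" using \<xi>(3) by (auto simp: Linf_def)
  note q = p(2)
  interpret bounded_domain \<Omega> by unfold_locales (rule \<Omega>)+
  interpret cutoff Fk p \<delta> by unfold_locales (use p(1) Fk in auto)
  \<comment> \<open>The maximum with 0 is needed because on an empty domain the a.e. bound
    \<open>C\<close> may be negative.\<close>
  interpret elliptic \<Omega> Fk p \<delta> f \<alpha> "max C 0"
    by unfold_locales (use \<xi>(5) f in \<open>auto simp: Lp_eq_LpV\<close>)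
  interpret hammerstein \<Omega> Fk p \<delta> f \<alpha> "max C 0" K q
  proof unfold_locales
    show "0 \<le> (\<integral>x. Bop \<Omega> K u x * u x \<partial>lebesgue_on \<Omega>)" if u: "LpV (lebesgue_on \<Omega>) q u" for u
    \<comment> \<open>Strict positivity is assumed for functions that are not a.e. zero; for the
      others the integral is zero.\<close>
    proof (cases "AE x in lebesgue_on \<Omega>. u x = 0")
      case True
      then have "AE x in lebesgue_on \<Omega>. Bop \<Omega> K u x * u x = 0" by eventually_elim simp
      then show ?thesis using integral_eq_zero_AE[of "\<lambda>x. Bop \<Omega> K u x * u x"] by simp
    next
      case False
      then show ?thesis using K(3)[of u] u by (simp add: Lp_eq_LpV intO_def)
    qed
  qed (use q K(1,2) in auto)
  interpret control_problem \<Omega> Fk p \<delta> f \<alpha> "max C 0" K q \<xi>1 \<xi>2 zd \<gamma>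
  proof unfold_locales
    show "AE x in lebesgue_on \<Omega>. \<alpha> \<le> \<xi>1 x \<and> \<xi>1 x \<le> \<xi>2 x \<and> \<xi>2 x \<le> max C 0"
      using \<xi>(6) C by eventually_elim auto
  qed (use \<Omega>(3) zd in \<open>auto simp: Lp_eq_LpV\<close>)
  show ?thesis using limit_admissible recovery by blast
qed

end
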